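(* Let $R$ be a (commutative) Noetherian local ring, $I$ an ideal of $R$, and $S=R/I$. Let $F$ be a free direct summand of the conormal module $I/I^2$ as an $S$-module. Let $S\to T$ be any homomorphism of commutative rings. Then the natural map of graded $T$-algebras $(\bigwedge_S F)\otimes_S T\to \operatorname{Tor}^R_*(S,T)$ splits as a map of algebras; that is, there is a homomorphism of graded $T$-algebras $\operatorname{Tor}^R_*(S,T)\to(\bigwedge_S F)\otimes_S T$ whose composition with the natural map, $(\bigwedge_S F)\otimes_S T\to\operatorname{Tor}^R_*(S,T)\to(\bigwedge_S F)\otimes_S T$, is the identity.
   Context: $T$ is regarded as an $R$-algebra via $R\twoheadrightarrow S\to T$. $\operatorname{Tor}^R_*(S,T)=\bigoplus_{i\ge 0}\operatorname{Tor}^R_i(S,T)$ carries its usual structure of a (strictly) graded-commutative $T$-algebra, e.g. computed as the homology of $P\otimes_R T$, where $P\to S$ is a resolution of $S$ by a graded-commutative differential graded $R$-algebra that is free as a graded $R$-module. There is a canonical isomorphism $\operatorname{Tor}^R_1(S,T)\cong (I/I^2)\otimes_S T$ (if $x\in P_1$ has $\partial(x)=a\in I$, then the class of $x\otimes 1$ corresponds to $\overline a\otimes 1$). The natural map $(\bigwedge_S F)\otimes_S T\cong\bigwedge_T(F\otimes_S T)\to\operatorname{Tor}^R_*(S,T)$ is the unique homomorphism of graded $T$-algebras which in degree $1$ is the map $F\otimes_S T\hookrightarrow (I/I^2)\otimes_S T\cong\operatorname{Tor}^R_1(S,T)$ induced by the inclusion $F\hookrightarrow I/I^2$. *)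

theory Defs
  imports "HOL-Algebra.Module" "HOL-Algebra.QuotRing" "HOL-Algebra.Ideal_Product"
    "HOL-Algebra.Ring_Divisibility" "HOL-Algebra.Free_Abelian_Groups"
begin

section \<open>Rings and modules\<close>

definition noetherian_local_ring :: "('a, 'm) ring_scheme \<Rightarrow> bool" where
  "noetherian_local_ring R \<longleftrightarrow> cring R \<and> noetherian_ring R \<and> (\<exists>!\<mm>. maximalideal \<mm> R)"

definition is_basis :: "('k, 'm) ring_scheme \<Rightarrow> ('k, 'a, 'n) module_scheme \<Rightarrow> 'a set \<Rightarrow> bool" where
  "is_basis K M B \<longleftrightarrow> B \<subseteq> carrier M \<and>
     (\<forall>x\<in>carrier M. \<exists>!c. c \<in> B \<rightarrow> carrier K \<and> (\<forall>b. b \<notin> B \<longrightarrow> c b = \<zero>\<^bsub>K\<^esub>) \<and>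
        finite {b. c b \<noteq> \<zero>\<^bsub>K\<^esub>} \<and>
        x = finsum M (\<lambda>b. c b \<odot>\<^bsub>M\<^esub> b) {b. c b \<noteq> \<zero>\<^bsub>K\<^esub>})"

definition free_module :: "('k, 'm) ring_scheme \<Rightarrow> ('k, 'a, 'n) module_scheme \<Rightarrow> bool" where
  "free_module K M \<longleftrightarrow> module K M \<and> (\<exists>B. is_basis K M B)"

definition direct_summand ::
    "('k, 'm) ring_scheme \<Rightarrow> ('k, 'a, 'n) module_scheme \<Rightarrow> 'a set \<Rightarrow> bool" where
  "direct_summand K M F \<longleftrightarrow> submodule F K M \<and>
     (\<exists>G. submodule G K M \<and> F \<inter> G = {\<zero>\<^bsub>M\<^esub>} \<and> F <+>\<^bsub>M\<^esub> G = carrier M)"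

text \<open>
  The conormal module \<open>I/I\<^sup>2\<close> over \<open>R/I\<close>: its elements are the cosets of \<open>I\<^sup>2\<close> in \<open>I\<close>, and
  \<open>(I + r) \<odot> (I\<^sup>2 + a) = I\<^sup>2 + r a\<close>. The record type also demands a multiplication and a unit;
  these two fields are never used.
\<close>

definition conormal :: "('a, 'm) ring_scheme \<Rightarrow> 'a set \<Rightarrow> ('a set, 'a set) module" where
  "conormal R I =
     \<lparr>carrier = a_rcosets\<^bsub>R\<lparr>carrier := I\<rparr>\<^esub> (I \<cdot>\<^bsub>R\<^esub> I),
      monoid.mult = (\<lambda>_ _. undefined), one = undefined,
      ring.zero = I \<cdot>\<^bsub>R\<^esub> I, add = set_add R,
      smult = rcoset_mult R (I \<cdot>\<^bsub>R\<^esub> I)\<rparr>"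


section \<open>Graded and differential graded algebras\<close>

record ('k, 'a) graded_algebra = "('k, 'a) module" +
  homog :: "nat \<Rightarrow> 'a set"

record ('k, 'a) dg_algebra = "('k, 'a) graded_algebra" +
  diff :: "'a \<Rightarrow> 'a"

text \<open>Associative unital \<open>K\<close>-algebras with an internal grading by the natural numbers.\<close>

locale graded_alg = module K A + ring A
  for K :: "('k, 'm) ring_scheme" and A :: "('k, 'a, 'n) graded_algebra_scheme" +
  assumes smult_mult_left:
      "\<lbrakk>k \<in> carrier K; x \<in> carrier A; y \<in> carrier A\<rbrakk> \<Longrightarrow>
        (k \<odot>\<^bsub>A\<^esub> x) \<otimes>\<^bsub>A\<^esub> y = k \<odot>\<^bsub>A\<^esub> (x \<otimes>\<^bsub>A\<^esub> y)"
    and smult_mult_right: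
      "\<lbrakk>k \<in> carrier K; x \<in> carrier A; y \<in> carrier A\<rbrakk> \<Longrightarrow>
        x \<otimes>\<^bsub>A\<^esub> (k \<odot>\<^bsub>A\<^esub> y) = k \<odot>\<^bsub>A\<^esub> (x \<otimes>\<^bsub>A\<^esub> y)"
    and homog_submodule: "submodule (homog A n) K A"
    and one_homog: "\<one>\<^bsub>A\<^esub> \<in> homog A 0"
    and mult_homog: "\<lbrakk>x \<in> homog A i; y \<in> homog A j\<rbrakk> \<Longrightarrow> x \<otimes>\<^bsub>A\<^esub> y \<in> homog A (i + j)"
    and homog_decomp: "x \<in> carrier A \<Longrightarrow>
        \<exists>!c. (\<forall>n. c n \<in> homog A n) \<and> finite {n. c n \<noteq> \<zero>\<^bsub>A\<^esub>} \<and>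
             x = finsum A c {n. c n \<noteq> \<zero>\<^bsub>A\<^esub>}"

locale graded_commutative_alg = graded_alg +
  assumes graded_comm: "\<lbrakk>x \<in> homog A i; y \<in> homog A j\<rbrakk> \<Longrightarrow>
      x \<otimes>\<^bsub>A\<^esub> y = (if even (i * j) then y \<otimes>\<^bsub>A\<^esub> x else \<ominus>\<^bsub>A\<^esub> (y \<otimes>\<^bsub>A\<^esub> x))"
    and odd_square: "\<lbrakk>x \<in> homog A i; odd i\<rbrakk> \<Longrightarrow> x \<otimes>\<^bsub>A\<^esub> x = \<zero>\<^bsub>A\<^esub>"

locale dg_alg = graded_alg K A
  for K :: "('k, 'm) ring_scheme" and A :: "('k, 'a, 'n) dg_algebra_scheme" +
  assumes diff_closed: "x \<in> carrier A \<Longrightarrow> diff A x \<in> carrier A"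
    and diff_add: "\<lbrakk>x \<in> carrier A; y \<in> carrier A\<rbrakk> \<Longrightarrow>
        diff A (x \<oplus>\<^bsub>A\<^esub> y) = diff A x \<oplus>\<^bsub>A\<^esub> diff A y"
    and diff_smult: "\<lbrakk>k \<in> carrier K; x \<in> carrier A\<rbrakk> \<Longrightarrow>
        diff A (k \<odot>\<^bsub>A\<^esub> x) = k \<odot>\<^bsub>A\<^esub> diff A x"
    and diff_homog_0: "x \<in> homog A 0 \<Longrightarrow> diff A x = \<zero>\<^bsub>A\<^esub>"
    and diff_homog_Suc: "x \<in> homog A (Suc n) \<Longrightarrow> diff A x \<in> homog A n"
    and diff_diff: "x \<in> carrier A \<Longrightarrow> diff A (diff A x) = \<zero>\<^bsub>A\<^esub>"
    and leibniz: "\<lbrakk>x \<in> homog A i; y \<in> carrier A\<rbrakk> \<Longrightarrow>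
        diff A (x \<otimes>\<^bsub>A\<^esub> y) = diff A x \<otimes>\<^bsub>A\<^esub> y \<oplus>\<^bsub>A\<^esub>
          (if even i then x \<otimes>\<^bsub>A\<^esub> diff A y else \<ominus>\<^bsub>A\<^esub> (x \<otimes>\<^bsub>A\<^esub> diff A y))"

definition graded_alg_hom ::
    "('k, 'm) ring_scheme \<Rightarrow> ('k, 'a, 'n) graded_algebra_scheme \<Rightarrow>
     ('k, 'b, 'l) graded_algebra_scheme \<Rightarrow> ('a \<Rightarrow> 'b) set" where
  "graded_alg_hom K A B = {f \<in> ring_hom A B.
     (\<forall>k\<in>carrier K. \<forall>x\<in>carrier A. f (k \<odot>\<^bsub>A\<^esub> x) = k \<odot>\<^bsub>B\<^esub> f x) \<and>
     (\<forall>n. f ` homog A n \<subseteq> homog B n)}"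

definition boundaries :: "('k, 'a, 'n) dg_algebra_scheme \<Rightarrow> 'a set" where
  "boundaries A = diff A ` carrier A"

definition cycles :: "('k, 'a, 'n) dg_algebra_scheme \<Rightarrow> 'a set" where
  "cycles A = {x \<in> carrier A. diff A x = \<zero>\<^bsub>A\<^esub>}"

definition homology_class :: "('k, 'a, 'n) dg_algebra_scheme \<Rightarrow> 'a \<Rightarrow> 'a set" where
  "homology_class A x = boundaries A +>\<^bsub>A\<^esub> x"

definition homology :: "('k, 'a, 'n) dg_algebra_scheme \<Rightarrow> ('k, 'a set) graded_algebra" where
  "homology A = (let Q = (A\<lparr>carrier := cycles A\<rparr>) Quot boundaries A in
     \<lparr>carrier = carrier Q, monoid.mult = monoid.mult Q, one = one Q, ring.zero = ring.zero Q, ring.add = ring.add Q,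
      smult = (\<lambda>k X. \<Union>x\<in>X. homology_class A (k \<odot>\<^bsub>A\<^esub> x)),
      homog = (\<lambda>n. homology_class A ` (cycles A \<inter> homog A n))\<rparr>)"


section \<open>Algebras presented as quotients of free abelian groups\<close>

text \<open>
  Let \<open>G\<close> be a set with a multiplication \<open>mul\<close>, a unit \<open>e\<close>, an action \<open>act\<close> of the scalars and a
  decomposition into subsets \<open>gr n\<close>. All of this is extended additively to the free abelian group
  on \<open>G\<close> and then passed to the quotient by the subgroup generated by \<open>Rel\<close>. In the two instances
  below this subgroup is stable under multiplication by elements of \<open>G\<close> and under \<open>act\<close>, so that
  each of the unions is a union of copies of one single coset.
\<close>

definition frag_class :: "'g set \<Rightarrow> ('g \<Rightarrow>\<^sub>0 int) set \<Rightarrow> ('g \<Rightarrow>\<^sub>0 int) \<Rightarrow> ('g \<Rightarrow>\<^sub>0 int) set" where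
  "frag_class G Rel f =
     generate (free_Abelian_group G) Rel #>\<^bsub>free_Abelian_group G\<^esub> f"

definition presented_algebra ::
    "'g set \<Rightarrow> ('g \<Rightarrow>\<^sub>0 int) set \<Rightarrow> ('g \<Rightarrow> 'g \<Rightarrow> 'g) \<Rightarrow> 'g \<Rightarrow> ('k \<Rightarrow> 'g \<Rightarrow> 'g) \<Rightarrow> (nat \<Rightarrow> 'g set) \<Rightarrow>
     ('k, ('g \<Rightarrow>\<^sub>0 int) set) graded_algebra" where
  "presented_algebra G Rel mul e act gr =
     (let Q = free_Abelian_group G Mod generate (free_Abelian_group G) Rel in
      \<lparr>carrier = carrier Q,
       monoid.mult = (\<lambda>X Y. \<Union>f\<in>X. \<Union>g\<in>Y. frag_class G Rel
                 (frag_extend (\<lambda>x. frag_extend (\<lambda>y. frag_of (mul x y)) g) f)),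
       one = frag_class G Rel (frag_of e),
       ring.zero = one Q,
       add = monoid.mult Q,
       smult = (\<lambda>k X. \<Union>f\<in>X. frag_class G Rel (frag_extend (\<lambda>x. frag_of (act k x)) f)),
       homog = (\<lambda>n. frag_class G Rel ` carrier (free_Abelian_group (gr n)))\<rparr>)"


subsection \<open>Exterior algebra\<close>

text \<open>
  The generator \<open>(k, [x\<^sub>1, \<dots>, x\<^sub>n])\<close> stands for \<open>k \<cdot> x\<^sub>1 \<and> \<dots> \<and> x\<^sub>n\<close>. The first four families of
  relations give the tensor algebra of \<open>M\<close> over \<open>K\<close>; the last one divides out the two-sided ideal
  generated by the elements \<open>x \<otimes> x\<close>.
\<close>

definition exterior_gens ::
    "('k, 'm) ring_scheme \<Rightarrow> ('k, 'a, 'n) module_scheme \<Rightarrow> ('k \<times> 'a list) set" where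
  "exterior_gens K M = carrier K \<times> lists (carrier M)"

definition exterior_rels ::
    "('k, 'm) ring_scheme \<Rightarrow> ('k, 'a, 'n) module_scheme \<Rightarrow> ('k \<times> 'a list \<Rightarrow>\<^sub>0 int) set" where
  "exterior_rels K M =
     {frag_of (k \<oplus>\<^bsub>K\<^esub> l, u) - frag_of (k, u) - frag_of (l, u) | k l u.
        k \<in> carrier K \<and> l \<in> carrier K \<and> u \<in> lists (carrier M)} \<union>
     {frag_of (k, u @ [x \<oplus>\<^bsub>M\<^esub> y] @ v) - frag_of (k, u @ [x] @ v) - frag_of (k, u @ [y] @ v) | k x y u v.
        k \<in> carrier K \<and> x \<in> carrier M \<and> y \<in> carrier M \<and>
        u \<in> lists (carrier M) \<and> v \<in> lists (carrier M)} \<union>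
     {frag_of (k, u @ [l \<odot>\<^bsub>M\<^esub> x] @ v) - frag_of (k \<otimes>\<^bsub>K\<^esub> l, u @ [x] @ v) | k l x u v.
        k \<in> carrier K \<and> l \<in> carrier K \<and> x \<in> carrier M \<and>
        u \<in> lists (carrier M) \<and> v \<in> lists (carrier M)} \<union>
     {frag_of (k, u @ [x, x] @ v) | k x u v.
        k \<in> carrier K \<and> x \<in> carrier M \<and> u \<in> lists (carrier M) \<and> v \<in> lists (carrier M)}"

definition exterior_algebra ::
    "('k, 'm) ring_scheme \<Rightarrow> ('k, 'a, 'n) module_scheme \<Rightarrow>
     ('k, ('k \<times> 'a list \<Rightarrow>\<^sub>0 int) set) graded_algebra" where
  "exterior_algebra K M = presented_algebra (exterior_gens K M) (exterior_rels K M)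
     (\<lambda>(k, u) (l, v). (k \<otimes>\<^bsub>K\<^esub> l, u @ v)) (\<one>\<^bsub>K\<^esub>, [])
     (\<lambda>c (k, u). (c \<otimes>\<^bsub>K\<^esub> k, u))
     (\<lambda>n. {(k, u) \<in> exterior_gens K M. length u = n})"

definition exterior_incl ::
    "('k, 'm) ring_scheme \<Rightarrow> ('k, 'a, 'n) module_scheme \<Rightarrow> 'a \<Rightarrow> ('k \<times> 'a list \<Rightarrow>\<^sub>0 int) set" where
  "exterior_incl K M x =
     frag_class (exterior_gens K M) (exterior_rels K M) (frag_of (\<one>\<^bsub>K\<^esub>, [x]))"


subsection \<open>Base change\<close>

text \<open>
  For a graded \<open>K\<close>-algebra \<open>A\<close> and a ring homomorphism \<open>h\<close> from \<open>K\<close> to the commutative ring \<open>T\<close>,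
  this is the \<open>T\<close>-algebra \<open>A \<otimes>\<^sub>K T\<close>, with \<open>T\<close> in degree \<open>0\<close>. The generator \<open>(a, t)\<close> stands for
  \<open>a \<otimes> t\<close>.
\<close>

definition tensor_rels ::
    "('k, 'm) ring_scheme \<Rightarrow> ('k, 'a, 'n) module_scheme \<Rightarrow> ('k \<Rightarrow> 't) \<Rightarrow> ('t, 'l) ring_scheme \<Rightarrow>
     ('a \<times> 't \<Rightarrow>\<^sub>0 int) set" where
  "tensor_rels K A h T =
     {frag_of (a \<oplus>\<^bsub>A\<^esub> b, t) - frag_of (a, t) - frag_of (b, t) | a b t.
        a \<in> carrier A \<and> b \<in> carrier A \<and> t \<in> carrier T} \<union>
     {frag_of (a, s \<oplus>\<^bsub>T\<^esub> t) - frag_of (a, s) - frag_of (a, t) | a s t.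
        a \<in> carrier A \<and> s \<in> carrier T \<and> t \<in> carrier T} \<union>
     {frag_of (k \<odot>\<^bsub>A\<^esub> a, t) - frag_of (a, h k \<otimes>\<^bsub>T\<^esub> t) | k a t.
        k \<in> carrier K \<and> a \<in> carrier A \<and> t \<in> carrier T}"

definition pure_tensor ::
    "('k, 'm) ring_scheme \<Rightarrow> ('k, 'a, 'n) module_scheme \<Rightarrow> ('k \<Rightarrow> 't) \<Rightarrow> ('t, 'l) ring_scheme \<Rightarrow>
     'a \<Rightarrow> 't \<Rightarrow> ('a \<times> 't \<Rightarrow>\<^sub>0 int) set" where
  "pure_tensor K A h T a t =
     frag_class (carrier A \<times> carrier T) (tensor_rels K A h T) (frag_of (a, t))"

definition base_change ::
    "('k, 'm) ring_scheme \<Rightarrow> ('k, 'a, 'n) graded_algebra_scheme \<Rightarrow> ('k \<Rightarrow> 't) \<Rightarrow>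
     ('t, 'l) ring_scheme \<Rightarrow> ('t, ('a \<times> 't \<Rightarrow>\<^sub>0 int) set) graded_algebra" where
  "base_change K A h T = presented_algebra (carrier A \<times> carrier T) (tensor_rels K A h T)
     (\<lambda>(a, s) (b, t). (a \<otimes>\<^bsub>A\<^esub> b, s \<otimes>\<^bsub>T\<^esub> t)) (\<one>\<^bsub>A\<^esub>, \<one>\<^bsub>T\<^esub>)
     (\<lambda>s (a, t). (a, s \<otimes>\<^bsub>T\<^esub> t))
     (\<lambda>n. homog A n \<times> carrier T)"

definition dg_base_change ::
    "('k, 'm) ring_scheme \<Rightarrow> ('k, 'a, 'n) dg_algebra_scheme \<Rightarrow> ('k \<Rightarrow> 't) \<Rightarrow>
     ('t, 'l) ring_scheme \<Rightarrow> ('t, ('a \<times> 't \<Rightarrow>\<^sub>0 int) set) dg_algebra" where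
  "dg_base_change K A h T = graded_algebra.extend (base_change K A h T)
     (dg_algebra.fields (\<lambda>X. \<Union>f\<in>X. frag_class (carrier A \<times> carrier T) (tensor_rels K A h T)
        (frag_extend (\<lambda>(a, t). frag_of (diff A a, t)) f)))"


section \<open>The Tor algebra and the natural map\<close>

text \<open>
  A resolution \<open>\<epsilon> : P \<rightarrow> R/I\<close> by a graded-commutative DG \<open>R\<close>-algebra which is free as a graded
  \<open>R\<close>-module. It is not required that \<open>P\<^sub>0 = R\<close>.
\<close>

locale dg_algebra_resolution = dg_alg R P + graded_commutative_alg R P
  for R :: "('a, 'm) ring_scheme" and P :: "('a, 'p, 'n) dg_algebra_scheme" +
  fixes I :: "'a set" and \<epsilon> :: "'p \<Rightarrow> 'a set"
  assumes free_homog: "free_module R (P\<lparr>carrier := homog P n\<rparr>)"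
    and augmentation_hom: "\<epsilon> \<in> ring_hom P (R Quot I)"
    and augmentation_smult: "\<lbrakk>r \<in> carrier R; x \<in> carrier P\<rbrakk> \<Longrightarrow>
        \<epsilon> (r \<odot>\<^bsub>P\<^esub> x) = (I +>\<^bsub>R\<^esub> r) \<otimes>\<^bsub>R Quot I\<^esub> \<epsilon> x"
    and augmentation_pos: "x \<in> homog P (Suc n) \<Longrightarrow> \<epsilon> x = \<zero>\<^bsub>R Quot I\<^esub>"
    and augmentation_surj: "\<epsilon> ` homog P 0 = carrier (R Quot I)"
    and exact_0: "{x \<in> homog P 0. \<epsilon> x = \<zero>\<^bsub>R Quot I\<^esub>} = diff P ` homog P 1"
    and exact_Suc: "{x \<in> homog P (Suc n). diff P x = \<zero>\<^bsub>P\<^esub>} = diff P ` homog P (Suc (Suc n))"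

text \<open>
  For a homomorphism \<open>h : R/I \<rightarrow> T\<close>, the algebra \<open>P \<otimes>\<^sub>R T\<close>, and \<open>Tor\<^sup>R(R/I, T)\<close> computed from \<open>P\<close>.
\<close>

definition tor_complex ::
    "('a, 'm) ring_scheme \<Rightarrow> 'a set \<Rightarrow> ('a, 'p, 'n) dg_algebra_scheme \<Rightarrow> ('a set \<Rightarrow> 't) \<Rightarrow>
     ('t, 'l) ring_scheme \<Rightarrow> ('t, ('p \<times> 't \<Rightarrow>\<^sub>0 int) set) dg_algebra" where
  "tor_complex R I P h T = dg_base_change R P (\<lambda>r. h (I +>\<^bsub>R\<^esub> r)) T"

definition tor_algebra ::
    "('a, 'm) ring_scheme \<Rightarrow> 'a set \<Rightarrow> ('a, 'p, 'n) dg_algebra_scheme \<Rightarrow> ('a set \<Rightarrow> 't) \<Rightarrow>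
     ('t, 'l) ring_scheme \<Rightarrow> ('t, ('p \<times> 't \<Rightarrow>\<^sub>0 int) set set) graded_algebra" where
  "tor_algebra R I P h T = homology (tor_complex R I P h T)"

text \<open>The algebra \<open>(\<And>\<^sub>S F) \<otimes>\<^sub>S T\<close> for \<open>S = R/I\<close> and a submodule \<open>F\<close> of \<open>I/I\<^sup>2\<close>, and its
  elements \<open>f \<otimes> t\<close> for \<open>f \<in> F\<close>.\<close>

definition ext_conormal ::
    "('a, 'm) ring_scheme \<Rightarrow> 'a set \<Rightarrow> 'a set set \<Rightarrow> ('a set, ('a set \<times> 'a set list \<Rightarrow>\<^sub>0 int) set) graded_algebra"
  where "ext_conormal R I F = exterior_algebra (R Quot I) ((conormal R I)\<lparr>carrier := F\<rparr>)"

definition ext_tensor ::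
    "('a, 'm) ring_scheme \<Rightarrow> 'a set \<Rightarrow> 'a set set \<Rightarrow> ('a set \<Rightarrow> 't) \<Rightarrow> ('t, 'l) ring_scheme \<Rightarrow>
     ('t, (('a set \<times> 'a set list \<Rightarrow>\<^sub>0 int) set \<times> 't \<Rightarrow>\<^sub>0 int) set) graded_algebra" where
  "ext_tensor R I F h T = base_change (R Quot I) (ext_conormal R I F) h T"

definition ext_tensor_gen ::
    "('a, 'm) ring_scheme \<Rightarrow> 'a set \<Rightarrow> 'a set set \<Rightarrow> ('a set \<Rightarrow> 't) \<Rightarrow> ('t, 'l) ring_scheme \<Rightarrow>
     'a set \<Rightarrow> 't \<Rightarrow> (('a set \<times> 'a set list \<Rightarrow>\<^sub>0 int) set \<times> 't \<Rightarrow>\<^sub>0 int) set" where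
  "ext_tensor_gen R I F h T f t = pure_tensor (R Quot I) (ext_conormal R I F) h T
     (exterior_incl (R Quot I) ((conormal R I)\<lparr>carrier := F\<rparr>) f) t"

text \<open>
  The isomorphism of \<open>(I/I\<^sup>2) \<otimes>\<^sub>S T\<close> with \<open>Tor\<^sub>1\<close> sends \<open>(I\<^sup>2 + a) \<otimes> t\<close> to the class of \<open>x \<otimes> t\<close>
  for any \<open>x \<in> P\<^sub>1\<close> with \<open>\<partial>x = a \<cdot> 1\<close>. The natural map is the homomorphism of graded
  \<open>T\<close>-algebras which is given by this formula on the elements \<open>f \<otimes> t\<close> with \<open>f = I\<^sup>2 + a \<in> F\<close>; it is
  taken to be \<open>undefined\<close> outside the carrier, so that it is unique as a HOL function.
\<close>

definition is_natural_map ::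
    "('a, 'm) ring_scheme \<Rightarrow> 'a set \<Rightarrow> 'a set set \<Rightarrow> ('a, 'p, 'n) dg_algebra_scheme \<Rightarrow>
     ('a set \<Rightarrow> 't) \<Rightarrow> ('t, 'l) ring_scheme \<Rightarrow>
     ((('a set \<times> 'a set list \<Rightarrow>\<^sub>0 int) set \<times> 't \<Rightarrow>\<^sub>0 int) set \<Rightarrow> ('p \<times> 't \<Rightarrow>\<^sub>0 int) set set) \<Rightarrow> bool" where
  "is_natural_map R I F P h T \<nu> \<longleftrightarrow>
     \<nu> \<in> extensional (carrier (ext_tensor R I F h T)) \<and>
     \<nu> \<in> graded_alg_hom T (ext_tensor R I F h T) (tor_algebra R I P h T) \<and>
     (\<forall>a\<in>I. \<forall>x\<in>homog P 1. \<forall>t\<in>carrier T.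
        (I \<cdot>\<^bsub>R\<^esub> I) +>\<^bsub>R\<^esub> a \<in> F \<and> diff P x = a \<odot>\<^bsub>P\<^esub> \<one>\<^bsub>P\<^esub> \<longrightarrow>
        \<nu> (ext_tensor_gen R I F h T ((I \<cdot>\<^bsub>R\<^esub> I) +>\<^bsub>R\<^esub> a) t) =
          homology_class (tor_complex R I P h T)
            (pure_tensor R P (\<lambda>r. h (I +>\<^bsub>R\<^esub> r)) T x t))"

end

theory Submission
  imports Defs
begin

text \<open>
  Write \<open>I/I\<^sup>2 = F \<oplus> G\<close>, let \<open>f\<^sub>1, \<dots>, f\<^sub>r\<close> be a basis of \<open>F\<close> and \<open>\<psi>\<^sub>k : I \<rightarrow> R/I\<close> the
  \<open>k\<close>-th coordinate of the projection to \<open>F\<close>. It lifts to an \<open>R\<close>-linear map \<open>\<theta>\<^sub>k\<close> of degree \<open>-1\<close> on \<open>P\<close>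
  that anticommutes with the differential and induces \<open>\<psi>\<^sub>k\<close> on \<open>P\<^sub>1\<close>. Since \<open>P\<close> has no divided
  powers, \<open>\<theta>\<^sub>k\<close> cannot in general be chosen to be a derivation; but its failure to be one is a chain map from
  \<open>P \<otimes>\<^sub>R P\<close> to \<open>P\<close> which is null-homotopic, because \<open>P\<close> is free and acyclic and the obstruction
  in degree zero is the failure of a linear lift \<open>P\<^sub>0 \<rightarrow> R\<close> of the augmentation to be multiplicative.
  Hence every \<open>\<theta>\<^sub>k\<close> induces a derivation on Tor. As \<open>f\<^sub>k \<and> f\<^sub>k = 0\<close>, the maps \<open>1 + f\<^sub>k \<theta>\<^sub>k\<close> on
  \<open>\<And>F \<otimes> Tor\<close> are multiplicative, and so is their composition followed by the augmentation of Tor,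
  which is the required retraction.
\<close>

section \<open>Additive and linear maps\<close>

text \<open>\<open>P\<close> is not assumed to start with \<open>R\<close> in degree 0, so an
  element \<open>a\<close> of \<open>I\<close> is visible in \<open>P\<close> only as
  \<open>a \<cdot> 1\<close>, and the boundary of an element of degree 1 is not an element of
  \<open>I\<close>. The linear lift \<mu> of the augmentation repairs this: it sends the kernel of
  \<epsilon> into \<open>I\<close>, where the coordinate functionals live. Neither \<And>F \<otimes>
  Tor nor \<open>P \<otimes> P\<close> is ever formed. The twisted maps are linear maps from
  \<open>P \<otimes> T\<close> to \<And>F \<otimes> T that kill boundaries and are multiplicative on
  cycles; maps out of \<open>P \<otimes> P\<close> are bilinear maps fixed by their values on pairs
  of basis elements. The lowering maps and the homotopies are both constructed by recursion on
  degree, which is why linear extensions of only partially known values recur. There is one twist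
  per basis element of \<open>F\<close>, so the basis must be finite; this is where the Noetherian
  hypothesis enters. The composite is a retraction because it sends the class of
  \<open>x \<otimes> t\<close>, where \<open>x\<close> has boundary \<open>a \<cdot> 1\<close>, to
  the sum of the \<psi>(a) f \<otimes> t over the basis elements \<open>f\<close>, and an algebra
  endomorphism of \<And>F \<otimes> T that fixes all \<open>f \<otimes> t\<close> is the
  identity.\<close>

text \<open>Speaks only of \<open>carrier\<close> and \<open>add\<close>, so that one notion serves
  rings, modules, complexes and homology, and nothing is demanded off the carrier.\<close>

definition additive_map :: "('a, 'm) ring_scheme \<Rightarrow> ('b, 'n) ring_scheme \<Rightarrow> ('a \<Rightarrow> 'b) \<Rightarrow> bool" where
  "additive_map A B u \<longleftrightarrow> u \<in> carrier A \<rightarrow> carrier B \<and>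
     (\<forall>x\<in>carrier A. \<forall>y\<in>carrier A. u (x \<oplus>\<^bsub>A\<^esub> y) = u x \<oplus>\<^bsub>B\<^esub> u y)"

lemma additive_mapI:
  assumes "\<And>x. x \<in> carrier A \<Longrightarrow> u x \<in> carrier B"
    and "\<And>x y. \<lbrakk>x \<in> carrier A; y \<in> carrier A\<rbrakk> \<Longrightarrow> u (x \<oplus>\<^bsub>A\<^esub> y) = u x \<oplus>\<^bsub>B\<^esub> u y"
  shows "additive_map A B u"
  using assms by (auto simp: additive_map_def)

lemma additive_closed: "\<lbrakk>additive_map A B u; x \<in> carrier A\<rbrakk> \<Longrightarrow> u x \<in> carrier B"
  by (auto simp: additive_map_def)

lemma additive_add:
  "\<lbrakk>additive_map A B u; x \<in> carrier A; y \<in> carrier A\<rbrakk> \<Longrightarrow> u (x \<oplus>\<^bsub>A\<^esub> y) = u x \<oplus>\<^bsub>B\<^esub> u y"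
  by (auto simp: additive_map_def)

lemma additive_zero:
  assumes "abelian_group A" "abelian_group B" "additive_map A B u"
  shows "u \<zero>\<^bsub>A\<^esub> = \<zero>\<^bsub>B\<^esub>"
proof -
  interpret A: abelian_group A by fact
  interpret B: abelian_group B by fact
  have "u \<zero>\<^bsub>A\<^esub> \<oplus>\<^bsub>B\<^esub> u \<zero>\<^bsub>A\<^esub> = u \<zero>\<^bsub>A\<^esub>"
    using additive_add[OF assms(3), of "\<zero>\<^bsub>A\<^esub>" "\<zero>\<^bsub>A\<^esub>"] by simp
  then show ?thesis
    using additive_closed[OF assms(3) A.zero_closed] by (metis B.add.r_cancel_one)
qed

lemma additive_minus:
  assumes "abelian_group A" "abelian_group B" "additive_map A B u" "x \<in> carrier A"
  shows "u (\<ominus>\<^bsub>A\<^esub> x) = \<ominus>\<^bsub>B\<^esub> u x"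
proof -
  interpret A: abelian_group A by fact
  interpret B: abelian_group B by fact
  have "u (\<ominus>\<^bsub>A\<^esub> x) \<oplus>\<^bsub>B\<^esub> u x = \<zero>\<^bsub>B\<^esub>"
    using additive_add[OF assms(3), of "\<ominus>\<^bsub>A\<^esub> x" x] assms(4) additive_zero[OF assms(1-3)]
    by (simp add: A.l_neg)
  then show ?thesis
    using additive_closed[OF assms(3)] assms(4) by (metis A.a_inv_closed B.minus_equality)
qed

lemma additive_diff:
  assumes "abelian_group A" "abelian_group B" "additive_map A B u" "x \<in> carrier A" "y \<in> carrier A"
  shows "u (x \<ominus>\<^bsub>A\<^esub> y) = u x \<ominus>\<^bsub>B\<^esub> u y"
proof -
  interpret A: abelian_group A by fact
  show ?thesis
    using assms by (simp add: a_minus_def additive_add[OF assms(3)] additive_minus[OF assms(1-3)])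
qed

lemma additive_finsum:
  assumes "abelian_group A" "abelian_group B" "additive_map A B u" "f \<in> S \<rightarrow> carrier A"
  shows "u (finsum A f S) = finsum B (\<lambda>i. u (f i)) S"
proof -
  interpret A: abelian_group A by fact
  interpret B: abelian_group B by fact
  show ?thesis
    using assms(4)
  proof (induction S rule: infinite_finite_induct)
    case (insert i S)
    then have "f i \<in> carrier A" "f \<in> S \<rightarrow> carrier A" by auto
    moreover have "(\<lambda>i. u (f i)) \<in> S \<rightarrow> carrier B" "u (f i) \<in> carrier B"
      using calculation additive_closed[OF assms(3)] by (auto simp: Pi_iff)
    ultimately show ?case
      using insert by (simp add: A.finsum_insert B.finsum_insert additive_add[OF assms(3)])
  qed (auto simp: additive_zero[OF assms(1-3)] A.finsum_infinite B.finsum_infinite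
      A.finsum_empty B.finsum_empty)
qed

definition linear_map ::
    "('k, 'l) ring_scheme \<Rightarrow> ('k, 'a, 'm) module_scheme \<Rightarrow> ('k, 'b, 'n) module_scheme \<Rightarrow> ('a \<Rightarrow> 'b) \<Rightarrow> bool"
  where "linear_map K M N u \<longleftrightarrow> additive_map M N u \<and>
     (\<forall>k\<in>carrier K. \<forall>x\<in>carrier M. u (k \<odot>\<^bsub>M\<^esub> x) = k \<odot>\<^bsub>N\<^esub> u x)"

lemma linear_mapI:
  assumes "additive_map M N u"
    and "\<And>k x. \<lbrakk>k \<in> carrier K; x \<in> carrier M\<rbrakk> \<Longrightarrow> u (k \<odot>\<^bsub>M\<^esub> x) = k \<odot>\<^bsub>N\<^esub> u x"
  shows "linear_map K M N u"
  using assms by (auto simp: linear_map_def)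

lemma linear_map_additive: "linear_map K M N u \<Longrightarrow> additive_map M N u"
  by (simp add: linear_map_def)

lemma linear_map_smult:
  "\<lbrakk>linear_map K M N u; k \<in> carrier K; x \<in> carrier M\<rbrakk> \<Longrightarrow> u (k \<odot>\<^bsub>M\<^esub> x) = k \<odot>\<^bsub>N\<^esub> u x"
  by (simp add: linear_map_def)

text \<open>The ungraded core of \<open>graded_alg\<close>. Presented algebras and homology are
  shown to satisfy exactly this; their homogeneous parts are treated separately, as
  submodules.\<close>

locale scalar_alg = module K A + ring A
  for K :: "('k, 'm) ring_scheme" and A :: "('k, 'a, 'n) module_scheme" +
  assumes smult_mult_left:
      "\<lbrakk>k \<in> carrier K; x \<in> carrier A; y \<in> carrier A\<rbrakk> \<Longrightarrow>
        (k \<odot>\<^bsub>A\<^esub> x) \<otimes>\<^bsub>A\<^esub> y = k \<odot>\<^bsub>A\<^esub> (x \<otimes>\<^bsub>A\<^esub> y)"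
    and smult_mult_right:
      "\<lbrakk>k \<in> carrier K; x \<in> carrier A; y \<in> carrier A\<rbrakk> \<Longrightarrow>
        x \<otimes>\<^bsub>A\<^esub> (k \<odot>\<^bsub>A\<^esub> y) = k \<odot>\<^bsub>A\<^esub> (x \<otimes>\<^bsub>A\<^esub> y)"

sublocale graded_alg \<subseteq> scalar_alg K A
  by unfold_locales (auto simp: smult_mult_left smult_mult_right)

lemma linear_map_comp:
  "\<lbrakk>linear_map K M N u; linear_map K N L v\<rbrakk> \<Longrightarrow> linear_map K M L (\<lambda>x. v (u x))"
  by (auto simp: linear_map_def additive_map_def Pi_iff)

lemma linear_map_id: "linear_map K M M (\<lambda>x. x)"
  by (auto simp: linear_map_def additive_map_def)

lemma (in module) linear_map_add:
  assumes "linear_map R N M u" "linear_map R N M v"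
  shows "linear_map R N M (\<lambda>x. u x \<oplus>\<^bsub>M\<^esub> v x)"
  using assms by (auto simp: linear_map_def additive_map_def Pi_iff M.a_ac smult_r_distr)

lemma (in module) linear_map_minus:
  assumes "linear_map R N M u"
  shows "linear_map R N M (\<lambda>x. \<ominus>\<^bsub>M\<^esub> u x)"
  using assms by (auto simp: linear_map_def additive_map_def Pi_iff M.minus_add smult_r_minus)

lemma (in module) linear_map_diff:
  assumes "linear_map R N M u" "linear_map R N M v"
  shows "linear_map R N M (\<lambda>x. u x \<ominus>\<^bsub>M\<^esub> v x)"
  unfolding a_minus_def by (rule linear_map_add[OF assms(1) linear_map_minus[OF assms(2)]])

lemma (in scalar_alg) linear_map_mult_left:
  assumes "linear_map K N A u" "y \<in> carrier A"
  shows "linear_map K N A (\<lambda>x. y \<otimes>\<^bsub>A\<^esub> u x)"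
  using assms by (auto simp: linear_map_def additive_map_def Pi_iff r_distr smult_mult_right)

lemma (in scalar_alg) linear_map_mult_right:
  assumes "linear_map K N A u" "y \<in> carrier A"
  shows "linear_map K N A (\<lambda>x. u x \<otimes>\<^bsub>A\<^esub> y)"
  using assms by (auto simp: linear_map_def additive_map_def Pi_iff l_distr smult_mult_left)

lemma additive_comp: "\<lbrakk>additive_map A B u; additive_map B D v\<rbrakk> \<Longrightarrow> additive_map A D (\<lambda>x. v (u x))"
  by (auto simp: additive_map_def Pi_iff)

lemma additive_id: "additive_map A A (\<lambda>x. x)"
  by (auto simp: additive_map_def)

lemma (in abelian_group) additive_plus:
  "\<lbrakk>additive_map A G u; additive_map A G v\<rbrakk> \<Longrightarrow> additive_map A G (\<lambda>x. u x \<oplus> v x)"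
  by (auto simp: additive_map_def Pi_iff a_ac)

lemma (in ring) additive_mult_left: "\<lbrakk>additive_map A R u; y \<in> carrier R\<rbrakk> \<Longrightarrow> additive_map A R (\<lambda>x. y \<otimes> u x)"
  and additive_mult_right: "\<lbrakk>additive_map A R u; y \<in> carrier R\<rbrakk> \<Longrightarrow> additive_map A R (\<lambda>x. u x \<otimes> y)"
  by (auto simp: additive_map_def Pi_iff r_distr l_distr)

section \<open>Presented algebras\<close>

locale presentation =
  fixes G :: "'g set" and Rel :: "('g \<Rightarrow>\<^sub>0 int) set"
  assumes Rel: "Rel \<subseteq> carrier (free_Abelian_group G)"
begin

abbreviation "nul \<equiv> generate (free_Abelian_group G) Rel"
abbreviation "Q \<equiv> free_Abelian_group G Mod nul"
abbreviation "cls \<equiv> frag_class G Rel"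

lemma nul_subgroup: "subgroup nul (free_Abelian_group G)"
  by (rule group.generate_is_subgroup[OF group_free_Abelian_group Rel])

lemma nul_normal: "nul \<lhd> free_Abelian_group G"
  by (rule comm_group.normal_iff_subgroup[THEN iffD2, OF abelian_free_Abelian_group nul_subgroup])

lemma nul_keys: "f \<in> nul \<Longrightarrow> Poly_Mapping.keys f \<subseteq> G"
  using subgroup.mem_carrier[OF nul_subgroup] by simp

lemma nul_zero: "0 \<in> nul"
  using subgroup.one_closed[OF nul_subgroup] by simp

lemma nul_add: "\<lbrakk>f \<in> nul; g \<in> nul\<rbrakk> \<Longrightarrow> f + g \<in> nul"
  using subgroup.m_closed[OF nul_subgroup, of f g] by simp

lemma nul_uminus: "f \<in> nul \<Longrightarrow> - f \<in> nul"
  using subgroup.m_inv_closed[OF nul_subgroup, of f] by (simp add: nul_keys)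

lemma nul_diff: "\<lbrakk>f \<in> nul; g \<in> nul\<rbrakk> \<Longrightarrow> f - g \<in> nul"
  using nul_add[OF _ nul_uminus, of f g] by simp

lemma nul_rel: "r \<in> Rel \<Longrightarrow> r \<in> nul"
  by (rule generate.incl)

text \<open>Compatibility with differences already yields zero, negatives and sums, and a set with 0
  closed under differences is a subgroup; so membership of the image is tested on the relations
  alone.\<close>

lemma nul_additive_image:
  assumes diff: "\<And>f g. \<phi> (f - g) = \<phi> f - \<phi> g"
    and Rel: "\<And>r. r \<in> Rel \<Longrightarrow> \<phi> r \<in> N"
    and N: "0 \<in> N" "\<And>f g. \<lbrakk>f \<in> N; g \<in> N\<rbrakk> \<Longrightarrow> f - g \<in> N"
    and f: "f \<in> nul"
  shows "\<phi> f \<in> (N :: ('h \<Rightarrow>\<^sub>0 int) set)"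
proof -
  have zero: "\<phi> 0 = 0" using diff[of 0 0] by simp
  have neg: "\<phi> (- f) = - \<phi> f" for f using diff[of 0 f] zero by simp
  have N_neg: "- f \<in> N" if "f \<in> N" for f using N(2)[OF N(1) that] by simp
  have add: "\<phi> (f + g) = \<phi> f + \<phi> g" for f g
    using diff[of f "- g"] neg[of g] by simp
  have N_add: "f + g \<in> N" if "f \<in> N" "g \<in> N" for f g
    using N(2)[OF that(1) N_neg[OF that(2)]] by simp
  show ?thesis
    using f
  proof (induction rule: generate.induct)
    case one
    show ?case by (simp add: zero N)
  next
    case (incl h)
    then show ?case by (rule assms(2))
  next
    case (inv h)
    then have "inv\<^bsub>free_Abelian_group G\<^esub> h = - h"
      using presentation.Rel[OF presentation_axioms] by auto
    then show ?case using inv by (simp add: neg N_neg assms(2))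
  next
    case (eng h1 h2)
    then show ?case by (simp add: add N_add)
  qed
qed

lemma cls_eq: "cls f = (\<lambda>n. n + f) ` nul"
  by (auto simp: frag_class_def r_coset_def)

lemma cls_self: "f \<in> cls f"
  unfolding cls_eq by (rule image_eqI[OF _ nul_zero]) simp

lemma cls_mem: "g \<in> cls f \<longleftrightarrow> g - f \<in> nul"
proof
  assume "g \<in> cls f" then show "g - f \<in> nul" by (auto simp: cls_eq)
next
  assume "g - f \<in> nul"
  then show "g \<in> cls f" unfolding cls_eq by (intro image_eqI[of _ _ "g - f"]) auto
qed

lemma cls_eq_iff: "cls f = cls g \<longleftrightarrow> f - g \<in> nul"
proof
  assume "cls f = cls g"
  then show "f - g \<in> nul" using cls_self[of f] cls_mem by blast
next
  assume a: "f - g \<in> nul"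
  have "x - f \<in> nul \<longleftrightarrow> x - g \<in> nul" for x
    using nul_add[OF _ a, of "x - f"] nul_diff[OF _ a, of "x - g"] by auto
  then show "cls f = cls g" by (auto simp: cls_mem)
qed

lemma cls_closed: "Poly_Mapping.keys f \<subseteq> G \<Longrightarrow> cls f \<in> carrier Q"
  unfolding frag_class_def carrier_FactGroup by simp

lemma Q_cases:
  assumes "X \<in> carrier Q"
  obtains f where "Poly_Mapping.keys f \<subseteq> G" "X = cls f"
  using assms unfolding carrier_FactGroup frag_class_def by auto

lemma cls_add:
  assumes "Poly_Mapping.keys f \<subseteq> G" "Poly_Mapping.keys g \<subseteq> G"
  shows "cls f \<otimes>\<^bsub>Q\<^esub> cls g = cls (f + g)"
  using normal.rcos_sum[OF nul_normal, of f g] assms unfolding frag_class_def by simp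

lemma cls_zero: "cls 0 = \<one>\<^bsub>Q\<^esub>"
  by (auto simp: cls_eq)

lemma Q_comm_group: "comm_group Q"
  by (rule comm_group.abelian_FactGroup[OF abelian_free_Abelian_group nul_subgroup])

lemma keys_extend:
  assumes "\<And>x. x \<in> G \<Longrightarrow> Poly_Mapping.keys (\<phi> x) \<subseteq> H" "Poly_Mapping.keys f \<subseteq> G"
  shows "Poly_Mapping.keys (frag_extend \<phi> f) \<subseteq> H"
  using keys_frag_extend[of \<phi> f] assms by blast

text \<open>The operations of \<open>presented_algebra\<close> are unions over representatives. Once
  the term is independent of the representative, the union collapses, because the coset is
  nonempty.\<close>

lemma union_cls:
  assumes "\<And>x y. x - y \<in> nul \<Longrightarrow> \<psi> x = \<psi> y"
  shows "(\<Union>x\<in>cls f. \<psi> x) = \<psi> f"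
proof -
  have "(\<Union>x\<in>cls f. \<psi> x) = (\<Union>x\<in>cls f. \<psi> f)"
    by (rule SUP_cong[OF refl]) (rule assms, simp add: cls_mem)
  then show ?thesis using cls_self[of f] by auto
qed

text \<open>The universal property of generators and relations in its raw form. Those of the tensor
  product and of the exterior algebra are derived from it through
  \<open>additive_ext\<close>.\<close>

lemma Q_hom_ext:
  assumes "comm_group H" "u \<in> hom (free_Abelian_group G) H" "\<And>r. r \<in> Rel \<Longrightarrow> u r = \<one>\<^bsub>H\<^esub>"
  obtains v where "v \<in> hom Q H" "\<And>f. Poly_Mapping.keys f \<subseteq> G \<Longrightarrow> v (cls f) = u f"
proof -
  interpret H: comm_group H by fact
  interpret u: group_hom "free_Abelian_group G" H u
    by (simp add: group_hom_def group_hom_axioms_def assms H.is_group)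
  have ker: "u f = \<one>\<^bsub>H\<^esub>" if "f \<in> nul" for f
    using that
  proof (induction rule: generate.induct)
    case (inv h)
    then have "h \<in> carrier (free_Abelian_group G)" using Rel by blast
    from u.hom_inv[OF this] show ?case using assms(3)[OF inv] by simp
  next
    case (eng a b)
    then have "a \<in> carrier (free_Abelian_group G)" "b \<in> carrier (free_Abelian_group G)"
      using nul_keys by auto
    from u.hom_mult[OF this] eng show ?case by simp
  qed (use assms(3) u.hom_one in auto)
  have "u f = u g" if fg: "f \<in> carrier (free_Abelian_group G)" "g \<in> carrier (free_Abelian_group G)"
     "nul #>\<^bsub>free_Abelian_group G\<^esub> f = nul #>\<^bsub>free_Abelian_group G\<^esub> g" for f g
  proof -
    have "f - g \<in> nul" using fg(3) cls_eq_iff unfolding frag_class_def by blast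
    then have "u (f - g) = \<one>\<^bsub>H\<^esub>" by (rule ker)
    moreover have "u f = u (f - g) \<otimes>\<^bsub>H\<^esub> u g"
      using u.hom_mult[of "f - g" g] fg keys_diff[of f g] by auto
    ultimately show ?thesis using fg by simp
  qed
  from FactGroup_universal[OF assms(2) nul_normal this]
  obtain v where "v \<in> hom Q H" "\<And>f. f \<in> carrier (free_Abelian_group G) \<Longrightarrow> v (nul #>\<^bsub>free_Abelian_group G\<^esub> f) = u f"
    by metis
  then show ?thesis using that unfolding frag_class_def by simp
qed

lemma Q_induct [consumes 1, case_names zero gen diff]:
  assumes "X \<in> carrier Q"
    and "P (cls 0)"
    and "\<And>x. x \<in> G \<Longrightarrow> P (cls (frag_of x))"
    and "\<And>f g. \<lbrakk>Poly_Mapping.keys f \<subseteq> G; Poly_Mapping.keys g \<subseteq> G; P (cls f); P (cls g)\<rbrakk> \<Longrightarrow> P (cls (f - g))"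
  shows "P X"
proof -
  obtain f where f: "Poly_Mapping.keys f \<subseteq> G" "X = cls f"
    using assms(1) by (rule Q_cases)
  show ?thesis
    unfolding f(2) by (rule free_Abelian_group_induct[OF f(1)]) (use assms in auto)
qed

end

section \<open>Biadditive extension on free abelian groups\<close>

lemma frag_cmul_diff: "frag_cmul k (p - q) = frag_cmul k p - frag_cmul k q"
  by (rule poly_mapping_eqI) (simp add: lookup_minus right_diff_distrib)

lemma frag_extend_fun_diff: "frag_extend (\<lambda>x. a x - b x) f = frag_extend a f - frag_extend b f"
  by (simp add: frag_extend_def sum_subtractf frag_cmul_diff)

lemmas keys_induct = free_Abelian_group_induct [consumes 1, case_names zero diff gen]

definition frag_biextend :: "('g \<Rightarrow> 'h \<Rightarrow> 'c \<Rightarrow>\<^sub>0 int) \<Rightarrow> ('g \<Rightarrow>\<^sub>0 int) \<Rightarrow> ('h \<Rightarrow>\<^sub>0 int) \<Rightarrow> 'c \<Rightarrow>\<^sub>0 int" where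
  "frag_biextend \<phi> f g = frag_extend (\<lambda>x. frag_extend (\<phi> x) g) f"

lemma frag_biextend_diff_left: "frag_biextend \<phi> (f - f') g = frag_biextend \<phi> f g - frag_biextend \<phi> f' g"
  by (simp add: frag_biextend_def frag_extend_diff)

lemma frag_biextend_diff_right: "frag_biextend \<phi> f (g - g') = frag_biextend \<phi> f g - frag_biextend \<phi> f g'"
  by (simp add: frag_biextend_def frag_extend_diff frag_extend_fun_diff)

lemma frag_biextend_zero [simp]: "frag_biextend \<phi> 0 g = 0" "frag_biextend \<phi> f 0 = 0"
  using frag_biextend_diff_left[of \<phi> 0 0 g] frag_biextend_diff_right[of \<phi> f 0 0] by simp_all

lemma frag_biextend_add_left: "frag_biextend \<phi> (f + f') g = frag_biextend \<phi> f g + frag_biextend \<phi> f' g"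
  using frag_biextend_diff_left[of \<phi> "f + f'" f' g] by simp

lemma frag_biextend_add_right: "frag_biextend \<phi> f (g + g') = frag_biextend \<phi> f g + frag_biextend \<phi> f g'"
  using frag_biextend_diff_right[of \<phi> f "g + g'" g'] by simp

lemma frag_biextend_of [simp]: "frag_biextend \<phi> (frag_of x) (frag_of y) = \<phi> x y"
  by (simp add: frag_biextend_def)

section \<open>Additive and biadditive operations that descend to the quotient\<close>

context presentation
begin

text \<open>What a biadditive operation needs in order to descend in both arguments, tested only on
  a relation against a generator.\<close>

definition bistable :: "('g \<Rightarrow> 'g \<Rightarrow> 'g \<Rightarrow>\<^sub>0 int) \<Rightarrow> bool" where
  "bistable \<phi> \<longleftrightarrow> (\<forall>x\<in>G. \<forall>y\<in>G. Poly_Mapping.keys (\<phi> x y) \<subseteq> G) \<and>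
     (\<forall>r\<in>Rel. \<forall>x\<in>G. frag_extend (\<phi> x) r \<in> nul \<and> frag_extend (\<lambda>y. \<phi> y x) r \<in> nul)"

lemma biextend_closed:
  assumes "bistable \<phi>" "Poly_Mapping.keys f \<subseteq> G" "Poly_Mapping.keys g \<subseteq> G"
  shows "Poly_Mapping.keys (frag_biextend \<phi> f g) \<subseteq> G"
  unfolding frag_biextend_def
  by (intro keys_extend) (use assms in \<open>auto simp: bistable_def\<close>)

lemma biextend_nul_left:
  assumes \<phi>: "bistable \<phi>" and f: "f \<in> nul" and g: "Poly_Mapping.keys g \<subseteq> G"
  shows "frag_biextend \<phi> f g \<in> nul"
  using g
proof (induction rule: keys_induct)
  case (gen y)
  have "frag_biextend \<phi> r (frag_of y) \<in> nul" if "r \<in> Rel" for r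
    using \<phi> that gen by (simp add: bistable_def frag_biextend_def)
  then show ?case
    by (rule nul_additive_image[OF frag_biextend_diff_left _ nul_zero nul_diff f])
qed (simp_all add: nul_zero frag_biextend_diff_right nul_diff)

lemma biextend_nul_right:
  assumes \<phi>: "bistable \<phi>" and g: "g \<in> nul" and f: "Poly_Mapping.keys f \<subseteq> G"
  shows "frag_biextend \<phi> f g \<in> nul"
  using f
proof (induction rule: keys_induct)
  case (gen x)
  have "frag_biextend \<phi> (frag_of x) r \<in> nul" if "r \<in> Rel" for r
    using \<phi> that gen by (simp add: bistable_def frag_biextend_def)
  then show ?case
    by (rule nul_additive_image[OF frag_biextend_diff_right _ nul_zero nul_diff g])
qed (simp_all add: nul_zero frag_biextend_diff_left nul_diff)

text \<open>Changing the two representatives one after the other splits the change of the value into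
  two terms, each with one argument in \<open>nul\<close>. Hence all cosets in the double union
  coincide.\<close>

lemma cls_biextend:
  assumes \<phi>: "bistable \<phi>" and f: "Poly_Mapping.keys f \<subseteq> G" and g: "Poly_Mapping.keys g \<subseteq> G"
  shows "(\<Union>f'\<in>cls f. \<Union>g'\<in>cls g. cls (frag_extend (\<lambda>x. frag_extend (\<phi> x) g') f')) =
    cls (frag_biextend \<phi> f g)"
proof -
  have keys: "Poly_Mapping.keys h' \<subseteq> G" if "h' \<in> cls h" "Poly_Mapping.keys h \<subseteq> G" for h h'
    using that keys_add unfolding cls_eq by (fastforce dest: nul_keys)
  have eq: "cls (frag_biextend \<phi> f' g') = cls (frag_biextend \<phi> f g)"
    if "f' \<in> cls f" "g' \<in> cls g" for f' g'
  proof -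
    have "frag_biextend \<phi> f' g' - frag_biextend \<phi> f g =
        frag_biextend \<phi> (f' - f) g' + frag_biextend \<phi> f (g' - g)"
      by (simp add: frag_biextend_diff_left frag_biextend_diff_right)
    also have "\<dots> \<in> nul"
      using that keys f g by (intro nul_add biextend_nul_left biextend_nul_right \<phi>) (auto simp: cls_mem)
    finally show ?thesis by (simp add: cls_eq_iff)
  qed
  have "(\<Union>f'\<in>cls f. \<Union>g'\<in>cls g. cls (frag_biextend \<phi> f' g')) =
      (\<Union>f'\<in>cls f. \<Union>g'\<in>cls g. cls (frag_biextend \<phi> f g))"
    by (intro SUP_cong refl eq)
  then show ?thesis
    unfolding frag_biextend_def[symmetric] using cls_self[of f] cls_self[of g] by auto
qed

lemma cls_extend:
  assumes "\<And>r. r \<in> Rel \<Longrightarrow> frag_extend \<phi> r \<in> nul"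
  shows "(\<Union>f'\<in>cls f. cls (frag_extend \<phi> f')) = cls (frag_extend \<phi> f)"
proof (rule union_cls)
  fix x y assume "x - y \<in> nul"
  then have "frag_extend \<phi> (x - y) \<in> nul"
    by (rule nul_additive_image[where \<phi> = "frag_extend \<phi>" and N = nul, rotated -1])
      (simp_all add: frag_extend_diff assms nul_zero nul_diff)
  then show "cls (frag_extend \<phi> x) = cls (frag_extend \<phi> y)"
    by (simp add: cls_eq_iff frag_extend_diff)
qed

end

text \<open>The monoid laws are demanded as equalities of generators, but additivity of
  \<open>act\<close> in the scalar only modulo \<open>nul\<close>, since the action of a sum is
  again a single generator. \<open>X\<close> is tied to the construction field by field, so that
  records with further fields, such as a differential, are covered.\<close>

locale presented_alg = presentation G Rel + K: cring K
  for G :: "'g set" and Rel and K :: "('k, 'm) ring_scheme" +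
  fixes mul :: "'g \<Rightarrow> 'g \<Rightarrow> 'g" and e :: 'g and act :: "'k \<Rightarrow> 'g \<Rightarrow> 'g"
    and X :: "('k, ('g \<Rightarrow>\<^sub>0 int) set, 'z) module_scheme"
  assumes mul_closed: "\<lbrakk>x \<in> G; y \<in> G\<rbrakk> \<Longrightarrow> mul x y \<in> G"
    and mul_assoc: "\<lbrakk>x \<in> G; y \<in> G; z \<in> G\<rbrakk> \<Longrightarrow> mul (mul x y) z = mul x (mul y z)"
    and e_closed: "e \<in> G"
    and e_left: "x \<in> G \<Longrightarrow> mul e x = x" and e_right: "x \<in> G \<Longrightarrow> mul x e = x"
    and act_closed: "\<lbrakk>k \<in> carrier K; x \<in> G\<rbrakk> \<Longrightarrow> act k x \<in> G"
    and mul_rel: "\<lbrakk>r \<in> Rel; x \<in> G\<rbrakk> \<Longrightarrow> frag_extend (\<lambda>y. frag_of (mul x y)) r \<in> nul"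
      "\<lbrakk>r \<in> Rel; x \<in> G\<rbrakk> \<Longrightarrow> frag_extend (\<lambda>y. frag_of (mul y x)) r \<in> nul"
    and act_rel: "\<lbrakk>r \<in> Rel; k \<in> carrier K\<rbrakk> \<Longrightarrow> frag_extend (\<lambda>x. frag_of (act k x)) r \<in> nul"
    and act_add: "\<lbrakk>k \<in> carrier K; l \<in> carrier K; x \<in> G\<rbrakk> \<Longrightarrow>
      frag_of (act (k \<oplus>\<^bsub>K\<^esub> l) x) - frag_of (act k x) - frag_of (act l x) \<in> nul"
    and act_act: "\<lbrakk>k \<in> carrier K; l \<in> carrier K; x \<in> G\<rbrakk> \<Longrightarrow> act (k \<otimes>\<^bsub>K\<^esub> l) x = act k (act l x)"
    and act_one: "x \<in> G \<Longrightarrow> act \<one>\<^bsub>K\<^esub> x = x"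
    and act_mul_left: "\<lbrakk>k \<in> carrier K; x \<in> G; y \<in> G\<rbrakk> \<Longrightarrow> mul (act k x) y = act k (mul x y)"
    and act_mul_right: "\<lbrakk>k \<in> carrier K; x \<in> G; y \<in> G\<rbrakk> \<Longrightarrow> mul x (act k y) = act k (mul x y)"
    and X_carrier: "carrier X = carrier Q"
    and X_zero: "\<zero>\<^bsub>X\<^esub> = \<one>\<^bsub>Q\<^esub>"
    and X_add: "add X = monoid.mult Q"
    and X_one: "\<one>\<^bsub>X\<^esub> = cls (frag_of e)"
    and X_mult: "monoid.mult X = (\<lambda>X Y. \<Union>f\<in>X. \<Union>g\<in>Y.
      cls (frag_extend (\<lambda>x. frag_extend (\<lambda>y. frag_of (mul x y)) g) f))"
    and X_smult: "smult X = (\<lambda>k X. \<Union>f\<in>X. cls (frag_extend (\<lambda>x. frag_of (act k x)) f))"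
begin

abbreviation "M \<equiv> frag_biextend (\<lambda>x y. frag_of (mul x y))"
abbreviation "A k \<equiv> frag_extend (\<lambda>x. frag_of (act k x))"

lemma bistable_mul: "bistable (\<lambda>x y. frag_of (mul x y))"
  by (auto simp: bistable_def mul_closed mul_rel)

lemma A_closed: "\<lbrakk>k \<in> carrier K; Poly_Mapping.keys f \<subseteq> G\<rbrakk> \<Longrightarrow> Poly_Mapping.keys (A k f) \<subseteq> G"
  by (rule keys_extend) (auto simp: act_closed)

lemma mult_cls:
  "\<lbrakk>Poly_Mapping.keys f \<subseteq> G; Poly_Mapping.keys g \<subseteq> G\<rbrakk> \<Longrightarrow> cls f \<otimes>\<^bsub>X\<^esub> cls g = cls (M f g)"
  unfolding X_mult by (rule cls_biextend[OF bistable_mul])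

lemma smult_cls: "k \<in> carrier K \<Longrightarrow> k \<odot>\<^bsub>X\<^esub> cls f = cls (A k f)"
  unfolding X_smult by (rule cls_extend) (rule act_rel)

lemma add_cls:
  "\<lbrakk>Poly_Mapping.keys f \<subseteq> G; Poly_Mapping.keys g \<subseteq> G\<rbrakk> \<Longrightarrow> cls f \<oplus>\<^bsub>X\<^esub> cls g = cls (f + g)"
  using cls_add by (simp add: X_add)

lemma zero_cls: "\<zero>\<^bsub>X\<^esub> = cls 0"
  by (simp add: X_zero cls_zero)

lemma abelian_group_X: "abelian_group X"
proof -
  interpret Q: comm_group Q by (rule Q_comm_group)
  show ?thesis
  proof (rule abelian_groupI, unfold X_carrier X_add X_zero)
    fix x assume "x \<in> carrier Q"
    then show "\<exists>y\<in>carrier Q. y \<otimes>\<^bsub>Q\<^esub> x = \<one>\<^bsub>Q\<^esub>"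
      using Q.l_inv_ex by blast
  qed (simp_all add: Q.m_assoc Q.m_comm Q.m_lcomm del: mult_FactGroup one_FactGroup)
qed

lemma M_assoc:
  assumes "Poly_Mapping.keys f \<subseteq> G" "Poly_Mapping.keys g \<subseteq> G" "Poly_Mapping.keys h \<subseteq> G"
  shows "M (M f g) h = M f (M g h)"
  using assms(1)
proof (induction rule: keys_induct)
  case (gen x)
  then have x: "x \<in> G" .
  show ?case
    using assms(2)
  proof (induction rule: keys_induct)
    case (gen y)
    then have y: "y \<in> G" .
    show ?case
      using assms(3)
      by (induction rule: keys_induct)
        (simp_all add: frag_biextend_diff_right mul_assoc x y)
  qed (simp_all add: frag_biextend_diff_left frag_biextend_diff_right)
qed (simp_all add: frag_biextend_diff_left)

lemma M_one:
  assumes "Poly_Mapping.keys f \<subseteq> G"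
  shows "M (frag_of e) f = f" "M f (frag_of e) = f"
  using assms
  by (induction rule: keys_induct)
    (simp_all add: frag_biextend_diff_left frag_biextend_diff_right e_left e_right)

lemma A_M:
  assumes "k \<in> carrier K" "Poly_Mapping.keys f \<subseteq> G" "Poly_Mapping.keys g \<subseteq> G"
  shows "M (A k f) g = A k (M f g)" "M f (A k g) = A k (M f g)"
proof -
  have "M (A k f) g = A k (M f g) \<and> M f (A k g) = A k (M f g)"
    using assms(2)
  proof (induction rule: keys_induct)
    case (gen x)
    then have x: "x \<in> G" .
    show ?case
      using assms(3)
      by (induction rule: keys_induct)
        (simp_all add: frag_biextend_diff_right frag_extend_diff act_mul_left act_mul_right x assms(1))
  qed (simp_all add: frag_biextend_diff_left frag_extend_diff)
  then show "M (A k f) g = A k (M f g)" "M f (A k g) = A k (M f g)" by auto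
qed

lemma A_A:
  assumes "k \<in> carrier K" "l \<in> carrier K" "Poly_Mapping.keys f \<subseteq> G"
  shows "A (k \<otimes>\<^bsub>K\<^esub> l) f = A k (A l f)"
  using assms(3)
  by (induction rule: keys_induct) (simp_all add: frag_extend_diff act_act assms(1,2))

lemma A_one: "Poly_Mapping.keys f \<subseteq> G \<Longrightarrow> A \<one>\<^bsub>K\<^esub> f = f"
  by (induction rule: keys_induct) (simp_all add: frag_extend_diff act_one)

lemma A_add:
  assumes "k \<in> carrier K" "l \<in> carrier K" "Poly_Mapping.keys f \<subseteq> G"
  shows "A (k \<oplus>\<^bsub>K\<^esub> l) f - (A k f + A l f) \<in> nul"
  using assms(3)
proof (induction rule: keys_induct)
  case (diff f g)
  have "A (k \<oplus>\<^bsub>K\<^esub> l) (f - g) - (A k (f - g) + A l (f - g)) =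
      (A (k \<oplus>\<^bsub>K\<^esub> l) f - (A k f + A l f)) - (A (k \<oplus>\<^bsub>K\<^esub> l) g - (A k g + A l g))"
    by (simp add: frag_extend_diff)
  then show ?case using nul_diff[OF diff(3,4)] by simp
next
  case (gen x)
  then show ?case using act_add[OF assms(1,2)] by (simp add: algebra_simps)
qed (simp add: nul_zero)

lemma cls_A_add:
  assumes "k \<in> carrier K" "l \<in> carrier K" "Poly_Mapping.keys f \<subseteq> G"
  shows "cls (A (k \<oplus>\<^bsub>K\<^esub> l) f) = cls (A k f + A l f)"
  unfolding cls_eq_iff by (rule A_add[OF assms])

lemma scalar_alg: "scalar_alg K X"
proof -
  have keys_sum: "Poly_Mapping.keys (f + g) \<subseteq> G"
    if "Poly_Mapping.keys f \<subseteq> G" "Poly_Mapping.keys g \<subseteq> G" for f g :: "'g \<Rightarrow>\<^sub>0 int"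
    using keys_add[of f g] that by blast
  note closed = keys_sum A_closed biextend_closed[OF bistable_mul]
  have ring: "ring X"
  proof (rule ringI)
    show "abelian_group X" by (rule abelian_group_X)
    show "Group.monoid X"
    proof (rule monoidI; (unfold X_carrier)?)
      show "\<one>\<^bsub>X\<^esub> \<in> carrier Q" by (simp add: X_one cls_closed e_closed)
    qed (auto elim!: Q_cases simp: mult_cls X_one e_closed closed cls_closed M_assoc M_one)
  qed (auto simp: X_carrier elim!: Q_cases simp: mult_cls add_cls closed
      frag_biextend_add_left frag_biextend_add_right)
  have module: "module K X"
    by (rule moduleI[OF K.is_cring abelian_group_X])
      (auto simp: X_carrier elim!: Q_cases simp: smult_cls add_cls closed cls_closed cls_A_add
        frag_extend_add A_A A_one)
  show ?thesis
    by (intro scalar_alg.intro module ring scalar_alg_axioms.intro)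
      (auto simp: X_carrier elim!: Q_cases simp: smult_cls mult_cls closed A_M)
qed

lemma X_cases:
  assumes "Y \<in> carrier X"
  obtains f where "Poly_Mapping.keys f \<subseteq> G" "Y = cls f"
  using assms unfolding X_carrier by (rule Q_cases)

lemma X_closed: "Poly_Mapping.keys f \<subseteq> G \<Longrightarrow> cls f \<in> carrier X"
  unfolding X_carrier by (rule cls_closed)

lemma minus_cls:
  assumes "Poly_Mapping.keys f \<subseteq> G"
  shows "\<ominus>\<^bsub>X\<^esub> cls f = cls (- f)"
proof -
  interpret X: abelian_group X by (rule abelian_group_X)
  show ?thesis
    by (rule X.minus_equality) (use assms in \<open>auto simp: add_cls zero_cls X_closed\<close>)
qed

lemma X_induct [consumes 1, case_names gen add minus]:
  assumes "Y \<in> carrier X"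
    and "\<And>x. x \<in> G \<Longrightarrow> P (cls (frag_of x))"
    and "\<And>Y Z. \<lbrakk>Y \<in> carrier X; Z \<in> carrier X; P Y; P Z\<rbrakk> \<Longrightarrow> P (Y \<oplus>\<^bsub>X\<^esub> Z)"
    and "\<And>Y. \<lbrakk>Y \<in> carrier X; P Y\<rbrakk> \<Longrightarrow> P (\<ominus>\<^bsub>X\<^esub> Y)"
  shows "P Y"
proof -
  interpret X: abelian_group X by (rule abelian_group_X)
  have P_diff: "P (cls (f - g))" if "Poly_Mapping.keys f \<subseteq> G" "Poly_Mapping.keys g \<subseteq> G"
      "P (cls f)" "P (cls g)" for f g
    using assms(3)[of "cls f" "\<ominus>\<^bsub>X\<^esub> cls g"] assms(4)[of "cls g"] that
    by (simp add: X_closed minus_cls add_cls)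
  have "P (cls 0)"
    using P_diff[of "frag_of e" "frag_of e"] assms(2)[OF e_closed] e_closed by simp
  then show ?thesis
    using assms(1) P_diff assms(2) unfolding X_carrier by (auto elim: Q_induct)
qed

text \<open>The hypothesis \<open>rel\<close> ranges over all \<open>u\<close> because the extension
  of \<open>g\<close> to the free abelian group is known only through its values on
  generators.\<close>

lemma additive_ext:
  assumes "abelian_group H" "g \<in> G \<rightarrow> carrier H"
    and rel: "\<And>u r. \<lbrakk>u \<in> hom (free_Abelian_group G) (add_monoid H); \<And>x. x \<in> G \<Longrightarrow> u (frag_of x) = g x; r \<in> Rel\<rbrakk>
      \<Longrightarrow> u r = \<zero>\<^bsub>H\<^esub>"
  obtains v where "additive_map X H v" "\<And>x. x \<in> G \<Longrightarrow> v (cls (frag_of x)) = g x"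
proof -
  interpret H: abelian_group H by fact
  obtain u where u: "u \<in> hom (free_Abelian_group G) (add_monoid H)" "\<And>x. x \<in> G \<Longrightarrow> u (frag_of x) = g x"
    using comm_group.free_Abelian_group_universal[OF H.a_comm_group, of g G] assms(2) by auto
  obtain v where v: "v \<in> hom Q (add_monoid H)" "\<And>f. Poly_Mapping.keys f \<subseteq> G \<Longrightarrow> v (cls f) = u f"
    using Q_hom_ext[OF H.a_comm_group u(1)] rel[OF u] by auto
  show ?thesis
  proof
    show "additive_map X H v"
      using v(1) by (auto simp: hom_def additive_map_def X_carrier X_add)
    show "\<And>x. x \<in> G \<Longrightarrow> v (cls (frag_of x)) = g x"
      using v(2) u(2) by simp
  qed
qed

end

lemma additive_frag_diff:
  assumes "abelian_group H" "u \<in> hom (free_Abelian_group G) (add_monoid H)"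
    "Poly_Mapping.keys f \<subseteq> G" "Poly_Mapping.keys g \<subseteq> G"
  shows "u (f - g) = u f \<ominus>\<^bsub>H\<^esub> u g" "u f \<in> carrier H"
proof -
  interpret H: abelian_group H by fact
  interpret u: group_hom "free_Abelian_group G" "add_monoid H" u
    using assms(2) H.a_comm_group by (simp add: group_hom_def group_hom_axioms_def comm_group.axioms)
  have "u (f - g) = u (f \<otimes>\<^bsub>free_Abelian_group G\<^esub> inv\<^bsub>free_Abelian_group G\<^esub> g)"
    using assms(4) by simp
  also have "\<dots> = u f \<otimes>\<^bsub>add_monoid H\<^esub> u (inv\<^bsub>free_Abelian_group G\<^esub> g)"
    by (rule u.hom_mult) (use assms(3,4) in auto)
  also have "\<dots> = u f \<ominus>\<^bsub>H\<^esub> u g"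
    using assms(4) u.hom_inv[of g] by (simp add: a_minus_def a_inv_def del: inv_free_Abelian_group)
  finally show "u (f - g) = u f \<ominus>\<^bsub>H\<^esub> u g" .
  show "u f \<in> carrier H"
    using u.hom_closed[of f] assms(3) by simp
qed

section \<open>Submodules spanned by classes of generators\<close>

context presented_alg
begin

lemma submodule_cls:
  assumes "H \<subseteq> G" "\<And>k x. \<lbrakk>k \<in> carrier K; x \<in> H\<rbrakk> \<Longrightarrow> act k x \<in> H"
  shows "submodule (cls ` carrier (free_Abelian_group H)) K X"
proof -
  interpret X: scalar_alg K X by (rule scalar_alg)
  have keys: "Poly_Mapping.keys f \<subseteq> G" if "Poly_Mapping.keys f \<subseteq> H" for f
    using that assms(1) by (rule order.trans)
  have sum: "Poly_Mapping.keys (f + g) \<subseteq> H" if "Poly_Mapping.keys f \<subseteq> H" "Poly_Mapping.keys g \<subseteq> H" for f g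
    using keys_add[of f g] that by blast
  have A: "Poly_Mapping.keys (A k f) \<subseteq> H" if "k \<in> carrier K" "Poly_Mapping.keys f \<subseteq> H" for k f
    using keys_frag_extend[of "\<lambda>x. frag_of (act k x)" f] that assms(2)[OF that(1)] by auto
  show ?thesis
  proof (rule X.submoduleI)
    show "cls ` carrier (free_Abelian_group H) \<subseteq> carrier X"
      by (rule image_subsetI) (simp add: X_closed keys)
    show "\<zero>\<^bsub>X\<^esub> \<in> cls ` carrier (free_Abelian_group H)"
      unfolding zero_cls by (rule imageI) simp
  next
    fix a assume "a \<in> cls ` carrier (free_Abelian_group H)"
    then obtain f where f: "Poly_Mapping.keys f \<subseteq> H" "a = cls f" by auto
    then have "\<ominus>\<^bsub>X\<^esub> a = cls (- f)" by (simp add: minus_cls keys)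
    then show "\<ominus>\<^bsub>X\<^esub> a \<in> cls ` carrier (free_Abelian_group H)" using f by (auto simp: image_iff)
  next
    fix a b assume "a \<in> cls ` carrier (free_Abelian_group H)" "b \<in> cls ` carrier (free_Abelian_group H)"
    then obtain f g where f: "Poly_Mapping.keys f \<subseteq> H" "a = cls f" "Poly_Mapping.keys g \<subseteq> H" "b = cls g" by auto
    then have "a \<oplus>\<^bsub>X\<^esub> b = cls (f + g)" by (simp add: add_cls keys)
    then show "a \<oplus>\<^bsub>X\<^esub> b \<in> cls ` carrier (free_Abelian_group H)" using sum[OF f(1,3)] by simp
  next
    fix k a assume k: "k \<in> carrier K" and "a \<in> cls ` carrier (free_Abelian_group H)"
    then obtain f where f: "Poly_Mapping.keys f \<subseteq> H" "a = cls f" by auto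
    then have "k \<odot>\<^bsub>X\<^esub> a = cls (A k f)" by (simp add: smult_cls k)
    then show "k \<odot>\<^bsub>X\<^esub> a \<in> cls ` carrier (free_Abelian_group H)" using A[OF k f(1)] by simp
  qed
qed

text \<open>In \<open>X_induct\<close> zero arises as the difference of \<open>e\<close> with
  itself; \<open>H\<close> may miss \<open>e\<close>, so here zero is a case of its own.\<close>

lemma cls_image_induct [consumes 2, case_names gen add minus]:
  assumes "Y \<in> cls ` carrier (free_Abelian_group H)" "H \<subseteq> G"
    and gen: "\<And>x. x \<in> H \<Longrightarrow> P (cls (frag_of x))"
    and add: "\<And>Y Z. \<lbrakk>Y \<in> carrier X; Z \<in> carrier X; P Y; P Z\<rbrakk> \<Longrightarrow> P (Y \<oplus>\<^bsub>X\<^esub> Z)"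
    and minus: "\<And>Y. \<lbrakk>Y \<in> carrier X; P Y\<rbrakk> \<Longrightarrow> P (\<ominus>\<^bsub>X\<^esub> Y)"
    and zero: "P \<zero>\<^bsub>X\<^esub>"
  shows "P Y"
proof -
  obtain f where f: "Poly_Mapping.keys f \<subseteq> H" "Y = cls f" using assms(1) by auto
  have "P (cls f)"
    using f(1)
  proof (induction rule: keys_induct)
    case zero
    show ?case using assms(6) by (simp add: zero_cls)
  next
    case (diff f g)
    then have "Poly_Mapping.keys f \<subseteq> G" "Poly_Mapping.keys g \<subseteq> G" using assms(2) by auto
    then have "cls (f - g) = cls f \<oplus>\<^bsub>X\<^esub> \<ominus>\<^bsub>X\<^esub> cls g" "cls f \<in> carrier X" "cls g \<in> carrier X"
      "\<ominus>\<^bsub>X\<^esub> cls g \<in> carrier X"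
      by (simp_all add: minus_cls add_cls X_closed)
    then show ?case using diff(3,4) add minus by simp
  next
    case (gen x)
    then show ?case by (rule assms(3))
  qed
  then show ?thesis using f by simp
qed

end

section \<open>Base change\<close>

text \<open>Only the truncation of \<open>X\<close> is prescribed: \<open>X\<close> is the plain
  base change in the case of the exterior algebra, and carries a differential in the case of the
  resolution.\<close>

locale tensor = scalar_alg K A + T: cring T
  for K :: "('k, 'm) ring_scheme" and A :: "('k, 'a, 'n) graded_algebra_scheme" (structure)
    and T :: "('t, 'l) ring_scheme" +
  fixes h :: "'k \<Rightarrow> 't" and X :: "('t, ('a \<times> 't \<Rightarrow>\<^sub>0 int) set, 'z) graded_algebra_scheme"
  assumes h_hom: "h \<in> ring_hom K T"
    and X_eq: "graded_algebra.truncate X = base_change K A h T"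
begin

abbreviation "GT \<equiv> carrier A \<times> carrier T"
abbreviation "RT \<equiv> tensor_rels K A h T"
abbreviation "pt \<equiv> pure_tensor K A h T"

lemma h_closed: "k \<in> carrier K \<Longrightarrow> h k \<in> carrier T"
  by (rule ring_hom_closed[OF h_hom])

lemma X_fields:
  "carrier X = carrier (base_change K A h T)" "monoid.mult X = monoid.mult (base_change K A h T)"
  "\<one>\<^bsub>X\<^esub> = \<one>\<^bsub>base_change K A h T\<^esub>" "\<zero>\<^bsub>X\<^esub> = \<zero>\<^bsub>base_change K A h T\<^esub>"
  "add X = add (base_change K A h T)" "smult X = smult (base_change K A h T)"
  "homog X = homog (base_change K A h T)"
  unfolding X_eq[symmetric] by (simp_all add: graded_algebra.truncate_def)

lemma tensor_rels_add_left:
  "\<lbrakk>a \<in> carrier A; b \<in> carrier A; t \<in> carrier T\<rbrakk> \<Longrightarrow>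
    frag_of (a \<oplus>\<^bsub>A\<^esub> b, t) - frag_of (a, t) - frag_of (b, t) \<in> RT"
  by (auto simp: tensor_rels_def)

lemma tensor_rels_add_right:
  "\<lbrakk>a \<in> carrier A; s \<in> carrier T; t \<in> carrier T\<rbrakk> \<Longrightarrow>
    frag_of (a, s \<oplus>\<^bsub>T\<^esub> t) - frag_of (a, s) - frag_of (a, t) \<in> RT"
  by (auto simp: tensor_rels_def)

lemma tensor_rels_balance:
  "\<lbrakk>k \<in> carrier K; a \<in> carrier A; t \<in> carrier T\<rbrakk> \<Longrightarrow>
    frag_of (k \<odot>\<^bsub>A\<^esub> a, t) - frag_of (a, h k \<otimes>\<^bsub>T\<^esub> t) \<in> RT"
  by (auto simp: tensor_rels_def)

lemma tensor_rels_cases [consumes 1, case_names add_left add_right balance]: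
  assumes "r \<in> RT"
  obtains a b t where "a \<in> carrier A" "b \<in> carrier A" "t \<in> carrier T"
      "r = frag_of (a \<oplus>\<^bsub>A\<^esub> b, t) - frag_of (a, t) - frag_of (b, t)"
    | a s t where "a \<in> carrier A" "s \<in> carrier T" "t \<in> carrier T"
      "r = frag_of (a, s \<oplus>\<^bsub>T\<^esub> t) - frag_of (a, s) - frag_of (a, t)"
    | k a t where "k \<in> carrier K" "a \<in> carrier A" "t \<in> carrier T"
      "r = frag_of (k \<odot>\<^bsub>A\<^esub> a, t) - frag_of (a, h k \<otimes>\<^bsub>T\<^esub> t)"
  using assms unfolding tensor_rels_def Un_iff mem_Collect_eq
  by - (elim disjE exE conjE; rule that; assumption)

sublocale pres: presentation GT RT
proof
  show "RT \<subseteq> carrier (free_Abelian_group GT)"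
  proof
    fix r assume "r \<in> RT"
    then show "r \<in> carrier (free_Abelian_group GT)"
      by (cases rule: tensor_rels_cases)
        (auto simp: h_closed dest!: subsetD[OF keys_diff])
  qed
qed

lemmas rels_nul = tensor_rels_add_left[THEN pres.nul_rel] tensor_rels_add_right[THEN pres.nul_rel]
  tensor_rels_balance[THEN pres.nul_rel]

text \<open>Multiplying by a generator on either side (goals 7 and 8) or acting by a scalar (goal 9)
  turns every defining relation into a relation of the same family. Goal 10, additivity of the
  action in the scalar, is itself a relation of the second family.\<close>

sublocale pres: presented_alg GT RT T "\<lambda>(a, s) (b, t). (a \<otimes>\<^bsub>A\<^esub> b, s \<otimes>\<^bsub>T\<^esub> t)" "(\<one>\<^bsub>A\<^esub>, \<one>\<^bsub>T\<^esub>)"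
  "\<lambda>s (a, t). (a, s \<otimes>\<^bsub>T\<^esub> t)" X
proof (unfold_locales, goal_cases)
  case (7 r x)
  then obtain a s where x: "x = (a, s)" "a \<in> carrier A" "s \<in> carrier T" by auto
  from 7(1) show ?case
  proof (cases rule: tensor_rels_cases)
    case (add_left b c t)
    then show ?thesis
      using x rels_nul(1)[of "a \<otimes> b" "a \<otimes> c" "s \<otimes>\<^bsub>T\<^esub> t"] by (simp add: frag_extend_diff r_distr)
  next
    case (add_right b t t')
    then show ?thesis
      using x rels_nul(2)[of "a \<otimes> b" "s \<otimes>\<^bsub>T\<^esub> t" "s \<otimes>\<^bsub>T\<^esub> t'"] by (simp add: frag_extend_diff T.r_distr)
  next
    case (balance k b t)
    then show ?thesis
      using x rels_nul(3)[of k "a \<otimes> b" "s \<otimes>\<^bsub>T\<^esub> t"] h_closed[of k]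
      by (simp add: frag_extend_diff smult_mult_right T.m_lcomm)
  qed
next
  case (8 r x)
  then obtain a s where x: "x = (a, s)" "a \<in> carrier A" "s \<in> carrier T" by auto
  from 8(1) show ?case
  proof (cases rule: tensor_rels_cases)
    case (add_left b c t)
    then show ?thesis
      using x rels_nul(1)[of "b \<otimes> a" "c \<otimes> a" "t \<otimes>\<^bsub>T\<^esub> s"] by (simp add: frag_extend_diff l_distr)
  next
    case (add_right b t t')
    then show ?thesis
      using x rels_nul(2)[of "b \<otimes> a" "t \<otimes>\<^bsub>T\<^esub> s" "t' \<otimes>\<^bsub>T\<^esub> s"] by (simp add: frag_extend_diff T.l_distr)
  next
    case (balance k b t)
    then show ?thesis
      using x rels_nul(3)[of k "b \<otimes> a" "t \<otimes>\<^bsub>T\<^esub> s"] h_closed[of k]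
      by (simp add: frag_extend_diff smult_mult_left T.m_assoc)
  qed
next
  case (9 r s)
  note s = 9(2)
  from 9(1) show ?case
  proof (cases rule: tensor_rels_cases)
    case (add_left b c t)
    then show ?thesis
      using s rels_nul(1)[of b c "s \<otimes>\<^bsub>T\<^esub> t"] by (simp add: frag_extend_diff)
  next
    case (add_right b t t')
    then show ?thesis
      using s rels_nul(2)[of b "s \<otimes>\<^bsub>T\<^esub> t" "s \<otimes>\<^bsub>T\<^esub> t'"] by (simp add: frag_extend_diff T.r_distr)
  next
    case (balance k b t)
    then show ?thesis
      using s rels_nul(3)[of k b "s \<otimes>\<^bsub>T\<^esub> t"] h_closed[of k] by (simp add: frag_extend_diff T.m_lcomm)
  qed
next
  case (10 k l x)
  then obtain a s where x: "x = (a, s)" "a \<in> carrier A" "s \<in> carrier T" by auto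
  then show ?case
    using 10 rels_nul(2)[of a "k \<otimes>\<^bsub>T\<^esub> s" "l \<otimes>\<^bsub>T\<^esub> s"] by (simp add: T.l_distr)
qed (auto simp: T.m_assoc T.m_lcomm m_assoc X_fields base_change_def presented_algebra_def Let_def
    simp del: mult_FactGroup one_FactGroup)

sublocale X: scalar_alg T X
  by (rule pres.scalar_alg)

lemma pt_eq: "pt a t = pres.cls (frag_of (a, t))"
  by (simp add: pure_tensor_def)

lemma pt_closed [simp]: "\<lbrakk>a \<in> carrier A; t \<in> carrier T\<rbrakk> \<Longrightarrow> pt a t \<in> carrier X"
  unfolding pt_eq by (rule pres.X_closed) simp

lemma pt_add_left:
  assumes "a \<in> carrier A" "b \<in> carrier A" "t \<in> carrier T"
  shows "pt (a \<oplus>\<^bsub>A\<^esub> b) t = pt a t \<oplus>\<^bsub>X\<^esub> pt b t"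
  using assms rels_nul(1)[OF assms] by (simp add: pt_eq pres.add_cls pres.cls_eq_iff algebra_simps)

lemma pt_add_right:
  assumes "a \<in> carrier A" "s \<in> carrier T" "t \<in> carrier T"
  shows "pt a (s \<oplus>\<^bsub>T\<^esub> t) = pt a s \<oplus>\<^bsub>X\<^esub> pt a t"
  using assms rels_nul(2)[OF assms] by (simp add: pt_eq pres.add_cls pres.cls_eq_iff algebra_simps)

lemma pt_balance:
  assumes "k \<in> carrier K" "a \<in> carrier A" "t \<in> carrier T"
  shows "pt (k \<odot>\<^bsub>A\<^esub> a) t = pt a (h k \<otimes>\<^bsub>T\<^esub> t)"
  using assms rels_nul(3)[OF assms] by (simp add: pt_eq pres.cls_eq_iff)

lemma pt_mult:
  "\<lbrakk>a \<in> carrier A; b \<in> carrier A; s \<in> carrier T; t \<in> carrier T\<rbrakk> \<Longrightarrow>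
    pt a s \<otimes>\<^bsub>X\<^esub> pt b t = pt (a \<otimes>\<^bsub>A\<^esub> b) (s \<otimes>\<^bsub>T\<^esub> t)"
  by (simp add: pt_eq pres.mult_cls)

lemma pt_smult:
  "\<lbrakk>a \<in> carrier A; s \<in> carrier T; t \<in> carrier T\<rbrakk> \<Longrightarrow> s \<odot>\<^bsub>X\<^esub> pt a t = pt a (s \<otimes>\<^bsub>T\<^esub> t)"
  by (simp add: pt_eq pres.smult_cls)

lemma pt_one: "\<one>\<^bsub>X\<^esub> = pt \<one>\<^bsub>A\<^esub> \<one>\<^bsub>T\<^esub>"
  by (simp add: pt_eq pres.X_one)

lemma pt_additive_left: "t \<in> carrier T \<Longrightarrow> additive_map A X (\<lambda>a. pt a t)"
  by (rule additive_mapI) (simp_all add: pt_add_left)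

lemma pt_additive_right: "a \<in> carrier A \<Longrightarrow> additive_map T X (pt a)"
  by (rule additive_mapI) (simp_all add: pt_add_right)

lemma pt_minus: "\<lbrakk>a \<in> carrier A; t \<in> carrier T\<rbrakk> \<Longrightarrow> pt (\<ominus>\<^bsub>A\<^esub> a) t = \<ominus>\<^bsub>X\<^esub> pt a t"
  by (rule additive_minus[OF is_abelian_group X.is_abelian_group pt_additive_left])

lemma pt_zero_left: "t \<in> carrier T \<Longrightarrow> pt \<zero>\<^bsub>A\<^esub> t = \<zero>\<^bsub>X\<^esub>"
  by (rule additive_zero[OF is_abelian_group X.is_abelian_group pt_additive_left])

lemma pt_zero_right: "a \<in> carrier A \<Longrightarrow> pt a \<zero>\<^bsub>T\<^esub> = \<zero>\<^bsub>X\<^esub>"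
  by (rule additive_zero[OF T.is_abelian_group X.is_abelian_group pt_additive_right])

text \<open>A minus sign is absorbed into the left factor, so sums of pure tensors exhaust the
  carrier. Proving \<open>P\<close> for an element together with its negative makes the steps of
  \<open>X_induct\<close> go through.\<close>

lemma tensor_induct [consumes 1, case_names pt add]:
  assumes "Y \<in> carrier X"
    and pt: "\<And>a t. \<lbrakk>a \<in> carrier A; t \<in> carrier T\<rbrakk> \<Longrightarrow> P (pt a t)"
    and add: "\<And>Y Z. \<lbrakk>Y \<in> carrier X; Z \<in> carrier X; P Y; P Z\<rbrakk> \<Longrightarrow> P (Y \<oplus>\<^bsub>X\<^esub> Z)"
  shows "P Y"
proof -
  have "P Y \<and> P (\<ominus>\<^bsub>X\<^esub> Y)"
    using assms(1)
  proof (induction rule: pres.X_induct)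
    case (gen x)
    then show ?case using pt by (auto simp: pt_eq[symmetric] pt_minus[symmetric])
  next
    case (add Y Z)
    then show ?case using assms(3) by (simp add: X.minus_add)
  qed auto
  then show ?thesis ..
qed

lemma additive_eqI:
  assumes "additive_map X H u" "additive_map X H v" "\<And>a t. \<lbrakk>a \<in> carrier A; t \<in> carrier T\<rbrakk> \<Longrightarrow> u (pt a t) = v (pt a t)"
    and "Y \<in> carrier X"
  shows "u Y = v Y"
  using assms(4)
  by (induction rule: tensor_induct) (simp_all add: assms(3) additive_add[OF assms(1)] additive_add[OF assms(2)])

text \<open>The target is just an abelian group; linearity over \<open>T\<close> and
  multiplicativity of the lift are checked at each use by induction on pure tensors.\<close>

lemma tensor_lift:
  assumes H: "abelian_group H"
    and g_left: "\<And>t. t \<in> carrier T \<Longrightarrow> additive_map A H (\<lambda>a. g a t)"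
    and g_right: "\<And>a. a \<in> carrier A \<Longrightarrow> additive_map T H (g a)"
    and g_balance: "\<And>k a t. \<lbrakk>k \<in> carrier K; a \<in> carrier A; t \<in> carrier T\<rbrakk> \<Longrightarrow> g (k \<odot>\<^bsub>A\<^esub> a) t = g a (h k \<otimes>\<^bsub>T\<^esub> t)"
  obtains v where "additive_map X H v" "\<And>a t. \<lbrakk>a \<in> carrier A; t \<in> carrier T\<rbrakk> \<Longrightarrow> v (pt a t) = g a t"
proof -
  interpret H: abelian_group H by fact
  have gc: "g a t \<in> carrier H" if "a \<in> carrier A" "t \<in> carrier T" for a t
    using additive_closed[OF g_left] that by blast
  have ga: "g (a \<oplus>\<^bsub>A\<^esub> b) t = g a t \<oplus>\<^bsub>H\<^esub> g b t" if "a \<in> carrier A" "b \<in> carrier A" "t \<in> carrier T" for a b t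
    using additive_add[OF g_left] that by blast
  have gb: "g a (s \<oplus>\<^bsub>T\<^esub> t) = g a s \<oplus>\<^bsub>H\<^esub> g a t" if "a \<in> carrier A" "s \<in> carrier T" "t \<in> carrier T" for a s t
    using additive_add[OF g_right] that by blast
  show ?thesis
  proof (rule pres.additive_ext[OF H, of "\<lambda>(a, t). g a t"])
    show "(\<lambda>(a, t). g a t) \<in> GT \<rightarrow> carrier H" using gc by auto
  next
    fix u r
    assume u: "u \<in> hom (free_Abelian_group GT) (add_monoid H)"
      and uv: "\<And>x. x \<in> GT \<Longrightarrow> u (frag_of x) = (case x of (a, t) \<Rightarrow> g a t)" and r: "r \<in> RT"
    have keys: "Poly_Mapping.keys (frag_of x - frag_of y) \<subseteq> GT" if "x \<in> GT" "y \<in> GT" for x y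
      using keys_diff[of "frag_of x" "frag_of y"] that by auto
    note u_diff = additive_frag_diff(1)[OF H u]
    from r show "u r = \<zero>\<^bsub>H\<^esub>"
    proof (cases rule: tensor_rels_cases)
      case (add_left a b t)
      have "p \<oplus>\<^bsub>H\<^esub> q \<ominus>\<^bsub>H\<^esub> p \<ominus>\<^bsub>H\<^esub> q = \<zero>\<^bsub>H\<^esub>" if "p \<in> carrier H" "q \<in> carrier H" for p q
        using that by (simp add: a_minus_def H.a_comm[of p q] H.a_assoc H.r_neg2 H.r_neg)
      then show ?thesis
        using add_left by (simp add: u_diff keys uv ga gc)
    next
      case (add_right a s t)
      have "p \<oplus>\<^bsub>H\<^esub> q \<ominus>\<^bsub>H\<^esub> p \<ominus>\<^bsub>H\<^esub> q = \<zero>\<^bsub>H\<^esub>" if "p \<in> carrier H" "q \<in> carrier H" for p q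
        using that by (simp add: a_minus_def H.a_comm[of p q] H.a_assoc H.r_neg2 H.r_neg)
      then show ?thesis
        using add_right by (simp add: u_diff keys uv gb gc)
    next
      case (balance k a t)
      then show ?thesis
        by (simp add: u_diff keys uv g_balance gc h_closed H.r_neg a_minus_def)
    qed
  next
    fix v assume "additive_map X H v" "\<And>x. x \<in> GT \<Longrightarrow> v (pres.cls (frag_of x)) = (case x of (a, t) \<Rightarrow> g a t)"
    then show thesis by (intro that[of v]) (auto simp: pt_eq)
  qed
qed

text \<open>The base change of \<open>u\<close>. The body copies the differential of
  \<open>dg_base_change\<close>, so that the differential of the Tor complex is literally
  \<open>tensor_map (diff P)\<close>.\<close>

definition tensor_map :: "('a \<Rightarrow> 'a) \<Rightarrow> ('a \<times> 't \<Rightarrow>\<^sub>0 int) set \<Rightarrow> ('a \<times> 't \<Rightarrow>\<^sub>0 int) set" where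
  "tensor_map u Y = (\<Union>f\<in>Y. pres.cls (frag_extend (\<lambda>(a, t). frag_of (u a, t)) f))"

lemma tensor_map:
  assumes "linear_map K A A u"
  shows tensor_map_linear: "linear_map T X X (tensor_map u)"
    and tensor_map_pt: "\<And>a t. \<lbrakk>a \<in> carrier A; t \<in> carrier T\<rbrakk> \<Longrightarrow> tensor_map u (pt a t) = pt (u a) t"
proof -
  note u = linear_map_additive[OF assms]
  let ?U = "frag_extend (\<lambda>x. frag_of (u (fst x), snd x))"
  have rel: "?U r \<in> pres.nul" if "r \<in> RT" for r
    using that
  proof (cases rule: tensor_rels_cases)
    case (add_left a b t)
    then show ?thesis
      using rels_nul(1)[of "u a" "u b" t] additive_closed[OF u] by (simp add: frag_extend_diff additive_add[OF u])
  next
    case (add_right a s t)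
    then show ?thesis
      using rels_nul(2)[of "u a" s t] additive_closed[OF u] by (simp add: frag_extend_diff)
  next
    case (balance k a t)
    then show ?thesis
      using rels_nul(3)[of k "u a" t] additive_closed[OF u] by (simp add: frag_extend_diff linear_map_smult[OF assms])
  qed
  have cls: "tensor_map u (pres.cls f) = pres.cls (?U f)" for f
    unfolding tensor_map_def using pres.cls_extend[OF rel] by (simp add: case_prod_unfold)
  show pt: "tensor_map u (pt a t) = pt (u a) t" if "a \<in> carrier A" "t \<in> carrier T" for a t
    unfolding pt_eq cls by simp
  have U_closed: "Poly_Mapping.keys (?U f) \<subseteq> GT" if "Poly_Mapping.keys f \<subseteq> GT" for f
    by (rule pres.keys_extend[OF _ that]) (simp add: additive_closed[OF u] mem_Times_iff)
  have add: "additive_map X X (tensor_map u)"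
    by (intro additive_mapI; elim pres.X_cases)
      (simp_all add: cls pres.add_cls U_closed frag_extend_add pres.X_closed)
  show "linear_map T X X (tensor_map u)"
  proof (rule linear_mapI[OF add])
    fix s Y assume "s \<in> carrier T" "Y \<in> carrier X"
    from this(2) show "tensor_map u (s \<odot>\<^bsub>X\<^esub> Y) = s \<odot>\<^bsub>X\<^esub> tensor_map u Y"
      by (induction rule: tensor_induct)
        (use \<open>s \<in> carrier T\<close> in \<open>simp_all add: pt_smult pt additive_closed[OF u] X.smult_r_distr
          additive_add[OF add] additive_closed[OF add]\<close>)
  qed
qed

text \<open>The base change of a bilinear map. It carries the homotopy for the Leibniz rule from
  \<open>P\<close> over to \<open>P \<otimes> T\<close>.\<close>

definition tensor_bimap ::
    "('a \<Rightarrow> 'a \<Rightarrow> 'a) \<Rightarrow> ('a \<times> 't \<Rightarrow>\<^sub>0 int) set \<Rightarrow> ('a \<times> 't \<Rightarrow>\<^sub>0 int) set \<Rightarrow> ('a \<times> 't \<Rightarrow>\<^sub>0 int) set" where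
  "tensor_bimap \<mu> Y Z = (\<Union>f\<in>Y. \<Union>g\<in>Z. pres.cls (frag_extend (\<lambda>x. frag_extend (\<lambda>y.
     frag_of (\<mu> (fst x) (fst y), snd x \<otimes>\<^bsub>T\<^esub> snd y)) g) f))"

lemma tensor_bimap:
  assumes left: "\<And>b. b \<in> carrier A \<Longrightarrow> linear_map K A A (\<lambda>a. \<mu> a b)"
    and right: "\<And>a. a \<in> carrier A \<Longrightarrow> linear_map K A A (\<mu> a)"
  shows tensor_bimap_left: "\<And>Z. Z \<in> carrier X \<Longrightarrow> additive_map X X (\<lambda>Y. tensor_bimap \<mu> Y Z)"
    and tensor_bimap_right: "\<And>Y. Y \<in> carrier X \<Longrightarrow> additive_map X X (tensor_bimap \<mu> Y)"
    and tensor_bimap_pt: "\<And>a b s t. \<lbrakk>a \<in> carrier A; b \<in> carrier A; s \<in> carrier T; t \<in> carrier T\<rbrakk> \<Longrightarrow>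
      tensor_bimap \<mu> (pt a s) (pt b t) = pt (\<mu> a b) (s \<otimes>\<^bsub>T\<^esub> t)"
proof -
  have closed: "\<mu> a b \<in> carrier A" if "a \<in> carrier A" "b \<in> carrier A" for a b
    using additive_closed[OF linear_map_additive[OF right]] that by blast
  have left_add: "\<mu> (a \<oplus>\<^bsub>A\<^esub> a') b = \<mu> a b \<oplus>\<^bsub>A\<^esub> \<mu> a' b" if "a \<in> carrier A" "a' \<in> carrier A" "b \<in> carrier A" for a a' b
    using additive_add[OF linear_map_additive[OF left]] that by blast
  have right_add: "\<mu> a (b \<oplus>\<^bsub>A\<^esub> b') = \<mu> a b \<oplus>\<^bsub>A\<^esub> \<mu> a b'" if "a \<in> carrier A" "b' \<in> carrier A" "b \<in> carrier A" for a b b'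
    using additive_add[OF linear_map_additive[OF right]] that by blast
  have left_smult: "\<mu> (k \<odot>\<^bsub>A\<^esub> a) b = k \<odot>\<^bsub>A\<^esub> \<mu> a b" if "a \<in> carrier A" "k \<in> carrier K" "b \<in> carrier A" for a k b
    using linear_map_smult[OF left] that by blast
  have right_smult: "\<mu> a (k \<odot>\<^bsub>A\<^esub> b) = k \<odot>\<^bsub>A\<^esub> \<mu> a b" if "a \<in> carrier A" "k \<in> carrier K" "b \<in> carrier A" for a k b
    using linear_map_smult[OF right] that by blast
  let ?\<phi> = "\<lambda>x y. frag_of (\<mu> (fst x) (fst y), snd x \<otimes>\<^bsub>T\<^esub> snd y)"
  have st: "pres.bistable ?\<phi>"
    unfolding pres.bistable_def
  proof (intro conjI ballI)
    fix x y assume "x \<in> GT" "y \<in> GT"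
    then show "Poly_Mapping.keys (?\<phi> x y) \<subseteq> GT" by (auto simp: closed)
  next
    fix r x assume r: "r \<in> RT" and "x \<in> GT"
    then obtain a s where x: "x = (a, s)" "a \<in> carrier A" "s \<in> carrier T" by auto
    from r show "frag_extend (?\<phi> x) r \<in> pres.nul"
    proof (cases rule: tensor_rels_cases)
      case (add_left b c t)
      then show ?thesis
        using x rels_nul(1)[of "\<mu> a b" "\<mu> a c" "s \<otimes>\<^bsub>T\<^esub> t"] by (simp add: frag_extend_diff right_add closed)
    next
      case (add_right b t t')
      then show ?thesis
        using x rels_nul(2)[of "\<mu> a b" "s \<otimes>\<^bsub>T\<^esub> t" "s \<otimes>\<^bsub>T\<^esub> t'"] by (simp add: frag_extend_diff T.r_distr closed)
    next
      case (balance k b t)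
      then show ?thesis
        using x rels_nul(3)[of k "\<mu> a b" "s \<otimes>\<^bsub>T\<^esub> t"] h_closed[of k]
        by (simp add: frag_extend_diff right_smult T.m_lcomm closed)
    qed
    from r show "frag_extend (\<lambda>y. ?\<phi> y x) r \<in> pres.nul"
    proof (cases rule: tensor_rels_cases)
      case (add_left b c t)
      then show ?thesis
        using x rels_nul(1)[of "\<mu> b a" "\<mu> c a" "t \<otimes>\<^bsub>T\<^esub> s"] by (simp add: frag_extend_diff left_add closed)
    next
      case (add_right b t t')
      then show ?thesis
        using x rels_nul(2)[of "\<mu> b a" "t \<otimes>\<^bsub>T\<^esub> s" "t' \<otimes>\<^bsub>T\<^esub> s"] by (simp add: frag_extend_diff T.l_distr closed)
    next
      case (balance k b t)
      then show ?thesis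
        using x rels_nul(3)[of k "\<mu> b a" "t \<otimes>\<^bsub>T\<^esub> s"] h_closed[of k]
        by (simp add: frag_extend_diff left_smult T.m_assoc closed)
    qed
  qed
  have cls: "tensor_bimap \<mu> (pres.cls f) (pres.cls g) = pres.cls (frag_biextend ?\<phi> f g)"
    if "Poly_Mapping.keys f \<subseteq> GT" "Poly_Mapping.keys g \<subseteq> GT" for f g
    unfolding tensor_bimap_def by (rule pres.cls_biextend[OF st that])
  have keys_sum: "Poly_Mapping.keys (f + g) \<subseteq> GT"
    if "Poly_Mapping.keys f \<subseteq> GT" "Poly_Mapping.keys g \<subseteq> GT" for f g :: "'a \<times> 't \<Rightarrow>\<^sub>0 int"
    using keys_add[of f g] that by blast
  note simps = cls pres.add_cls pres.biextend_closed[OF st] keys_sum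
    frag_biextend_add_left frag_biextend_add_right pres.X_closed
  show "additive_map X X (\<lambda>Y. tensor_bimap \<mu> Y Z)" if "Z \<in> carrier X" for Z
    using that by (intro additive_mapI; elim pres.X_cases) (simp_all add: simps)
  show "additive_map X X (tensor_bimap \<mu> Y)" if "Y \<in> carrier X" for Y
    using that by (intro additive_mapI; elim pres.X_cases) (simp_all add: simps)
  show "tensor_bimap \<mu> (pt a s) (pt b t) = pt (\<mu> a b) (s \<otimes>\<^bsub>T\<^esub> t)"
    if "a \<in> carrier A" "b \<in> carrier A" "s \<in> carrier T" "t \<in> carrier T" for a b s t
    using that by (simp add: pt_eq cls)
qed

end

section \<open>The grading of a base change\<close>

context tensor
begin

lemma homog_X: "homog X n = pres.cls ` carrier (free_Abelian_group (homog A n \<times> carrier T))"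
  by (simp add: X_fields base_change_def presented_algebra_def)

lemma pt_homog: "\<lbrakk>a \<in> homog A n; t \<in> carrier T\<rbrakk> \<Longrightarrow> pt a t \<in> homog X n"
  unfolding homog_X pt_eq by (rule imageI) simp

lemma homog_X_subset:
  assumes "homog A n \<subseteq> carrier A"
  shows "homog X n \<subseteq> carrier X"
proof -
  have GT: "homog A n \<times> carrier T \<subseteq> GT" using assms by auto
  show ?thesis
    unfolding homog_X
  proof (rule image_subsetI)
    fix f assume "f \<in> carrier (free_Abelian_group (homog A n \<times> carrier T))"
    then have "Poly_Mapping.keys f \<subseteq> GT"
      unfolding carrier_free_Abelian_group_iff using GT by (rule order.trans)
    then show "pres.cls f \<in> carrier X" by (rule pres.X_closed)
  qed
qed

lemma homog_X_submodule:
  assumes "homog A n \<subseteq> carrier A"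
  shows "submodule (homog X n) T X"
  unfolding homog_X by (rule pres.submodule_cls) (use assms in auto)

lemma homog_X_induct [consumes 2, case_names pt add]:
  assumes Y: "Y \<in> homog X n" and sub: "submodule (homog A n) K A"
    and pt: "\<And>a t. \<lbrakk>a \<in> homog A n; t \<in> carrier T\<rbrakk> \<Longrightarrow> P (pt a t)"
    and add: "\<And>Y Z. \<lbrakk>Y \<in> carrier X; Z \<in> carrier X; P Y; P Z\<rbrakk> \<Longrightarrow> P (Y \<oplus>\<^bsub>X\<^esub> Z)"
  shows "P Y"
proof -
  let ?G = "homog A n \<times> carrier T"
  note subg = submodule.axioms(1)[OF sub]
  have sub': "homog A n \<subseteq> carrier A" using subgroup.subset[OF subg] by simp
  then have GT: "?G \<subseteq> GT" by auto
  have zero: "P \<zero>\<^bsub>X\<^esub>"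
    using pt[of "\<zero>\<^bsub>A\<^esub>" "\<zero>\<^bsub>T\<^esub>"] subgroup.one_closed[OF subg] by (simp add: pt_zero_right)
  have "P Y \<and> P (\<ominus>\<^bsub>X\<^esub> Y)"
    using Y GT unfolding homog_X
  proof (induction rule: pres.cls_image_induct)
    case (gen x)
    then obtain a t where x: "x = (a, t)" "a \<in> homog A n" "t \<in> carrier T" by auto
    have "\<ominus>\<^bsub>A\<^esub> a \<in> homog A n"
      using subgroup.m_inv_closed[OF subg] x by (simp add: a_inv_def)
    moreover have "\<ominus>\<^bsub>X\<^esub> pt a t = pt (\<ominus>\<^bsub>A\<^esub> a) t" using x sub' by (simp add: pt_minus subset_iff)
    ultimately show ?case using pt x by (simp add: pt_eq[symmetric])
  next
    case (add Y Z)
    then show ?case using assms(4) by (simp add: X.minus_add)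
  qed (use zero in auto)
  then show ?thesis ..
qed

end

section \<open>Exterior algebras\<close>

locale exterior = module K M
  for K :: "('k, 'm) ring_scheme" and M :: "('k, 'a, 'n) module_scheme" (structure)
begin

abbreviation "GE \<equiv> exterior_gens K M"
abbreviation "RE \<equiv> exterior_rels K M"
abbreviation "E \<equiv> exterior_algebra K M"

lemma exterior_rels_add:
  "\<lbrakk>k \<in> carrier K; l \<in> carrier K; u \<in> lists (carrier M)\<rbrakk> \<Longrightarrow>
    frag_of (k \<oplus>\<^bsub>K\<^esub> l, u) - frag_of (k, u) - frag_of (l, u) \<in> RE"
  unfolding exterior_rels_def by blast

lemma exterior_rels_multi:
  "\<lbrakk>k \<in> carrier K; x \<in> carrier M; y \<in> carrier M; u \<in> lists (carrier M); v \<in> lists (carrier M)\<rbrakk> \<Longrightarrow>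
    frag_of (k, u @ [x \<oplus>\<^bsub>M\<^esub> y] @ v) - frag_of (k, u @ [x] @ v) - frag_of (k, u @ [y] @ v) \<in> RE"
  unfolding exterior_rels_def by blast

lemma exterior_rels_smult:
  "\<lbrakk>k \<in> carrier K; l \<in> carrier K; x \<in> carrier M; u \<in> lists (carrier M); v \<in> lists (carrier M)\<rbrakk> \<Longrightarrow>
    frag_of (k, u @ [l \<odot>\<^bsub>M\<^esub> x] @ v) - frag_of (k \<otimes>\<^bsub>K\<^esub> l, u @ [x] @ v) \<in> RE"
  unfolding exterior_rels_def by blast

lemma exterior_rels_alt:
  "\<lbrakk>k \<in> carrier K; x \<in> carrier M; u \<in> lists (carrier M); v \<in> lists (carrier M)\<rbrakk> \<Longrightarrow>
    frag_of (k, u @ [x, x] @ v) \<in> RE"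
  unfolding exterior_rels_def by blast

lemma exterior_rels_cases [consumes 1, case_names add multi smult alt]:
  assumes "r \<in> RE"
  obtains k l u where "k \<in> carrier K" "l \<in> carrier K" "u \<in> lists (carrier M)"
      "r = frag_of (k \<oplus>\<^bsub>K\<^esub> l, u) - frag_of (k, u) - frag_of (l, u)"
    | k x y u v where "k \<in> carrier K" "x \<in> carrier M" "y \<in> carrier M"
      "u \<in> lists (carrier M)" "v \<in> lists (carrier M)"
      "r = frag_of (k, u @ [x \<oplus>\<^bsub>M\<^esub> y] @ v) - frag_of (k, u @ [x] @ v) - frag_of (k, u @ [y] @ v)"
    | k l x u v where "k \<in> carrier K" "l \<in> carrier K" "x \<in> carrier M"
      "u \<in> lists (carrier M)" "v \<in> lists (carrier M)"
      "r = frag_of (k, u @ [l \<odot>\<^bsub>M\<^esub> x] @ v) - frag_of (k \<otimes>\<^bsub>K\<^esub> l, u @ [x] @ v)"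
    | k x u v where "k \<in> carrier K" "x \<in> carrier M" "u \<in> lists (carrier M)" "v \<in> lists (carrier M)"
      "r = frag_of (k, u @ [x, x] @ v)"
  using assms unfolding exterior_rels_def Un_iff mem_Collect_eq
  by - (elim disjE exE conjE; rule that; assumption)

lemma GE_iff: "(k, u) \<in> GE \<longleftrightarrow> k \<in> carrier K \<and> u \<in> lists (carrier M)"
  by (simp add: exterior_gens_def)

sublocale pres: presentation GE RE
proof
  show "RE \<subseteq> carrier (free_Abelian_group GE)"
  proof
    fix r assume "r \<in> RE"
    then show "r \<in> carrier (free_Abelian_group GE)"
      by (cases rule: exterior_rels_cases)
        (auto simp: GE_iff dest!: subsetD[OF keys_diff])
  qed
qed

lemmas rels_nul = exterior_rels_add[THEN pres.nul_rel] exterior_rels_multi[THEN pres.nul_rel]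
  exterior_rels_smult[THEN pres.nul_rel] exterior_rels_alt[THEN pres.nul_rel]

text \<open>The relations come with arbitrary words \<open>u\<close> and \<open>v\<close> on both
  sides, so multiplication by a word only lengthens one of these and each relation stays in its
  family. Multiplication on the right uses commutativity of \<open>K\<close> to move the new
  coefficient past \<open>l\<close>.\<close>

sublocale pres: presented_alg GE RE K "\<lambda>(k, u) (l, v). (k \<otimes>\<^bsub>K\<^esub> l, u @ v)" "(\<one>\<^bsub>K\<^esub>, [])"
  "\<lambda>c (k, u). (c \<otimes>\<^bsub>K\<^esub> k, u)" E
proof (unfold_locales, goal_cases)
  case (7 r x)
  then obtain c w where x: "x = (c, w)" "c \<in> carrier K" "w \<in> lists (carrier M)" by (auto simp: exterior_gens_def)
  from 7(1) show ?case
  proof (cases rule: exterior_rels_cases)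
    case (add k l u)
    then show ?thesis
      using x rels_nul(1)[of "c \<otimes>\<^bsub>K\<^esub> k" "c \<otimes>\<^bsub>K\<^esub> l" "w @ u"] by (simp add: frag_extend_diff R.r_distr)
  next
    case (multi k y z u v)
    then show ?thesis
      using x rels_nul(2)[of "c \<otimes>\<^bsub>K\<^esub> k" y z "w @ u" v] by (simp add: frag_extend_diff)
  next
    case (smult k l y u v)
    then show ?thesis
      using x rels_nul(3)[of "c \<otimes>\<^bsub>K\<^esub> k" l y "w @ u" v] by (simp add: frag_extend_diff R.m_assoc)
  next
    case (alt k y u v)
    then show ?thesis
      using x rels_nul(4)[of "c \<otimes>\<^bsub>K\<^esub> k" y "w @ u" v] by simp
  qed
next
  case (8 r x)
  then obtain c w where x: "x = (c, w)" "c \<in> carrier K" "w \<in> lists (carrier M)" by (auto simp: exterior_gens_def)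
  from 8(1) show ?case
  proof (cases rule: exterior_rels_cases)
    case (add k l u)
    then show ?thesis
      using x rels_nul(1)[of "k \<otimes>\<^bsub>K\<^esub> c" "l \<otimes>\<^bsub>K\<^esub> c" "u @ w"] by (simp add: frag_extend_diff R.l_distr)
  next
    case (multi k y z u v)
    then show ?thesis
      using x rels_nul(2)[of "k \<otimes>\<^bsub>K\<^esub> c" y z u "v @ w"] by (simp add: frag_extend_diff)
  next
    case (smult k l y u v)
    then show ?thesis
      using x rels_nul(3)[of "k \<otimes>\<^bsub>K\<^esub> c" l y u "v @ w"]
      by (simp add: frag_extend_diff R.m_assoc R.m_comm[of l c])
  next
    case (alt k y u v)
    then show ?thesis
      using x rels_nul(4)[of "k \<otimes>\<^bsub>K\<^esub> c" y u "v @ w"] by simp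
  qed
next
  case (9 r c)
  note c = 9(2)
  from 9(1) show ?case
  proof (cases rule: exterior_rels_cases)
    case (add k l u)
    then show ?thesis
      using c rels_nul(1)[of "c \<otimes>\<^bsub>K\<^esub> k" "c \<otimes>\<^bsub>K\<^esub> l" u] by (simp add: frag_extend_diff R.r_distr)
  next
    case (multi k y z u v)
    then show ?thesis
      using c rels_nul(2)[of "c \<otimes>\<^bsub>K\<^esub> k" y z u v] by (simp add: frag_extend_diff)
  next
    case (smult k l y u v)
    then show ?thesis
      using c rels_nul(3)[of "c \<otimes>\<^bsub>K\<^esub> k" l y u v] by (simp add: frag_extend_diff R.m_assoc)
  next
    case (alt k y u v)
    then show ?thesis
      using c rels_nul(4)[of "c \<otimes>\<^bsub>K\<^esub> k" y u v] by simp
  qed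
next
  case (10 k l x)
  then obtain c w where x: "x = (c, w)" "c \<in> carrier K" "w \<in> lists (carrier M)" by (auto simp: exterior_gens_def)
  then show ?case
    using 10 rels_nul(1)[of "k \<otimes>\<^bsub>K\<^esub> c" "l \<otimes>\<^bsub>K\<^esub> c" w] by (simp add: R.l_distr)
qed (auto simp: exterior_gens_def R.m_assoc R.m_lcomm exterior_algebra_def presented_algebra_def Let_def
    simp del: mult_FactGroup one_FactGroup)

sublocale E: scalar_alg K E
  by (rule pres.scalar_alg)

definition wd :: "'k \<Rightarrow> 'a list \<Rightarrow> ('k \<times> 'a list \<Rightarrow>\<^sub>0 int) set" where
  "wd k u = pres.cls (frag_of (k, u))"

lemma wd_closed [simp]: "\<lbrakk>k \<in> carrier K; u \<in> lists (carrier M)\<rbrakk> \<Longrightarrow> wd k u \<in> carrier E"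
  unfolding wd_def by (rule pres.X_closed) (simp add: GE_iff)

lemma wd_mult:
  "\<lbrakk>k \<in> carrier K; l \<in> carrier K; u \<in> lists (carrier M); v \<in> lists (carrier M)\<rbrakk> \<Longrightarrow>
    wd k u \<otimes>\<^bsub>E\<^esub> wd l v = wd (k \<otimes>\<^bsub>K\<^esub> l) (u @ v)"
  by (simp add: wd_def pres.mult_cls GE_iff)

lemma wd_smult:
  "\<lbrakk>k \<in> carrier K; l \<in> carrier K; u \<in> lists (carrier M)\<rbrakk> \<Longrightarrow> k \<odot>\<^bsub>E\<^esub> wd l u = wd (k \<otimes>\<^bsub>K\<^esub> l) u"
  by (simp add: wd_def pres.smult_cls GE_iff)

lemma wd_one: "\<one>\<^bsub>E\<^esub> = wd \<one>\<^bsub>K\<^esub> []"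
  by (simp add: wd_def pres.X_one)

lemma incl_eq: "exterior_incl K M x = wd \<one>\<^bsub>K\<^esub> [x]"
  by (simp add: exterior_incl_def wd_def)

lemma incl_closed: "x \<in> carrier M \<Longrightarrow> exterior_incl K M x \<in> carrier E"
  by (simp add: incl_eq)

lemma incl_add:
  assumes "x \<in> carrier M" "y \<in> carrier M"
  shows "exterior_incl K M (x \<oplus>\<^bsub>M\<^esub> y) = exterior_incl K M x \<oplus>\<^bsub>E\<^esub> exterior_incl K M y"
  using rels_nul(2)[of "\<one>\<^bsub>K\<^esub>" x y "[]" "[]"] assms
  by (simp add: incl_eq wd_def pres.add_cls pres.cls_eq_iff GE_iff algebra_simps)

lemma incl_smult:
  assumes "k \<in> carrier K" "x \<in> carrier M"
  shows "exterior_incl K M (k \<odot>\<^bsub>M\<^esub> x) = k \<odot>\<^bsub>E\<^esub> exterior_incl K M x"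
  using rels_nul(3)[of "\<one>\<^bsub>K\<^esub>" k x "[]" "[]"] assms
  by (simp add: incl_eq wd_smult) (simp add: wd_def pres.cls_eq_iff)

lemma incl_square:
  assumes "x \<in> carrier M"
  shows "exterior_incl K M x \<otimes>\<^bsub>E\<^esub> exterior_incl K M x = \<zero>\<^bsub>E\<^esub>"
  using rels_nul(4)[of "\<one>\<^bsub>K\<^esub>" x "[]" "[]"] assms
  by (simp add: incl_eq wd_mult) (simp add: wd_def pres.zero_cls pres.cls_eq_iff)

lemma wd_Cons:
  assumes "k \<in> carrier K" "x \<in> carrier M" "u \<in> lists (carrier M)"
  shows "wd k (x # u) = exterior_incl K M x \<otimes>\<^bsub>E\<^esub> wd k u"
  using assms by (simp add: incl_eq wd_mult)

lemma wd_minus: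
  assumes "k \<in> carrier K" "u \<in> lists (carrier M)"
  shows "\<ominus>\<^bsub>E\<^esub> wd k u = wd (\<ominus>\<^bsub>K\<^esub> k) u"
proof -
  have "wd (\<ominus>\<^bsub>K\<^esub> k) u = (\<ominus>\<^bsub>K\<^esub> \<one>\<^bsub>K\<^esub>) \<odot>\<^bsub>E\<^esub> wd k u"
    using assms by (simp add: wd_smult R.l_minus)
  also have "\<dots> = \<ominus>\<^bsub>E\<^esub> wd k u"
    using assms by (subst E.smult_l_minus) simp_all
  finally show ?thesis by simp
qed

text \<open>As in \<open>tensor_induct\<close>, signs are absorbed, here into the coefficient of the
  word.\<close>

lemma E_induct [consumes 1, case_names wd add]:
  assumes "Y \<in> carrier E"
    and wd: "\<And>k u. \<lbrakk>k \<in> carrier K; u \<in> lists (carrier M)\<rbrakk> \<Longrightarrow> P (wd k u)"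
    and add: "\<And>Y Z. \<lbrakk>Y \<in> carrier E; Z \<in> carrier E; P Y; P Z\<rbrakk> \<Longrightarrow> P (Y \<oplus>\<^bsub>E\<^esub> Z)"
  shows "P Y"
proof -
  have "P Y \<and> P (\<ominus>\<^bsub>E\<^esub> Y)"
    using assms(1)
  proof (induction rule: pres.X_induct)
    case (gen x)
    then obtain k u where x: "x = (k, u)" "k \<in> carrier K" "u \<in> lists (carrier M)" by (auto simp: exterior_gens_def)
    have "P (wd k u)" "P (\<ominus>\<^bsub>E\<^esub> wd k u)"
      unfolding wd_minus[OF x(2,3)] by (intro wd; use x in simp)+
    then show ?case unfolding x(1) wd_def by simp
  next
    case (add Y Z)
    then show ?case using assms(3) by (simp add: E.minus_add)
  qed auto
  then show ?thesis ..
qed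

lemma homog_E: "homog E n = pres.cls ` carrier (free_Abelian_group {(k, u) \<in> GE. length u = n})"
  by (simp add: exterior_algebra_def presented_algebra_def)

lemma homog_E_submodule: "submodule (homog E n) K E"
  unfolding homog_E by (rule pres.submodule_cls) (auto simp: exterior_gens_def)

lemma wd_homog: "\<lbrakk>k \<in> carrier K; u \<in> lists (carrier M)\<rbrakk> \<Longrightarrow> wd k u \<in> homog E (length u)"
  unfolding homog_E wd_def by (rule imageI) (simp add: exterior_gens_def)

lemma homog_E_induct [consumes 1, case_names wd add zero]:
  assumes Y: "Y \<in> homog E n"
    and wd: "\<And>k u. \<lbrakk>k \<in> carrier K; u \<in> lists (carrier M); length u = n\<rbrakk> \<Longrightarrow> P (wd k u)"
    and add: "\<And>Y Z. \<lbrakk>Y \<in> carrier E; Z \<in> carrier E; P Y; P Z\<rbrakk> \<Longrightarrow> P (Y \<oplus>\<^bsub>E\<^esub> Z)"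
    and zero: "P \<zero>\<^bsub>E\<^esub>"
  shows "P Y"
proof -
  have "{(k, u) \<in> GE. length u = n} \<subseteq> GE" by auto
  with Y have "P Y \<and> P (\<ominus>\<^bsub>E\<^esub> Y)"
    unfolding homog_E
  proof (induction rule: pres.cls_image_induct)
    case (gen x)
    then obtain k u where x: "x = (k, u)" "k \<in> carrier K" "u \<in> lists (carrier M)" "length u = n"
      by (auto simp: exterior_gens_def)
    have "P (wd k u)" "P (\<ominus>\<^bsub>E\<^esub> wd k u)"
      unfolding wd_minus[OF x(2,3)] by (intro wd; use x in simp)+
    then show ?case unfolding x(1) wd_def by simp
  next
    case (add Y Z)
    then show ?case using assms(3) by (simp add: E.minus_add)
  qed (use zero in auto)
  then show ?thesis ..
qed

lemma incl_mult_homog: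
  assumes "x \<in> carrier M" "Y \<in> homog E n"
  shows "exterior_incl K M x \<otimes>\<^bsub>E\<^esub> Y \<in> homog E (Suc n)"
proof -
  note sub = submodule.axioms(1)[OF homog_E_submodule[of "Suc n"]]
  show ?thesis
    using assms(2)
  proof (induction rule: homog_E_induct)
    case (wd k u)
    then show ?case using assms(1) wd_homog[of k "x # u"] by (simp add: wd_Cons)
  next
    case (add Y Z)
    then show ?case using subgroup.m_closed[OF sub] assms(1) by (simp add: E.r_distr incl_closed)
  next
    case zero
    then show ?case using subgroup.one_closed[OF sub] assms(1) by (simp add: incl_closed)
  qed
qed

end

lemma (in ring) foldr_mult_append:
  assumes "\<And>x. x \<in> set u \<union> set v \<Longrightarrow> g x \<in> carrier R"
  shows "foldr (\<lambda>x. (\<otimes>) (g x)) (u @ v) \<one> = foldr (\<lambda>x. (\<otimes>) (g x)) u \<one> \<otimes> foldr (\<lambda>x. (\<otimes>) (g x)) v \<one>"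
    and "foldr (\<lambda>x. (\<otimes>) (g x)) u \<one> \<in> carrier R"
proof -
  have closed: "foldr (\<lambda>x. (\<otimes>) (g x)) w \<one> \<in> carrier R" if "set w \<subseteq> set u \<union> set v" for w
    using that assms by (induction w) auto
  show "foldr (\<lambda>x. (\<otimes>) (g x)) u \<one> \<in> carrier R" by (rule closed) simp
  show "foldr (\<lambda>x. (\<otimes>) (g x)) (u @ v) \<one> = foldr (\<lambda>x. (\<otimes>) (g x)) u \<one> \<otimes> foldr (\<lambda>x. (\<otimes>) (g x)) v \<one>"
    using assms closed by (induction u) (auto simp: m_assoc subset_iff)
qed

section \<open>The base change of an exterior algebra\<close>

locale exterior_tensor =
  ext: exterior K M + ten: tensor K "exterior_algebra K M" T h X
  for K :: "('k, 'm) ring_scheme" and M :: "('k, 'a, 'n) module_scheme"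
    and T :: "('t, 'l) ring_scheme" and h X
begin

definition gen :: "'a \<Rightarrow> 't \<Rightarrow> (('k \<times> 'a list \<Rightarrow>\<^sub>0 int) set \<times> 't \<Rightarrow>\<^sub>0 int) set" where
  "gen f t = ten.pt (exterior_incl K M f) t"

lemma gen_closed [simp]: "\<lbrakk>f \<in> carrier M; t \<in> carrier T\<rbrakk> \<Longrightarrow> gen f t \<in> carrier X"
  by (simp add: gen_def ext.incl_closed)

lemma gen_smult: "\<lbrakk>f \<in> carrier M; s \<in> carrier T; t \<in> carrier T\<rbrakk> \<Longrightarrow> s \<odot>\<^bsub>X\<^esub> gen f t = gen f (s \<otimes>\<^bsub>T\<^esub> t)"
  by (simp add: gen_def ten.pt_smult ext.incl_closed)

lemma gen_add: "\<lbrakk>f \<in> carrier M; g \<in> carrier M; t \<in> carrier T\<rbrakk> \<Longrightarrow> gen (f \<oplus>\<^bsub>M\<^esub> g) t = gen f t \<oplus>\<^bsub>X\<^esub> gen g t"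
  by (simp add: gen_def ten.pt_add_left ext.incl_add ext.incl_closed)

lemma gen_balance:
  "\<lbrakk>k \<in> carrier K; f \<in> carrier M; t \<in> carrier T\<rbrakk> \<Longrightarrow> gen (k \<odot>\<^bsub>M\<^esub> f) t = gen f (h k \<otimes>\<^bsub>T\<^esub> t)"
  by (simp add: gen_def ten.pt_balance ext.incl_smult ext.incl_closed)

lemma gen_square: "f \<in> carrier M \<Longrightarrow> gen f \<one>\<^bsub>T\<^esub> \<otimes>\<^bsub>X\<^esub> gen f \<one>\<^bsub>T\<^esub> = \<zero>\<^bsub>X\<^esub>"
  by (simp add: gen_def ten.pt_mult ext.incl_closed ext.incl_square ten.pt_zero_left)

text \<open>Polarisation of \<open>gen_square\<close>: expand the square of the generator of the sum
  of \<open>f\<close> and \<open>g\<close>.\<close>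

lemma gen_anticomm:
  assumes "f \<in> carrier M" "g \<in> carrier M"
  shows "gen f \<one>\<^bsub>T\<^esub> \<otimes>\<^bsub>X\<^esub> gen g \<one>\<^bsub>T\<^esub> = \<ominus>\<^bsub>X\<^esub> (gen g \<one>\<^bsub>T\<^esub> \<otimes>\<^bsub>X\<^esub> gen f \<one>\<^bsub>T\<^esub>)"
proof -
  let ?f = "gen f \<one>\<^bsub>T\<^esub>" and ?g = "gen g \<one>\<^bsub>T\<^esub>"
  have c: "?f \<in> carrier X" "?g \<in> carrier X" using assms by simp_all
  have "(?f \<oplus>\<^bsub>X\<^esub> ?g) \<otimes>\<^bsub>X\<^esub> (?f \<oplus>\<^bsub>X\<^esub> ?g) = \<zero>\<^bsub>X\<^esub>"
    using gen_square[of "f \<oplus>\<^bsub>M\<^esub> g"] assms by (simp add: gen_add)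
  then have "?f \<otimes>\<^bsub>X\<^esub> ?g \<oplus>\<^bsub>X\<^esub> ?g \<otimes>\<^bsub>X\<^esub> ?f = \<zero>\<^bsub>X\<^esub>"
    using c assms by (simp add: ten.X.l_distr ten.X.r_distr gen_square ten.X.a_comm)
  then show ?thesis using c by (metis ten.X.m_closed ten.X.minus_equality ten.X.a_comm)
qed

lemma gen_mult_homog:
  assumes "f \<in> carrier M" "Y \<in> homog X n"
  shows "gen f \<one>\<^bsub>T\<^esub> \<otimes>\<^bsub>X\<^esub> Y \<in> homog X (Suc n)"
proof -
  note E_sub = subgroup.subset[OF submodule.axioms(1)[OF ext.homog_E_submodule], simplified]
  note sub = submodule.axioms(1)[OF ten.homog_X_submodule[OF E_sub, of "Suc n"]]
  show ?thesis
    using assms(2) ext.homog_E_submodule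
  proof (induction rule: ten.homog_X_induct)
    case (pt a t)
    then have "a \<in> carrier (exterior_algebra K M)" using E_sub by blast
    then show ?case
      using pt assms(1) ext.incl_mult_homog[OF assms(1) pt(1)]
      by (simp add: gen_def ten.pt_mult ext.incl_closed ten.pt_homog)
  next
    case (add Y Z)
    then show ?case using subgroup.m_closed[OF sub] assms(1) by (simp add: ten.X.r_distr)
  qed
qed

lemma homog_subset: "homog X n \<subseteq> carrier X"
  by (rule ten.homog_X_subset) (use subgroup.subset[OF submodule.axioms(1)[OF ext.homog_E_submodule]] in simp)

lemma homog_submodule: "submodule (homog X n) T X"
  by (rule ten.homog_X_submodule) (use subgroup.subset[OF submodule.axioms(1)[OF ext.homog_E_submodule]] in simp)

lemma one_homog: "\<one>\<^bsub>X\<^esub> \<in> homog X 0"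
  unfolding ten.pt_one ext.wd_one by (rule ten.pt_homog) (use ext.wd_homog[of "\<one>\<^bsub>K\<^esub>" "[]"] in simp_all)

text \<open>The elements \<open>gen f t\<close> generate \<open>X\<close> as a
  \<open>T\<close>-algebra: letters are split off a word from the left, and a coefficient
  \<open>k\<close> of a word crosses the tensor sign as \<open>h k\<close>. Used for uniqueness of
  the natural map and to identify the composite with the retraction.\<close>

lemma hom_eqI:
  assumes D: "scalar_alg T D"
    and a: "a \<in> ring_hom X D" "\<And>s Y. \<lbrakk>s \<in> carrier T; Y \<in> carrier X\<rbrakk> \<Longrightarrow> a (s \<odot>\<^bsub>X\<^esub> Y) = s \<odot>\<^bsub>D\<^esub> a Y"
    and b: "b \<in> ring_hom X D" "\<And>s Y. \<lbrakk>s \<in> carrier T; Y \<in> carrier X\<rbrakk> \<Longrightarrow> b (s \<odot>\<^bsub>X\<^esub> Y) = s \<odot>\<^bsub>D\<^esub> b Y"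
    and gen: "\<And>f t. \<lbrakk>f \<in> carrier M; t \<in> carrier T\<rbrakk> \<Longrightarrow> a (gen f t) = b (gen f t)"
    and Y: "Y \<in> carrier X"
  shows "a Y = b Y"
proof -
  interpret D: scalar_alg T D by fact
  have add: "additive_map X D a" "additive_map X D b"
    by (simp_all add: additive_map_def ring_hom_closed[OF a(1)] ring_hom_add[OF a(1)]
        ring_hom_closed[OF b(1)] ring_hom_add[OF b(1)])
  have one_wd: "a (ten.pt (ext.wd \<one>\<^bsub>K\<^esub> u) t) = b (ten.pt (ext.wd \<one>\<^bsub>K\<^esub> u) t)"
    if "u \<in> lists (carrier M)" "t \<in> carrier T" for u t
    using that
  proof (induction u arbitrary: t)
    case Nil
    have "ten.pt (ext.wd \<one>\<^bsub>K\<^esub> []) t = t \<odot>\<^bsub>X\<^esub> \<one>\<^bsub>X\<^esub>"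
      using Nil by (simp add: ten.pt_one ext.wd_one ten.pt_smult)
    then show ?case using Nil by (simp add: a b ring_hom_one[OF a(1)] ring_hom_one[OF b(1)])
  next
    case (Cons x u)
    then have c: "x \<in> carrier M" "u \<in> lists (carrier M)" by auto
    have "ten.pt (ext.wd \<one>\<^bsub>K\<^esub> (x # u)) t = gen x t \<otimes>\<^bsub>X\<^esub> ten.pt (ext.wd \<one>\<^bsub>K\<^esub> u) \<one>\<^bsub>T\<^esub>"
      using c Cons.prems by (simp add: gen_def ten.pt_mult ext.wd_Cons ext.incl_closed)
    then show ?case
      using c Cons by (simp add: ring_hom_mult[OF a(1)] ring_hom_mult[OF b(1)] gen)
  qed
  have wd: "a (ten.pt (ext.wd k u) t) = b (ten.pt (ext.wd k u) t)"
    if "k \<in> carrier K" "u \<in> lists (carrier M)" "t \<in> carrier T" for k u t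
  proof -
    have "ext.wd k u = k \<odot>\<^bsub>exterior_algebra K M\<^esub> ext.wd \<one>\<^bsub>K\<^esub> u"
      using that by (simp add: ext.wd_smult)
    then have "ten.pt (ext.wd k u) t = ten.pt (ext.wd \<one>\<^bsub>K\<^esub> u) (h k \<otimes>\<^bsub>T\<^esub> t)"
      using that by (simp add: ten.pt_balance)
    then show ?thesis using that one_wd ten.h_closed by simp
  qed
  have "a (ten.pt e t) = b (ten.pt e t)" if "e \<in> carrier (exterior_algebra K M)" "t \<in> carrier T" for e t
    using that(1)
    by (induction rule: ext.E_induct)
      (simp_all add: wd that(2) ten.pt_add_left additive_add[OF add(1)] additive_add[OF add(2)])
  then show ?thesis by (rule ten.additive_eqI[OF add _ Y])
qed

text \<open>The universal property of the exterior algebra after base change. Squares of the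
  \<open>g f\<close> vanishing is all that the alternating relation asks, so no commutativity of
  \<open>D\<close> is assumed. The submodules \<open>S n\<close> stand for the homogeneous parts of
  a target whose grading is not axiomatised.\<close>

lemma hom_lift:
  assumes D: "scalar_alg T D" and g: "additive_map M D g"
    and g_smult: "\<And>k f. \<lbrakk>k \<in> carrier K; f \<in> carrier M\<rbrakk> \<Longrightarrow> g (k \<odot>\<^bsub>M\<^esub> f) = h k \<odot>\<^bsub>D\<^esub> g f"
    and g_square: "\<And>f. f \<in> carrier M \<Longrightarrow> g f \<otimes>\<^bsub>D\<^esub> g f = \<zero>\<^bsub>D\<^esub>"
    and S: "\<And>n. submodule (S n) T D" "\<one>\<^bsub>D\<^esub> \<in> S 0"
      "\<And>f Y n. \<lbrakk>f \<in> carrier M; Y \<in> S n\<rbrakk> \<Longrightarrow> g f \<otimes>\<^bsub>D\<^esub> Y \<in> S (Suc n)"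
  obtains \<psi> where "\<psi> \<in> ring_hom X D" "\<And>s Y. \<lbrakk>s \<in> carrier T; Y \<in> carrier X\<rbrakk> \<Longrightarrow> \<psi> (s \<odot>\<^bsub>X\<^esub> Y) = s \<odot>\<^bsub>D\<^esub> \<psi> Y"
    "\<And>f t. \<lbrakk>f \<in> carrier M; t \<in> carrier T\<rbrakk> \<Longrightarrow> \<psi> (gen f t) = t \<odot>\<^bsub>D\<^esub> g f"
    "\<And>n. \<psi> ` homog X n \<subseteq> S n"
proof -
  interpret D: scalar_alg T D by fact
  note gc = additive_closed[OF g]
  \<comment> \<open>The value on a word is the product of the images of its letters; it is first
    extended to the exterior algebra, semilinearly along \<open>h\<close>, and then over the tensor
    product.\<close>
  define pr where "pr u = foldr (\<lambda>x. (\<otimes>\<^bsub>D\<^esub>) (g x)) u \<one>\<^bsub>D\<^esub>" for u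
  have pr_append: "pr (u @ v) = pr u \<otimes>\<^bsub>D\<^esub> pr v" and pr_closed: "pr u \<in> carrier D"
    if "u \<in> lists (carrier M)" "v \<in> lists (carrier M)" for u v
  proof -
    have "g x \<in> carrier D" if "x \<in> set u \<union> set v" for x
      using that \<open>u \<in> lists (carrier M)\<close> \<open>v \<in> lists (carrier M)\<close> gc by auto
    from D.foldr_mult_append[of u v g, OF this]
    show "pr (u @ v) = pr u \<otimes>\<^bsub>D\<^esub> pr v" "pr u \<in> carrier D" unfolding pr_def by simp_all
  qed
  have pr_simps [simp]: "pr [] = \<one>\<^bsub>D\<^esub>" "pr (x # u) = g x \<otimes>\<^bsub>D\<^esub> pr u" for x u by (simp_all add: pr_def)
  have pr_S: "pr u \<in> S (length u)" if "u \<in> lists (carrier M)" for u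
    using that by (induction u) (auto simp: S)
  note pr_c [simp] = pr_closed[OF _ lists.Nil]
  note hc [simp] = ten.h_closed
  have h_add: "h (k \<oplus>\<^bsub>K\<^esub> l) = h k \<oplus>\<^bsub>T\<^esub> h l" and h_mult: "h (k \<otimes>\<^bsub>K\<^esub> l) = h k \<otimes>\<^bsub>T\<^esub> h l"
    if "k \<in> carrier K" "l \<in> carrier K" for k l
    using ring_hom_add[OF ten.h_hom that] ring_hom_mult[OF ten.h_hom that] by simp_all
  have h_one: "h \<one>\<^bsub>K\<^esub> = \<one>\<^bsub>T\<^esub>" by (rule ring_hom_one[OF ten.h_hom])
  have cancel: "p \<oplus>\<^bsub>D\<^esub> q \<ominus>\<^bsub>D\<^esub> p \<ominus>\<^bsub>D\<^esub> q = \<zero>\<^bsub>D\<^esub>" if "p \<in> carrier D" "q \<in> carrier D" for p q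
    using that by (simp add: a_minus_def D.a_comm[of p q] D.a_assoc D.r_neg2 D.r_neg)
  obtain \<phi> where \<phi>: "additive_map (exterior_algebra K M) D \<phi>"
    "\<And>x. x \<in> ext.GE \<Longrightarrow> \<phi> (ext.pres.cls (frag_of x)) = (case x of (k, u) \<Rightarrow> h k \<odot>\<^bsub>D\<^esub> pr u)"
  proof (rule ext.pres.additive_ext[OF D.is_abelian_group, of "\<lambda>(k, u). h k \<odot>\<^bsub>D\<^esub> pr u"])
    show "(\<lambda>(k, u). h k \<odot>\<^bsub>D\<^esub> pr u) \<in> ext.GE \<rightarrow> carrier D"
      by (auto simp: exterior_gens_def intro!: D.smult_closed pr_c)
  next
    fix w r
    assume w: "w \<in> hom (free_Abelian_group ext.GE) (add_monoid D)"
      and wv: "\<And>x. x \<in> ext.GE \<Longrightarrow> w (frag_of x) = (case x of (k, u) \<Rightarrow> h k \<odot>\<^bsub>D\<^esub> pr u)" and r: "r \<in> ext.RE"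
    have keys: "Poly_Mapping.keys (frag_of x - frag_of y) \<subseteq> ext.GE" if "x \<in> ext.GE" "y \<in> ext.GE" for x y
      using keys_diff[of "frag_of x" "frag_of y"] that by auto
    note w_diff = additive_frag_diff(1)[OF D.is_abelian_group w]
    note simps = w_diff keys wv ext.GE_iff pr_append gc
    from r show "w r = \<zero>\<^bsub>D\<^esub>"
    proof (cases rule: ext.exterior_rels_cases)
      case (add k l u)
      then show ?thesis
        by (simp add: simps h_add D.smult_l_distr cancel)
    next
      case (multi k x y u v)
      then show ?thesis
        by (simp add: simps additive_add[OF g] D.l_distr D.r_distr D.smult_r_distr cancel)
    next
      case (smult k l x u v)
      then show ?thesis
        by (simp add: simps g_smult h_mult D.smult_mult_left D.smult_mult_right D.smult_assoc1
            a_minus_def D.r_neg)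
    next
      case (alt k x u v)
      then show ?thesis
        by (simp add: simps D.m_assoc[symmetric] g_square)
    qed
  qed blast
  have \<phi>_wd: "\<phi> (ext.wd k u) = h k \<odot>\<^bsub>D\<^esub> pr u" if "k \<in> carrier K" "u \<in> lists (carrier M)" for k u
    using \<phi>(2)[of "(k, u)"] that by (simp add: ext.wd_def ext.GE_iff)
  note \<phi>c [simp] = additive_closed[OF \<phi>(1)]
  note \<phi>_add = additive_add[OF \<phi>(1)]
  have \<phi>_smult: "\<phi> (k \<odot>\<^bsub>exterior_algebra K M\<^esub> Y) = h k \<odot>\<^bsub>D\<^esub> \<phi> Y" if k: "k \<in> carrier K" and "Y \<in> carrier (exterior_algebra K M)" for k Y
    using that(2)
    by (induction rule: ext.E_induct)
      (simp_all add: k \<phi>_wd ext.wd_smult h_mult D.smult_assoc1 \<phi>_add D.smult_r_distr ext.E.smult_r_distr)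
  have \<phi>_mult: "\<phi> (Y \<otimes>\<^bsub>exterior_algebra K M\<^esub> Z) = \<phi> Y \<otimes>\<^bsub>D\<^esub> \<phi> Z"
    if Y: "Y \<in> carrier (exterior_algebra K M)" and Z: "Z \<in> carrier (exterior_algebra K M)" for Y Z
    using Y
  proof (induction rule: ext.E_induct)
    case (wd k u)
    from Z show ?case
      by (induction rule: ext.E_induct)
        (simp_all add: wd \<phi>_wd ext.wd_mult h_mult pr_append D.smult_assoc1[symmetric] ten.T.m_comm D.smult_mult_left D.smult_mult_right
          \<phi>_add D.r_distr ext.E.r_distr)
  next
    case (add Y Y')
    then show ?case using Z by (simp add: \<phi>_add D.l_distr ext.E.l_distr)
  qed
  have \<phi>_one: "\<phi> \<one>\<^bsub>exterior_algebra K M\<^esub> = \<one>\<^bsub>D\<^esub>"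
    by (simp add: ext.wd_one \<phi>_wd h_one)
  obtain \<psi> where \<psi>: "additive_map X D \<psi>"
    "\<And>a t. \<lbrakk>a \<in> carrier (exterior_algebra K M); t \<in> carrier T\<rbrakk> \<Longrightarrow> \<psi> (ten.pt a t) = t \<odot>\<^bsub>D\<^esub> \<phi> a"
  proof (rule ten.tensor_lift[OF D.is_abelian_group, of "\<lambda>a t. t \<odot>\<^bsub>D\<^esub> \<phi> a"])
    show "additive_map (exterior_algebra K M) D (\<lambda>a. t \<odot>\<^bsub>D\<^esub> \<phi> a)" if "t \<in> carrier T" for t
      using that by (intro additive_mapI) (simp_all add: \<phi>_add D.smult_r_distr)
    show "additive_map T D (\<lambda>t. t \<odot>\<^bsub>D\<^esub> \<phi> a)" if "a \<in> carrier (exterior_algebra K M)" for a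
      using that by (intro additive_mapI) (simp_all add: D.smult_l_distr)
    show "t \<odot>\<^bsub>D\<^esub> \<phi> (k \<odot>\<^bsub>exterior_algebra K M\<^esub> a) = (h k \<otimes>\<^bsub>T\<^esub> t) \<odot>\<^bsub>D\<^esub> \<phi> a"
      if "k \<in> carrier K" "a \<in> carrier (exterior_algebra K M)" "t \<in> carrier T" for k a t
      using that by (simp add: \<phi>_smult D.smult_assoc1[symmetric] ten.T.m_comm)
  qed blast
  note \<psi>c [simp] = additive_closed[OF \<psi>(1)]
  note \<psi>_add = additive_add[OF \<psi>(1)]
  have \<psi>_smult: "\<psi> (s \<odot>\<^bsub>X\<^esub> Y) = s \<odot>\<^bsub>D\<^esub> \<psi> Y" if s: "s \<in> carrier T" and "Y \<in> carrier X" for s Y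
    using that(2)
    by (induction rule: ten.tensor_induct)
      (simp_all add: s \<psi> ten.pt_smult D.smult_assoc1 \<psi>_add D.smult_r_distr ten.X.smult_r_distr)
  have \<psi>_mult: "\<psi> (Y \<otimes>\<^bsub>X\<^esub> Z) = \<psi> Y \<otimes>\<^bsub>D\<^esub> \<psi> Z" if Y: "Y \<in> carrier X" and Z: "Z \<in> carrier X" for Y Z
    using Y
  proof (induction rule: ten.tensor_induct)
    case (pt a t)
    from Z show ?case
      by (induction rule: ten.tensor_induct)
        (simp_all add: pt \<psi> ten.pt_mult \<phi>_mult D.smult_assoc1[symmetric] ten.T.m_comm D.smult_mult_left D.smult_mult_right
          \<psi>_add D.r_distr ten.X.r_distr)
  next
    case (add Y Y')
    then show ?case using Z by (simp add: \<psi>_add D.l_distr ten.X.l_distr)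
  qed
  show thesis
  proof
    show "\<psi> \<in> ring_hom X D"
      by (rule ring_hom_memI) (simp_all add: \<psi>_mult \<psi>_add, simp add: ten.pt_one \<psi> \<phi>_one)
    show "\<psi> (s \<odot>\<^bsub>X\<^esub> Y) = s \<odot>\<^bsub>D\<^esub> \<psi> Y" if "s \<in> carrier T" "Y \<in> carrier X" for s Y
      using that by (rule \<psi>_smult)
    show "\<psi> (gen f t) = t \<odot>\<^bsub>D\<^esub> g f" if "f \<in> carrier M" "t \<in> carrier T" for f t
      using that by (simp add: gen_def \<psi> ext.incl_closed) (simp add: ext.incl_eq \<phi>_wd h_one gc)
    show "\<psi> ` homog X n \<subseteq> S n" for n
    proof (rule image_subsetI)
      fix Y assume Y: "Y \<in> homog X n"
      note S_add = subgroup.m_closed[OF submodule.axioms(1)[OF S(1)], simplified]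
      note S_zero = subgroup.one_closed[OF submodule.axioms(1)[OF S(1)], simplified]
      note S_smult = submodule.smult_closed[OF S(1)]
      have "\<phi> a \<in> S n" if "a \<in> homog (exterior_algebra K M) n" for a
        using that
        by (induction rule: ext.homog_E_induct)
          (auto simp: \<phi>_wd \<phi>_add S_add S_zero intro!: S_smult pr_S simp:
            additive_zero[OF ext.E.is_abelian_group D.is_abelian_group \<phi>(1)])
      then have pt: "\<psi> (ten.pt a t) \<in> S n" if "a \<in> homog (exterior_algebra K M) n" "t \<in> carrier T" for a t
        using that subgroup.subset[OF submodule.axioms(1)[OF ext.homog_E_submodule[of n]]]
        by (simp add: subset_iff \<psi> S_smult)
      show "\<psi> Y \<in> S n"
        using Y ext.homog_E_submodule
        by (induction rule: ten.homog_X_induct) (simp_all add: pt \<psi>_add S_add)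
    qed
  qed
qed

end

section \<open>Homology\<close>

text \<open>
  The sign of the Leibniz rule is carried by an involution \<open>sg\<close>, so that elements need not be
  decomposed into homogeneous ones.
\<close>

locale signed_dga = scalar_alg T C
  for T :: "('t, 'm) ring_scheme" and C :: "('t, 'a, 'n) dg_algebra_scheme" (structure) +
  fixes sg :: "'a \<Rightarrow> 'a"
  assumes diff_linear: "linear_map T C C (diff C)"
    and diff_diff: "x \<in> carrier C \<Longrightarrow> diff C (diff C x) = \<zero>"
    and sg_additive: "additive_map C C sg"
    and sg_sg: "x \<in> carrier C \<Longrightarrow> sg (sg x) = x"
    and diff_sg: "x \<in> carrier C \<Longrightarrow> diff C (sg x) = \<ominus> sg (diff C x)"
    and leibniz: "\<lbrakk>x \<in> carrier C; y \<in> carrier C\<rbrakk> \<Longrightarrow>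
      diff C (x \<otimes> y) = diff C x \<otimes> y \<oplus> sg x \<otimes> diff C y"
    and diff_one: "diff C \<one> = \<zero>"
    and homog_submodule: "submodule (homog C n) T C"
begin

abbreviation "Z \<equiv> C\<lparr>carrier := cycles C\<rparr>"
abbreviation "B \<equiv> boundaries C"
abbreviation "hc \<equiv> homology_class C"
abbreviation "H \<equiv> homology C"

lemmas diff_additive = linear_map_additive[OF diff_linear]
lemmas diff_closed [simp] = additive_closed[OF diff_additive]
lemmas diff_add = additive_add[OF diff_additive]
lemmas diff_zero [simp] = additive_zero[OF is_abelian_group is_abelian_group diff_additive]
lemmas diff_minus = additive_minus[OF is_abelian_group is_abelian_group diff_additive]
lemmas diff_smult = linear_map_smult[OF diff_linear]
lemmas sg_closed [simp] = additive_closed[OF sg_additive]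

lemma cycles_iff: "x \<in> cycles C \<longleftrightarrow> x \<in> carrier C \<and> diff C x = \<zero>"
  by (simp add: cycles_def)

lemma cycles_closed: "x \<in> cycles C \<Longrightarrow> x \<in> carrier C"
  by (simp add: cycles_def)

lemma cycles_zero: "\<zero> \<in> cycles C" and cycles_one: "\<one> \<in> cycles C"
  by (simp_all add: cycles_iff diff_one)

lemma cycles_add: "\<lbrakk>x \<in> cycles C; y \<in> cycles C\<rbrakk> \<Longrightarrow> x \<oplus> y \<in> cycles C"
  and cycles_minus: "x \<in> cycles C \<Longrightarrow> \<ominus> x \<in> cycles C"
  and cycles_mult: "\<lbrakk>x \<in> cycles C; y \<in> cycles C\<rbrakk> \<Longrightarrow> x \<otimes> y \<in> cycles C"
  and cycles_smult: "\<lbrakk>s \<in> carrier T; x \<in> cycles C\<rbrakk> \<Longrightarrow> s \<odot> x \<in> cycles C"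
  by (simp_all add: cycles_iff diff_add diff_minus leibniz diff_smult)

lemma sg_zero [simp]: "sg \<zero> = \<zero>"
  by (rule additive_zero[OF is_abelian_group is_abelian_group sg_additive])

lemma cycles_sg: "x \<in> cycles C \<Longrightarrow> sg x \<in> cycles C"
  by (simp add: cycles_iff diff_sg)

lemma boundariesI: "x \<in> carrier C \<Longrightarrow> diff C x \<in> B"
  by (simp add: boundaries_def)

lemma boundaries_cycles: "x \<in> B \<Longrightarrow> x \<in> cycles C"
  by (auto simp: boundaries_def cycles_iff diff_diff)

lemma Z_ring: "ring Z"
proof (rule ringI)
  show "abelian_group Z"
  proof (rule abelian_groupI; simp)
    fix x assume "x \<in> cycles C"
    then show "\<exists>y\<in>cycles C. y \<oplus> x = \<zero>"
      using cycles_minus cycles_closed l_neg by blast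
  qed (auto simp: cycles_add cycles_zero a_ac cycles_closed)
  show "Group.monoid Z"
    by (rule monoidI) (auto simp: cycles_mult cycles_one m_assoc cycles_closed)
qed (auto simp: cycles_closed l_distr r_distr)

text \<open>The left-hand case needs the sign: for a cycle \<open>z\<close>, the product of
  \<open>z\<close> with the boundary of \<open>x\<close> is the boundary of
  \<open>sg z \<otimes> x\<close>, since \<open>sg z\<close> is again a cycle and \<open>sg\<close>
  is an involution.\<close>

lemma B_ideal: "ideal B Z"
proof (rule idealI[OF Z_ring])
  interpret Z: ring Z by (rule Z_ring)
  have minus: "\<ominus>\<^bsub>Z\<^esub> x = \<ominus> x" if "x \<in> cycles C" for x
    using that by (intro Z.minus_equality) (simp_all add: cycles_minus cycles_closed l_neg)
  show "subgroup B (add_monoid Z)"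
  proof
    show "B \<subseteq> carrier (add_monoid Z)" using boundaries_cycles by auto
    show "\<one>\<^bsub>add_monoid Z\<^esub> \<in> B" using boundariesI[of \<zero>] by simp
    show "x \<otimes>\<^bsub>add_monoid Z\<^esub> y \<in> B" if "x \<in> B" "y \<in> B" for x y
      using that by (auto simp: boundaries_def diff_add[symmetric])
    show "inv\<^bsub>add_monoid Z\<^esub> x \<in> B" if "x \<in> B" for x
    proof -
      have "inv\<^bsub>add_monoid Z\<^esub> x = \<ominus> x" using minus[OF boundaries_cycles[OF that]] by (simp add: a_inv_def)
      then show ?thesis using that by (auto simp: boundaries_def diff_minus[symmetric])
    qed
  qed
  fix b z assume b: "b \<in> B" and "z \<in> carrier Z"
  then obtain x where x: "x \<in> carrier C" "b = diff C x" and z: "z \<in> carrier C" "diff C z = \<zero>"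
    by (auto simp: boundaries_def cycles_iff)
  have "diff C (sg z \<otimes> x) = z \<otimes> b"
    using x z by (simp add: leibniz diff_sg sg_sg)
  then show "z \<otimes>\<^bsub>Z\<^esub> b \<in> B" using boundariesI[of "sg z \<otimes> x"] x z by simp
  have "diff C (x \<otimes> z) = b \<otimes> z"
    using x z by (simp add: leibniz)
  then show "b \<otimes>\<^bsub>Z\<^esub> z \<in> B" using boundariesI[of "x \<otimes> z"] x z by simp
qed

lemma hc_Z: "B +>\<^bsub>Z\<^esub> x = hc x"
  by (simp add: homology_class_def a_r_coset_def')

lemma H_fields:
  "carrier H = a_rcosets\<^bsub>Z\<^esub> B" "monoid.mult H = rcoset_mult Z B" "\<one>\<^bsub>H\<^esub> = B +>\<^bsub>Z\<^esub> \<one>"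
  "\<zero>\<^bsub>H\<^esub> = B" "add H = set_add Z" "homog H n = hc ` (cycles C \<inter> homog C n)"
  "s \<odot>\<^bsub>H\<^esub> X = (\<Union>x\<in>X. hc (s \<odot> x))"
  by (simp_all add: homology_def Let_def FactRing_def)

lemma hc_self: "x \<in> carrier C \<Longrightarrow> x \<in> hc x"
  using boundariesI[of \<zero>] by (force simp: homology_class_def a_r_coset_def')

lemma hc_mem: "x \<in> cycles C \<Longrightarrow> y \<in> hc x \<longleftrightarrow> y \<in> cycles C \<and> y \<ominus> x \<in> B"
proof -
  assume x: "x \<in> cycles C"
  have "y \<in> cycles C \<and> y \<ominus> x \<in> B" if "y \<in> hc x"
  proof -
    obtain b where b: "b \<in> B" "y = b \<oplus> x" using \<open>y \<in> hc x\<close> by (auto simp: homology_class_def a_r_coset_def')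
    then have "y \<ominus> x = b" using cycles_closed[OF x] cycles_closed[OF boundaries_cycles[OF b(1)]]
      by (simp add: a_minus_def a_assoc r_neg)
    then show ?thesis using b x boundaries_cycles cycles_add by auto
  qed
  moreover have "y \<in> hc x" if y: "y \<in> cycles C" "y \<ominus> x \<in> B"
  proof -
    have "y = (y \<ominus> x) \<oplus> x" using x y cycles_closed by (simp add: a_minus_def a_assoc l_neg)
    then show ?thesis using y(2) by (auto simp: homology_class_def a_r_coset_def')
  qed
  ultimately show ?thesis by blast
qed

lemma hc_eq_iff:
  assumes "x \<in> cycles C" "y \<in> cycles C"
  shows "hc x = hc y \<longleftrightarrow> x \<ominus> y \<in> B"
proof
  assume "hc x = hc y"
  then show "x \<ominus> y \<in> B" using hc_self[OF cycles_closed[OF assms(1)]] hc_mem[OF assms(2)] by simp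
next
  assume "x \<ominus> y \<in> B"
  then have "x \<in> hc y" using hc_mem[OF assms(2)] assms by simp
  interpret I: ideal B Z by (rule B_ideal)
  have "B +>\<^bsub>Z\<^esub> y = B +>\<^bsub>Z\<^esub> x"
    by (rule I.a_repr_independence[OF _ _ I.a_subgroup]) (use \<open>x \<in> hc y\<close> assms in \<open>simp_all add: hc_Z\<close>)
  then show "hc x = hc y" by (simp add: hc_Z)
qed

lemma hc_ring_hom: "hc \<in> ring_hom Z (Z Quot B)"
proof -
  interpret I: ideal B Z by (rule B_ideal)
  have "(+>\<^bsub>Z\<^esub>) B = hc" by (rule ext) (rule hc_Z)
  then show ?thesis using I.rcos_ring_hom by simp
qed

lemma H_carrier: "carrier H = hc ` cycles C"
  unfolding H_fields A_RCOSETS_def' by (auto simp: hc_Z)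

lemma hc_closed: "x \<in> cycles C \<Longrightarrow> hc x \<in> carrier H"
  by (simp add: H_carrier)

lemma hc_add: "\<lbrakk>x \<in> cycles C; y \<in> cycles C\<rbrakk> \<Longrightarrow> hc x \<oplus>\<^bsub>H\<^esub> hc y = hc (x \<oplus> y)"
  using ring_hom_add[OF hc_ring_hom, of x y] by (simp add: H_fields FactRing_def)

lemma hc_mult: "\<lbrakk>x \<in> cycles C; y \<in> cycles C\<rbrakk> \<Longrightarrow> hc x \<otimes>\<^bsub>H\<^esub> hc y = hc (x \<otimes> y)"
  using ring_hom_mult[OF hc_ring_hom, of x y] by (simp add: H_fields FactRing_def)

lemma hc_one: "\<one>\<^bsub>H\<^esub> = hc \<one>"
  by (simp add: H_fields hc_Z)

lemma hc_zero: "\<zero>\<^bsub>H\<^esub> = hc \<zero>"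
proof -
  have "b \<in> B \<Longrightarrow> b \<oplus> \<zero> = b" for b using boundaries_cycles cycles_closed by simp
  then show ?thesis by (auto simp: H_fields homology_class_def a_r_coset_def')
qed

lemma hc_smult:
  assumes "s \<in> carrier T" "x \<in> cycles C"
  shows "s \<odot>\<^bsub>H\<^esub> hc x = hc (s \<odot> x)"
proof -
  have eq: "hc (s \<odot> y) = hc (s \<odot> x)" if "y \<in> hc x" for y
  proof -
    have y: "y \<in> cycles C" and "y \<ominus> x \<in> B"
      using that by (simp_all add: hc_mem[OF assms(2)])
    then obtain b where b: "b \<in> carrier C" "y \<ominus> x = diff C b"
      unfolding boundaries_def by (auto elim: imageE)
    have "s \<odot> y \<ominus> s \<odot> x = s \<odot> (y \<ominus> x)"
      using assms y cycles_closed
      by (simp add: a_minus_def smult_r_distr smult_r_minus)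
    also have "\<dots> = diff C (s \<odot> b)" using b assms by (simp add: diff_smult)
    finally show ?thesis using assms y b by (simp add: hc_eq_iff cycles_smult boundariesI)
  qed
  have "(\<Union>y\<in>hc x. hc (s \<odot> y)) = (\<Union>y\<in>hc x. hc (s \<odot> x))"
    by (rule SUP_cong[OF refl eq])
  then show ?thesis using hc_self[OF cycles_closed[OF assms(2)]] by (auto simp: H_fields)
qed

lemma H_cases:
  assumes "X \<in> carrier H"
  obtains x where "x \<in> cycles C" "X = hc x"
  using assms by (auto simp: H_carrier)

lemma H_scalar_alg: "scalar_alg T H"
proof -
  note simps = hc_add hc_mult hc_one hc_zero hc_smult cycles_add cycles_mult cycles_one cycles_zero cycles_smult
    hc_closed cycles_closed
  have ab: "abelian_group H"
  proof (rule abelian_groupI)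
    fix X assume "X \<in> carrier H"
    then obtain x where "x \<in> cycles C" "X = hc x" by (rule H_cases)
    then show "\<exists>Y\<in>carrier H. Y \<oplus>\<^bsub>H\<^esub> X = \<zero>\<^bsub>H\<^esub>"
      by (intro bexI[of _ "hc (\<ominus> x)"]) (simp_all add: simps cycles_minus l_neg)
  qed (auto elim!: H_cases simp: simps a_assoc, auto simp: a_comm cycles_closed)
  have "ring H"
    by (intro ringI ab monoidI) (auto elim!: H_cases simp: simps m_assoc l_distr r_distr)
  moreover have "module T H"
    by (intro moduleI ab is_cring) (auto elim!: H_cases simp: simps smult_l_distr smult_r_distr smult_assoc1)
  ultimately show ?thesis
    by (intro scalar_alg.intro scalar_alg_axioms.intro)
      (auto elim!: H_cases simp: simps smult_mult_left smult_mult_right)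
qed

lemma hc_minus: "x \<in> cycles C \<Longrightarrow> \<ominus>\<^bsub>H\<^esub> hc x = hc (\<ominus> x)"
proof -
  interpret H: scalar_alg T H by (rule H_scalar_alg)
  show "x \<in> cycles C \<Longrightarrow> \<ominus>\<^bsub>H\<^esub> hc x = hc (\<ominus> x)"
    by (rule H.minus_equality) (simp_all add: hc_add cycles_minus cycles_closed l_neg hc_zero hc_closed)
qed

lemma H_homog_submodule: "submodule (homog H n) T H"
proof -
  interpret H: scalar_alg T H by (rule H_scalar_alg)
  note sub = submodule.axioms(1)[OF homog_submodule]
  note facts = subgroup.m_closed[OF sub, simplified] subgroup.one_closed[OF sub, simplified]
    subgroup.m_inv_closed[OF sub, folded a_inv_def] submodule.smult_closed[OF homog_submodule]
  show ?thesis
    unfolding H_fields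
  proof (rule H.submoduleI)
    show "\<zero>\<^bsub>H\<^esub> \<in> hc ` (cycles C \<inter> homog C n)"
      unfolding hc_zero by (intro imageI IntI cycles_zero facts)
  qed (auto simp: hc_closed hc_minus hc_add hc_smult facts cycles_minus cycles_add cycles_smult)
qed

end

section \<open>Modules with coordinates\<close>

lemma (in abelian_monoid) finsum_support:
  assumes "finite S" "{i. f i \<noteq> \<zero>} \<subseteq> S" "f \<in> S \<rightarrow> carrier G"
  shows "finsum G f {i. f i \<noteq> \<zero>} = finsum G f S"
  by (rule add.finprod_mono_neutral_cong_left[OF assms(1,2)]) (use assms(3) in auto)

text \<open>A free module given by coordinate functions. Indices are kept apart from the basis
  vectors \<open>e c\<close>: for \<open>F\<close> they coincide, whereas a basis element of the
  resolution is indexed together with its degree.\<close>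

locale based_module = module K M
  for K :: "('k, 'm) ring_scheme" and M :: "('k, 'a, 'n) module_scheme" (structure) +
  fixes C :: "'c set" and e :: "'c \<Rightarrow> 'a" and \<kappa> :: "'c \<Rightarrow> 'a \<Rightarrow> 'k"
  assumes e_closed: "c \<in> C \<Longrightarrow> e c \<in> carrier M"
    and \<kappa>_additive: "c \<in> C \<Longrightarrow> additive_map M K (\<kappa> c)"
    and \<kappa>_smult: "\<lbrakk>c \<in> C; k \<in> carrier K; x \<in> carrier M\<rbrakk> \<Longrightarrow> \<kappa> c (k \<odot> x) = k \<otimes>\<^bsub>K\<^esub> \<kappa> c x"
    and finite_support: "x \<in> carrier M \<Longrightarrow> finite {c \<in> C. \<kappa> c x \<noteq> \<zero>\<^bsub>K\<^esub>}"
    and expansion: "x \<in> carrier M \<Longrightarrow> x = finsum M (\<lambda>c. \<kappa> c x \<odot> e c) {c \<in> C. \<kappa> c x \<noteq> \<zero>\<^bsub>K\<^esub>}"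
    and \<kappa>_e: "\<lbrakk>c \<in> C; d \<in> C\<rbrakk> \<Longrightarrow> \<kappa> c (e d) = (if c = d then \<one>\<^bsub>K\<^esub> else \<zero>\<^bsub>K\<^esub>)"
begin

definition supp :: "'a \<Rightarrow> 'c set" where
  "supp x = {c \<in> C. \<kappa> c x \<noteq> \<zero>\<^bsub>K\<^esub>}"

definition lin_ext :: "('k, 'b, 'l) module_scheme \<Rightarrow> ('c \<Rightarrow> 'b) \<Rightarrow> 'a \<Rightarrow> 'b" where
  "lin_ext N v x = finsum N (\<lambda>c. \<kappa> c x \<odot>\<^bsub>N\<^esub> v c) (supp x)"

lemma \<kappa>_closed: "\<lbrakk>c \<in> C; x \<in> carrier M\<rbrakk> \<Longrightarrow> \<kappa> c x \<in> carrier K"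
  by (rule additive_closed[OF \<kappa>_additive])

lemma supp_subset: "supp x \<subseteq> C" and supp_finite: "x \<in> carrier M \<Longrightarrow> finite (supp x)"
  by (auto simp: supp_def finite_support)

lemma lin_ext_superset:
  assumes N: "module K N" and v: "v \<in> C \<rightarrow> carrier N" and x: "x \<in> carrier M"
    and S: "finite S" "supp x \<subseteq> S" "S \<subseteq> C"
  shows "lin_ext N v x = finsum N (\<lambda>c. \<kappa> c x \<odot>\<^bsub>N\<^esub> v c) S"
proof -
  interpret N: module K N by fact
  show ?thesis
    unfolding lin_ext_def
  proof (rule N.add.finprod_mono_neutral_cong_left[OF S(1,2)])
    fix c assume "c \<in> S - supp x"
    then have "c \<in> C" "\<kappa> c x = \<zero>\<^bsub>K\<^esub>" using S(3) by (auto simp: supp_def)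
    then show "\<kappa> c x \<odot>\<^bsub>N\<^esub> v c = \<zero>\<^bsub>N\<^esub>" using v by (simp add: Pi_iff)
  qed (use v S x in \<open>auto intro!: N.smult_closed \<kappa>_closed\<close>)
qed

lemma lin_ext_closed:
  assumes N: "module K N" and v: "v \<in> C \<rightarrow> carrier N" and x: "x \<in> carrier M"
  shows "lin_ext N v x \<in> carrier N"
proof -
  interpret N: module K N by fact
  show ?thesis
    unfolding lin_ext_def using v x supp_subset[of x]
    by (intro N.finsum_closed) (auto intro!: N.smult_closed \<kappa>_closed)
qed

lemma lin_ext_linear:
  assumes N: "module K N" and v: "v \<in> C \<rightarrow> carrier N"
  shows "linear_map K M N (lin_ext N v)"
proof (intro linear_mapI additive_mapI)
  interpret N: module K N by fact
  show "lin_ext N v x \<in> carrier N" if "x \<in> carrier M" for x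
    by (rule lin_ext_closed[OF N v that])
  show "lin_ext N v (x \<oplus> y) = lin_ext N v x \<oplus>\<^bsub>N\<^esub> lin_ext N v y" if x: "x \<in> carrier M" and y: "y \<in> carrier M" for x y
  proof -
    let ?S = "supp x \<union> supp y \<union> supp (x \<oplus> y)"
    have S: "finite ?S" "?S \<subseteq> C" using supp_finite supp_subset x y by auto
    have cl: "c \<in> ?S \<Longrightarrow> \<kappa> c x \<odot>\<^bsub>N\<^esub> v c \<in> carrier N \<and> \<kappa> c y \<odot>\<^bsub>N\<^esub> v c \<in> carrier N" for c
      using S(2) v \<kappa>_closed x y by (auto simp: Pi_iff)
    have "lin_ext N v (x \<oplus> y) = finsum N (\<lambda>c. \<kappa> c (x \<oplus> y) \<odot>\<^bsub>N\<^esub> v c) ?S"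
      using x y S by (intro lin_ext_superset[OF N v]) auto
    also have "\<dots> = finsum N (\<lambda>c. \<kappa> c x \<odot>\<^bsub>N\<^esub> v c \<oplus>\<^bsub>N\<^esub> \<kappa> c y \<odot>\<^bsub>N\<^esub> v c) ?S"
    proof (rule N.finsum_cong'[OF refl])
      fix c assume "c \<in> ?S"
      then have "c \<in> C" "v c \<in> carrier N" using S(2) v by auto
      then show "\<kappa> c (x \<oplus> y) \<odot>\<^bsub>N\<^esub> v c = \<kappa> c x \<odot>\<^bsub>N\<^esub> v c \<oplus>\<^bsub>N\<^esub> \<kappa> c y \<odot>\<^bsub>N\<^esub> v c"
        using x y by (simp add: additive_add[OF \<kappa>_additive] \<kappa>_closed N.smult_l_distr)
    qed (use cl in auto)
    also have "\<dots> = finsum N (\<lambda>c. \<kappa> c x \<odot>\<^bsub>N\<^esub> v c) ?S \<oplus>\<^bsub>N\<^esub> finsum N (\<lambda>c. \<kappa> c y \<odot>\<^bsub>N\<^esub> v c) ?S"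
      using cl by (intro N.finsum_addf) auto
    also have "finsum N (\<lambda>c. \<kappa> c x \<odot>\<^bsub>N\<^esub> v c) ?S = lin_ext N v x"
      using x S by (intro lin_ext_superset[OF N v, symmetric]) auto
    also have "finsum N (\<lambda>c. \<kappa> c y \<odot>\<^bsub>N\<^esub> v c) ?S = lin_ext N v y"
      using y S by (intro lin_ext_superset[OF N v, symmetric]) auto
    finally show ?thesis .
  qed
  show "lin_ext N v (k \<odot> x) = k \<odot>\<^bsub>N\<^esub> lin_ext N v x" if k: "k \<in> carrier K" and x: "x \<in> carrier M" for k x
  proof -
    let ?S = "supp x \<union> supp (k \<odot> x)"
    have S: "finite ?S" "?S \<subseteq> C" using supp_finite supp_subset x k by auto
    have cl: "c \<in> ?S \<Longrightarrow> \<kappa> c x \<odot>\<^bsub>N\<^esub> v c \<in> carrier N" for c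
      using S(2) v \<kappa>_closed x by (auto simp: Pi_iff)
    have "lin_ext N v (k \<odot> x) = finsum N (\<lambda>c. \<kappa> c (k \<odot> x) \<odot>\<^bsub>N\<^esub> v c) ?S"
      using x k S by (intro lin_ext_superset[OF N v]) auto
    also have "\<dots> = finsum N (\<lambda>c. k \<odot>\<^bsub>N\<^esub> (\<kappa> c x \<odot>\<^bsub>N\<^esub> v c)) ?S"
    proof (rule N.finsum_cong'[OF refl])
      fix c assume "c \<in> ?S"
      then have "c \<in> C" "v c \<in> carrier N" using S(2) v by auto
      then show "\<kappa> c (k \<odot> x) \<odot>\<^bsub>N\<^esub> v c = k \<odot>\<^bsub>N\<^esub> (\<kappa> c x \<odot>\<^bsub>N\<^esub> v c)"
        using x k by (simp add: \<kappa>_smult \<kappa>_closed N.smult_assoc1)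
    qed (use cl k in auto)
    also have "\<dots> = k \<odot>\<^bsub>N\<^esub> finsum N (\<lambda>c. \<kappa> c x \<odot>\<^bsub>N\<^esub> v c) ?S"
    proof -
      have "additive_map N N (\<lambda>y. k \<odot>\<^bsub>N\<^esub> y)" using k by (intro additive_mapI) (simp_all add: N.smult_r_distr)
      from additive_finsum[OF N.abelian_group_axioms N.abelian_group_axioms this, of "\<lambda>c. \<kappa> c x \<odot>\<^bsub>N\<^esub> v c" ?S] cl
      show ?thesis by auto
    qed
    also have "finsum N (\<lambda>c. \<kappa> c x \<odot>\<^bsub>N\<^esub> v c) ?S = lin_ext N v x"
      using x S by (intro lin_ext_superset[OF N v, symmetric]) auto
    finally show ?thesis .
  qed
qed

lemma lin_ext_e:
  assumes N: "module K N" and v: "v \<in> C \<rightarrow> carrier N" and c: "c \<in> C"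
  shows "lin_ext N v (e c) = v c"
proof -
  interpret N: module K N by fact
  have "supp (e c) \<subseteq> {c}" using c by (auto simp: supp_def \<kappa>_e split: if_splits)
  then have "lin_ext N v (e c) = finsum N (\<lambda>d. \<kappa> d (e c) \<odot>\<^bsub>N\<^esub> v d) {c}"
    using c e_closed by (intro lin_ext_superset[OF N v]) auto
  also have "\<dots> = v c"
    using v c by (subst N.finsum_insert) (auto simp: \<kappa>_e N.finsum_empty Pi_iff)
  finally show ?thesis .
qed

lemma linear_expansion:
  assumes N: "module K N" and u: "linear_map K M N u" and x: "x \<in> carrier M"
  shows "u x = lin_ext N (\<lambda>c. u (e c)) x"
proof -
  interpret N: module K N by fact
  have cl: "c \<in> supp x \<Longrightarrow> \<kappa> c x \<odot> e c \<in> carrier M" for c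
    using \<kappa>_closed e_closed x by (auto simp: supp_def)
  have "u x = u (finsum M (\<lambda>c. \<kappa> c x \<odot> e c) (supp x))"
    using expansion[OF x] by (simp add: supp_def)
  also have "\<dots> = finsum N (\<lambda>c. u (\<kappa> c x \<odot> e c)) (supp x)"
    using cl by (intro additive_finsum[OF abelian_group_axioms N.abelian_group_axioms linear_map_additive[OF u]]) auto
  also have "\<dots> = lin_ext N (\<lambda>c. u (e c)) x"
    unfolding lin_ext_def
  proof (rule N.finsum_cong'[OF refl])
    fix c assume "c \<in> supp x"
    then have "c \<in> C" using supp_subset by auto
    then show "u (\<kappa> c x \<odot> e c) = \<kappa> c x \<odot>\<^bsub>N\<^esub> u (e c)"
      using x by (simp add: linear_map_smult[OF u] \<kappa>_closed e_closed)
  qed (use supp_subset[of x] \<kappa>_closed x e_closed additive_closed[OF linear_map_additive[OF u]] in \<open>simp add: subset_iff\<close>)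
  finally show ?thesis .
qed

text \<open>Only the values on the support of \<open>x\<close> count. The recursions below depend on
  this, since there a family of values is known in low degrees and filled up with zeros.\<close>

lemma lin_ext_cong:
  assumes N: "module K N" and v: "w \<in> C \<rightarrow> carrier N" and x: "x \<in> carrier M"
    and eq: "\<And>c. c \<in> supp x \<Longrightarrow> v c = w c"
  shows "lin_ext N v x = lin_ext N w x"
proof -
  interpret N: module K N by fact
  show ?thesis
    unfolding lin_ext_def
    by (rule N.finsum_cong'[OF refl]) (use v eq x supp_subset[of x] in \<open>auto intro!: N.smult_closed \<kappa>_closed\<close>)
qed

text \<open>Agreement is needed only on basis vectors that occur in \<open>x\<close>; for
  homogeneous \<open>x\<close> in the resolution these all share its degree.\<close>

lemma linear_eqI:
  assumes N: "module K N" and u: "linear_map K M N u" and w: "linear_map K M N w" and x: "x \<in> carrier M"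
    and eq: "\<And>c. c \<in> supp x \<Longrightarrow> u (e c) = w (e c)"
  shows "u x = w x"
proof -
  have "(\<lambda>c. w (e c)) \<in> C \<rightarrow> carrier N"
    using additive_closed[OF linear_map_additive[OF w]] e_closed by auto
  then show ?thesis
    unfolding linear_expansion[OF N u x] linear_expansion[OF N w x] using x eq
    by (intro lin_ext_cong[OF N])
qed

end

text \<open>Uniqueness of the coefficients makes the coordinates linear: the pointwise sum of two
  coefficient families represents the sum of the elements, and likewise for multiples.\<close>

lemma basis_coords:
  assumes M: "module K M" and B: "is_basis K M B"
  obtains \<kappa> where "based_module K M B (\<lambda>b. b) \<kappa>"
proof -
  interpret module K M by fact
  define P where "P x c \<longleftrightarrow> c \<in> B \<rightarrow> carrier K \<and> (\<forall>b. b \<notin> B \<longrightarrow> c b = \<zero>\<^bsub>K\<^esub>) \<and>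
        finite {b. c b \<noteq> \<zero>\<^bsub>K\<^esub>} \<and>
        x = finsum M (\<lambda>b. c b \<odot>\<^bsub>M\<^esub> b) {b. c b \<noteq> \<zero>\<^bsub>K\<^esub>}" for x c
  have B_sub: "B \<subseteq> carrier M" and ex1: "x \<in> carrier M \<Longrightarrow> \<exists>!c. P x c" for x
    using B unfolding is_basis_def P_def by auto
  define cf where "cf x = (THE c. P x c)" for x
  have cf: "P x (cf x)" if "x \<in> carrier M" for x
    unfolding cf_def by (rule theI'[OF ex1[OF that]])
  have cf_eq: "cf x = c" if "P x c" "x \<in> carrier M" for x c
    using ex1[OF that(2)] cf[OF that(2)] that(1) by blast
  have cl: "cf x b \<in> carrier K" if "x \<in> carrier M" for x b
    using cf[OF that] unfolding P_def by (cases "b \<in> B") auto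
  have zero_out: "cf x b = \<zero>\<^bsub>K\<^esub>" if "x \<in> carrier M" "b \<notin> B" for x b
    using cf[OF that(1)] that(2) unfolding P_def by auto
  have fin: "finite {b. cf x b \<noteq> \<zero>\<^bsub>K\<^esub>}" if "x \<in> carrier M" for x
    using cf[OF that(1)] unfolding P_def by auto
  have sub: "{b. c b \<noteq> \<zero>\<^bsub>K\<^esub>} \<subseteq> B" if "\<forall>b. b \<notin> B \<longrightarrow> c b = \<zero>\<^bsub>K\<^esub>" for c :: "'c \<Rightarrow> 'a"
    using that by auto
  have sum_super: "finsum M (\<lambda>b. c b \<odot>\<^bsub>M\<^esub> b) {b. c b \<noteq> \<zero>\<^bsub>K\<^esub>} = finsum M (\<lambda>b. c b \<odot>\<^bsub>M\<^esub> b) S"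
    if "finite S" "{b. c b \<noteq> \<zero>\<^bsub>K\<^esub>} \<subseteq> S" "S \<subseteq> B" "c \<in> B \<rightarrow> carrier K" for c S
    using that B_sub by (intro M.add.finprod_mono_neutral_cong_left) (auto intro!: smult_closed)
  have expand: "x = finsum M (\<lambda>b. cf x b \<odot>\<^bsub>M\<^esub> b) S"
    if "x \<in> carrier M" "finite S" "{b. cf x b \<noteq> \<zero>\<^bsub>K\<^esub>} \<subseteq> S" "S \<subseteq> B" for x S
    using cf[OF that(1)] sum_super[OF that(2-4)] unfolding P_def by auto
  \<comment> \<open>\<open>P\<close> speaks of the exact support; it suffices to verify the
    expansion over any finite subset of the basis off which \<open>c\<close> vanishes, and sums of
    families come with such a set.\<close>
  have PI: "P x c" if "finite S" "S \<subseteq> B" "\<And>b. b \<in> S \<Longrightarrow> c b \<in> carrier K" "\<And>b. b \<notin> S \<Longrightarrow> c b = \<zero>\<^bsub>K\<^esub>"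
     "x = finsum M (\<lambda>b. c b \<odot>\<^bsub>M\<^esub> b) S" for x c S
  proof -
    have s: "{b. c b \<noteq> \<zero>\<^bsub>K\<^esub>} \<subseteq> S" using that(4) by auto
    have "c b \<in> carrier K" for b using that(3,4) R.zero_closed by (cases "b \<in> S") auto
    then have "c \<in> B \<rightarrow> carrier K" by auto
    then show ?thesis
      unfolding P_def using that s finite_subset[OF s] sum_super[OF that(1) s that(2)] by auto
  qed
  have add: "cf (x \<oplus>\<^bsub>M\<^esub> y) = (\<lambda>b. cf x b \<oplus>\<^bsub>K\<^esub> cf y b)" if x: "x \<in> carrier M" and y: "y \<in> carrier M" for x y
  proof (rule cf_eq)
    let ?S = "{b. cf x b \<noteq> \<zero>\<^bsub>K\<^esub>} \<union> {b. cf y b \<noteq> \<zero>\<^bsub>K\<^esub>}"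
    have S: "finite ?S" "?S \<subseteq> B" using fin x y zero_out by auto
    have SM: "b \<in> ?S \<Longrightarrow> b \<in> carrier M" for b using S(2) B_sub by auto
    have "x \<oplus>\<^bsub>M\<^esub> y = finsum M (\<lambda>b. cf x b \<odot>\<^bsub>M\<^esub> b) ?S \<oplus>\<^bsub>M\<^esub> finsum M (\<lambda>b. cf y b \<odot>\<^bsub>M\<^esub> b) ?S"
      using expand[OF x S(1) _ S(2)] expand[OF y S(1) _ S(2)] by simp
    also have "\<dots> = finsum M (\<lambda>b. cf x b \<odot>\<^bsub>M\<^esub> b \<oplus>\<^bsub>M\<^esub> cf y b \<odot>\<^bsub>M\<^esub> b) ?S"
      using SM cl x y by (intro M.finsum_addf[symmetric]) auto
    also have "\<dots> = finsum M (\<lambda>b. (cf x b \<oplus>\<^bsub>K\<^esub> cf y b) \<odot>\<^bsub>M\<^esub> b) ?S"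
      using SM cl x y by (intro M.finsum_cong'[OF refl]) (auto simp: smult_l_distr)
    finally show "P (x \<oplus>\<^bsub>M\<^esub> y) (\<lambda>b. cf x b \<oplus>\<^bsub>K\<^esub> cf y b)"
      using S cl x y by (intro PI[of ?S]) auto
  qed (use x y in simp)
  have smult: "cf (k \<odot>\<^bsub>M\<^esub> x) = (\<lambda>b. k \<otimes>\<^bsub>K\<^esub> cf x b)" if k: "k \<in> carrier K" and x: "x \<in> carrier M" for k x
  proof (rule cf_eq)
    let ?S = "{b. cf x b \<noteq> \<zero>\<^bsub>K\<^esub>}"
    have S: "finite ?S" "?S \<subseteq> B" using fin x zero_out by auto
    have SM: "b \<in> ?S \<Longrightarrow> b \<in> carrier M" for b using S(2) B_sub by auto
    have "additive_map M M (\<lambda>y. k \<odot>\<^bsub>M\<^esub> y)" using k by (intro additive_mapI) (simp_all add: smult_r_distr)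
    from additive_finsum[OF M.abelian_group_axioms M.abelian_group_axioms this, of "\<lambda>b. cf x b \<odot>\<^bsub>M\<^esub> b" ?S]
    have "k \<odot>\<^bsub>M\<^esub> finsum M (\<lambda>b. cf x b \<odot>\<^bsub>M\<^esub> b) ?S = finsum M (\<lambda>b. k \<odot>\<^bsub>M\<^esub> (cf x b \<odot>\<^bsub>M\<^esub> b)) ?S"
      using SM cl x by auto
    also have "\<dots> = finsum M (\<lambda>b. (k \<otimes>\<^bsub>K\<^esub> cf x b) \<odot>\<^bsub>M\<^esub> b) ?S"
      using SM cl x k by (intro M.finsum_cong'[OF refl]) (auto simp: smult_assoc1)
    finally show "P (k \<odot>\<^bsub>M\<^esub> x) (\<lambda>b. k \<otimes>\<^bsub>K\<^esub> cf x b)"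
      using S cl x k expand[OF x S(1) _ S(2)] by (intro PI[of ?S]) auto
  qed (use x k in simp)
  have basis: "cf b = (\<lambda>b'. if b' = b then \<one>\<^bsub>K\<^esub> else \<zero>\<^bsub>K\<^esub>)" if "b \<in> B" for b
  proof (rule cf_eq)
    show b: "b \<in> carrier M" using that B_sub by auto
    show "P b (\<lambda>b'. if b' = b then \<one>\<^bsub>K\<^esub> else \<zero>\<^bsub>K\<^esub>)"
      by (rule PI[of "{b}"]) (use that b in \<open>auto simp: M.finsum_insert M.finsum_empty\<close>)
  qed
  have supp: "{c \<in> B. cf x c \<noteq> \<zero>\<^bsub>K\<^esub>} = {b. cf x b \<noteq> \<zero>\<^bsub>K\<^esub>}" if "x \<in> carrier M" for x
    using zero_out[OF that] by auto
  have "based_module K M B (\<lambda>b. b) (\<lambda>b x. cf x b)"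
  proof
    fix x assume x: "x \<in> carrier M"
    show "finite {c \<in> B. cf x c \<noteq> \<zero>\<^bsub>K\<^esub>}" using fin[OF x] supp[OF x] by simp
    show "x = finsum M (\<lambda>c. cf x c \<odot>\<^bsub>M\<^esub> c) {c \<in> B. cf x c \<noteq> \<zero>\<^bsub>K\<^esub>}"
      unfolding supp[OF x] using expand[OF x fin[OF x]] zero_out[OF x] by auto
  qed (use B_sub in \<open>auto simp: add smult basis cl intro!: additive_mapI\<close>)
  then show ?thesis by (rule that)
qed

section \<open>Graded algebras\<close>

context graded_alg
begin

lemma homog_closed: "x \<in> homog A n \<Longrightarrow> x \<in> carrier A"
  using subgroup.subset[OF submodule.axioms(1)[OF homog_submodule[of n]]] by auto

lemma homog_add: "\<lbrakk>x \<in> homog A n; y \<in> homog A n\<rbrakk> \<Longrightarrow> x \<oplus>\<^bsub>A\<^esub> y \<in> homog A n"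
  using subgroup.m_closed[OF submodule.axioms(1)[OF homog_submodule[of n]]] by simp

lemma homog_zero: "\<zero>\<^bsub>A\<^esub> \<in> homog A n"
  using subgroup.one_closed[OF submodule.axioms(1)[OF homog_submodule[of n]]] by simp

lemma homog_minus: "x \<in> homog A n \<Longrightarrow> \<ominus>\<^bsub>A\<^esub> x \<in> homog A n"
  using subgroup.m_inv_closed[OF submodule.axioms(1)[OF homog_submodule[of n]]] by (simp add: a_inv_def)

lemma homog_smult: "\<lbrakk>k \<in> carrier K; x \<in> homog A n\<rbrakk> \<Longrightarrow> k \<odot>\<^bsub>A\<^esub> x \<in> homog A n"
  by (rule submodule.smult_closed[OF homog_submodule])

definition component :: "'a \<Rightarrow> nat \<Rightarrow> 'a" where
  "component x = (THE c. (\<forall>n. c n \<in> homog A n) \<and> finite {n. c n \<noteq> \<zero>\<^bsub>A\<^esub>} \<and>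
     x = finsum A c {n. c n \<noteq> \<zero>\<^bsub>A\<^esub>})"

lemma comp_spec:
  assumes "x \<in> carrier A"
  shows comp_homog: "component x n \<in> homog A n" and comp_finite: "finite {n. component x n \<noteq> \<zero>\<^bsub>A\<^esub>}"
    and comp_sum: "x = finsum A (component x) {n. component x n \<noteq> \<zero>\<^bsub>A\<^esub>}"
  using theI'[OF homog_decomp[OF assms]] unfolding component_def[symmetric] by auto

lemma comp_closed: "x \<in> carrier A \<Longrightarrow> component x n \<in> carrier A"
  by (rule homog_closed[OF comp_homog])

lemma comp_superset:
  assumes "x \<in> carrier A" "finite S" "{n. component x n \<noteq> \<zero>\<^bsub>A\<^esub>} \<subseteq> S"
  shows "x = finsum A (component x) S"
proof -
  have "finsum A (component x) {n. component x n \<noteq> \<zero>\<^bsub>A\<^esub>} = finsum A (component x) S"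
    by (rule finsum_support[OF assms(2,3)]) (use comp_closed[OF assms(1)] in auto)
  then show ?thesis using comp_sum[OF assms(1)] by simp
qed

lemma comp_eqI:
  assumes "x \<in> carrier A" "finite S" "\<And>n. c n \<in> homog A n" "\<And>n. n \<notin> S \<Longrightarrow> c n = \<zero>\<^bsub>A\<^esub>" "x = finsum A c S"
  shows "component x = c"
proof -
  have s: "{n. c n \<noteq> \<zero>\<^bsub>A\<^esub>} \<subseteq> S" using assms(4) by auto
  have "finsum A c {n. c n \<noteq> \<zero>\<^bsub>A\<^esub>} = finsum A c S"
    by (rule finsum_support[OF assms(2) s]) (use homog_closed[OF assms(3)] in auto)
  then have "(\<forall>n. c n \<in> homog A n) \<and> finite {n. c n \<noteq> \<zero>\<^bsub>A\<^esub>} \<and> x = finsum A c {n. c n \<noteq> \<zero>\<^bsub>A\<^esub>}"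
    using assms(3,5) finite_subset[OF s assms(2)] by simp
  then show ?thesis
    unfolding component_def by (rule the1_equality[OF homog_decomp[OF assms(1)]])
qed

lemma comp_add:
  assumes x: "x \<in> carrier A" and y: "y \<in> carrier A"
  shows "component (x \<oplus>\<^bsub>A\<^esub> y) = (\<lambda>n. component x n \<oplus>\<^bsub>A\<^esub> component y n)"
proof (rule comp_eqI)
  let ?S = "{n. component x n \<noteq> \<zero>\<^bsub>A\<^esub>} \<union> {n. component y n \<noteq> \<zero>\<^bsub>A\<^esub>}"
  show S: "finite ?S" using comp_finite x y by auto
  show "x \<oplus>\<^bsub>A\<^esub> y = finsum A (\<lambda>n. component x n \<oplus>\<^bsub>A\<^esub> component y n) ?S"
    using comp_superset[OF x S] comp_superset[OF y S] comp_closed x y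
    by (subst finsum_addf) auto
  show "component x n \<oplus>\<^bsub>A\<^esub> component y n \<in> homog A n" for n
    using x y by (intro homog_add comp_homog)
  show "component x n \<oplus>\<^bsub>A\<^esub> component y n = \<zero>\<^bsub>A\<^esub>" if "n \<notin> ?S" for n
    using that by simp
qed (use x y in simp)

lemma comp_smult:
  assumes k: "k \<in> carrier K" and x: "x \<in> carrier A"
  shows "component (k \<odot>\<^bsub>A\<^esub> x) = (\<lambda>n. k \<odot>\<^bsub>A\<^esub> component x n)"
proof (rule comp_eqI)
  let ?S = "{n. component x n \<noteq> \<zero>\<^bsub>A\<^esub>}"
  show S: "finite ?S" using comp_finite x by auto
  have "additive_map A A (\<lambda>y. k \<odot>\<^bsub>A\<^esub> y)" using k by (intro additive_mapI) (simp_all add: smult_r_distr)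
  from additive_finsum[OF is_abelian_group is_abelian_group this, of "component x" ?S]
  show "k \<odot>\<^bsub>A\<^esub> x = finsum A (\<lambda>n. k \<odot>\<^bsub>A\<^esub> component x n) ?S"
    using comp_sum[OF x] comp_closed[OF x] by auto
qed (use k x in \<open>auto intro: homog_smult comp_homog\<close>)

lemma comp_of_homog:
  assumes "x \<in> homog A n"
  shows "component x = (\<lambda>m. if m = n then x else \<zero>\<^bsub>A\<^esub>)"
  by (rule comp_eqI[of _ "{n}"])
    (use assms homog_closed in \<open>auto simp: homog_zero finsum_insert finsum_empty\<close>)

lemma homog_additive_eqI:
  assumes N: "abelian_group N" and u: "additive_map A N u" and w: "additive_map A N w" and x: "x \<in> carrier A"
    and eq: "\<And>n y. y \<in> homog A n \<Longrightarrow> u y = w y"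
  shows "u x = w x"
proof -
  interpret N: abelian_group N by fact
  let ?S = "{n. component x n \<noteq> \<zero>\<^bsub>A\<^esub>}"
  have c: "component x \<in> ?S \<rightarrow> carrier A" using comp_closed[OF x] by auto
  have "u x = finsum N (\<lambda>n. u (component x n)) ?S"
    using additive_finsum[OF is_abelian_group N u c] comp_sum[OF x] by simp
  also have "\<dots> = finsum N (\<lambda>n. w (component x n)) ?S"
    using additive_closed[OF w] comp_closed[OF x] by (intro N.finsum_cong'[OF refl] eq[OF comp_homog[OF x]]) auto
  also have "\<dots> = w x"
    using additive_finsum[OF is_abelian_group N w c] comp_sum[OF x] by simp
  finally show ?thesis .
qed

end

section \<open>Homogeneous coordinates on a graded free algebra\<close>

lemma finsum_carrier_update:
  assumes "abelian_group M" "abelian_group (M\<lparr>carrier := S\<rparr>)" "S \<subseteq> carrier M" "f \<in> I \<rightarrow> S"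
  shows "finsum (M\<lparr>carrier := S\<rparr>) f I = finsum M f I"
proof -
  interpret M: abelian_group M by fact
  interpret N: abelian_group "M\<lparr>carrier := S\<rparr>" by fact
  have "additive_map (M\<lparr>carrier := S\<rparr>) M (\<lambda>x. x)" using assms(3) by (auto intro!: additive_mapI)
  from additive_finsum[OF assms(2,1) this, of f I] assms(4) show ?thesis by simp
qed

lemma (in abelian_group) finsum_Sigma:
  assumes "finite S" "\<And>i. i \<in> S \<Longrightarrow> finite (T i)" "\<And>i j. \<lbrakk>i \<in> S; j \<in> T i\<rbrakk> \<Longrightarrow> f (i, j) \<in> carrier G"
  shows "finsum G f (Sigma S T) = finsum G (\<lambda>i. finsum G (\<lambda>j. f (i, j)) (T i)) S"
proof -
  have "finsum G f (Sigma S T) = finsum G f (\<Union>i\<in>S. Pair i ` T i)"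
    by (rule arg_cong[where f = "finsum G f"]) auto
  also have "\<dots> = finsum G (\<lambda>i. finsum G f (Pair i ` T i)) S"
    by (rule add.finprod_UN_disjoint) (use assms in \<open>auto simp: pairwise_def disjnt_def\<close>)
  also have "\<dots> = finsum G (\<lambda>i. finsum G (\<lambda>j. f (i, j)) (T i)) S"
  proof (rule finsum_cong'[OF refl])
    fix i assume "i \<in> S"
    then show "finsum G f (Pair i ` T i) = finsum G (\<lambda>j. f (i, j)) (T i)"
      using assms(3) by (intro finsum_reindex) (auto simp: inj_on_def)
  qed (use assms(3) in \<open>auto intro!: finsum_closed\<close>)
  finally show ?thesis .
qed

text \<open>The bases of the homogeneous parts are glued over pairs of a degree and a basis element;
  a coordinate of \<open>x\<close> is that of its component in the given degree. Having the degree
  as \<open>fst\<close> of the index is what the later recursions run on.\<close>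

lemma (in graded_alg) homogeneous_coords:
  assumes free: "\<And>n. free_module K (A\<lparr>carrier := homog A n\<rparr>)"
  obtains C \<kappa> where "based_module K A C snd \<kappa>" "\<And>c. c \<in> C \<Longrightarrow> snd c \<in> homog A (fst c)"
    "\<And>c x n. \<lbrakk>c \<in> C; x \<in> homog A n; fst c \<noteq> n\<rbrakk> \<Longrightarrow> \<kappa> c x = \<zero>\<^bsub>K\<^esub>"
proof -
  let ?An = "\<lambda>n. A\<lparr>carrier := homog A n\<rparr>"
  have "\<exists>B \<kappa>. based_module K (?An n) B (\<lambda>b. b) \<kappa>" for n
    using free[of n] basis_coords unfolding free_module_def by metis
  then obtain B \<kappa>n where bm: "\<And>n. based_module K (?An n) (B n) (\<lambda>b. b) (\<kappa>n n)" by metis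
  note ag = module.axioms(2)[OF based_module.axioms(1)[OF bm]]
  let ?C = "Sigma UNIV B"
  define \<kappa> where "\<kappa> c x = \<kappa>n (fst c) (snd c) (component x (fst c))" for c x
  have B: "b \<in> homog A n" if "b \<in> B n" for n b
    using based_module.e_closed[OF bm that] by simp
  have \<kappa>n_closed: "\<kappa>n n b x \<in> carrier K" if "b \<in> B n" "x \<in> homog A n" for n b x
    using additive_closed[OF based_module.\<kappa>_additive[OF bm that(1)]] that(2) by simp
  have \<kappa>n_zero: "\<kappa>n n b \<zero>\<^bsub>A\<^esub> = \<zero>\<^bsub>K\<^esub>" if "b \<in> B n" for n b
    using additive_zero[OF ag R.is_abelian_group based_module.\<kappa>_additive[OF bm that]] by simp
  have \<kappa>n_add: "\<kappa>n n b (x \<oplus>\<^bsub>A\<^esub> y) = \<kappa>n n b x \<oplus>\<^bsub>K\<^esub> \<kappa>n n b y" if "b \<in> B n" "x \<in> homog A n" "y \<in> homog A n" for n b x y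
    using additive_add[OF based_module.\<kappa>_additive[OF bm that(1)], of x y] that(2,3) by simp
  have \<kappa>n_smult: "\<kappa>n n b (k \<odot>\<^bsub>A\<^esub> x) = k \<otimes>\<^bsub>K\<^esub> \<kappa>n n b x" if "b \<in> B n" "x \<in> homog A n" "k \<in> carrier K" for n b x k
    using based_module.\<kappa>_smult[OF bm that(1), of k x] that(2,3) by simp
  have \<kappa>n_fin: "finite {b \<in> B n. \<kappa>n n b x \<noteq> \<zero>\<^bsub>K\<^esub>}" if "x \<in> homog A n" for n x
    using based_module.finite_support[OF bm, of x n] that by simp
  have \<kappa>n_exp: "x = finsum A (\<lambda>b. \<kappa>n n b x \<odot>\<^bsub>A\<^esub> b) {b \<in> B n. \<kappa>n n b x \<noteq> \<zero>\<^bsub>K\<^esub>}" if "x \<in> homog A n" for n x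
  proof -
    have "x = finsum (?An n) (\<lambda>b. \<kappa>n n b x \<odot>\<^bsub>A\<^esub> b) {b \<in> B n. \<kappa>n n b x \<noteq> \<zero>\<^bsub>K\<^esub>}"
      using based_module.expansion[OF bm, of x n] that by simp
    also have "\<dots> = finsum A (\<lambda>b. \<kappa>n n b x \<odot>\<^bsub>A\<^esub> b) {b \<in> B n. \<kappa>n n b x \<noteq> \<zero>\<^bsub>K\<^esub>}"
      by (rule finsum_carrier_update[OF is_abelian_group ag])
        (use B \<kappa>n_closed that in \<open>auto intro!: homog_smult dest: homog_closed\<close>)
    finally show ?thesis .
  qed
  show thesis
  proof (rule that)
    show "based_module K A ?C snd \<kappa>"
    proof
      fix c assume "c \<in> ?C"
      then obtain n b where c: "c = (n, b)" "b \<in> B n" by auto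
      show "snd c \<in> carrier A" using c B homog_closed by auto
      show "additive_map A K (\<kappa> c)"
        using c by (intro additive_mapI) (simp_all add: \<kappa>_def \<kappa>n_closed comp_add \<kappa>n_add comp_homog)
      show "\<kappa> c (k \<odot>\<^bsub>A\<^esub> x) = k \<otimes>\<^bsub>K\<^esub> \<kappa> c x" if "k \<in> carrier K" "x \<in> carrier A" for k x
        using c that by (simp add: \<kappa>_def comp_smult \<kappa>n_smult comp_homog)
      fix d assume "d \<in> ?C"
      then obtain m b' where d: "d = (m, b')" "b' \<in> B m" by auto
      show "\<kappa> c (snd d) = (if c = d then \<one>\<^bsub>K\<^esub> else \<zero>\<^bsub>K\<^esub>)"
        using c d based_module.\<kappa>_e[OF bm, of b n b']
        by (auto simp: \<kappa>_def comp_of_homog[OF B[OF d(2)]] \<kappa>n_zero)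
    next
      fix x assume x: "x \<in> carrier A"
      let ?S = "{n. component x n \<noteq> \<zero>\<^bsub>A\<^esub>}" and ?T = "\<lambda>n. {b \<in> B n. \<kappa>n n b (component x n) \<noteq> \<zero>\<^bsub>K\<^esub>}"
      have eq: "{c \<in> ?C. \<kappa> c x \<noteq> \<zero>\<^bsub>K\<^esub>} = Sigma ?S ?T"
        using \<kappa>n_zero by (auto simp: \<kappa>_def)
      have fin: "finite ?S" "\<And>n. finite (?T n)" using comp_finite[OF x] \<kappa>n_fin comp_homog[OF x] by auto
      show "finite {c \<in> ?C. \<kappa> c x \<noteq> \<zero>\<^bsub>K\<^esub>}" unfolding eq using fin by auto
      have "finsum A (\<lambda>c. \<kappa> c x \<odot>\<^bsub>A\<^esub> snd c) (Sigma ?S ?T) =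
          finsum A (\<lambda>n. finsum A (\<lambda>b. \<kappa> (n, b) x \<odot>\<^bsub>A\<^esub> snd (n, b)) (?T n)) ?S"
        by (rule finsum_Sigma[OF fin])
          (use comp_homog[OF x] B in \<open>auto simp: \<kappa>_def intro!: smult_closed \<kappa>n_closed intro: homog_closed\<close>)
      also have "\<dots> = finsum A (component x) ?S"
        by (rule finsum_cong'[OF refl])
          (use \<kappa>n_exp[OF comp_homog[OF x], symmetric] comp_closed[OF x] in \<open>auto simp: \<kappa>_def\<close>)
      also have "\<dots> = x" using comp_sum[OF x] by simp
      finally show "x = finsum A (\<lambda>c. \<kappa> c x \<odot>\<^bsub>A\<^esub> snd c) {c \<in> ?C. \<kappa> c x \<noteq> \<zero>\<^bsub>K\<^esub>}" unfolding eq by simp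
    qed
    show "\<kappa> c x = \<zero>\<^bsub>K\<^esub>" if "c \<in> ?C" "x \<in> homog A n" "fst c \<noteq> n" for c x n
      using that \<kappa>n_zero by (auto simp: \<kappa>_def comp_of_homog)
  qed (use B in auto)
qed

section \<open>Derivations on the resolution\<close>

locale coord_resolution = dg_algebra_resolution R P I \<epsilon> + I: ideal I R +
    based_module R P C snd \<kappa>
  for R :: "('a, 'm) ring_scheme" and P :: "('a, 'p, 'n) dg_algebra_scheme" (structure)
    and I :: "'a set" and \<epsilon> :: "'p \<Rightarrow> 'a set" and C :: "(nat \<times> 'p) set" and \<kappa> +
  assumes e_homog: "c \<in> C \<Longrightarrow> snd c \<in> homog P (fst c)"
    and \<kappa>_homog: "\<lbrakk>c \<in> C; x \<in> homog P n; fst c \<noteq> n\<rbrakk> \<Longrightarrow> \<kappa> c x = \<zero>\<^bsub>R\<^esub>"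
begin

abbreviation "lin \<equiv> linear_map R P P"
abbreviation "S \<equiv> R Quot I"
abbreviation "rc \<equiv> a_r_coset R I"

lemma P_module: "module R P" by (rule module_axioms)

lemma supp_homog: "\<lbrakk>x \<in> homog P n; c \<in> supp x\<rbrakk> \<Longrightarrow> fst c = n"
  using \<kappa>_homog[of c x n] by (auto simp: supp_def simp del: split_paired_All)

text \<open>Applied with \<open>U\<close> a homogeneous part, to control the degree of a map defined
  on basis elements.\<close>

lemma lin_ext_submodule:
  assumes "submodule U R P" "x \<in> carrier P" "\<And>c. c \<in> supp x \<Longrightarrow> v c \<in> U"
  shows "lin_ext P v x \<in> U"
proof -
  note sub = submodule.axioms(1)[OF assms(1)]
  have U: "U \<subseteq> carrier P" using subgroup.subset[OF sub] by simp
  have "finsum P f J \<in> U" if "finite J" "f \<in> J \<rightarrow> U" for f and J :: "(nat \<times> 'p) set"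
    using that
  proof (induction J rule: finite_induct)
    case empty
    show ?case using subgroup.one_closed[OF sub] by (simp add: finsum_empty)
  next
    case (insert i J)
    then have "f i \<in> U" "f \<in> J \<rightarrow> carrier P" using U by auto
    then show ?case using insert U subgroup.m_closed[OF sub, of "f i" "finsum P f J"] by (subst finsum_insert) auto
  qed
  moreover have "(\<lambda>c. \<kappa> c x \<odot> v c) \<in> supp x \<rightarrow> U"
    using assms supp_subset[of x] \<kappa>_closed by (auto intro!: submodule.smult_closed[OF assms(1)])
  ultimately show ?thesis unfolding lin_ext_def using supp_finite[OF assms(2)] by blast
qed

lemma diff_lin: "lin (diff P)"
  by (intro linear_mapI additive_mapI) (auto simp: diff_closed diff_add diff_smult)

lemmas diff_additive = linear_map_additive[OF diff_lin]
lemmas diff_zero [simp] = additive_zero[OF is_abelian_group is_abelian_group diff_additive]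
lemmas diff_minus = additive_minus[OF is_abelian_group is_abelian_group diff_additive]
declare diff_closed [simp]

subsection \<open>The sign involution\<close>

definition sg :: "'p \<Rightarrow> 'p" where
  "sg = lin_ext P (\<lambda>c. if even (fst c) then snd c else \<ominus> snd c)"

lemma sg_lin: "lin sg"
  unfolding sg_def by (rule lin_ext_linear[OF P_module]) (auto simp: e_closed)

lemmas sg_additive = linear_map_additive[OF sg_lin]
lemmas sg_closed [simp] = additive_closed[OF sg_additive]
lemmas sg_zero [simp] = additive_zero[OF is_abelian_group is_abelian_group sg_additive]
lemmas sg_minus = additive_minus[OF is_abelian_group is_abelian_group sg_additive]
lemmas sg_add = additive_add[OF sg_additive]

lemma sg_homog:
  assumes x: "x \<in> homog P n"
  shows "sg x = (if even n then x else \<ominus> x)"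
proof -
  have lin: "lin (\<lambda>x. if even n then x else \<ominus> x)"
    using linear_map_id[of R P] linear_map_minus[OF linear_map_id[of R P]] by (cases "even n") simp_all
  have v: "(\<lambda>c. if even (fst c) then snd c else \<ominus> snd c) \<in> C \<rightarrow> carrier P"
    by (auto simp: e_closed)
  show ?thesis
  proof (rule linear_eqI[OF P_module sg_lin lin homog_closed[OF x]])
    fix c assume "c \<in> supp x"
    then have "c \<in> C" "fst c = n" using supp_subset supp_homog[OF x] by auto
    then show "sg (snd c) = (if even n then snd c else \<ominus> snd c)"
      unfolding sg_def by (simp add: lin_ext_e[OF P_module v])
  qed
qed

lemma sg_in_homog: "x \<in> homog P n \<Longrightarrow> sg x \<in> homog P n"
  by (simp add: sg_homog homog_minus)

lemma sg_sg: "x \<in> carrier P \<Longrightarrow> sg (sg x) = x"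
  by (rule homog_additive_eqI[OF is_abelian_group linear_map_additive[OF linear_map_comp[OF sg_lin sg_lin]]
        linear_map_additive[OF linear_map_id]])
    (auto simp: sg_homog sg_minus homog_minus homog_closed)

lemma diff_homog: "x \<in> homog P n \<Longrightarrow> diff P x \<in> homog P (n - 1)"
  using diff_homog_0 diff_homog_Suc homog_zero by (cases n) auto

lemma diff_sg:
  assumes "x \<in> carrier P"
  shows "diff P (sg x) = \<ominus> sg (diff P x)"
proof (rule homog_additive_eqI[OF is_abelian_group _ _ assms])
  show "additive_map P P (\<lambda>x. diff P (sg x))"
    by (rule linear_map_additive[OF linear_map_comp[OF sg_lin diff_lin]])
  show "additive_map P P (\<lambda>x. \<ominus> sg (diff P x))"
    by (rule linear_map_additive[OF linear_map_minus[OF linear_map_comp[OF diff_lin sg_lin]]])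
  fix n y assume y: "y \<in> homog P n"
  show "diff P (sg y) = \<ominus> sg (diff P y)"
  proof (cases n)
    case 0
    then show ?thesis using y diff_homog_0 sg_in_homog[OF y] by simp
  next
    case (Suc m)
    then show ?thesis using y diff_homog_Suc[of y m] homog_closed[OF y]
      by (auto simp: sg_homog[OF y] sg_homog[of "diff P y" m] diff_minus)
  qed
qed

lemma leibniz_sg:
  assumes x: "x \<in> carrier P" and y: "y \<in> carrier P"
  shows "diff P (x \<otimes> y) = diff P x \<otimes> y \<oplus> sg x \<otimes> diff P y"
proof (rule homog_additive_eqI[OF is_abelian_group _ _ x])
  show "additive_map P P (\<lambda>x. diff P (x \<otimes> y))"
    by (rule linear_map_additive[OF linear_map_comp[OF linear_map_mult_right[OF linear_map_id y] diff_lin]])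
  show "additive_map P P (\<lambda>x. diff P x \<otimes> y \<oplus> sg x \<otimes> diff P y)"
    by (intro linear_map_additive[where K = R] linear_map_add linear_map_mult_right diff_lin sg_lin y diff_closed)
  fix n z assume z: "z \<in> homog P n"
  show "diff P (z \<otimes> y) = diff P z \<otimes> y \<oplus> sg z \<otimes> diff P y"
    using leibniz[OF z y] homog_closed[OF z] y by (simp add: sg_homog[OF z] l_minus)
qed

subsection \<open>The augmentation\<close>

text \<open>\<open>S\<close> with \<open>R\<close> acting through the quotient map, recast as a
  module record because \<open>linear_map\<close> and \<open>lin_ext\<close> want a target over the
  same scalars as the source. \<open>RR\<close> does the same for \<open>R\<close>.\<close>

definition SR :: "('a, 'a set) module" where
  "SR = \<lparr>carrier = carrier S, monoid.mult = monoid.mult S, one = \<one>\<^bsub>S\<^esub>, ring.zero = \<zero>\<^bsub>S\<^esub>, add = add S,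
     smult = (\<lambda>r s. rc r \<otimes>\<^bsub>S\<^esub> s)\<rparr>"

definition RR :: "('a, 'a) module" where
  "RR = \<lparr>carrier = carrier R, monoid.mult = monoid.mult R, one = \<one>\<^bsub>R\<^esub>, ring.zero = \<zero>\<^bsub>R\<^esub>, add = add R,
     smult = monoid.mult R\<rparr>"

lemma S_cring: "cring S"
  by (rule I.quotient_is_cring[OF R.is_cring])

sublocale S: cring S
  by (rule S_cring)

lemma rc_hom: "rc \<in> ring_hom R S"
  by (rule I.rcos_ring_hom)

lemmas rc_closed [simp] = ring_hom_closed[OF rc_hom]

lemma SR_sel [simp]: "carrier SR = carrier S" "\<zero>\<^bsub>SR\<^esub> = \<zero>\<^bsub>S\<^esub>" "add SR = add S" "smult SR = (\<lambda>r s. rc r \<otimes>\<^bsub>S\<^esub> s)"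
  by (simp_all add: SR_def)

lemma RR_sel [simp]: "carrier RR = carrier R" "\<zero>\<^bsub>RR\<^esub> = \<zero>\<^bsub>R\<^esub>" "add RR = add R" "smult RR = monoid.mult R"
  by (simp_all add: RR_def)

lemma SR_module: "module R SR"
proof (rule moduleI[OF R.is_cring])
  show "abelian_group SR"
    by (rule abelian_groupI) (auto simp: S.a_ac intro: S.l_neg bexI[of _ "\<ominus>\<^bsub>S\<^esub> _"])
qed (simp_all add: ring_hom_add[OF rc_hom] ring_hom_mult[OF rc_hom] ring_hom_one[OF rc_hom]
    S.l_distr S.r_distr S.m_assoc)

lemma RR_module: "module R RR"
proof (rule moduleI[OF R.is_cring])
  show "abelian_group RR"
    by (rule abelian_groupI) (auto simp: R.a_ac intro: R.l_neg bexI[of _ "\<ominus>\<^bsub>R\<^esub> _"])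
qed (simp_all add: R.l_distr R.r_distr R.m_assoc)

lemma eps_lin: "linear_map R P SR \<epsilon>"
  by (intro linear_mapI additive_mapI)
    (simp_all add: augmentation_smult ring_hom_closed[OF augmentation_hom] ring_hom_add[OF augmentation_hom])

lemmas eps_closed [simp] = ring_hom_closed[OF augmentation_hom]
lemmas eps_add = ring_hom_add[OF augmentation_hom]
lemmas eps_mult = ring_hom_mult[OF augmentation_hom]

lemma eps_zero [simp]: "\<epsilon> \<zero> = \<zero>\<^bsub>S\<^esub>"
  using additive_zero[OF is_abelian_group module.axioms(2)[OF SR_module] linear_map_additive[OF eps_lin]] by simp

lemma eps_additive: "additive_map P S \<epsilon>"
  by (rule additive_mapI) (simp_all add: eps_add)

lemmas eps_minus = additive_minus[OF is_abelian_group S.is_abelian_group eps_additive]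

lemma eps_one: "\<epsilon> \<one> = \<one>\<^bsub>S\<^esub>"
  by (rule ring_hom_one[OF augmentation_hom])

text \<open>In degree 1 this is half of \<open>exact_0\<close>; in all other degrees the boundary is
  zero or of positive degree, where \<epsilon> vanishes.\<close>

lemma eps_diff [simp]:
  assumes "x \<in> carrier P"
  shows "\<epsilon> (diff P x) = \<zero>\<^bsub>S\<^esub>"
proof (rule homog_additive_eqI[OF S.is_abelian_group _ _ assms])
  show "additive_map P S (\<lambda>x. \<epsilon> (diff P x))" by (rule additive_mapI) (simp_all add: diff_add eps_add)
  show "additive_map P S (\<lambda>x. \<zero>\<^bsub>S\<^esub>)" by (rule additive_mapI) simp_all
  fix n y assume y: "y \<in> homog P n"
  consider "n = 0" | "n = 1" | m where "n = Suc (Suc m)" by (cases n; cases "n - 1") auto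
  then show "\<epsilon> (diff P y) = \<zero>\<^bsub>S\<^esub>"
  proof cases
    case 1 then show ?thesis using y diff_homog_0 by simp
  next
    case 2 then show ?thesis using y exact_0 by blast
  next
    case 3 then show ?thesis using y augmentation_pos[OF diff_homog_Suc] by simp
  qed
qed

text \<open>The sign is trivial in degree 0, and \<epsilon> vanishes in positive degrees.\<close>

lemma eps_sg:
  assumes "x \<in> carrier P"
  shows "\<epsilon> (sg x) = \<epsilon> x"
proof (rule homog_additive_eqI[OF S.is_abelian_group _ eps_additive assms])
  show "additive_map P S (\<lambda>x. \<epsilon> (sg x))" by (rule additive_mapI) (simp_all add: sg_add eps_add)
  fix n y assume y: "y \<in> homog P n"
  show "\<epsilon> (sg y) = \<epsilon> y"
    using y augmentation_pos sg_in_homog[OF y] sg_homog[OF y] by (cases n) auto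
qed

text \<open>\<open>P\<close> is free, so the augmentation lifts along the surjection from
  \<open>R\<close> to \<open>S\<close>. The lift substitutes for an identification of degree 0 with
  \<open>R\<close>; it is linear but in general not multiplicative.\<close>

lemma obtain_eps_lift:
  obtains \<mu> where "linear_map R P RR \<mu>" "\<And>x. x \<in> carrier P \<Longrightarrow> rc (\<mu> x) = \<epsilon> x"
proof -
  have "\<exists>r\<in>carrier R. rc r = s" if "s \<in> carrier S" for s
    using that by (auto simp: FactRing_def A_RCOSETS_def')
  then have "\<forall>c\<in>C. \<exists>r\<in>carrier R. rc r = \<epsilon> (snd c)"
    using e_closed by simp
  then obtain v where v: "\<And>c. c \<in> C \<Longrightarrow> v c \<in> carrier R" "\<And>c. c \<in> C \<Longrightarrow> rc (v c) = \<epsilon> (snd c)"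
    by metis
  then have vC: "v \<in> C \<rightarrow> carrier RR" by auto
  let ?\<mu> = "lin_ext RR v"
  have lin: "linear_map R P RR ?\<mu>" by (rule lin_ext_linear[OF RR_module vC])
  have rc: "linear_map R RR SR rc"
    by (intro linear_mapI additive_mapI) (simp_all add: ring_hom_add[OF rc_hom] ring_hom_mult[OF rc_hom])
  have "rc (?\<mu> x) = \<epsilon> x" if "x \<in> carrier P" for x
  proof (rule linear_eqI[OF SR_module linear_map_comp[OF lin rc] eps_lin that])
    fix c assume "c \<in> supp x"
    then have "c \<in> C" using supp_subset by auto
    then show "rc (?\<mu> (snd c)) = \<epsilon> (snd c)" by (simp add: lin_ext_e[OF RR_module vC] v)
  qed
  then show ?thesis using lin that by blast
qed

lemma eps_preimage: "s \<in> carrier S \<Longrightarrow> \<exists>p\<in>homog P 0. \<epsilon> p = s"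
  using augmentation_surj by (metis imageE)

lemma exact_pos: "\<lbrakk>x \<in> homog P (Suc n); diff P x = \<zero>\<rbrakk> \<Longrightarrow> \<exists>p\<in>homog P (Suc (Suc n)). diff P p = x"
  using exact_Suc[of n] by (metis (mono_tags, lifting) imageE mem_Collect_eq)

lemma exact_aug: "\<lbrakk>x \<in> homog P 0; \<epsilon> x = \<zero>\<^bsub>S\<^esub>\<rbrakk> \<Longrightarrow> \<exists>p\<in>homog P 1. diff P p = x"
  using exact_0 by (metis (mono_tags, lifting) imageE mem_Collect_eq)

end

text \<open>\<psi> is an \<open>R\<close>-linear functional from \<open>I\<close> to
  \<open>R/I\<close>. By \<open>\<psi>_smult\<close> it kills products of two elements of
  \<open>I\<close>, so it amounts to a functional on the conormal module.\<close>

locale functional_resolution = coord_resolution R P I \<epsilon> C \<kappa>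
  for R :: "('a, 'm) ring_scheme" and P :: "('a, 'p, 'n) dg_algebra_scheme" (structure)
    and I :: "'a set" and \<epsilon> :: "'p \<Rightarrow> 'a set" and C :: "(nat \<times> 'p) set" and \<kappa> +
  fixes \<psi> :: "'a \<Rightarrow> 'a set" and \<mu> :: "'p \<Rightarrow> 'a"
  assumes \<psi>_closed [simp]: "a \<in> I \<Longrightarrow> \<psi> a \<in> carrier S"
    and \<psi>_add: "\<lbrakk>a \<in> I; b \<in> I\<rbrakk> \<Longrightarrow> \<psi> (a \<oplus>\<^bsub>R\<^esub> b) = \<psi> a \<oplus>\<^bsub>S\<^esub> \<psi> b"
    and \<psi>_smult: "\<lbrakk>r \<in> carrier R; a \<in> I\<rbrakk> \<Longrightarrow> \<psi> (r \<otimes>\<^bsub>R\<^esub> a) = rc r \<otimes>\<^bsub>S\<^esub> \<psi> a"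
    and \<mu>_lin: "linear_map R P RR \<mu>"
    and rc_\<mu>: "x \<in> carrier P \<Longrightarrow> rc (\<mu> x) = \<epsilon> x"
begin

lemma \<mu>_closed [simp]: "x \<in> carrier P \<Longrightarrow> \<mu> x \<in> carrier R"
  using additive_closed[OF linear_map_additive[OF \<mu>_lin]] by simp

lemma \<mu>_add: "\<lbrakk>x \<in> carrier P; y \<in> carrier P\<rbrakk> \<Longrightarrow> \<mu> (x \<oplus> y) = \<mu> x \<oplus>\<^bsub>R\<^esub> \<mu> y"
  using additive_add[OF linear_map_additive[OF \<mu>_lin]] by simp

lemma \<mu>_smult: "\<lbrakk>r \<in> carrier R; x \<in> carrier P\<rbrakk> \<Longrightarrow> \<mu> (r \<odot> x) = r \<otimes>\<^bsub>R\<^esub> \<mu> x"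
  using linear_map_smult[OF \<mu>_lin] by simp

lemma rc_zero_iff: "r \<in> carrier R \<Longrightarrow> rc r = \<zero>\<^bsub>S\<^esub> \<longleftrightarrow> r \<in> I"
  using I.a_rcos_const I.a_rcos_self by (auto simp: FactRing_def)

lemma \<mu>_I: "\<lbrakk>x \<in> carrier P; \<epsilon> x = \<zero>\<^bsub>S\<^esub>\<rbrakk> \<Longrightarrow> \<mu> x \<in> I"
  using rc_zero_iff[of "\<mu> x"] rc_\<mu>[of x] by simp

lemma \<psi>_zero: "\<psi> \<zero>\<^bsub>R\<^esub> = \<zero>\<^bsub>S\<^esub>"
proof -
  have "\<zero>\<^bsub>R\<^esub> \<in> I" by (rule I.zero_closed)
  then have "\<psi> \<zero>\<^bsub>R\<^esub> \<oplus>\<^bsub>S\<^esub> \<psi> \<zero>\<^bsub>R\<^esub> = \<psi> \<zero>\<^bsub>R\<^esub>" "\<psi> \<zero>\<^bsub>R\<^esub> \<in> carrier S"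
    using \<psi>_add[of "\<zero>\<^bsub>R\<^esub>" "\<zero>\<^bsub>R\<^esub>"] by simp_all
  then show ?thesis by (metis S.add.r_cancel_one)
qed

text \<open>The functional that the lowering map has to induce: \<mu> takes boundaries into
  \<open>I\<close> because \<epsilon> kills them, so \<psi> can be applied.\<close>

definition \<phi> :: "'p \<Rightarrow> 'a set" where
  "\<phi> x = \<psi> (\<mu> (diff P x))"

lemma \<mu>_diff_I [simp]: "x \<in> carrier P \<Longrightarrow> \<mu> (diff P x) \<in> I"
  by (rule \<mu>_I) simp_all

lemma \<phi>_lin: "linear_map R P SR \<phi>"
  by (intro linear_mapI additive_mapI)
    (simp_all add: \<phi>_def diff_add \<mu>_add \<psi>_add diff_smult \<mu>_smult \<psi>_smult)

lemma \<phi>_diff: "x \<in> carrier P \<Longrightarrow> \<phi> (diff P x) = \<zero>\<^bsub>S\<^esub>"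
  using linear_map_smult[OF \<mu>_lin, of "\<zero>\<^bsub>R\<^esub>" \<zero>] by (simp add: \<phi>_def diff_diff \<psi>_zero)

lemma \<phi>_closed [simp]: "x \<in> carrier P \<Longrightarrow> \<phi> x \<in> carrier S"
  by (simp add: \<phi>_def)

text \<open>Since \<open>\<mu> 1\<close> is congruent to \<open>1\<close> modulo \<open>I\<close>, the functional \<open>\<psi> \<circ> \<mu>\<close> extends \<open>\<psi>\<close>.\<close>

lemma \<phi>_eq:
  assumes "x \<in> carrier P" "a \<in> I" "diff P x = a \<odot> \<one>"
  shows "\<phi> x = \<psi> a"
proof -
  have a: "a \<in> carrier R" using assms(2) by (rule I.Icarr)
  have "\<mu> (diff P x) = \<mu> \<one> \<otimes>\<^bsub>R\<^esub> a"
    using assms(3) a by (simp add: \<mu>_smult R.m_comm)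
  then have "\<phi> x = rc (\<mu> \<one>) \<otimes>\<^bsub>S\<^esub> \<psi> a"
    by (simp add: \<phi>_def \<psi>_smult assms(2))
  then show ?thesis using assms(2) by (simp add: rc_\<mu> eps_one)
qed

text \<open>As in the comparison theorem for resolutions, \<theta> is chosen on basis elements by
  recursion on degree. For a basis element of degree at least 2, minus \<theta> of its boundary is
  again a cycle by the anticommutation already known in lower degrees (in degree 2: it lies in the
  kernel of \<epsilon>, because \<phi> kills boundaries), so exactness provides a value.\<close>

lemma degree_lowering_exists:
  obtains \<theta> where "lin \<theta>" "\<And>x. x \<in> homog P 0 \<Longrightarrow> \<theta> x = \<zero>" "\<And>n x. x \<in> homog P (Suc n) \<Longrightarrow> \<theta> x \<in> homog P n"
    "\<And>x. x \<in> homog P 1 \<Longrightarrow> \<epsilon> (\<theta> x) = \<phi> x" "\<And>x. x \<in> carrier P \<Longrightarrow> diff P (\<theta> x) = \<ominus> \<theta> (diff P x)"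
proof -
  \<comment> \<open>The choice cut off below degree \<open>n\<close> and extended by zero. The
    requirement on the value at \<open>c\<close> then refers to earlier values only.\<close>
  define lo where "lo f n = (\<lambda>d. if d \<in> C \<and> fst d < n then f d else \<zero>)" for f :: "nat \<times> 'p \<Rightarrow> 'p" and n
  \<comment> \<open>Degree 0 forces the value zero, degree 1 prescribes only the augmentation, and
    from degree 2 on the value must bound minus the image of the boundary.\<close>
  define good where "good f c p \<longleftrightarrow> p \<in> carrier P \<and> (fst c = 0 \<longrightarrow> p = \<zero>) \<and>
    (\<forall>n. fst c = Suc n \<longrightarrow> p \<in> homog P n) \<and> (fst c = 1 \<longrightarrow> \<epsilon> p = \<phi> (snd c)) \<and>
    (fst c \<ge> 2 \<longrightarrow> diff P p = \<ominus> lin_ext P (lo f (fst c)) (diff P (snd c)))" for f c p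
  have "\<exists>f. \<forall>c. c \<in> C \<longrightarrow> good f c (f c)"
  \<comment> \<open>Recursive choice along the degree. The first obligation says that
    \<open>good\<close> looks at the choice only below the degree of \<open>c\<close>; the second
    produces a value there.\<close>
  proof (rule dependent_wf_choice[OF wf_measure[of fst]])
    fix f g :: "nat \<times> 'p \<Rightarrow> 'p" and c r
    assume "\<And>z. (z, c) \<in> measure fst \<Longrightarrow> f z = g z"
    then have "lo f (fst c) = lo g (fst c)" by (auto simp: lo_def)
    then show "(c \<in> C \<longrightarrow> good f c r) = (c \<in> C \<longrightarrow> good g c r)" by (simp add: good_def)
  next
    fix c f
    assume IH: "\<And>d. (d, c) \<in> measure fst \<Longrightarrow> d \<in> C \<longrightarrow> good f d (f d)"
    show "\<exists>r. c \<in> C \<longrightarrow> good f c r"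
    proof (cases "c \<in> C")
      case True
      let ?x = "snd c"
      let ?v = "lo f (fst c)"
      let ?u = "lin_ext P ?v"
      have x: "?x \<in> homog P (fst c)" "?x \<in> carrier P" using e_homog[OF True] homog_closed by auto
      have good: "good f d (f d)" if "d \<in> C" "fst d < fst c" for d
        using IH[of d] that by simp
      have v: "?v \<in> C \<rightarrow> carrier P" using good by (auto simp: lo_def good_def)
      have u_lin: "lin ?u" by (rule lin_ext_linear[OF P_module v])
      have u_closed: "?u y \<in> carrier P" if "y \<in> carrier P" for y by (rule lin_ext_closed[OF P_module v that])
      have u_e: "?u (snd d) = f d" if "d \<in> C" "fst d < fst c" for d
        unfolding lin_ext_e[OF P_module v that(1)] using that by (simp add: lo_def)
      \<comment> \<open>The requirement at \<open>d\<close> uses the cut-off at the degree of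
        \<open>d\<close>, while \<open>?u\<close> uses the one at \<open>c\<close>. They agree on
        the boundary of \<open>snd d\<close>, which is supported one degree below
        \<open>d\<close>.\<close>
      have u_lower: "lin_ext P (lo f (fst d)) (diff P (snd d)) = ?u (diff P (snd d))"
        if "d \<in> C" "fst d < fst c" "fst d \<ge> 1" for d
      proof (rule lin_ext_cong[OF P_module v])
        show "diff P (snd d) \<in> carrier P" using e_closed[OF that(1)] by simp
        fix d' assume d': "d' \<in> supp (diff P (snd d))"
        have "fst d' = fst d - 1" using supp_homog[OF diff_homog[OF e_homog[OF that(1)]] d'] .
        then show "lo f (fst d) d' = ?v d'" using that by (auto simp: lo_def)
      qed
      consider "fst c = 0" | "fst c = 1" | n where "fst c = Suc (Suc n)"
        by (cases "fst c"; cases "fst c - 1") auto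
      then have "\<exists>r. good f c r"
      proof cases
        case 1
        then show ?thesis by (intro exI[of _ \<zero>]) (simp add: good_def)
      next
        case 2
        obtain p where "p \<in> homog P 0" "\<epsilon> p = \<phi> ?x"
          using eps_preimage[OF \<phi>_closed[OF x(2)]] by auto
        then show ?thesis using 2 homog_closed by (intro exI[of _ p]) (auto simp: good_def)
      next
        case (3 n)
        define z where "z = diff P ?x"
        have z: "z \<in> homog P (Suc n)" "z \<in> carrier P" "diff P z = \<zero>"
          using x diff_homog_Suc[of ?x "Suc n"] 3 by (auto simp: z_def diff_diff)
        have sz: "d \<in> C \<and> fst d = Suc n" if "d \<in> supp z" for d
          using that supp_subset supp_homog[OF z(1)] by auto
        have y: "?u z \<in> homog P n"
        proof (rule lin_ext_submodule[OF homog_submodule z(2)])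
          fix d assume "d \<in> supp z"
          then show "?v d \<in> homog P n" using sz[of d] good[of d] 3 by (auto simp: lo_def good_def)
        qed
        \<comment> \<open>The obstruction step. For \<open>n = 0\<close> exactness needs the
          augmentation of the right-hand side to vanish, otherwise its boundary.\<close>
        have "\<exists>p\<in>homog P (Suc n). diff P p = \<ominus> ?u z"
        proof (cases n)
          case 0
          have "\<epsilon> (?u z) = \<phi> z"
          proof (rule linear_eqI[OF SR_module linear_map_comp[OF u_lin eps_lin] \<phi>_lin z(2)])
            fix d assume "d \<in> supp z"
            then have d: "d \<in> C" "fst d = Suc n" using sz by auto
            then show "\<epsilon> (?u (snd d)) = \<phi> (snd d)" using good[of d] u_e[of d] 3 0 by (simp add: good_def)
          qed
          then have "\<epsilon> (\<ominus> ?u z) = \<zero>\<^bsub>S\<^esub>"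
            using \<phi>_diff[OF x(2)] u_closed[OF z(2)] by (simp add: z_def eps_minus)
          then show ?thesis using exact_aug[of "\<ominus> ?u z"] homog_minus[OF y] 0 by simp
        next
          case (Suc m)
          have "diff P (?u z) = \<ominus> ?u (diff P z)"
          proof (rule linear_eqI[OF P_module linear_map_comp[OF u_lin diff_lin]
                linear_map_minus[OF linear_map_comp[OF diff_lin u_lin]] z(2)])
            fix d assume "d \<in> supp z"
            then have d: "d \<in> C" "fst d = Suc n" using sz by auto
            then show "diff P (?u (snd d)) = \<ominus> ?u (diff P (snd d))"
              using good[of d] u_e[of d] u_lower[of d] 3 Suc by (simp add: good_def)
          qed
          then have "diff P (\<ominus> ?u z) = \<zero>"
            using z(3) u_closed[OF z(2)] additive_zero[OF is_abelian_group is_abelian_group linear_map_additive[OF u_lin]]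
            by (simp add: diff_minus)
          then show ?thesis using exact_pos[of "\<ominus> ?u z" m] homog_minus[OF y] Suc by simp
        qed
        then obtain p where "p \<in> homog P (Suc n)" "diff P p = \<ominus> ?u z" by auto
        then show ?thesis using 3 homog_closed by (intro exI[of _ p]) (auto simp: good_def z_def)
      qed
      then show ?thesis by auto
    qed auto
  qed
  then obtain f where f: "\<And>c. c \<in> C \<Longrightarrow> good f c (f c)" by auto
  define \<theta> where "\<theta> = lin_ext P f"
  have v: "f \<in> C \<rightarrow> carrier P" using f by (auto simp: good_def)
  have lin: "lin \<theta>" unfolding \<theta>_def by (rule lin_ext_linear[OF P_module v])
  note \<theta>_additive = linear_map_additive[OF lin]
  note \<theta>_zero = additive_zero[OF is_abelian_group is_abelian_group \<theta>_additive]
  have \<theta>_e: "\<theta> (snd c) = f c" if "c \<in> C" for c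
    unfolding \<theta>_def by (rule lin_ext_e[OF P_module v that])
  have zero: "\<theta> x = \<zero>" if x: "x \<in> homog P 0" for x
  proof (rule linear_eqI[OF P_module lin _ homog_closed[OF x]])
    show "lin (\<lambda>x. \<zero>)" by (intro linear_mapI additive_mapI) simp_all
    fix c assume "c \<in> supp x"
    then have "c \<in> C" "fst c = 0" using supp_subset supp_homog[OF x] by auto
    then show "\<theta> (snd c) = \<zero>" using f[of c] by (simp add: \<theta>_e good_def)
  qed
  have Suc: "\<theta> x \<in> homog P n" if x: "x \<in> homog P (Suc n)" for n x
    unfolding \<theta>_def
  proof (rule lin_ext_submodule[OF homog_submodule homog_closed[OF x]])
    fix c assume "c \<in> supp x"
    then have "c \<in> C" "fst c = Suc n" using supp_subset supp_homog[OF x] by auto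
    then show "f c \<in> homog P n" using f[of c] by (simp add: good_def)
  qed
  have one: "\<epsilon> (\<theta> x) = \<phi> x" if x: "x \<in> homog P 1" for x
  proof (rule linear_eqI[OF SR_module linear_map_comp[OF lin eps_lin] \<phi>_lin homog_closed[OF x]])
    fix c assume "c \<in> supp x"
    then have "c \<in> C" "fst c = 1" using supp_subset supp_homog[OF x] by auto
    then show "\<epsilon> (\<theta> (snd c)) = \<phi> (snd c)" using f[of c] by (simp add: \<theta>_e good_def)
  qed
  have diff: "diff P (\<theta> x) = \<ominus> \<theta> (diff P x)" if x: "x \<in> carrier P" for x
  proof (rule linear_eqI[OF P_module linear_map_comp[OF lin diff_lin]
        linear_map_minus[OF linear_map_comp[OF diff_lin lin]] x])
    fix c assume "c \<in> supp x"
    then have c: "c \<in> C" using supp_subset by auto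
    note ec = e_homog[OF c] homog_closed[OF e_homog[OF c]]
    consider "fst c = 0" | "fst c = 1" | "fst c \<ge> 2" by linarith
    then show "diff P (\<theta> (snd c)) = \<ominus> \<theta> (diff P (snd c))"
    proof cases
      case 1
      then show ?thesis using ec zero[of "snd c"] diff_homog_0[of "snd c"] by (simp add: \<theta>_zero)
    next
      case 2
      then have "\<theta> (snd c) \<in> homog P 0" "diff P (snd c) \<in> homog P 0"
        using ec Suc[of "snd c" 0] diff_homog_Suc[of "snd c" 0] by simp_all
      then show ?thesis using zero diff_homog_0 by simp
    next
      case 3
      have "lin_ext P (lo f (fst c)) (diff P (snd c)) = \<theta> (diff P (snd c))"
        unfolding \<theta>_def
      proof (rule lin_ext_cong[OF P_module v])
        show "diff P (snd c) \<in> carrier P" using ec by simp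
        fix d assume d: "d \<in> supp (diff P (snd c))"
        have "fst d = fst c - 1" "d \<in> C" using supp_homog[OF diff_homog[OF ec(1)] d] d supp_subset by auto
        then show "lo f (fst c) d = f d" using 3 by (simp add: lo_def)
      qed
      then show ?thesis using f[OF c] 3 by (simp add: \<theta>_e[OF c] good_def)
    qed
  qed
  from that[OF lin zero Suc one diff] show thesis .
qed

end

subsection \<open>Failure of the Leibniz rule is null-homotopic\<close>

context coord_resolution
begin

definition bilinear :: "('a, 'q, 'l) module_scheme \<Rightarrow> ('p \<Rightarrow> 'p \<Rightarrow> 'q) \<Rightarrow> bool" where
  "bilinear N \<beta> \<longleftrightarrow> (\<forall>y\<in>carrier P. linear_map R P N (\<lambda>x. \<beta> x y)) \<and> (\<forall>x\<in>carrier P. linear_map R P N (\<beta> x))"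

lemma bilinear_left: "\<lbrakk>bilinear N \<beta>; y \<in> carrier P\<rbrakk> \<Longrightarrow> linear_map R P N (\<lambda>x. \<beta> x y)"
  and bilinear_right: "\<lbrakk>bilinear N \<beta>; x \<in> carrier P\<rbrakk> \<Longrightarrow> linear_map R P N (\<beta> x)"
  by (simp_all add: bilinear_def)

lemma bilinear_closed: "\<lbrakk>bilinear N \<beta>; x \<in> carrier P; y \<in> carrier P\<rbrakk> \<Longrightarrow> \<beta> x y \<in> carrier N"
  by (rule additive_closed[OF linear_map_additive[OF bilinear_right]])

lemma bilinear_zero:
  assumes N: "module R N" and b: "bilinear N \<beta>" and x: "x \<in> carrier P"
  shows "\<beta> \<zero> x = \<zero>\<^bsub>N\<^esub>" "\<beta> x \<zero> = \<zero>\<^bsub>N\<^esub>"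
  using additive_zero[OF is_abelian_group module.axioms(2)[OF N] linear_map_additive[OF bilinear_left[OF b x]]]
    additive_zero[OF is_abelian_group module.axioms(2)[OF N] linear_map_additive[OF bilinear_right[OF b x]]]
  by simp_all

lemma bilinear_minus:
  assumes N: "module R N" and b: "bilinear N \<beta>" and x: "x \<in> carrier P" "y \<in> carrier P"
  shows "\<beta> (\<ominus> y) x = \<ominus>\<^bsub>N\<^esub> \<beta> y x" "\<beta> x (\<ominus> y) = \<ominus>\<^bsub>N\<^esub> \<beta> x y"
  using additive_minus[OF is_abelian_group module.axioms(2)[OF N] linear_map_additive[OF bilinear_left[OF b x(1)]] x(2)]
    additive_minus[OF is_abelian_group module.axioms(2)[OF N] linear_map_additive[OF bilinear_right[OF b x(1)]] x(2)]
  by simp_all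

lemma bilinear_comp:
  assumes "bilinear N \<beta>" "lin u" "lin v"
  shows "bilinear N (\<lambda>x y. \<beta> (u x) (v y))"
  unfolding bilinear_def
proof (intro conjI ballI)
  fix y assume "y \<in> carrier P"
  then have "v y \<in> carrier P" by (rule additive_closed[OF linear_map_additive[OF assms(3)]])
  from linear_map_comp[OF assms(2) bilinear_left[OF assms(1) this]]
  show "linear_map R P N (\<lambda>x. \<beta> (u x) (v y))" .
next
  fix x assume "x \<in> carrier P"
  then have "u x \<in> carrier P" by (rule additive_closed[OF linear_map_additive[OF assms(2)]])
  from linear_map_comp[OF assms(3) bilinear_right[OF assms(1) this]]
  show "linear_map R P N (\<lambda>y. \<beta> (u x) (v y))" .
qed

lemma bilinear_post: "\<lbrakk>bilinear N \<beta>; linear_map R N L w\<rbrakk> \<Longrightarrow> bilinear L (\<lambda>x y. w (\<beta> x y))"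
  by (auto simp: bilinear_def intro: linear_map_comp)

lemma bilinear_add: "\<lbrakk>bilinear P \<beta>; bilinear P \<gamma>\<rbrakk> \<Longrightarrow> bilinear P (\<lambda>x y. \<beta> x y \<oplus> \<gamma> x y)"
  by (auto simp: bilinear_def intro: linear_map_add)

lemma bilinear_diff: "\<lbrakk>bilinear P \<beta>; bilinear P \<gamma>\<rbrakk> \<Longrightarrow> bilinear P (\<lambda>x y. \<beta> x y \<ominus> \<gamma> x y)"
  by (auto simp: bilinear_def intro: linear_map_diff)

lemma bilinear_mult: "bilinear P (\<lambda>x y. x \<otimes> y)"
  unfolding bilinear_def
  using linear_map_mult_left[OF linear_map_id] linear_map_mult_right[OF linear_map_id] by blast

lemma bilinear_eqI:
  assumes N: "module R N" and b: "bilinear N \<beta>" and g: "bilinear N \<gamma>"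
    and x: "x \<in> carrier P" and y: "y \<in> carrier P"
    and eq: "\<And>c d. \<lbrakk>c \<in> C; d \<in> C; c \<in> supp x; d \<in> supp y\<rbrakk> \<Longrightarrow> \<beta> (snd c) (snd d) = \<gamma> (snd c) (snd d)"
  shows "\<beta> x y = \<gamma> x y"
proof (rule linear_eqI[OF N bilinear_left[OF b y] bilinear_left[OF g y] x])
  fix c assume c: "c \<in> supp x"
  then have cC: "c \<in> C" using supp_subset by auto
  show "\<beta> (snd c) y = \<gamma> (snd c) y"
    by (rule linear_eqI[OF N bilinear_right[OF b e_closed[OF cC]] bilinear_right[OF g e_closed[OF cC]] y])
      (rule eq, use cC c supp_subset in auto)
qed

text \<open>The bilinear map with value \<open>f c d\<close> at a pair of basis elements; it plays
  the part of linear extension from the induced basis of \<open>P \<otimes> P\<close>.\<close>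

definition bi_ext :: "(nat \<times> 'p \<Rightarrow> nat \<times> 'p \<Rightarrow> 'p) \<Rightarrow> 'p \<Rightarrow> 'p \<Rightarrow> 'p" where
  "bi_ext f x y = lin_ext P (\<lambda>c. lin_ext P (f c) y) x"

lemma lin_ext_fun_add:
  assumes "v \<in> C \<rightarrow> carrier P" "w \<in> C \<rightarrow> carrier P" "x \<in> carrier P"
  shows "lin_ext P (\<lambda>c. v c \<oplus> w c) x = lin_ext P v x \<oplus> lin_ext P w x"
proof -
  have cl: "\<kappa> c x \<odot> v c \<in> carrier P \<and> \<kappa> c x \<odot> w c \<in> carrier P" if "c \<in> supp x" for c
    using that assms supp_subset[of x] by (auto intro!: smult_closed \<kappa>_closed)
  have "finsum P (\<lambda>c. \<kappa> c x \<odot> (v c \<oplus> w c)) (supp x) = finsum P (\<lambda>c. \<kappa> c x \<odot> v c \<oplus> \<kappa> c x \<odot> w c) (supp x)"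
  proof (rule finsum_cong'[OF refl])
    fix c assume "c \<in> supp x"
    then have "c \<in> C" using supp_subset by auto
    then show "\<kappa> c x \<odot> (v c \<oplus> w c) = \<kappa> c x \<odot> v c \<oplus> \<kappa> c x \<odot> w c"
      using assms by (intro smult_r_distr \<kappa>_closed) auto
  qed (use cl in auto)
  also have "\<dots> = finsum P (\<lambda>c. \<kappa> c x \<odot> v c) (supp x) \<oplus> finsum P (\<lambda>c. \<kappa> c x \<odot> w c) (supp x)"
    using cl by (intro finsum_addf) auto
  finally show ?thesis by (simp add: lin_ext_def)
qed

lemma lin_ext_fun_smult:
  assumes "v \<in> C \<rightarrow> carrier P" "k \<in> carrier R" "x \<in> carrier P"
  shows "lin_ext P (\<lambda>c. k \<odot> v c) x = k \<odot> lin_ext P v x"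
proof -
  have cl: "\<kappa> c x \<odot> v c \<in> carrier P" if "c \<in> supp x" for c
    using that assms supp_subset[of x] by (auto intro!: smult_closed \<kappa>_closed)
  have "finsum P (\<lambda>c. \<kappa> c x \<odot> (k \<odot> v c)) (supp x) = finsum P (\<lambda>c. k \<odot> (\<kappa> c x \<odot> v c)) (supp x)"
  proof (rule finsum_cong'[OF refl])
    fix c assume "c \<in> supp x"
    then have "c \<in> C" using supp_subset by auto
    then have "v c \<in> carrier P" "\<kappa> c x \<in> carrier R" using assms by (auto intro: \<kappa>_closed)
    then show "\<kappa> c x \<odot> (k \<odot> v c) = k \<odot> (\<kappa> c x \<odot> v c)"
      using assms(2) by (simp add: smult_assoc1[symmetric] R.m_comm)
  qed (use cl assms(2) in auto)
  also have "\<dots> = k \<odot> finsum P (\<lambda>c. \<kappa> c x \<odot> v c) (supp x)"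
  proof -
    have "additive_map P P (\<lambda>y. k \<odot> y)" using assms(2) by (intro additive_mapI) (simp_all add: smult_r_distr)
    from additive_finsum[OF is_abelian_group is_abelian_group this, of "\<lambda>c. \<kappa> c x \<odot> v c" "supp x"] cl
    show ?thesis by auto
  qed
  finally show ?thesis by (simp add: lin_ext_def)
qed

lemma bi_ext_bilinear:
  assumes f: "\<And>c d. \<lbrakk>c \<in> C; d \<in> C\<rbrakk> \<Longrightarrow> f c d \<in> carrier P"
  shows "bilinear P (bi_ext f)"
proof -
  have fc: "f c \<in> C \<rightarrow> carrier P" if "c \<in> C" for c using f that by auto
  note inner = lin_ext_linear[OF P_module fc]
  have icl: "(\<lambda>c. lin_ext P (f c) y) \<in> C \<rightarrow> carrier P" if "y \<in> carrier P" for y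
    using lin_ext_closed[OF P_module fc that] by auto
  show ?thesis
    unfolding bilinear_def
  proof (intro conjI ballI)
    fix y assume y: "y \<in> carrier P"
    show "lin (\<lambda>x. bi_ext f x y)"
      unfolding bi_ext_def by (rule lin_ext_linear[OF P_module icl[OF y]])
  next
    fix x assume x: "x \<in> carrier P"
    show "lin (bi_ext f x)"
    proof (intro linear_mapI additive_mapI)
      show "bi_ext f x y \<in> carrier P" if "y \<in> carrier P" for y
        unfolding bi_ext_def by (rule lin_ext_closed[OF P_module icl[OF that] x])
      show "bi_ext f x (y \<oplus> y') = bi_ext f x y \<oplus> bi_ext f x y'" if y: "y \<in> carrier P" "y' \<in> carrier P" for y y'
      proof -
        have "bi_ext f x (y \<oplus> y') = lin_ext P (\<lambda>c. lin_ext P (f c) y \<oplus> lin_ext P (f c) y') x"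
          unfolding bi_ext_def
        proof (rule lin_ext_cong[OF P_module _ x])
          fix c assume "c \<in> supp x"
          then have "c \<in> C" using supp_subset by auto
          then show "lin_ext P (f c) (y \<oplus> y') = lin_ext P (f c) y \<oplus> lin_ext P (f c) y'"
            by (intro additive_add[OF linear_map_additive[OF inner]] y)
        qed (use icl[OF y(1)] icl[OF y(2)] in auto)
        then show ?thesis unfolding bi_ext_def by (simp add: lin_ext_fun_add[OF icl[OF y(1)] icl[OF y(2)] x])
      qed
      show "bi_ext f x (k \<odot> y) = k \<odot> bi_ext f x y" if k: "k \<in> carrier R" and y: "y \<in> carrier P" for k y
      proof -
        have "bi_ext f x (k \<odot> y) = lin_ext P (\<lambda>c. k \<odot> lin_ext P (f c) y) x"
          unfolding bi_ext_def
        proof (rule lin_ext_cong[OF P_module _ x])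
          fix c assume "c \<in> supp x"
          then have "c \<in> C" using supp_subset by auto
          then show "lin_ext P (f c) (k \<odot> y) = k \<odot> lin_ext P (f c) y"
            by (intro linear_map_smult[OF inner] k y)
        qed (use icl[OF y] k in auto)
        then show ?thesis unfolding bi_ext_def by (simp add: lin_ext_fun_smult[OF icl[OF y] k x])
      qed
    qed
  qed
qed

lemma bi_ext_e:
  assumes f: "\<And>c d. \<lbrakk>c \<in> C; d \<in> C\<rbrakk> \<Longrightarrow> f c d \<in> carrier P" and "c \<in> C" "d \<in> C"
  shows "bi_ext f (snd c) (snd d) = f c d"
proof -
  have fc: "f c \<in> C \<rightarrow> carrier P" if "c \<in> C" for c using f that by auto
  have "(\<lambda>c. lin_ext P (f c) (snd d)) \<in> C \<rightarrow> carrier P"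
    using lin_ext_closed[OF P_module fc e_closed[OF assms(3)]] by auto
  then show ?thesis
    unfolding bi_ext_def using assms(2,3) fc by (simp add: lin_ext_e[OF P_module])
qed

lemma bi_ext_cong:
  assumes f: "\<And>c d. \<lbrakk>c \<in> C; d \<in> C\<rbrakk> \<Longrightarrow> f c d \<in> carrier P" and g: "\<And>c d. \<lbrakk>c \<in> C; d \<in> C\<rbrakk> \<Longrightarrow> g c d \<in> carrier P"
    and x: "x \<in> carrier P" and y: "y \<in> carrier P"
    and eq: "\<And>c d. \<lbrakk>c \<in> C; d \<in> C; c \<in> supp x; d \<in> supp y\<rbrakk> \<Longrightarrow> f c d = g c d"
  shows "bi_ext f x y = bi_ext g x y"
  by (rule bilinear_eqI[OF P_module bi_ext_bilinear[of f, OF f] bi_ext_bilinear[of g, OF g] x y])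
    (simp_all add: bi_ext_e[of f, OF f] bi_ext_e[of g, OF g] eq)

lemma bi_ext_submodule:
  assumes U: "submodule U R P" and x: "x \<in> carrier P" and y: "y \<in> carrier P"
    and f: "\<And>c d. \<lbrakk>c \<in> C; d \<in> C; c \<in> supp x; d \<in> supp y\<rbrakk> \<Longrightarrow> f c d \<in> U"
  shows "bi_ext f x y \<in> U"
  unfolding bi_ext_def
  by (intro lin_ext_submodule[OF U] x y f) (use supp_subset in auto)

end

text \<open>The regrouping behind \<open>diff_defect\<close>, stated for plain variables so that
  \<open>algebra\<close> meets atoms in place of composite terms.\<close>

lemma (in ring) leibniz_defect_cancel:
  assumes "a \<in> carrier R" "b \<in> carrier R" "c \<in> carrier R" "d \<in> carrier R" "f \<in> carrier R" "g \<in> carrier R"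
  shows "\<ominus> (a \<oplus> b) \<ominus> (\<ominus> c \<oplus> \<ominus> f) \<ominus> (\<ominus> d \<oplus> \<ominus> g) = \<ominus> (a \<ominus> c \<ominus> d) \<ominus> (b \<ominus> f \<ominus> g)"
  using assms by algebra

locale derivation_data = functional_resolution R P I \<epsilon> C \<kappa> \<psi> \<mu>
  for R :: "('a, 'm) ring_scheme" and P :: "('a, 'p, 'n) dg_algebra_scheme" (structure)
    and I :: "'a set" and \<epsilon> :: "'p \<Rightarrow> 'a set" and C :: "(nat \<times> 'p) set" and \<kappa> \<psi> \<mu> +
  fixes \<theta> :: "'p \<Rightarrow> 'p"
  assumes \<theta>_lin: "lin \<theta>" and \<theta>_0: "x \<in> homog P 0 \<Longrightarrow> \<theta> x = \<zero>"
    and \<theta>_Suc: "x \<in> homog P (Suc n) \<Longrightarrow> \<theta> x \<in> homog P n"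
    and eps_\<theta>: "x \<in> homog P 1 \<Longrightarrow> \<epsilon> (\<theta> x) = \<phi> x"
    and diff_\<theta>: "x \<in> carrier P \<Longrightarrow> diff P (\<theta> x) = \<ominus> \<theta> (diff P x)"
begin

lemmas \<theta>_additive = linear_map_additive[OF \<theta>_lin]
lemmas \<theta>_closed [simp] = additive_closed[OF \<theta>_additive]
lemmas \<theta>_minus = additive_minus[OF is_abelian_group is_abelian_group \<theta>_additive]

lemma \<theta>_homog: "x \<in> homog P n \<Longrightarrow> \<theta> x \<in> homog P (n - 1)"
  using \<theta>_0 \<theta>_Suc homog_zero by (cases n) auto

text \<open>\<theta> lowers the degree by one and so changes parity; on degree 0 both sides
  vanish.\<close>

lemma \<theta>_sg:
  assumes "x \<in> carrier P"
  shows "\<theta> (sg x) = \<ominus> sg (\<theta> x)"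
proof (rule homog_additive_eqI[OF is_abelian_group _ _ assms])
  show "additive_map P P (\<lambda>x. \<theta> (sg x))"
    by (rule linear_map_additive[OF linear_map_comp[OF sg_lin \<theta>_lin]])
  show "additive_map P P (\<lambda>x. \<ominus> sg (\<theta> x))"
    by (rule linear_map_additive[OF linear_map_minus[OF linear_map_comp[OF \<theta>_lin sg_lin]]])
  fix n y assume y: "y \<in> homog P n"
  show "\<theta> (sg y) = \<ominus> sg (\<theta> y)"
  proof (cases n)
    case 0
    then show ?thesis using y \<theta>_0 sg_in_homog[OF y] by simp
  next
    case (Suc m)
    then show ?thesis using y \<theta>_Suc[of y m] homog_closed[OF y]
      by (auto simp: sg_homog[OF y] sg_homog[of "\<theta> y" m] \<theta>_minus)
  qed
qed

definition defect :: "'p \<Rightarrow> 'p \<Rightarrow> 'p" where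
  "defect x y = \<theta> (x \<otimes> y) \<ominus> \<theta> x \<otimes> y \<ominus> sg x \<otimes> \<theta> y"

lemma defect_bilinear: "bilinear P defect"
proof -
  have "bilinear P (\<lambda>x y. \<theta> (x \<otimes> y))" by (rule bilinear_post[OF bilinear_mult \<theta>_lin])
  moreover have "bilinear P (\<lambda>x y. \<theta> x \<otimes> y)" by (rule bilinear_comp[OF bilinear_mult \<theta>_lin linear_map_id])
  moreover have "bilinear P (\<lambda>x y. sg x \<otimes> \<theta> y)" by (rule bilinear_comp[OF bilinear_mult sg_lin \<theta>_lin])
  ultimately have "bilinear P (\<lambda>x y. \<theta> (x \<otimes> y) \<ominus> \<theta> x \<otimes> y \<ominus> sg x \<otimes> \<theta> y)"
    by (intro bilinear_diff)
  then show ?thesis unfolding defect_def .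
qed

lemmas defect_closed [simp] = bilinear_closed[OF defect_bilinear]

text \<open>Seen as a map on \<open>P \<otimes> P\<close>, with boundary of
  \<open>x \<otimes> y\<close> given by the signed Leibniz rule, the defect anticommutes with the
  differentials. This follows because \<theta> does and because \<theta> and the differential each
  anticommute with \<open>sg\<close>.\<close>

lemma diff_defect:
  assumes x: "x \<in> carrier P" and y: "y \<in> carrier P"
  shows "diff P (defect x y) = \<ominus> defect (diff P x) y \<ominus> defect (sg x) (diff P y)"
proof -
  note diff_diff' = additive_diff[OF is_abelian_group is_abelian_group diff_additive]
  have sg_\<theta>: "sg (\<theta> x) = \<ominus> \<theta> (sg x)" using \<theta>_sg[OF x] x by simp
  have "diff P (\<theta> (x \<otimes> y)) = \<ominus> (\<theta> (diff P x \<otimes> y) \<oplus> \<theta> (sg x \<otimes> diff P y))"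
    using x y by (simp add: diff_\<theta> leibniz_sg additive_add[OF \<theta>_additive])
  moreover have "diff P (\<theta> x \<otimes> y) = \<ominus> (\<theta> (diff P x) \<otimes> y) \<oplus> \<ominus> (\<theta> (sg x) \<otimes> diff P y)"
    using x y by (simp add: leibniz_sg diff_\<theta> sg_\<theta> l_minus)
  moreover have "diff P (sg x \<otimes> \<theta> y) = \<ominus> (sg (diff P x) \<otimes> \<theta> y) \<oplus> \<ominus> (x \<otimes> \<theta> (diff P y))"
    using x y by (simp add: leibniz_sg diff_\<theta> diff_sg sg_sg l_minus r_minus)
  ultimately have "diff P (defect x y) =
      \<ominus> (\<theta> (diff P x \<otimes> y) \<oplus> \<theta> (sg x \<otimes> diff P y)) \<ominus>
      (\<ominus> (\<theta> (diff P x) \<otimes> y) \<oplus> \<ominus> (\<theta> (sg x) \<otimes> diff P y)) \<ominus>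
      (\<ominus> (sg (diff P x) \<otimes> \<theta> y) \<oplus> \<ominus> (x \<otimes> \<theta> (diff P y)))"
    using x y by (simp add: defect_def diff_diff')
  also have "\<dots> = \<ominus> defect (diff P x) y \<ominus> defect (sg x) (diff P y)"
    using x y by (subst leibniz_defect_cancel) (simp_all add: defect_def sg_sg)
  finally show ?thesis .
qed

text \<open>For \<open>i = j = 0\<close> the truncated difference gives degree 0 where -1 is meant;
  this is harmless, since \<theta> kills degree 0 and the defect is zero there.\<close>

lemma defect_homog:
  assumes x: "x \<in> homog P i" and y: "y \<in> homog P j"
  shows "defect x y \<in> homog P (i + j - 1)"
proof -
  have "\<theta> x \<otimes> y \<in> homog P (i + j - 1)"
  proof (cases i)
    case 0
    then show ?thesis using x homog_closed[OF y] by (simp add: \<theta>_0 homog_zero)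
  next
    case (Suc m)
    then show ?thesis using mult_homog[OF \<theta>_Suc[of x m] y] x by simp
  qed
  moreover have "sg x \<otimes> \<theta> y \<in> homog P (i + j - 1)"
  proof (cases j)
    case 0
    then show ?thesis using y homog_closed[OF x] by (simp add: \<theta>_0 homog_zero)
  next
    case (Suc m)
    then show ?thesis using mult_homog[OF sg_in_homog[OF x] \<theta>_Suc[of y m]] y by simp
  qed
  moreover have "\<theta> (x \<otimes> y) \<in> homog P (i + j - 1)"
    by (rule \<theta>_homog[OF mult_homog[OF x y]])
  ultimately show ?thesis
    unfolding defect_def a_minus_def by (intro homog_add homog_minus)
qed

definition mu_defect :: "'p \<Rightarrow> 'p \<Rightarrow> 'a" where
  "mu_defect x y = \<mu> (x \<otimes> y) \<ominus>\<^bsub>R\<^esub> \<mu> x \<otimes>\<^bsub>R\<^esub> \<mu> y"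

text \<open>Modulo \<open>I\<close> the map \<mu> becomes the augmentation, which is
  multiplicative.\<close>

lemma mu_defect_I:
  assumes x: "x \<in> carrier P" and y: "y \<in> carrier P"
  shows "mu_defect x y \<in> I"
proof -
  have "rc (mu_defect x y) = rc (\<mu> (x \<otimes> y)) \<ominus>\<^bsub>S\<^esub> rc (\<mu> x \<otimes>\<^bsub>R\<^esub> \<mu> y)"
    unfolding mu_defect_def
    by (rule additive_diff[OF R.is_abelian_group S.is_abelian_group])
      (use x y in \<open>simp_all add: additive_map_def ring_hom_add[OF rc_hom]\<close>)
  also have "\<dots> = \<zero>\<^bsub>S\<^esub>"
    using x y by (simp add: rc_\<mu> ring_hom_mult[OF rc_hom] eps_mult S.r_neg a_minus_def)
  finally show ?thesis using x y rc_zero_iff[of "mu_defect x y"] by (simp add: mu_defect_def)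
qed

text \<open>The augmentation prescribed for the homotopy in total degree 0. The sign is forced by
  the homotopy equation in total degree 1, where \<epsilon> kills the boundary on its left-hand
  side.\<close>

definition \<omega> :: "'p \<Rightarrow> 'p \<Rightarrow> 'a set" where
  "\<omega> x y = \<ominus>\<^bsub>S\<^esub> \<psi> (mu_defect x y)"

lemma \<omega>_closed [simp]: "\<lbrakk>x \<in> carrier P; y \<in> carrier P\<rbrakk> \<Longrightarrow> \<omega> x y \<in> carrier S"
  by (simp add: \<omega>_def mu_defect_I)

lemma mu_defect_add:
  assumes "x \<in> carrier P" "x' \<in> carrier P" "y \<in> carrier P"
  shows "mu_defect (x \<oplus> x') y = mu_defect x y \<oplus>\<^bsub>R\<^esub> mu_defect x' y"
    "mu_defect y (x \<oplus> x') = mu_defect y x \<oplus>\<^bsub>R\<^esub> mu_defect y x'"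
proof -
  have "(p \<oplus>\<^bsub>R\<^esub> q) \<ominus>\<^bsub>R\<^esub> (r \<oplus>\<^bsub>R\<^esub> s) = (p \<ominus>\<^bsub>R\<^esub> r) \<oplus>\<^bsub>R\<^esub> (q \<ominus>\<^bsub>R\<^esub> s)"
    if "p \<in> carrier R" "q \<in> carrier R" "r \<in> carrier R" "s \<in> carrier R" for p q r s
    using that by (simp add: a_minus_def R.minus_add R.a_ac)
  then show "mu_defect (x \<oplus> x') y = mu_defect x y \<oplus>\<^bsub>R\<^esub> mu_defect x' y"
    "mu_defect y (x \<oplus> x') = mu_defect y x \<oplus>\<^bsub>R\<^esub> mu_defect y x'"
    using assms by (simp_all add: mu_defect_def \<mu>_add l_distr r_distr R.l_distr R.r_distr)
qed

lemma mu_defect_smult: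
  assumes "x \<in> carrier P" "k \<in> carrier R" "y \<in> carrier P"
  shows "mu_defect (k \<odot> x) y = k \<otimes>\<^bsub>R\<^esub> mu_defect x y" "mu_defect y (k \<odot> x) = k \<otimes>\<^bsub>R\<^esub> mu_defect y x"
  using assms by (simp_all add: mu_defect_def \<mu>_smult smult_mult_left smult_mult_right
      R.m_assoc R.m_lcomm a_minus_def R.r_distr R.r_minus)

lemma \<omega>_bilinear: "bilinear SR \<omega>"
  unfolding bilinear_def
  by (intro conjI ballI linear_mapI additive_mapI)
    (simp_all add: \<omega>_def mu_defect_I mu_defect_add mu_defect_smult \<psi>_add \<psi>_smult S.minus_add S.r_minus)

text \<open>Split \<mu> of the product into \<open>mu_defect\<close> and the product of the values
  of \<mu>, both in \<open>I\<close>. By linearity \<psi> treats the second summand as wanted, and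
  \<omega> removes the first.\<close>

lemma \<psi>_\<mu>_mult:
  assumes "p \<in> carrier P" "\<epsilon> p = \<zero>\<^bsub>S\<^esub>" "w \<in> carrier P"
  shows "\<psi> (\<mu> (p \<otimes> w)) \<oplus>\<^bsub>S\<^esub> \<omega> p w = \<psi> (\<mu> p) \<otimes>\<^bsub>S\<^esub> \<epsilon> w"
    "\<psi> (\<mu> (w \<otimes> p)) \<oplus>\<^bsub>S\<^esub> \<omega> w p = \<epsilon> w \<otimes>\<^bsub>S\<^esub> \<psi> (\<mu> p)"
proof -
  have p: "\<mu> p \<in> I" by (rule \<mu>_I[OF assms(1,2)])
  then have wp: "\<mu> w \<otimes>\<^bsub>R\<^esub> \<mu> p \<in> I" using assms by (intro I.I_l_closed) simp_all
  have cancel: "(a \<ominus>\<^bsub>R\<^esub> b) \<oplus>\<^bsub>R\<^esub> b = a" if "a \<in> carrier R" "b \<in> carrier R" for a b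
    using that by (simp add: a_minus_def R.a_assoc R.l_neg)
  have cancel': "(a \<oplus>\<^bsub>S\<^esub> b) \<oplus>\<^bsub>S\<^esub> \<ominus>\<^bsub>S\<^esub> a = b" if "a \<in> carrier S" "b \<in> carrier S" for a b
    using that by (simp add: S.a_comm[of a b] S.a_assoc S.r_neg)
  have "\<mu> (p \<otimes> w) = mu_defect p w \<oplus>\<^bsub>R\<^esub> \<mu> w \<otimes>\<^bsub>R\<^esub> \<mu> p"
    using assms by (simp add: mu_defect_def R.m_comm[of "\<mu> w"] cancel)
  then show "\<psi> (\<mu> (p \<otimes> w)) \<oplus>\<^bsub>S\<^esub> \<omega> p w = \<psi> (\<mu> p) \<otimes>\<^bsub>S\<^esub> \<epsilon> w"
    using assms p wp mu_defect_I[OF assms(1,3)]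
    by (simp add: \<omega>_def \<psi>_add \<psi>_smult rc_\<mu> cancel' S.m_comm)
  have "\<mu> (w \<otimes> p) = mu_defect w p \<oplus>\<^bsub>R\<^esub> \<mu> w \<otimes>\<^bsub>R\<^esub> \<mu> p"
    using assms by (simp add: mu_defect_def cancel)
  then show "\<psi> (\<mu> (w \<otimes> p)) \<oplus>\<^bsub>S\<^esub> \<omega> w p = \<epsilon> w \<otimes>\<^bsub>S\<^esub> \<psi> (\<mu> p)"
    using assms p wp mu_defect_I[OF assms(3,1)]
    by (simp add: \<omega>_def \<psi>_add \<psi>_smult rc_\<mu> cancel' S.m_comm)
qed

text \<open>In total degree one the defect bounds the failure of \<open>\<mu>\<close> to be multiplicative.\<close>

lemma eps_defect:
  assumes x: "x \<in> homog P i" and y: "y \<in> homog P j" and ij: "i + j = 1"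
  shows "\<epsilon> (defect x y) \<oplus>\<^bsub>S\<^esub> \<omega> (diff P x) y \<oplus>\<^bsub>S\<^esub> \<omega> (sg x) (diff P y) = \<zero>\<^bsub>S\<^esub>"
proof -
  note xc = homog_closed[OF x] and yc = homog_closed[OF y]
  have \<omega>_zero: "\<omega> \<zero> z = \<zero>\<^bsub>S\<^esub>" "\<omega> z \<zero> = \<zero>\<^bsub>S\<^esub>" if "z \<in> carrier P" for z
    using bilinear_zero[OF SR_module \<omega>_bilinear that] by simp_all
  have xy: "\<epsilon> (\<theta> (x \<otimes> y)) = \<phi> (x \<otimes> y)"
    using eps_\<theta>[of "x \<otimes> y"] mult_homog[OF x y] ij by simp
  have eps_minus': "\<epsilon> (a \<ominus> b) = \<epsilon> a \<ominus>\<^bsub>S\<^esub> \<epsilon> b" if "a \<in> carrier P" "b \<in> carrier P" for a b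
    by (rule additive_diff[OF is_abelian_group S.is_abelian_group eps_additive that])
  have fin: "a \<ominus>\<^bsub>S\<^esub> c \<oplus>\<^bsub>S\<^esub> b = \<zero>\<^bsub>S\<^esub>" if "a \<oplus>\<^bsub>S\<^esub> b = c" "a \<in> carrier S" "b \<in> carrier S" for a b c
    using that by (auto simp: a_minus_def S.minus_add S.a_ac S.r_neg S.r_neg1 S.r_neg2)
  have minus_zero: "a \<ominus> \<zero> = a" if "a \<in> carrier P" for a
    using that by (simp add: a_minus_def)
  \<comment> \<open>One factor has degree 0, where \<theta> and the differential both vanish. So one
    summand of each Leibniz rule drops out and only one \<omega> term remains.\<close>
  consider "i = 1" "j = 0" | "i = 0" "j = 1" using ij by linarith
  then show ?thesis
  proof cases
    case 1
    then have 0: "\<theta> y = \<zero>" "diff P y = \<zero>" and \<theta>x: "\<epsilon> (\<theta> x) = \<phi> x"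
      using x y \<theta>_0 diff_homog_0 eps_\<theta> by simp_all
    have "\<phi> (x \<otimes> y) = \<psi> (\<mu> (diff P x \<otimes> y))"
      using xc yc 0 by (simp add: \<phi>_def leibniz_sg)
    then have "\<phi> (x \<otimes> y) \<oplus>\<^bsub>S\<^esub> \<omega> (diff P x) y = \<phi> x \<otimes>\<^bsub>S\<^esub> \<epsilon> y"
      using \<psi>_\<mu>_mult(1)[of "diff P x" y] xc yc by (simp add: \<phi>_def)
    note fin[OF this]
    moreover have "\<epsilon> (defect x y) = \<phi> (x \<otimes> y) \<ominus>\<^bsub>S\<^esub> \<phi> x \<otimes>\<^bsub>S\<^esub> \<epsilon> y"
      using xc yc 0 by (simp add: defect_def minus_zero eps_minus' xy eps_mult \<theta>x)
    ultimately show ?thesis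
      using xc yc 0 by (simp add: \<omega>_zero)
  next
    case 2
    then have 0: "\<theta> x = \<zero>" "diff P x = \<zero>" and \<theta>y: "\<epsilon> (\<theta> y) = \<phi> y" and sgx: "sg x = x"
      using x y \<theta>_0 diff_homog_0 eps_\<theta> sg_homog[OF x] by simp_all
    have "\<phi> (x \<otimes> y) = \<psi> (\<mu> (x \<otimes> diff P y))"
      using xc yc 0 by (simp add: \<phi>_def leibniz_sg sgx)
    then have "\<phi> (x \<otimes> y) \<oplus>\<^bsub>S\<^esub> \<omega> x (diff P y) = \<epsilon> x \<otimes>\<^bsub>S\<^esub> \<phi> y"
      using \<psi>_\<mu>_mult(2)[of "diff P y" x] xc yc by (simp add: \<phi>_def)
    note fin[OF this]
    moreover have "\<epsilon> (defect x y) = \<phi> (x \<otimes> y) \<ominus>\<^bsub>S\<^esub> \<epsilon> x \<otimes>\<^bsub>S\<^esub> \<phi> y"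
      using xc yc 0 by (simp add: defect_def minus_zero eps_minus' xy eps_mult \<theta>y sgx)
    ultimately show ?thesis
      using xc yc 0 by (simp add: \<omega>_zero sgx)
  qed
qed

text \<open>The homotopy preserves total degree, as the defect lowers it by one. It is chosen on
  pairs of basis elements by recursion on total degree: in degree 0 its augmentation is \<omega>;
  above, the right-hand side of the equation is a cycle by \<open>diff_defect\<close> and the
  earlier equations (in total degree 1: in the kernel of \<epsilon>, by \<open>eps_defect\<close>),
  hence a boundary.\<close>

lemma homotopy_exists:
  obtains H where "bilinear P H" "\<And>x y. \<lbrakk>x \<in> carrier P; y \<in> carrier P\<rbrakk> \<Longrightarrow>
    diff P (H x y) = defect x y \<oplus> H (diff P x) y \<oplus> H (sg x) (diff P y)"
proof -
  define tot where "tot cd = fst (fst cd) + fst (snd cd)" for cd :: "(nat \<times> 'p) \<times> (nat \<times> 'p)"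
  \<comment> \<open>The same cut-off as for \<theta>, now by total degree.\<close>
  define lo where "lo f n = (\<lambda>c d. if c \<in> C \<and> d \<in> C \<and> fst c + fst d < n then f (c, d) else \<zero>)"
    for f :: "(nat \<times> 'p) \<times> (nat \<times> 'p) \<Rightarrow> 'p" and n
  define rhs where "rhs F x y = defect x y \<oplus> F (diff P x) y \<oplus> F (sg x) (diff P y)" for F x y
  \<comment> \<open>In total degree 0 both sides of the homotopy equation are zero, so the only
    condition there is the augmentation, which starts the recursion.\<close>
  define good where "good f cd p \<longleftrightarrow> p \<in> homog P (tot cd) \<and>
      (tot cd = 0 \<longrightarrow> \<epsilon> p = \<omega> (snd (fst cd)) (snd (snd cd))) \<and>
      (tot cd > 0 \<longrightarrow> diff P p = rhs (bi_ext (lo f (tot cd))) (snd (fst cd)) (snd (snd cd)))" for f cd p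
  have rhs_bilinear: "bilinear P (rhs F)" if "bilinear P F" for F
  proof -
    have "bilinear P (\<lambda>x y. defect x y \<oplus> F (diff P x) y \<oplus> F (sg x) (diff P y))"
      by (intro bilinear_add defect_bilinear bilinear_comp[OF that diff_lin linear_map_id]
          bilinear_comp[OF that sg_lin diff_lin])
    moreover have "rhs F = (\<lambda>x y. defect x y \<oplus> F (diff P x) y \<oplus> F (sg x) (diff P y))"
      by (intro ext) (simp add: rhs_def)
    ultimately show ?thesis by simp
  qed
  \<comment> \<open>The right-hand side evaluates the bilinear map only in total degree one less
    than that of \<open>x\<close> and \<open>y\<close>. So it may be computed with any cut-off that
    retains those values.\<close>
  have rhs_cong: "rhs (bi_ext g) x y = rhs (bi_ext g') x y"
    if g: "\<And>c d. \<lbrakk>c \<in> C; d \<in> C\<rbrakk> \<Longrightarrow> g c d \<in> carrier P" and g': "\<And>c d. \<lbrakk>c \<in> C; d \<in> C\<rbrakk> \<Longrightarrow> g' c d \<in> carrier P"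
      and x: "x \<in> homog P i" and y: "y \<in> homog P j"
      and eq: "\<And>c d. \<lbrakk>c \<in> C; d \<in> C; fst c + fst d < i + j\<rbrakk> \<Longrightarrow> g c d = g' c d" for g g' x y i j
  proof -
    note xc = homog_closed[OF x] and yc = homog_closed[OF y]
    note zero = bilinear_zero[OF P_module bi_ext_bilinear[of g, OF g]] bilinear_zero[OF P_module bi_ext_bilinear[of g', OF g']]
    have "bi_ext g (diff P x) y = bi_ext g' (diff P x) y"
    proof (cases i)
      case 0
      then show ?thesis using x yc by (simp add: diff_homog_0 zero)
    next
      case (Suc m)
      then have dx: "diff P x \<in> homog P m" using x diff_homog_Suc by simp
      show ?thesis
        by (rule bi_ext_cong[of g g', OF g g' homog_closed[OF dx] yc])
          (use supp_homog[OF dx] supp_homog[OF y] Suc in \<open>auto intro!: eq\<close>)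
    qed
    moreover have "bi_ext g (sg x) (diff P y) = bi_ext g' (sg x) (diff P y)"
    proof (cases j)
      case 0
      then show ?thesis using y xc by (simp add: diff_homog_0 zero)
    next
      case (Suc m)
      then have dy: "diff P y \<in> homog P m" using y diff_homog_Suc by simp
      note sx = sg_in_homog[OF x]
      show ?thesis
        by (rule bi_ext_cong[of g g', OF g g' homog_closed[OF sx] homog_closed[OF dy]])
          (use supp_homog[OF dy] supp_homog[OF sx] Suc in \<open>auto intro!: eq\<close>)
    qed
    ultimately show ?thesis by (simp add: rhs_def)
  qed
  have "\<exists>f. \<forall>cd. cd \<in> C \<times> C \<longrightarrow> good f cd (f cd)"
  \<comment> \<open>Recursive choice along the total degree; again the requirement at a pair refers
    to pairs of smaller total degree only.\<close>
  proof (rule dependent_wf_choice[OF wf_measure[of tot]])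
    fix f g :: "(nat \<times> 'p) \<times> (nat \<times> 'p) \<Rightarrow> 'p" and cd r
    assume eq: "\<And>z. (z, cd) \<in> measure tot \<Longrightarrow> f z = g z"
    have "lo f (tot cd) = lo g (tot cd)"
      unfolding lo_def by (intro ext if_cong refl eq) (auto simp: tot_def)
    then show "(cd \<in> C \<times> C \<longrightarrow> good f cd r) = (cd \<in> C \<times> C \<longrightarrow> good g cd r)" by (simp add: good_def)
  next
    fix cd f
    assume IH: "\<And>z. (z, cd) \<in> measure tot \<Longrightarrow> z \<in> C \<times> C \<longrightarrow> good f z (f z)"
    show "\<exists>r. cd \<in> C \<times> C \<longrightarrow> good f cd r"
    proof (cases "cd \<in> C \<times> C")
      case True
      then obtain c d where cd: "cd = (c, d)" "c \<in> C" "d \<in> C" by auto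
      let ?n = "tot cd"
      have n: "?n = fst c + fst d" by (simp add: cd tot_def)
      let ?F = "bi_ext (lo f ?n)"
      have good: "good f (c', d') (f (c', d'))" if "c' \<in> C" "d' \<in> C" "fst c' + fst d' < ?n" for c' d'
        using IH[of "(c', d')"] that by (simp add: tot_def)
      have lo_closed: "lo f k c' d' \<in> carrier P" if "c' \<in> C" "d' \<in> C" "k \<le> ?n" for c' d' k
        using good[of c' d'] that homog_closed by (auto simp: lo_def good_def)
      note lon = lo_closed[OF _ _ le_refl]
      have F: "bilinear P ?F" by (rule bi_ext_bilinear) (rule lon)
      have F_e: "?F (snd c') (snd d') = lo f ?n c' d'" if "c' \<in> C" "d' \<in> C" for c' d'
        using lon that by (rule bi_ext_e)
      note F_closed = bilinear_closed[OF F]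
      have F_val: "?F (snd c') (snd d') = f (c', d')" if "c' \<in> C" "d' \<in> C" "fst c' + fst d' < ?n" for c' d'
        unfolding F_e[OF that(1,2)] using that by (simp add: lo_def)
      have F_homog: "?F a b \<in> homog P (i + j)" if a: "a \<in> homog P i" and b: "b \<in> homog P j" and ij: "i + j < ?n" for a b i j
      proof (rule bi_ext_submodule[OF homog_submodule homog_closed[OF a] homog_closed[OF b]])
        fix c' d' assume c': "c' \<in> C" "d' \<in> C" "c' \<in> supp a" "d' \<in> supp b"
        then have "fst c' = i" "fst d' = j" using supp_homog a b by auto
        then show "lo f ?n c' d' \<in> homog P (i + j)"
          using good[of c' d'] c' ij by (auto simp: lo_def good_def tot_def)
      qed
      \<comment> \<open>Positivity of \<open>?n\<close> ensures that pairs of total degree 0 survive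
        the cut-off.\<close>
      have F_0: "\<epsilon> (?F a b) = \<omega> a b" if a: "a \<in> homog P 0" and b: "b \<in> homog P 0" and "0 < ?n" for a b
      proof (rule bilinear_eqI[OF SR_module bilinear_post[OF F eps_lin] \<omega>_bilinear homog_closed[OF a] homog_closed[OF b]])
        fix c' d' assume c': "c' \<in> C" "d' \<in> C" "c' \<in> supp a" "d' \<in> supp b"
        then have "fst c' = 0" "fst d' = 0" using supp_homog a b by auto
        then show "\<epsilon> (?F (snd c') (snd d')) = \<omega> (snd c') (snd d')"
          using good[of c' d'] F_val[of c' d'] c' that(3) by (auto simp: good_def tot_def)
      qed
      have F_diff: "diff P (?F a b) = rhs ?F a b" if a: "a \<in> homog P i" and b: "b \<in> homog P j" and ij: "0 < i + j" "i + j < ?n" for a b i j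
      proof (rule bilinear_eqI[OF P_module bilinear_post[OF F diff_lin] rhs_bilinear[OF F] homog_closed[OF a] homog_closed[OF b]])
        fix c' d' assume c': "c' \<in> C" "d' \<in> C" "c' \<in> supp a" "d' \<in> supp b"
        then have deg: "fst c' = i" "fst d' = j" using supp_homog a b by auto
        have "diff P (?F (snd c') (snd d')) = rhs (bi_ext (lo f (i + j))) (snd c') (snd d')"
          using good[of c' d'] F_val[of c' d'] c' deg ij by (auto simp: good_def tot_def)
        also have "\<dots> = rhs ?F (snd c') (snd d')"
          by (rule rhs_cong[OF _ _ e_homog[OF c'(1)] e_homog[OF c'(2)]])
            (use lo_closed ij deg in \<open>auto simp: lo_def\<close>)
        finally show "diff P (?F (snd c') (snd d')) = rhs ?F (snd c') (snd d')" .
      qed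
      let ?x = "snd c" and ?w = "snd d"
      note x = e_homog[OF cd(2)] and w = e_homog[OF cd(3)]
      note xc = homog_closed[OF x] and wc = homog_closed[OF w]
      have zero: "?F \<zero> y = \<zero>" "?F y \<zero> = \<zero>" if "y \<in> carrier P" for y
        using bilinear_zero[OF P_module F that] .
      have "\<exists>r. good f cd r"
      proof (cases ?n)
        case 0
        obtain p where "p \<in> homog P 0" "\<epsilon> p = \<omega> ?x ?w"
          using eps_preimage[OF \<omega>_closed[OF xc wc]] by auto
        then show ?thesis using 0 by (intro exI[of _ p]) (simp add: good_def cd)
      next
        case (Suc m)
        define y where "y = rhs ?F ?x ?w"
        have terms: "?F (diff P ?x) ?w \<in> homog P m" "?F (sg ?x) (diff P ?w) \<in> homog P m"
        proof -
          show "?F (diff P ?x) ?w \<in> homog P m"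
          proof (cases "fst c")
            case 0
            then show ?thesis using x wc by (simp add: diff_homog_0 zero homog_zero)
          next
            case (Suc k)
            then have "diff P ?x \<in> homog P k" using x diff_homog_Suc by simp
            from F_homog[OF this w] show ?thesis using Suc n \<open>?n = Suc m\<close> by simp
          qed
          show "?F (sg ?x) (diff P ?w) \<in> homog P m"
          proof (cases "fst d")
            case 0
            then show ?thesis using w xc by (simp add: diff_homog_0 zero homog_zero)
          next
            case (Suc k)
            then have "diff P ?w \<in> homog P k" using w diff_homog_Suc by simp
            from F_homog[OF sg_in_homog[OF x] this] show ?thesis using Suc n \<open>?n = Suc m\<close> by simp
          qed
        qed
        have y: "y \<in> homog P m"
          unfolding y_def rhs_def using defect_homog[OF x w] terms Suc n by (intro homog_add) simp_all
        note tc = homog_closed[OF terms(1)] homog_closed[OF terms(2)]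
        \<comment> \<open>The obstruction step: \<open>y\<close> is shown to have augmentation zero
          for \<open>m = 0\<close>, and boundary zero otherwise.\<close>
        have "\<exists>p\<in>homog P (Suc m). diff P p = y"
        proof (cases m)
          case 0
          have "\<epsilon> (?F (diff P ?x) ?w) = \<omega> (diff P ?x) ?w"
          proof (cases "fst c")
            case 0
            then show ?thesis using x wc bilinear_zero[OF SR_module \<omega>_bilinear wc] by (simp add: diff_homog_0 zero)
          next
            case (Suc k)
            then have "diff P ?x \<in> homog P 0" "?w \<in> homog P 0" using x w n \<open>?n = Suc m\<close> \<open>m = 0\<close> diff_homog_Suc by auto
            then show ?thesis using F_0 \<open>?n = Suc m\<close> by simp
          qed
          moreover have "\<epsilon> (?F (sg ?x) (diff P ?w)) = \<omega> (sg ?x) (diff P ?w)"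
          proof (cases "fst d")
            case 0
            then show ?thesis using w xc bilinear_zero[OF SR_module \<omega>_bilinear sg_closed[OF xc]] by (simp add: diff_homog_0 zero)
          next
            case (Suc k)
            then have "diff P ?w \<in> homog P 0" "?x \<in> homog P 0" using x w n \<open>?n = Suc m\<close> \<open>m = 0\<close> diff_homog_Suc by auto
            then show ?thesis using F_0 sg_in_homog \<open>?n = Suc m\<close> by simp
          qed
          ultimately have "\<epsilon> y = \<zero>\<^bsub>S\<^esub>"
            using eps_defect[OF x w] xc wc tc n Suc 0 by (simp add: y_def rhs_def eps_add)
          then show ?thesis using exact_aug[of y] y 0 by simp
        next
          case (Suc m')
          \<comment> \<open>The earlier homotopy equation is applied to each of the two correction
            terms. Terms with a double boundary vanish, and the mixed term, with a boundary in both
            arguments, occurs in \<open>d1\<close> and \<open>d2\<close> with opposite signs because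
            the differential anticommutes with \<open>sg\<close>.\<close>
          have d1: "diff P (?F (diff P ?x) ?w) = defect (diff P ?x) ?w \<oplus> ?F (sg (diff P ?x)) (diff P ?w)"
          proof (cases "fst c")
            case 0
            then show ?thesis using x wc bilinear_zero[OF P_module defect_bilinear wc] by (simp add: diff_homog_0 zero)
          next
            case (Suc k)
            then have "diff P ?x \<in> homog P k" using x diff_homog_Suc by simp
            moreover have "0 < k + fst d" "k + fst d < ?n"
              using Suc n \<open>?n = Suc m\<close> \<open>m = Suc m'\<close> by linarith+
            ultimately have "diff P (?F (diff P ?x) ?w) = rhs ?F (diff P ?x) ?w"
              by (rule F_diff[OF _ w])
            then show ?thesis using xc wc F_closed[of "sg (diff P ?x)" "diff P ?w"] by (simp add: rhs_def diff_diff zero)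
          qed
          have d2: "diff P (?F (sg ?x) (diff P ?w)) = defect (sg ?x) (diff P ?w) \<oplus> \<ominus> ?F (sg (diff P ?x)) (diff P ?w)"
          proof (cases "fst d")
            case 0
            then show ?thesis using w xc bilinear_zero[OF P_module defect_bilinear sg_closed[OF xc]] by (simp add: diff_homog_0 zero)
          next
            case (Suc k)
            then have "diff P ?w \<in> homog P k" using w diff_homog_Suc by simp
            moreover have "0 < fst c + k" "fst c + k < ?n"
              using Suc n \<open>?n = Suc m\<close> \<open>m = Suc m'\<close> by linarith+
            ultimately have "diff P (?F (sg ?x) (diff P ?w)) = rhs ?F (sg ?x) (diff P ?w)"
              by (rule F_diff[OF sg_in_homog[OF x]])
            then show ?thesis using xc wc F_closed[of "sg (diff P ?x)" "diff P ?w"]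
              by (simp add: rhs_def diff_diff zero diff_sg sg_sg bilinear_minus[OF P_module F])
          qed
          have cancel: "(\<ominus> p \<ominus> q) \<oplus> (p \<oplus> r) \<oplus> (q \<oplus> \<ominus> r) = \<zero>"
            if "p \<in> carrier P" "q \<in> carrier P" "r \<in> carrier P" for p q r
            using that by algebra
          have "diff P y = (\<ominus> defect (diff P ?x) ?w \<ominus> defect (sg ?x) (diff P ?w)) \<oplus>
              (defect (diff P ?x) ?w \<oplus> ?F (sg (diff P ?x)) (diff P ?w)) \<oplus>
              (defect (sg ?x) (diff P ?w) \<oplus> \<ominus> ?F (sg (diff P ?x)) (diff P ?w))"
            using xc wc tc by (simp add: y_def rhs_def diff_add diff_defect d1 d2)
          also have "\<dots> = \<zero>"
            using xc wc F_closed by (intro cancel) simp_all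
          finally show ?thesis using exact_pos[of y m'] y Suc by simp
        qed
        then obtain p where "p \<in> homog P (Suc m)" "diff P p = y" by auto
        then show ?thesis using Suc by (intro exI[of _ p]) (simp add: good_def y_def cd)
      qed
      then show ?thesis by auto
    qed auto
  qed
  then obtain f where f_good: "\<forall>cd. cd \<in> C \<times> C \<longrightarrow> good f cd (f cd)" by (elim exE)
  have f: "good f (c, d) (f (c, d))" if "c \<in> C" "d \<in> C" for c d
    using f_good[rule_format, OF SigmaI[OF that]] .
  let ?f = "\<lambda>c d. f (c, d)"
  have f_closed: "f (c, d) \<in> carrier P" if "c \<in> C" "d \<in> C" for c d
    using f[OF that] homog_closed by (auto simp: good_def)
  define H where "H = bi_ext ?f"
  have H: "bilinear P H" unfolding H_def by (rule bi_ext_bilinear) (rule f_closed)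
  have H_e: "H (snd c) (snd d) = f (c, d)" if "c \<in> C" "d \<in> C" for c d
    unfolding H_def by (rule bi_ext_e[OF f_closed that])
  have "diff P (H x y) = rhs H x y" if "x \<in> carrier P" "y \<in> carrier P" for x y
  proof (rule bilinear_eqI[OF P_module bilinear_post[OF H diff_lin] rhs_bilinear[OF H] that])
    fix c d assume c: "c \<in> C" and d: "d \<in> C"
    note x = e_homog[OF c] and w = e_homog[OF d]
    show "diff P (H (snd c) (snd d)) = rhs H (snd c) (snd d)"
    \<comment> \<open>In total degree 0 the equation was not imposed during the choice; every term
      of it vanishes for degree reasons.\<close>
    proof (cases "fst c + fst d")
      case 0
      then have x0: "snd c \<in> homog P 0" and w0: "snd d \<in> homog P 0" using x w by auto
      have "defect (snd c) (snd d) = \<zero>"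
        using x0 w0 mult_homog[OF x0 w0] homog_closed[OF x0] homog_closed[OF w0]
        by (simp add: defect_def \<theta>_0 a_minus_def)
      moreover have "diff P (H (snd c) (snd d)) = \<zero>"
        using f[OF c d] 0 by (simp add: H_e c d good_def tot_def diff_homog_0)
      ultimately show ?thesis
        using x0 w0 homog_closed[OF x0] homog_closed[OF w0] by (simp add: rhs_def diff_homog_0 bilinear_zero[OF P_module H])
    next
      case (Suc m)
      have "diff P (H (snd c) (snd d)) = rhs (bi_ext (lo f (fst c + fst d))) (snd c) (snd d)"
        using f[OF c d] Suc by (simp add: H_e c d good_def tot_def)
      also have "\<dots> = rhs H (snd c) (snd d)"
        unfolding H_def by (rule rhs_cong[OF _ _ x w]) (auto simp: lo_def f_closed)
      finally show ?thesis .
    qed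
  qed
  then show thesis using H that unfolding rhs_def by blast
qed

end

section \<open>The conormal module\<close>

text \<open>The component in \<open>F\<close> is unique since \<open>F\<close> and \<open>G\<close>
  meet in zero only; this makes the chosen component linear and equal to the identity on
  \<open>F\<close>.\<close>

lemma direct_summand_projection:
  assumes N: "module K N" and F: "direct_summand K N F"
  obtains \<pi> where "linear_map K N (N\<lparr>carrier := F\<rparr>) \<pi>" "\<And>f. f \<in> F \<Longrightarrow> \<pi> f = f"
proof -
  interpret N: module K N by fact
  obtain G where sub: "submodule F K N" "submodule G K N" and int: "F \<inter> G = {\<zero>\<^bsub>N\<^esub>}"
    and sum: "F <+>\<^bsub>N\<^esub> G = carrier N"
    using F unfolding direct_summand_def by blast
  have closed: "x \<in> carrier N" "x \<oplus>\<^bsub>N\<^esub> y \<in> H" "\<ominus>\<^bsub>N\<^esub> x \<in> H" "\<zero>\<^bsub>N\<^esub> \<in> H"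
    if "submodule H K N" "x \<in> H" "y \<in> H" for H x y
  proof -
    note s = submodule.axioms(1)[OF that(1)]
    show "x \<in> carrier N" "x \<oplus>\<^bsub>N\<^esub> y \<in> H" "\<ominus>\<^bsub>N\<^esub> x \<in> H" "\<zero>\<^bsub>N\<^esub> \<in> H"
      using that subgroup.mem_carrier[OF s, of x] subgroup.m_closed[OF s, of x y] subgroup.m_inv_closed[OF s, of x]
        subgroup.one_closed[OF s] by (simp_all add: a_inv_def)
  qed
  note Fc = closed[OF sub(1)] and Gc = closed[OF sub(2)]
  define dec where "dec X f \<longleftrightarrow> f \<in> F \<and> (\<exists>g\<in>G. X = f \<oplus>\<^bsub>N\<^esub> g)" for X f
  have ex: "\<exists>f. dec X f" if "X \<in> carrier N" for X
    using that unfolding sum[symmetric] set_add_def' dec_def by auto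
  have uniq: "f = f'" if d: "dec X f" "dec X f'" for X f f'
  proof -
    obtain g g' where g: "f \<in> F" "f' \<in> F" "g \<in> G" "g' \<in> G" "f \<oplus>\<^bsub>N\<^esub> g = f' \<oplus>\<^bsub>N\<^esub> g'"
      using d unfolding dec_def by fast
    note c = Fc(1)[OF g(1,1)] Fc(1)[OF g(2,2)] Gc(1)[OF g(3,3)] Gc(1)[OF g(4,4)]
    have cancel: "(b \<oplus>\<^bsub>N\<^esub> a) \<oplus>\<^bsub>N\<^esub> (\<ominus>\<^bsub>N\<^esub> a \<oplus>\<^bsub>N\<^esub> \<ominus>\<^bsub>N\<^esub> c) = b \<oplus>\<^bsub>N\<^esub> \<ominus>\<^bsub>N\<^esub> c"
      if "a \<in> carrier N" "b \<in> carrier N" "c \<in> carrier N" for a b c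
      using that by (simp add: N.M.a_assoc N.M.r_neg2)
    have "f \<oplus>\<^bsub>N\<^esub> \<ominus>\<^bsub>N\<^esub> f' = (f \<oplus>\<^bsub>N\<^esub> g) \<oplus>\<^bsub>N\<^esub> (\<ominus>\<^bsub>N\<^esub> g \<oplus>\<^bsub>N\<^esub> \<ominus>\<^bsub>N\<^esub> f')"
      using c by (simp add: cancel)
    also have "\<dots> = (g' \<oplus>\<^bsub>N\<^esub> f') \<oplus>\<^bsub>N\<^esub> (\<ominus>\<^bsub>N\<^esub> f' \<oplus>\<^bsub>N\<^esub> \<ominus>\<^bsub>N\<^esub> g)"
      unfolding g(5) using c by (simp add: N.M.a_comm)
    also have "\<dots> = g' \<oplus>\<^bsub>N\<^esub> \<ominus>\<^bsub>N\<^esub> g"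
      using c by (simp add: cancel)
    finally have "f \<oplus>\<^bsub>N\<^esub> \<ominus>\<^bsub>N\<^esub> f' = g' \<oplus>\<^bsub>N\<^esub> \<ominus>\<^bsub>N\<^esub> g" .
    moreover have "f \<oplus>\<^bsub>N\<^esub> \<ominus>\<^bsub>N\<^esub> f' \<in> F"
      by (rule Fc(2)[OF g(1) Fc(3)[OF g(2,2)]])
    moreover have "g' \<oplus>\<^bsub>N\<^esub> \<ominus>\<^bsub>N\<^esub> g \<in> G"
      by (rule Gc(2)[OF g(4) Gc(3)[OF g(3,3)]])
    ultimately have "f \<oplus>\<^bsub>N\<^esub> \<ominus>\<^bsub>N\<^esub> f' = \<zero>\<^bsub>N\<^esub>" using int by auto
    then show "f = f'" using c by (metis N.M.a_inv_closed N.M.minus_equality N.M.minus_minus)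
  qed
  define \<pi> where "\<pi> X = (SOME f. dec X f)" for X
  have \<pi>: "dec X (\<pi> X)" if "X \<in> carrier N" for X
    unfolding \<pi>_def using ex[OF that] by (rule someI_ex)
  have \<pi>_eq: "\<pi> X = f" if "dec X f" "X \<in> carrier N" for X f
    using uniq[OF \<pi>[OF that(2)] that(1)] .
  show thesis
  proof
    show "linear_map K N (N\<lparr>carrier := F\<rparr>) \<pi>"
    proof (intro linear_mapI additive_mapI)
      show "\<pi> X \<in> carrier (N\<lparr>carrier := F\<rparr>)" if "X \<in> carrier N" for X
        using \<pi>[OF that] by (simp add: dec_def)
      show "\<pi> (X \<oplus>\<^bsub>N\<^esub> Y) = \<pi> X \<oplus>\<^bsub>N\<lparr>carrier := F\<rparr>\<^esub> \<pi> Y" if X: "X \<in> carrier N" and Y: "Y \<in> carrier N" for X Y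
      proof -
        obtain g g' where g: "\<pi> X \<in> F" "\<pi> Y \<in> F" "g \<in> G" "g' \<in> G" "X = \<pi> X \<oplus>\<^bsub>N\<^esub> g" "Y = \<pi> Y \<oplus>\<^bsub>N\<^esub> g'"
          using \<pi>[OF X] \<pi>[OF Y] unfolding dec_def by fast
        note c = Fc(1)[OF g(1,1)] Fc(1)[OF g(2,2)] Gc(1)[OF g(3,3)] Gc(1)[OF g(4,4)]
        have "X \<oplus>\<^bsub>N\<^esub> Y = (\<pi> X \<oplus>\<^bsub>N\<^esub> g) \<oplus>\<^bsub>N\<^esub> (\<pi> Y \<oplus>\<^bsub>N\<^esub> g')" using g(5,6) by simp
        also have "\<dots> = (\<pi> X \<oplus>\<^bsub>N\<^esub> \<pi> Y) \<oplus>\<^bsub>N\<^esub> (g \<oplus>\<^bsub>N\<^esub> g')" using c by (simp add: N.M.a_ac)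
        finally have "dec (X \<oplus>\<^bsub>N\<^esub> Y) (\<pi> X \<oplus>\<^bsub>N\<^esub> \<pi> Y)"
          using Fc(2)[OF g(1,2)] Gc(2)[OF g(3,4)] unfolding dec_def by blast
        then show ?thesis using \<pi>_eq X Y by simp
      qed
      show "\<pi> (k \<odot>\<^bsub>N\<^esub> X) = k \<odot>\<^bsub>N\<lparr>carrier := F\<rparr>\<^esub> \<pi> X" if k: "k \<in> carrier K" and X: "X \<in> carrier N" for k X
      proof -
        obtain g where g: "\<pi> X \<in> F" "g \<in> G" "X = \<pi> X \<oplus>\<^bsub>N\<^esub> g"
          using \<pi>[OF X] unfolding dec_def by fast
        have "k \<odot>\<^bsub>N\<^esub> X = k \<odot>\<^bsub>N\<^esub> (\<pi> X \<oplus>\<^bsub>N\<^esub> g)" using g(3) by simp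
        also have "\<dots> = k \<odot>\<^bsub>N\<^esub> \<pi> X \<oplus>\<^bsub>N\<^esub> k \<odot>\<^bsub>N\<^esub> g"
          using k Fc(1)[OF g(1,1)] Gc(1)[OF g(2,2)] by (rule N.smult_r_distr)
        finally have "dec (k \<odot>\<^bsub>N\<^esub> X) (k \<odot>\<^bsub>N\<^esub> \<pi> X)"
          using submodule.smult_closed[OF sub(1) k g(1)] submodule.smult_closed[OF sub(2) k g(2)]
          unfolding dec_def by blast
        then show ?thesis using \<pi>_eq X k by simp
      qed
    qed
    show "\<pi> f = f" if "f \<in> F" for f
    proof (rule \<pi>_eq)
      show "f \<in> carrier N" by (rule Fc(1)[OF that that])
      have "\<zero>\<^bsub>N\<^esub> \<in> G" using int by auto
      then show "dec f f" unfolding dec_def using that \<open>f \<in> carrier N\<close> by (intro conjI bexI[of _ "\<zero>\<^bsub>N\<^esub>"]) simp_all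
    qed
  qed
qed

locale conormal_ideal = ideal I R + cring R for I and R (structure)
begin

abbreviation "S \<equiv> R Quot I"
abbreviation "I2 \<equiv> I \<cdot>\<^bsub>R\<^esub> I"
abbreviation "cn a \<equiv> I2 +>\<^bsub>R\<^esub> a"
abbreviation "N \<equiv> conormal R I"

lemma I2_ideal: "ideal I2 R"
  by (rule ideal_prod_is_ideal[OF is_ideal is_ideal])

sublocale I2: ideal I2 R
  by (rule I2_ideal)

lemma conormal_sel:
  "carrier N = cn ` I" "\<zero>\<^bsub>N\<^esub> = I2" "add N = set_add R" "smult N = rcoset_mult R I2"
  by (auto simp: conormal_def A_RCOSETS_def' a_r_coset_def')

lemma S_cring: "cring S"
  by (rule quotient_is_cring[OF is_cring])

lemma S_carrier: "carrier S = (+>) I ` carrier R"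
  by (auto simp: FactRing_def A_RCOSETS_def')

lemma cn_closed: "a \<in> I \<Longrightarrow> cn a \<in> carrier N"
  by (simp add: conormal_sel)

lemma cn_eq_iff: "\<lbrakk>a \<in> I; b \<in> I\<rbrakk> \<Longrightarrow> cn a = cn b \<longleftrightarrow> a \<ominus> b \<in> I2"
  using quotient_eq_iff_same_a_r_cos[OF I2_ideal] Icarr by blast

lemma cn_add: "\<lbrakk>a \<in> I; b \<in> I\<rbrakk> \<Longrightarrow> cn a \<oplus>\<^bsub>N\<^esub> cn b = cn (a \<oplus> b)"
  by (simp add: conormal_sel I2.a_rcos_sum Icarr)

lemma cn_zero: "\<zero>\<^bsub>N\<^esub> = cn \<zero>"
  using I2.a_rcos_const[OF I2.zero_closed] by (simp add: conormal_sel)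

text \<open>The action is defined through all products of representatives. For \<open>i\<close> in
  \<open>I\<close> and \<open>j\<close> in the square of \<open>I\<close>, the product of
  \<open>i + r\<close> and \<open>j + a\<close> differs from \<open>r a\<close> by
  \<open>i j + i a + r j\<close>, which lies in the square of \<open>I\<close>; so only one coset
  occurs.\<close>

lemma cn_smult:
  assumes r: "r \<in> carrier R" and a: "a \<in> I"
  shows "(I +> r) \<odot>\<^bsub>N\<^esub> cn a = cn (r \<otimes> a)"
proof -
  have eq: "cn (x \<otimes> y) = cn (r \<otimes> a)" if "x \<in> I +> r" "y \<in> cn a" for x y
  proof -
    obtain i j where ij: "i \<in> I" "x = i \<oplus> r" "j \<in> I2" "y = j \<oplus> a"
      using \<open>x \<in> I +> r\<close> \<open>y \<in> cn a\<close> by (auto simp: a_r_coset_def')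
    have j: "j \<in> I" using ij(3) ideal_prod_inter[OF is_ideal is_ideal] by auto
    note c = Icarr[OF ij(1)] Icarr[OF j] Icarr[OF a] r
    have "i \<otimes> j \<in> I2" "i \<otimes> a \<in> I2" "r \<otimes> j \<in> I2"
      using ij j a c by (auto intro: ideal_prod.prod I2.I_l_closed)
    then have d: "i \<otimes> j \<oplus> i \<otimes> a \<oplus> r \<otimes> j \<in> I2" by (intro I2.a_closed)
    have "x \<otimes> y \<ominus> r \<otimes> a = i \<otimes> j \<oplus> i \<otimes> a \<oplus> r \<otimes> j"
      unfolding ij using c by algebra
    moreover have "x \<otimes> y \<in> I" "r \<otimes> a \<in> I"
      using ij j a c by (auto intro!: I_l_closed a_closed)
    ultimately show ?thesis using cn_eq_iff d by simp
  qed
  have "r \<in> I +> r" "a \<in> cn a"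
    using a_rcos_self[OF r] I2.a_rcos_self[OF Icarr[OF a]] by auto
  have "(I +> r) \<odot>\<^bsub>N\<^esub> cn a = (\<Union>x\<in>I +> r. \<Union>y\<in>cn a. cn (x \<otimes> y))"
    by (simp add: conormal_sel rcoset_mult_def)
  also have "\<dots> = (\<Union>x\<in>I +> r. \<Union>y\<in>cn a. cn (r \<otimes> a))"
    by (intro SUP_cong refl eq)
  also have "\<dots> = cn (r \<otimes> a)"
    using \<open>r \<in> I +> r\<close> \<open>a \<in> cn a\<close> by auto
  finally show ?thesis .
qed

lemma N_cases:
  assumes "X \<in> carrier N"
  obtains a where "a \<in> I" "X = cn a"
  using assms by (auto simp: conormal_sel(1))

lemma S_cases:
  assumes "s \<in> carrier S"
  obtains r where "r \<in> carrier R" "s = I +> r"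
  using assms by (auto simp: S_carrier)

lemma conormal_module: "module S N"
proof (rule moduleI[OF S_cring])
  note hom = rcos_ring_hom
  note simps = cn_add cn_zero cn_smult cn_closed a_closed I_l_closed Icarr zero_closed
    ring_hom_add[OF hom, symmetric] ring_hom_mult[OF hom, symmetric] ring_hom_one[OF hom, symmetric]
  show "abelian_group N"
  proof (rule abelian_groupI)
    fix X assume "X \<in> carrier N"
    then obtain a where a: "a \<in> I" "X = cn a" by (rule N_cases)
    then have "\<ominus> a \<in> I" by (simp add: a_inv_closed)
    then show "\<exists>Y\<in>carrier N. Y \<oplus>\<^bsub>N\<^esub> X = \<zero>\<^bsub>N\<^esub>"
      using a by (intro bexI[of _ "cn (\<ominus> a)"]) (simp_all add: simps l_neg)
  qed (auto elim!: N_cases simp: simps a_assoc, auto simp: a_comm Icarr)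
qed (auto elim!: N_cases S_cases simp: cn_add cn_zero cn_smult cn_closed a_closed I_l_closed Icarr l_distr r_distr m_assoc
    ring_hom_add[OF rcos_ring_hom, symmetric] ring_hom_mult[OF rcos_ring_hom, symmetric] ring_hom_one[OF rcos_ring_hom, symmetric])

text \<open>
  Finiteness of the basis: the elements of \<open>I\<close> whose coordinates vanish outside a finite set
  containing the supports of finitely many generators of \<open>I\<close> form an ideal.
\<close>

lemma conormal_coordinates:
  assumes noeth: "noetherian_ring R" and F: "direct_summand S N F" and free: "free_module S (N\<lparr>carrier := F\<rparr>)"
  obtains B \<kappa> \<psi> where "finite B" "based_module S (N\<lparr>carrier := F\<rparr>) B (\<lambda>b. b) \<kappa>"
    "\<And>b a. \<lbrakk>b \<in> B; a \<in> I\<rbrakk> \<Longrightarrow> \<psi> b a \<in> carrier S"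
    "\<And>b a a'. \<lbrakk>b \<in> B; a \<in> I; a' \<in> I\<rbrakk> \<Longrightarrow> \<psi> b (a \<oplus> a') = \<psi> b a \<oplus>\<^bsub>S\<^esub> \<psi> b a'"
    "\<And>b r a. \<lbrakk>b \<in> B; r \<in> carrier R; a \<in> I\<rbrakk> \<Longrightarrow> \<psi> b (r \<otimes> a) = (I +> r) \<otimes>\<^bsub>S\<^esub> \<psi> b a"
    "\<And>b a. \<lbrakk>b \<in> B; a \<in> I; cn a \<in> F\<rbrakk> \<Longrightarrow> \<psi> b a = \<kappa> b (cn a)"
proof -
  let ?M = "N\<lparr>carrier := F\<rparr>"
  interpret S: cring S by (rule S_cring)
  interpret M: module S ?M using free unfolding free_module_def by simp
  obtain B where "is_basis S ?M B" using free unfolding free_module_def by auto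
  from basis_coords[OF M.module_axioms this] obtain \<kappa> where "based_module S ?M B (\<lambda>b. b) \<kappa>" .
  then interpret bm: based_module S ?M B "\<lambda>b. b" \<kappa> .
  obtain \<pi> where \<pi>: "linear_map S N ?M \<pi>" "\<And>f. f \<in> F \<Longrightarrow> \<pi> f = f"
    by (rule direct_summand_projection[OF conormal_module F]) (rule that)
  define \<psi> where "\<psi> b a = \<kappa> b (\<pi> (cn a))" for b a
  have \<pi>c: "\<pi> (cn a) \<in> carrier ?M" if "a \<in> I" for a
    by (rule additive_closed[OF linear_map_additive[OF \<pi>(1)] cn_closed[OF that]])
  have closed: "\<psi> b a \<in> carrier S" if "b \<in> B" "a \<in> I" for b a
    unfolding \<psi>_def by (rule bm.\<kappa>_closed[OF that(1) \<pi>c[OF that(2)]])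
  have add: "\<psi> b (a \<oplus> a') = \<psi> b a \<oplus>\<^bsub>S\<^esub> \<psi> b a'" if "b \<in> B" "a \<in> I" "a' \<in> I" for b a a'
    unfolding \<psi>_def cn_add[OF that(2,3), symmetric]
      additive_add[OF linear_map_additive[OF \<pi>(1)] cn_closed[OF that(2)] cn_closed[OF that(3)]]
    by (rule additive_add[OF bm.\<kappa>_additive[OF that(1)] \<pi>c[OF that(2)] \<pi>c[OF that(3)]])
  have smult: "\<psi> b (r \<otimes> a) = (I +> r) \<otimes>\<^bsub>S\<^esub> \<psi> b a" if "b \<in> B" "r \<in> carrier R" "a \<in> I" for b r a
  proof -
    have r: "I +> r \<in> carrier S" using that(2) by (simp add: S_carrier)
    show ?thesis
      unfolding \<psi>_def cn_smult[OF that(2,3), symmetric] linear_map_smult[OF \<pi>(1) r cn_closed[OF that(3)]]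
      by (rule bm.\<kappa>_smult[OF that(1) r \<pi>c[OF that(3)]])
  qed
  have eq: "\<psi> b a = \<kappa> b (cn a)" if "b \<in> B" "a \<in> I" "cn a \<in> F" for b a
    unfolding \<psi>_def \<pi>(2)[OF that(3)] ..
  have "finite B"
  proof -
    obtain A where A: "A \<subseteq> carrier R" "finite A" "I = Idl A"
      using noetherian_ring.finetely_gen[OF noeth is_ideal] by auto
    have AI: "A \<subseteq> I" using genideal_self[OF A(1)] A(3) by simp
    define B' where "B' = (\<Union>a\<in>A. {b \<in> B. \<kappa> b (\<pi> (cn a)) \<noteq> \<zero>\<^bsub>S\<^esub>})"
    have "finite B'" unfolding B'_def using A(2) AI bm.finite_support[OF \<pi>c] by blast
    define J where "J = {a \<in> I. \<forall>b\<in>B - B'. \<psi> b a = \<zero>\<^bsub>S\<^esub>}"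
    have zero: "\<psi> b \<zero> = \<zero>\<^bsub>S\<^esub>" if "b \<in> B" for b
    proof -
      have "\<zero> \<in> I" by (rule additive_subgroup.zero_closed[OF ideal.axioms(1)[OF is_ideal]])
      then have "\<psi> b \<zero> \<oplus>\<^bsub>S\<^esub> \<psi> b \<zero> = \<psi> b \<zero>" "\<psi> b \<zero> \<in> carrier S"
        using add[OF that, of \<zero> \<zero>] closed[OF that] by simp_all
      then show ?thesis by (metis S.add.r_cancel_one)
    qed
    have rc: "I +> r \<in> carrier S" if "r \<in> carrier R" for r using that by (simp add: S_carrier)
    have "ideal J R"
    proof (rule idealI[OF ring_axioms])
      show "subgroup J (add_monoid R)"
      proof
        show "J \<subseteq> carrier (add_monoid R)" using Icarr by (auto simp: J_def)
        show "\<one>\<^bsub>add_monoid R\<^esub> \<in> J" using zero a_subgroup subgroup.one_closed by (fastforce simp: J_def)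
        show "x \<otimes>\<^bsub>add_monoid R\<^esub> y \<in> J" if "x \<in> J" "y \<in> J" for x y
          using that by (auto simp: J_def add a_closed)
        show "inv\<^bsub>add_monoid R\<^esub> x \<in> J" if "x \<in> J" for x
        proof -
          have x: "x \<in> I" using that by (simp add: J_def)
          have "\<ominus> x = \<ominus> \<one> \<otimes> x" using x Icarr by (simp add: l_minus)
          moreover have "\<ominus> \<one> \<otimes> x \<in> J"
            using that x smult[of _ "\<ominus> \<one>" x] rc[of "\<ominus> \<one>"] by (auto simp: J_def intro!: I_l_closed)
          ultimately show ?thesis by (simp add: a_inv_def)
        qed
      qed
      show "x \<otimes> a \<in> J" "a \<otimes> x \<in> J" if "a \<in> J" "x \<in> carrier R" for a x
      proof -
        have a: "a \<in> I" "a \<in> carrier R" using that Icarr by (auto simp: J_def)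
        show "x \<otimes> a \<in> J"
          using that a smult[of _ x a] rc[of x] by (auto simp: J_def intro!: I_l_closed)
        then show "a \<otimes> x \<in> J" using a that by (simp add: m_comm)
      qed
    qed
    moreover have "A \<subseteq> J" using AI by (auto simp: J_def B'_def \<psi>_def)
    ultimately have IJ: "I \<subseteq> J"
      using genideal_minimal[of J A] A(3) by simp
    show ?thesis
    proof (cases "B \<subseteq> B'")
      case True
      then show ?thesis using \<open>finite B'\<close> by (rule finite_subset)
    next
      \<comment> \<open>A basis element \<open>b\<close> outside \<open>B'\<close> is the class of
        some \<open>a\<close> in \<open>I\<close>, which is contained in \<open>J\<close>. Its own
        coordinate is then both one and zero, so \<open>S\<close> is the zero ring and every basis
        element is zero.\<close>
      case False
      then obtain b where b: "b \<in> B" "b \<notin> B'" by auto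
      then have "b \<in> F" using bm.e_closed by simp
      moreover have "F \<subseteq> carrier N"
        using F subgroup.subset[of F "add_monoid N"] unfolding direct_summand_def submodule_def by simp
      ultimately obtain a where a: "a \<in> I" "b = cn a" using N_cases by blast
      have "\<psi> b a = \<one>\<^bsub>S\<^esub>"
        using eq[OF b(1) a(1)] \<open>b \<in> F\<close> bm.\<kappa>_e[OF b(1) b(1)] a(2) by simp
      moreover have "\<psi> b a = \<zero>\<^bsub>S\<^esub>" using IJ a(1) b unfolding J_def by blast
      ultimately have one: "\<one>\<^bsub>S\<^esub> = \<zero>\<^bsub>S\<^esub>" by simp
      have "c = \<zero>\<^bsub>?M\<^esub>" if "c \<in> B" for c
        using M.smult_one[OF bm.e_closed[OF that]] M.smult_l_null[OF bm.e_closed[OF that]] one by simp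
      then have "B \<subseteq> {\<zero>\<^bsub>?M\<^esub>}" by blast
      then show ?thesis by (rule finite_subset) simp
    qed
  qed
  from that[OF this bm.based_module_axioms closed add smult eq] show thesis .
qed

end

section \<open>Algebra maps out of homology\<close>

text \<open>An abstract form of the target: \<open>C\<close> is the complex, \<open>L\<close> the
  exterior algebra over \<open>T\<close>, and \<open>W\<close> its generators of degree 1, of which
  only the relations needed for twisting are recorded.\<close>

locale twisted_target = C: signed_dga T C sg + L: scalar_alg T L
  for T :: "('t, 'm) ring_scheme" and C :: "('t, 'c, 'n) dg_algebra_scheme" and sg
    and L :: "('t, 'b, 'l) graded_algebra_scheme" +
  fixes W :: "'b set"
  assumes W_closed: "v \<in> W \<Longrightarrow> v \<in> carrier L"
    and W_square: "v \<in> W \<Longrightarrow> v \<otimes>\<^bsub>L\<^esub> v = \<zero>\<^bsub>L\<^esub>"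
    and W_anticomm: "\<lbrakk>v \<in> W; w \<in> W\<rbrakk> \<Longrightarrow> v \<otimes>\<^bsub>L\<^esub> w = \<ominus>\<^bsub>L\<^esub> (w \<otimes>\<^bsub>L\<^esub> v)"
    and W_homog: "\<lbrakk>v \<in> W; y \<in> homog L n\<rbrakk> \<Longrightarrow> v \<otimes>\<^bsub>L\<^esub> y \<in> homog L (Suc n)"
    and L_homog: "submodule (homog L n) T L"
begin

text \<open>Multiplicativity is asked on cycles only, because the twisting maps are derivations
  there up to boundaries. The condition on \<open>W\<close> says that values of \<open>r\<close>
  graded-commute with the generators; it is what allows a generator to be moved past
  \<open>r z\<close>.\<close>

definition good :: "('c \<Rightarrow> 'b) \<Rightarrow> bool" where
  "good r \<longleftrightarrow> linear_map T C L r \<and> (\<forall>z\<in>carrier C. r (diff C z) = \<zero>\<^bsub>L\<^esub>) \<and> r \<one>\<^bsub>C\<^esub> = \<one>\<^bsub>L\<^esub> \<and>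
     (\<forall>z\<in>cycles C. \<forall>w\<in>cycles C. r (z \<otimes>\<^bsub>C\<^esub> w) = r z \<otimes>\<^bsub>L\<^esub> r w) \<and>
     (\<forall>v\<in>W. \<forall>z\<in>carrier C. v \<otimes>\<^bsub>L\<^esub> r (sg z) = r z \<otimes>\<^bsub>L\<^esub> v) \<and>
     (\<forall>n. r ` homog C n \<subseteq> homog L n)"

text \<open>Twisting \<open>r\<close> by \<open>1 + v \<Theta>\<close> preserves all conditions. In
  the expanded product of two twisted values, the linear terms reproduce the Leibniz rule for
  \<Theta>, whose boundary \<open>r\<close> kills, and the quadratic term contains the square of
  \<open>v\<close>.\<close>

lemma good_step:
  assumes r: "good r" and v: "v \<in> W"
    and \<Theta>: "linear_map T C C \<Theta>" and \<Theta>_diff: "\<And>z. z \<in> carrier C \<Longrightarrow> diff C (\<Theta> z) = \<ominus>\<^bsub>C\<^esub> \<Theta> (diff C z)"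
    and \<Theta>_sg: "\<And>z. z \<in> carrier C \<Longrightarrow> \<Theta> (sg z) = \<ominus>\<^bsub>C\<^esub> sg (\<Theta> z)" and \<Theta>_one: "\<Theta> \<one>\<^bsub>C\<^esub> = \<zero>\<^bsub>C\<^esub>"
    and \<Theta>_mult: "\<And>z w. \<lbrakk>z \<in> cycles C; w \<in> cycles C\<rbrakk> \<Longrightarrow>
      \<exists>b\<in>carrier C. \<Theta> (z \<otimes>\<^bsub>C\<^esub> w) = diff C b \<oplus>\<^bsub>C\<^esub> \<Theta> z \<otimes>\<^bsub>C\<^esub> w \<oplus>\<^bsub>C\<^esub> sg z \<otimes>\<^bsub>C\<^esub> \<Theta> w"
    and \<Theta>_0: "\<And>z. z \<in> homog C 0 \<Longrightarrow> \<Theta> z = \<zero>\<^bsub>C\<^esub>" and \<Theta>_Suc: "\<And>z n. z \<in> homog C (Suc n) \<Longrightarrow> \<Theta> z \<in> homog C n"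
  shows "good (\<lambda>z. r z \<oplus>\<^bsub>L\<^esub> v \<otimes>\<^bsub>L\<^esub> r (\<Theta> z))"
proof -
  have lin: "linear_map T C L r" and r_diff: "\<And>z. z \<in> carrier C \<Longrightarrow> r (diff C z) = \<zero>\<^bsub>L\<^esub>" and r_one: "r \<one>\<^bsub>C\<^esub> = \<one>\<^bsub>L\<^esub>"
    and r_mult: "\<And>z w. \<lbrakk>z \<in> cycles C; w \<in> cycles C\<rbrakk> \<Longrightarrow> r (z \<otimes>\<^bsub>C\<^esub> w) = r z \<otimes>\<^bsub>L\<^esub> r w"
    and r_W: "\<And>v z. \<lbrakk>v \<in> W; z \<in> carrier C\<rbrakk> \<Longrightarrow> v \<otimes>\<^bsub>L\<^esub> r (sg z) = r z \<otimes>\<^bsub>L\<^esub> v"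
    and r_homog: "\<And>n z. z \<in> homog C n \<Longrightarrow> r z \<in> homog L n"
    using r unfolding good_def by (auto simp: image_subset_iff)
  note add = linear_map_additive[OF lin] and \<Theta>a = linear_map_additive[OF \<Theta>]
  note rc [simp] = additive_closed[OF add] and \<Theta>c [simp] = additive_closed[OF \<Theta>a]
  note r_add = additive_add[OF add]
  note r_minus = additive_minus[OF C.is_abelian_group L.is_abelian_group add]
  have r_zero [simp]: "r \<zero>\<^bsub>C\<^esub> = \<zero>\<^bsub>L\<^esub>" by (rule additive_zero[OF C.is_abelian_group L.is_abelian_group add])
  have \<Theta>_zero: "\<Theta> \<zero>\<^bsub>C\<^esub> = \<zero>\<^bsub>C\<^esub>" by (rule additive_zero[OF C.is_abelian_group C.is_abelian_group \<Theta>a])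
  note vc [simp] = W_closed[OF v]
  note cc = C.cycles_closed
  have \<Theta>_cycles: "\<Theta> z \<in> cycles C" if "z \<in> cycles C" for z
    using that by (simp add: C.cycles_iff \<Theta>_diff \<Theta>_zero)
  have "linear_map T C L (\<lambda>z. r z \<oplus>\<^bsub>L\<^esub> v \<otimes>\<^bsub>L\<^esub> r (\<Theta> z))"
    by (intro L.linear_map_add lin L.linear_map_mult_left linear_map_comp[OF \<Theta> lin] vc)
  moreover have "r (diff C z) \<oplus>\<^bsub>L\<^esub> v \<otimes>\<^bsub>L\<^esub> r (\<Theta> (diff C z)) = \<zero>\<^bsub>L\<^esub>" if z: "z \<in> carrier C" for z
  proof -
    have "\<Theta> (diff C z) = \<ominus>\<^bsub>C\<^esub> diff C (\<Theta> z)" using z by (simp add: \<Theta>_diff)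
    then show ?thesis using z by (simp add: r_diff r_minus)
  qed
  moreover have "r \<one>\<^bsub>C\<^esub> \<oplus>\<^bsub>L\<^esub> v \<otimes>\<^bsub>L\<^esub> r (\<Theta> \<one>\<^bsub>C\<^esub>) = \<one>\<^bsub>L\<^esub>"
    by (simp add: \<Theta>_one r_one)
  moreover have "r (z \<otimes>\<^bsub>C\<^esub> w) \<oplus>\<^bsub>L\<^esub> v \<otimes>\<^bsub>L\<^esub> r (\<Theta> (z \<otimes>\<^bsub>C\<^esub> w)) =
      (r z \<oplus>\<^bsub>L\<^esub> v \<otimes>\<^bsub>L\<^esub> r (\<Theta> z)) \<otimes>\<^bsub>L\<^esub> (r w \<oplus>\<^bsub>L\<^esub> v \<otimes>\<^bsub>L\<^esub> r (\<Theta> w))"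
    if z: "z \<in> cycles C" and w: "w \<in> cycles C" for z w
  proof -
    obtain b where b: "b \<in> carrier C" "\<Theta> (z \<otimes>\<^bsub>C\<^esub> w) = diff C b \<oplus>\<^bsub>C\<^esub> \<Theta> z \<otimes>\<^bsub>C\<^esub> w \<oplus>\<^bsub>C\<^esub> sg z \<otimes>\<^bsub>C\<^esub> \<Theta> w"
      using \<Theta>_mult[OF z w] by auto
    note zc = cc[OF z] and wc = cc[OF w]
    have "r (\<Theta> (z \<otimes>\<^bsub>C\<^esub> w)) = r (\<Theta> z) \<otimes>\<^bsub>L\<^esub> r w \<oplus>\<^bsub>L\<^esub> r (sg z) \<otimes>\<^bsub>L\<^esub> r (\<Theta> w)"
      using b(1) zc wc z w by (simp add: b(2) r_add r_diff r_mult \<Theta>_cycles C.cycles_sg)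
    then have "r (z \<otimes>\<^bsub>C\<^esub> w) \<oplus>\<^bsub>L\<^esub> v \<otimes>\<^bsub>L\<^esub> r (\<Theta> (z \<otimes>\<^bsub>C\<^esub> w)) =
        r z \<otimes>\<^bsub>L\<^esub> r w \<oplus>\<^bsub>L\<^esub> (v \<otimes>\<^bsub>L\<^esub> r (\<Theta> z) \<otimes>\<^bsub>L\<^esub> r w \<oplus>\<^bsub>L\<^esub> v \<otimes>\<^bsub>L\<^esub> r (sg z) \<otimes>\<^bsub>L\<^esub> r (\<Theta> w))"
      using zc wc z w by (simp add: r_mult L.r_distr L.m_assoc)
    also have "v \<otimes>\<^bsub>L\<^esub> r (sg z) = r z \<otimes>\<^bsub>L\<^esub> v" by (rule r_W[OF v zc])
    finally have 1: "r (z \<otimes>\<^bsub>C\<^esub> w) \<oplus>\<^bsub>L\<^esub> v \<otimes>\<^bsub>L\<^esub> r (\<Theta> (z \<otimes>\<^bsub>C\<^esub> w)) =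
        r z \<otimes>\<^bsub>L\<^esub> r w \<oplus>\<^bsub>L\<^esub> (v \<otimes>\<^bsub>L\<^esub> r (\<Theta> z) \<otimes>\<^bsub>L\<^esub> r w \<oplus>\<^bsub>L\<^esub> r z \<otimes>\<^bsub>L\<^esub> v \<otimes>\<^bsub>L\<^esub> r (\<Theta> w))" .
    \<comment> \<open>Commuting the second \<open>v\<close> to the left past
      \<open>r (\<Theta> z)\<close> brings the two copies of \<open>v\<close> together.\<close>
    have "(v \<otimes>\<^bsub>L\<^esub> r (\<Theta> z)) \<otimes>\<^bsub>L\<^esub> (v \<otimes>\<^bsub>L\<^esub> r (\<Theta> w)) = v \<otimes>\<^bsub>L\<^esub> (r (\<Theta> z) \<otimes>\<^bsub>L\<^esub> v) \<otimes>\<^bsub>L\<^esub> r (\<Theta> w)"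
      using zc wc by (simp add: L.m_assoc)
    also have "r (\<Theta> z) \<otimes>\<^bsub>L\<^esub> v = v \<otimes>\<^bsub>L\<^esub> r (sg (\<Theta> z))"
      using r_W[OF v \<Theta>c[OF zc]] by simp
    also have "v \<otimes>\<^bsub>L\<^esub> (v \<otimes>\<^bsub>L\<^esub> r (sg (\<Theta> z))) = \<zero>\<^bsub>L\<^esub>"
      using zc by (simp add: L.m_assoc[symmetric] W_square[OF v])
    finally have 2: "(v \<otimes>\<^bsub>L\<^esub> r (\<Theta> z)) \<otimes>\<^bsub>L\<^esub> (v \<otimes>\<^bsub>L\<^esub> r (\<Theta> w)) = \<zero>\<^bsub>L\<^esub>"
      using wc by simp
    have "(r z \<oplus>\<^bsub>L\<^esub> v \<otimes>\<^bsub>L\<^esub> r (\<Theta> z)) \<otimes>\<^bsub>L\<^esub> (r w \<oplus>\<^bsub>L\<^esub> v \<otimes>\<^bsub>L\<^esub> r (\<Theta> w)) =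
        r z \<otimes>\<^bsub>L\<^esub> r w \<oplus>\<^bsub>L\<^esub> v \<otimes>\<^bsub>L\<^esub> r (\<Theta> z) \<otimes>\<^bsub>L\<^esub> r w \<oplus>\<^bsub>L\<^esub>
          (r z \<otimes>\<^bsub>L\<^esub> (v \<otimes>\<^bsub>L\<^esub> r (\<Theta> w)) \<oplus>\<^bsub>L\<^esub> (v \<otimes>\<^bsub>L\<^esub> r (\<Theta> z)) \<otimes>\<^bsub>L\<^esub> (v \<otimes>\<^bsub>L\<^esub> r (\<Theta> w)))"
      using zc wc by (simp add: L.l_distr L.r_distr)
    then show ?thesis unfolding 1 2 using zc wc by (simp add: L.a_assoc L.m_assoc)
  qed
  moreover have "w \<otimes>\<^bsub>L\<^esub> (r (sg z) \<oplus>\<^bsub>L\<^esub> v \<otimes>\<^bsub>L\<^esub> r (\<Theta> (sg z))) = (r z \<oplus>\<^bsub>L\<^esub> v \<otimes>\<^bsub>L\<^esub> r (\<Theta> z)) \<otimes>\<^bsub>L\<^esub> w"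
    if w: "w \<in> W" and z: "z \<in> carrier C" for w z
  proof -
    note wc = W_closed[OF w]
    \<comment> \<open>Two signs cancel: one from exchanging \<Theta> with \<open>sg\<close>, the
      other from exchanging \<open>w\<close> with \<open>v\<close>.\<close>
    have "w \<otimes>\<^bsub>L\<^esub> (v \<otimes>\<^bsub>L\<^esub> r (\<Theta> (sg z))) = \<ominus>\<^bsub>L\<^esub> ((w \<otimes>\<^bsub>L\<^esub> v) \<otimes>\<^bsub>L\<^esub> r (sg (\<Theta> z)))"
      using wc z by (simp add: \<Theta>_sg r_minus L.r_minus L.m_assoc)
    also have "\<dots> = v \<otimes>\<^bsub>L\<^esub> (w \<otimes>\<^bsub>L\<^esub> r (sg (\<Theta> z)))"
      using wc z by (simp add: W_anticomm[OF w v] L.l_minus L.m_assoc)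
    also have "w \<otimes>\<^bsub>L\<^esub> r (sg (\<Theta> z)) = r (\<Theta> z) \<otimes>\<^bsub>L\<^esub> w" using z by (intro r_W[OF w]) simp
    finally show ?thesis using wc z by (simp add: L.r_distr L.l_distr r_W[OF w] L.m_assoc)
  qed
  moreover have "r z \<oplus>\<^bsub>L\<^esub> v \<otimes>\<^bsub>L\<^esub> r (\<Theta> z) \<in> homog L n" if z: "z \<in> homog C n" for n z
  proof -
    \<comment> \<open>\<Theta> lowers the degree by one and multiplication by \<open>v\<close>
      raises it again; in degree 0 the term is zero.\<close>
    have "v \<otimes>\<^bsub>L\<^esub> r (\<Theta> z) \<in> homog L n"
    proof (cases n)
      case 0
      then show ?thesis using z \<Theta>_0 subgroup.one_closed[OF submodule.axioms(1)[OF L_homog]] by simp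
    next
      case (Suc m)
      then show ?thesis using z \<Theta>_Suc by (auto intro!: W_homog v r_homog)
    qed
    then show ?thesis
      using subgroup.m_closed[OF submodule.axioms(1)[OF L_homog[of n]] r_homog[OF z]] by simp
  qed
  ultimately show ?thesis unfolding good_def by (auto simp: image_subset_iff)
qed

lemma good_descends:
  assumes r: "good r"
  obtains \<rho> where "\<rho> \<in> graded_alg_hom T (homology C) L" "\<And>z. z \<in> cycles C \<Longrightarrow> \<rho> (homology_class C z) = r z"
proof -
  have lin: "linear_map T C L r" and r_diff: "\<And>z. z \<in> carrier C \<Longrightarrow> r (diff C z) = \<zero>\<^bsub>L\<^esub>" and r_one: "r \<one>\<^bsub>C\<^esub> = \<one>\<^bsub>L\<^esub>"
    and r_mult: "\<And>z w. \<lbrakk>z \<in> cycles C; w \<in> cycles C\<rbrakk> \<Longrightarrow> r (z \<otimes>\<^bsub>C\<^esub> w) = r z \<otimes>\<^bsub>L\<^esub> r w"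
    and r_homog: "\<And>n z. z \<in> homog C n \<Longrightarrow> r z \<in> homog L n"
    using r unfolding good_def by (auto simp: image_subset_iff)
  note add = linear_map_additive[OF lin]
  note rc = additive_closed[OF add]
  define \<rho> where "\<rho> Y = r (SOME z. z \<in> cycles C \<and> homology_class C z = Y)" for Y
  have \<rho>: "\<rho> (homology_class C z) = r z" if z: "z \<in> cycles C" for z
  proof -
    define w where "w = (SOME w. w \<in> cycles C \<and> homology_class C w = homology_class C z)"
    have w: "w \<in> cycles C" "homology_class C w = homology_class C z"
      using someI[of "\<lambda>w. w \<in> cycles C \<and> homology_class C w = homology_class C z" z] z unfolding w_def by auto
    note c = C.cycles_closed[OF w(1)] C.cycles_closed[OF z]
    obtain b where b: "b \<in> carrier C" "w \<ominus>\<^bsub>C\<^esub> z = diff C b"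
      using w C.hc_eq_iff[OF w(1) z] unfolding boundaries_def by auto
    have "r w \<ominus>\<^bsub>L\<^esub> r z = \<zero>\<^bsub>L\<^esub>"
      using additive_diff[OF C.is_abelian_group L.is_abelian_group add c] b r_diff by simp
    then have "r w = r z" using rc[OF c(1)] rc[OF c(2)]
      by (simp add: a_minus_def) (metis L.a_inv_closed L.minus_equality L.minus_minus)
    then show ?thesis by (simp add: \<rho>_def w_def)
  qed
  note cyc = C.cycles_closed C.cycles_add C.cycles_mult C.cycles_smult C.cycles_one
  have "\<rho> \<in> graded_alg_hom T (homology C) L"
    unfolding graded_alg_hom_def
  proof (intro CollectI conjI ballI allI ring_hom_memI image_subsetI)
    show "\<rho> \<one>\<^bsub>homology C\<^esub> = \<one>\<^bsub>L\<^esub>" by (simp add: C.hc_one \<rho> cyc r_one)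
  next
    fix n Y assume "Y \<in> homog (homology C) n"
    then show "\<rho> Y \<in> homog L n" by (auto simp: C.H_fields \<rho> r_homog)
  qed (auto elim!: C.H_cases simp: C.hc_add C.hc_mult C.hc_smult \<rho> cyc r_mult rc
      additive_add[OF add] linear_map_smult[OF lin])
  then show thesis using \<rho> that by blast
qed

end

section \<open>The complex computing Tor\<close>

locale tor_setup = coord_resolution R P I \<epsilon> C \<kappa> + T: cring T
  for R :: "('a, 'm) ring_scheme" and P :: "('a, 'p, 'n) dg_algebra_scheme" (structure)
    and I :: "'a set" and \<epsilon> :: "'p \<Rightarrow> 'a set" and C :: "(nat \<times> 'p) set" and \<kappa>
    and T :: "('t, 'l) ring_scheme" +
  fixes h :: "'a set \<Rightarrow> 't"
  assumes h_hom: "h \<in> ring_hom S T"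
begin

abbreviation "X \<equiv> tor_complex R I P h T"

lemma h_rc_hom: "(\<lambda>r. h (rc r)) \<in> ring_hom R T"
  using ring_hom_trans[OF rc_hom h_hom] by (simp add: comp_def)

sublocale ten: tensor R P T "\<lambda>r. h (rc r)" X
  by unfold_locales
    (simp_all add: h_rc_hom tor_complex_def dg_base_change_def graded_algebra.truncate_def graded_algebra.extend_def)

lemma h_closed [simp]: "s \<in> carrier S \<Longrightarrow> h s \<in> carrier T"
  by (rule ring_hom_closed[OF h_hom])

lemma diff_X: "diff X = ten.tensor_map (diff P)"
  by (rule ext) (simp add: tor_complex_def dg_base_change_def graded_algebra.extend_def dg_algebra.fields_def
      ten.tensor_map_def)

lemmas tm_additive = linear_map_additive[OF ten.tensor_map_linear]

lemma tm_closed: "\<lbrakk>lin u; Y \<in> carrier X\<rbrakk> \<Longrightarrow> ten.tensor_map u Y \<in> carrier X"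
  by (rule additive_closed[OF tm_additive])

text \<open>The common shape of \<open>diff_sg\<close>, \<open>diff_\<theta>\<close> and
  \<open>\<theta>_sg\<close>, all of which are carried over to \<open>P \<otimes> T\<close> in this
  way.\<close>

lemma tm_comp_minus:
  assumes "lin u" "lin v" "lin u'" "lin v'" "\<And>x. x \<in> carrier P \<Longrightarrow> u (v x) = \<ominus> u' (v' x)" "Y \<in> carrier X"
  shows "ten.tensor_map u (ten.tensor_map v Y) = \<ominus>\<^bsub>X\<^esub> ten.tensor_map u' (ten.tensor_map v' Y)"
proof -
  have "additive_map X X (\<lambda>Y. \<ominus>\<^bsub>X\<^esub> ten.tensor_map u' (ten.tensor_map v' Y))"
    using linear_map_additive[OF ten.X.linear_map_minus[OF linear_map_comp[OF ten.tensor_map_linear[OF assms(4)]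
      ten.tensor_map_linear[OF assms(3)]]]] .
  from ten.additive_eqI[OF additive_comp[OF tm_additive[OF assms(2)] tm_additive[OF assms(1)]] this _ assms(6)]
  show ?thesis
    by (simp add: ten.tensor_map_pt assms(1-5) additive_closed[OF linear_map_additive[OF assms(2)]]
      additive_closed[OF linear_map_additive[OF assms(3)]] additive_closed[OF linear_map_additive[OF assms(4)]] ten.pt_minus)
qed

text \<open>Both sides of each identity are additive in every argument, so
  \<open>additive_eqI\<close> reduces it to pure tensors, where it is the identity in
  \<open>P\<close>.\<close>

sublocale X: signed_dga T X "ten.tensor_map sg"
proof (intro signed_dga.intro signed_dga_axioms.intro ten.X.scalar_alg_axioms, unfold diff_X)
  show "linear_map T X X (ten.tensor_map (diff P))" by (rule ten.tensor_map_linear[OF diff_lin])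
  show "additive_map X X (ten.tensor_map sg)" by (rule tm_additive[OF sg_lin])
  fix x assume x: "x \<in> carrier X"
  have zero: "additive_map X X (\<lambda>Y. \<zero>\<^bsub>X\<^esub>)" by (rule additive_mapI) simp_all
  show "ten.tensor_map (diff P) (ten.tensor_map (diff P) x) = \<zero>\<^bsub>X\<^esub>"
    by (rule ten.additive_eqI[OF additive_comp[OF tm_additive[OF diff_lin] tm_additive[OF diff_lin]] zero _ x])
      (simp add: ten.tensor_map_pt[OF diff_lin] diff_diff ten.pt_zero_left)
  show "ten.tensor_map sg (ten.tensor_map sg x) = x"
    by (rule ten.additive_eqI[OF additive_comp[OF tm_additive[OF sg_lin] tm_additive[OF sg_lin]] additive_id _ x])
      (simp add: ten.tensor_map_pt[OF sg_lin] sg_sg)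
  show "ten.tensor_map (diff P) (ten.tensor_map sg x) = \<ominus>\<^bsub>X\<^esub> ten.tensor_map sg (ten.tensor_map (diff P) x)"
    by (rule tm_comp_minus[OF diff_lin sg_lin sg_lin diff_lin diff_sg x])
  fix y assume y: "y \<in> carrier X"
  note D = tm_additive[OF diff_lin] and Sg = tm_additive[OF sg_lin]
  note mult = ten.X.additive_mult_left ten.X.additive_mult_right
  show "ten.tensor_map (diff P) (x \<otimes>\<^bsub>X\<^esub> y) =
      ten.tensor_map (diff P) x \<otimes>\<^bsub>X\<^esub> y \<oplus>\<^bsub>X\<^esub> ten.tensor_map sg x \<otimes>\<^bsub>X\<^esub> ten.tensor_map (diff P) y"
  proof (rule ten.additive_eqI[OF _ _ _ x])
    show "additive_map X X (\<lambda>x. ten.tensor_map (diff P) (x \<otimes>\<^bsub>X\<^esub> y))"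
      by (rule additive_comp[OF ten.X.additive_mult_right[OF additive_id y] D])
    show "additive_map X X (\<lambda>x. ten.tensor_map (diff P) x \<otimes>\<^bsub>X\<^esub> y \<oplus>\<^bsub>X\<^esub> ten.tensor_map sg x \<otimes>\<^bsub>X\<^esub> ten.tensor_map (diff P) y)"
      by (intro ten.X.additive_plus mult D Sg y tm_closed diff_lin)
    fix a s assume a: "a \<in> carrier P" "s \<in> carrier T"
    show "ten.tensor_map (diff P) (ten.pt a s \<otimes>\<^bsub>X\<^esub> y) =
      ten.tensor_map (diff P) (ten.pt a s) \<otimes>\<^bsub>X\<^esub> y \<oplus>\<^bsub>X\<^esub> ten.tensor_map sg (ten.pt a s) \<otimes>\<^bsub>X\<^esub> ten.tensor_map (diff P) y"
    proof (rule ten.additive_eqI[OF _ _ _ y])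
      show "additive_map X X (\<lambda>y. ten.tensor_map (diff P) (ten.pt a s \<otimes>\<^bsub>X\<^esub> y))"
        using a by (intro additive_comp[OF ten.X.additive_mult_left[OF additive_id] D]) simp
      show "additive_map X X (\<lambda>y. ten.tensor_map (diff P) (ten.pt a s) \<otimes>\<^bsub>X\<^esub> y \<oplus>\<^bsub>X\<^esub>
          ten.tensor_map sg (ten.pt a s) \<otimes>\<^bsub>X\<^esub> ten.tensor_map (diff P) y)"
        using a by (intro ten.X.additive_plus mult D additive_id tm_closed diff_lin sg_lin) simp_all
    qed (use a in \<open>simp add: ten.pt_mult ten.tensor_map_pt[OF diff_lin] ten.tensor_map_pt[OF sg_lin] leibniz_sg ten.pt_add_left\<close>)
  qed
next
  have "diff P \<one> = \<zero>" by (rule diff_homog_0[OF one_homog])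
  then show "ten.tensor_map (diff P) \<one>\<^bsub>X\<^esub> = \<zero>\<^bsub>X\<^esub>"
    by (simp add: ten.pt_one ten.tensor_map_pt[OF diff_lin] ten.pt_zero_left)
  show "submodule (homog X n) T X" for n
    by (rule ten.homog_X_submodule) (auto dest: homog_closed)
qed

text \<open>The boundary of \<open>x \<otimes> t\<close> is \<open>a \<cdot> 1 \<otimes> t\<close>;
  the scalar \<open>a\<close> crosses the tensor sign and acts as zero on \<open>T\<close>, since it
  lies in \<open>I\<close>.\<close>

lemma pt_cycle:
  assumes "x \<in> homog P 1" "diff P x = a \<odot> \<one>" "a \<in> I" "t \<in> carrier T"
  shows "ten.pt x t \<in> cycles X"
proof -
  have a: "a \<in> carrier R" by (rule I.Icarr[OF assms(3)])
  have "rc a = \<zero>\<^bsub>S\<^esub>" using I.a_rcos_const[OF assms(3)] by (simp add: FactRing_def)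
  then have ha: "h (rc a) = \<zero>\<^bsub>T\<^esub>"
    using additive_zero[OF S.is_abelian_group T.is_abelian_group, of h] ring_hom_add[OF h_hom] by (simp add: additive_map_def)
  have "diff X (ten.pt x t) = ten.pt (a \<odot> \<one>) t"
    using assms homog_closed[OF assms(1)] by (simp add: diff_X ten.tensor_map_pt[OF diff_lin])
  also have "\<dots> = ten.pt \<one> (h (rc a) \<otimes>\<^bsub>T\<^esub> t)"
    using a assms(4) by (simp add: ten.pt_balance)
  also have "\<dots> = \<zero>\<^bsub>X\<^esub>" using assms(4) by (simp add: ha ten.pt_zero_right)
  finally show ?thesis using assms homog_closed[OF assms(1)] by (simp add: X.cycles_iff)
qed

end

text \<open>The homotopy equation rearranged without subtraction: both sides become sums of
  composites that are carried over to \<open>P \<otimes> T\<close> term by term.\<close>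

lemma (in derivation_data) leibniz_up_to_homotopy:
  obtains H where "bilinear P H" "\<And>x y. \<lbrakk>x \<in> carrier P; y \<in> carrier P\<rbrakk> \<Longrightarrow>
    \<theta> (x \<otimes> y) \<oplus> H (diff P x) y \<oplus> H (sg x) (diff P y) = diff P (H x y) \<oplus> \<theta> x \<otimes> y \<oplus> sg x \<otimes> \<theta> y"
proof -
  obtain H where H: "bilinear P H" "\<And>x y. \<lbrakk>x \<in> carrier P; y \<in> carrier P\<rbrakk> \<Longrightarrow>
    diff P (H x y) = defect x y \<oplus> H (diff P x) y \<oplus> H (sg x) (diff P y)"
    using homotopy_exists by blast
  have cancel: "p \<oplus> u \<oplus> v = (p \<ominus> q \<ominus> s) \<oplus> u \<oplus> v \<oplus> q \<oplus> s"
    if "p \<in> carrier P" "q \<in> carrier P" "s \<in> carrier P" "u \<in> carrier P" "v \<in> carrier P" for p q s u v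
    using that by algebra
  have "\<theta> (x \<otimes> y) \<oplus> H (diff P x) y \<oplus> H (sg x) (diff P y) = diff P (H x y) \<oplus> \<theta> x \<otimes> y \<oplus> sg x \<otimes> \<theta> y"
    if "x \<in> carrier P" "y \<in> carrier P" for x y
    unfolding H(2)[OF that] defect_def using that bilinear_closed[OF H(1)] by (intro cancel) simp_all
  with H(1) that show thesis by blast
qed

locale tor_main = tor_setup R P I \<epsilon> C \<kappa> T h
  for R :: "('a, 'm) ring_scheme" and P :: "('a, 'p, 'n) dg_algebra_scheme" (structure)
    and I :: "'a set" and \<epsilon> :: "'p \<Rightarrow> 'a set" and C :: "(nat \<times> 'p) set" and \<kappa>
    and T :: "('t, 'l) ring_scheme" and h :: "'a set \<Rightarrow> 't" +
  fixes F :: "'a set set"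
  assumes F_module: "module (R Quot I) ((conormal R I)\<lparr>carrier := F\<rparr>)"
    and F_sub: "F \<subseteq> carrier (conormal R I)"
begin

abbreviation "M \<equiv> (conormal R I)\<lparr>carrier := F\<rparr>"
abbreviation "L \<equiv> ext_tensor R I F h T"

sublocale con: conormal_ideal I R
  by unfold_locales

sublocale ex: exterior_tensor S M T h L
proof -
  interpret e: exterior S M by (rule exterior.intro[OF F_module])
  have "graded_algebra.truncate L = L" by (cases L) (simp add: graded_algebra.truncate_def)
  then have "tensor S (exterior_algebra S M) T h L"
    by (intro tensor.intro tensor_axioms.intro e.E.scalar_alg_axioms T.is_cring h_hom)
      (simp add: ext_tensor_def ext_conormal_def)
  then show "exterior_tensor S M T h L"
    by (intro exterior_tensor.intro exterior.intro[OF F_module])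
qed

lemma gen_eq: "ext_tensor_gen R I F h T f t = ex.gen f t"
  by (simp add: ext_tensor_gen_def ex.gen_def ext_conormal_def)

abbreviation "W \<equiv> (\<lambda>f. ex.gen f \<one>\<^bsub>T\<^esub>) ` F"

sublocale tw: twisted_target T X "ten.tensor_map sg" L W
proof (intro twisted_target.intro twisted_target_axioms.intro X.signed_dga_axioms ex.ten.X.scalar_alg_axioms)
  show "v \<otimes>\<^bsub>L\<^esub> y \<in> homog L (Suc n)" if "v \<in> W" "y \<in> homog L n" for v y n
    using that ex.gen_mult_homog by auto
  show "v \<otimes>\<^bsub>L\<^esub> w = \<ominus>\<^bsub>L\<^esub> (w \<otimes>\<^bsub>L\<^esub> v)" if "v \<in> W" "w \<in> W" for v w
    using that ex.gen_anticomm by auto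
qed (use ex.gen_square ex.homog_submodule in auto)

subsection \<open>The retraction\<close>

text \<open>The untwisted start: the augmentation of \<open>P \<otimes> T\<close> to
  \<open>T\<close> followed by the structure map of \<open>L\<close>. Its values are multiples of
  one, hence commute with \<open>W\<close>, and the sign in the condition on \<open>W\<close> is
  invisible by \<open>eps_sg\<close>.\<close>

lemma good_base:
  obtains r where "tw.good r" "\<And>p t. \<lbrakk>p \<in> carrier P; t \<in> carrier T\<rbrakk> \<Longrightarrow>
    r (ten.pt p t) = (h (\<epsilon> p) \<otimes>\<^bsub>T\<^esub> t) \<odot>\<^bsub>L\<^esub> \<one>\<^bsub>L\<^esub>"
proof -
  let ?g = "\<lambda>p t. (h (\<epsilon> p) \<otimes>\<^bsub>T\<^esub> t) \<odot>\<^bsub>L\<^esub> \<one>\<^bsub>L\<^esub>"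
  have h_zero: "h \<zero>\<^bsub>S\<^esub> = \<zero>\<^bsub>T\<^esub>"
    using additive_zero[OF S.is_abelian_group T.is_abelian_group, of h] ring_hom_add[OF h_hom] by (simp add: additive_map_def)
  note h_add = ring_hom_add[OF h_hom] and h_mult = ring_hom_mult[OF h_hom] and h_one = ring_hom_one[OF h_hom]
  obtain r where r: "additive_map X L r" "\<And>p t. \<lbrakk>p \<in> carrier P; t \<in> carrier T\<rbrakk> \<Longrightarrow> r (ten.pt p t) = ?g p t"
  proof (rule ten.tensor_lift[OF ex.ten.X.is_abelian_group, of ?g])
    show "additive_map P L (\<lambda>p. ?g p t)" if "t \<in> carrier T" for t
      using that by (intro additive_mapI) (simp_all add: eps_add h_add T.l_distr ex.ten.X.smult_l_distr)
    show "additive_map T L (?g p)" if "p \<in> carrier P" for p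
      using that by (intro additive_mapI) (simp_all add: T.r_distr ex.ten.X.smult_l_distr)
    show "?g (k \<odot> p) t = ?g p (h (rc k) \<otimes>\<^bsub>T\<^esub> t)" if "k \<in> carrier R" "p \<in> carrier P" "t \<in> carrier T" for k p t
      using that by (simp add: augmentation_smult h_mult T.m_ac)
  qed blast
  note rc = additive_closed[OF r(1)] and r_add = additive_add[OF r(1)]
  have zero: "additive_map X L (\<lambda>Y. \<zero>\<^bsub>L\<^esub>)" by (rule additive_mapI) simp_all
  note Ls = ex.ten.X.smult_mult_left ex.ten.X.smult_mult_right
  have lin: "linear_map T X L r"
  proof (rule linear_mapI[OF r(1)])
    fix s Y assume s: "s \<in> carrier T" and "Y \<in> carrier X"
    from this(2) show "r (s \<odot>\<^bsub>X\<^esub> Y) = s \<odot>\<^bsub>L\<^esub> r Y"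
      by (induction rule: ten.tensor_induct)
        (simp_all add: s r ten.pt_smult r_add rc ex.ten.X.smult_r_distr ten.X.smult_r_distr
          ex.ten.X.smult_assoc1[symmetric] T.m_lcomm)
  qed
  have r_diff: "r (diff X z) = \<zero>\<^bsub>L\<^esub>" if z: "z \<in> carrier X" for z
    by (rule ten.additive_eqI[OF additive_comp[OF X.diff_additive r(1)] zero _ z])
      (simp add: diff_X ten.tensor_map_pt[OF diff_lin] r h_zero)
  have r_mult: "r (z \<otimes>\<^bsub>X\<^esub> w) = r z \<otimes>\<^bsub>L\<^esub> r w" if z: "z \<in> carrier X" and w: "w \<in> carrier X" for z w
    using z
  proof (induction rule: ten.tensor_induct)
    case (pt a s)
    from w show ?case
      by (induction rule: ten.tensor_induct)
        (simp_all add: pt r ten.pt_mult eps_mult h_mult T.m_ac Ls ex.ten.X.smult_assoc1[symmetric]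
          r_add rc ex.ten.X.r_distr ten.X.r_distr)
  next
    case (add Y Y')
    then show ?case using w by (simp add: r_add rc ex.ten.X.l_distr ten.X.l_distr)
  qed
  have r_W: "v \<otimes>\<^bsub>L\<^esub> r (ten.tensor_map sg z) = r z \<otimes>\<^bsub>L\<^esub> v" if v: "v \<in> W" and z: "z \<in> carrier X" for v z
  proof -
    note vc = tw.W_closed[OF v]
    have "v \<otimes>\<^bsub>L\<^esub> r (ten.tensor_map sg z) = v \<otimes>\<^bsub>L\<^esub> r z"
      by (rule ten.additive_eqI[OF ex.ten.X.additive_mult_left[OF additive_comp[OF X.sg_additive r(1)] vc]
            ex.ten.X.additive_mult_left[OF r(1) vc] _ z])
        (simp add: ten.tensor_map_pt[OF sg_lin] r eps_sg)
    also have "\<dots> = r z \<otimes>\<^bsub>L\<^esub> v"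
      by (rule ten.additive_eqI[OF ex.ten.X.additive_mult_left[OF r(1) vc] ex.ten.X.additive_mult_right[OF r(1) vc] _ z])
        (simp add: r Ls vc)
    finally show ?thesis .
  qed
  have r_homog: "r z \<in> homog L n" if "z \<in> homog X n" for z n
    using that homog_submodule
  proof (induction rule: ten.homog_X_induct)
    case (pt a t)
    note ac = homog_closed[OF pt(1)]
    show ?case
    proof (cases n)
      case 0
      then show ?thesis using pt ac by (simp add: r submodule.smult_closed[OF ex.homog_submodule] ex.one_homog)
    next
      case (Suc m)
      then have "\<epsilon> a = \<zero>\<^bsub>S\<^esub>" using pt augmentation_pos by simp
      then show ?thesis
        using pt ac subgroup.one_closed[OF submodule.axioms(1)[OF ex.homog_submodule]] by (simp add: r h_zero)
    qed
  next
    case (add Y Z)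
    then show ?case using subgroup.m_closed[OF submodule.axioms(1)[OF ex.homog_submodule]] by (simp add: r_add)
  qed
  have "r \<one>\<^bsub>X\<^esub> = \<one>\<^bsub>L\<^esub>" by (simp add: ten.pt_one r eps_one h_one)
  then have "tw.good r"
    unfolding tw.good_def using lin r_diff r_mult X.cycles_closed r_W r_homog by (auto simp: image_subset_iff)
  with r(2) that show thesis by blast
qed

text \<open>The base changes of \<theta> and of its homotopy satisfy the same equation on
  \<open>P \<otimes> T\<close>. On cycles the two homotopy terms with a differential in an argument
  vanish, which leaves the Leibniz rule up to a boundary, as \<open>good_step\<close>
  requires.\<close>

lemma good_derivation:
  assumes dd: "derivation_data R P I \<epsilon> C \<kappa> \<psi> \<mu> \<theta>" and f: "f \<in> F" and r: "tw.good r"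
  shows "tw.good (\<lambda>z. r z \<oplus>\<^bsub>L\<^esub> ex.gen f \<one>\<^bsub>T\<^esub> \<otimes>\<^bsub>L\<^esub> r (ten.tensor_map \<theta> z))"
proof -
  interpret dd: derivation_data R P I \<epsilon> C \<kappa> \<psi> \<mu> \<theta> by fact
  let ?\<Theta> = "ten.tensor_map \<theta>" and ?sg = "ten.tensor_map sg"
  note \<Theta>_pt = ten.tensor_map_pt[OF dd.\<theta>_lin] and \<Theta>a = tm_additive[OF dd.\<theta>_lin]
  note \<Theta>c = additive_closed[OF \<Theta>a]
  obtain H where H: "bilinear P H" "\<And>x y. \<lbrakk>x \<in> carrier P; y \<in> carrier P\<rbrakk> \<Longrightarrow>
    \<theta> (x \<otimes> y) \<oplus> H (diff P x) y \<oplus> H (sg x) (diff P y) = diff P (H x y) \<oplus> \<theta> x \<otimes> y \<oplus> sg x \<otimes> \<theta> y"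
    using dd.leibniz_up_to_homotopy by blast
  let ?H = "ten.tensor_bimap H"
  note Hl = bilinear_left[OF H(1)] and Hr = bilinear_right[OF H(1)]
  have HXl: "additive_map X X (\<lambda>Y. ?H Y Z)" if "Z \<in> carrier X" for Z
    using Hl Hr that by (rule ten.tensor_bimap_left)
  have HXr: "additive_map X X (?H Y)" if "Y \<in> carrier X" for Y
    using Hl Hr that by (rule ten.tensor_bimap_right)
  have HX_pt: "?H (ten.pt a s) (ten.pt b t) = ten.pt (H a b) (s \<otimes>\<^bsub>T\<^esub> t)"
    if "a \<in> carrier P" "b \<in> carrier P" "s \<in> carrier T" "t \<in> carrier T" for a b s t
    using Hl Hr that by (rule ten.tensor_bimap_pt)
  note Hc = bilinear_closed[OF H(1)]
  have HXc: "?H Y Z \<in> carrier X" if "Y \<in> carrier X" "Z \<in> carrier X" for Y Z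
    using additive_closed[OF HXr[OF that(1)] that(2)] .
  note closure = additive_id ten.X.additive_plus ten.X.additive_mult_left ten.X.additive_mult_right
  \<comment> \<open>Both sides are additive in \<open>z\<close> and in \<open>w\<close>; two nested
    reductions to pure tensors lead back to the equation in \<open>P\<close>.\<close>
  have homotopy: "?\<Theta> (z \<otimes>\<^bsub>X\<^esub> w) \<oplus>\<^bsub>X\<^esub> ?H (diff X z) w \<oplus>\<^bsub>X\<^esub> ?H (?sg z) (diff X w) =
      diff X (?H z w) \<oplus>\<^bsub>X\<^esub> ?\<Theta> z \<otimes>\<^bsub>X\<^esub> w \<oplus>\<^bsub>X\<^esub> ?sg z \<otimes>\<^bsub>X\<^esub> ?\<Theta> w"
    if z: "z \<in> carrier X" and w: "w \<in> carrier X" for z w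
  proof (rule ten.additive_eqI[OF _ _ _ z])
    show "additive_map X X (\<lambda>z. ?\<Theta> (z \<otimes>\<^bsub>X\<^esub> w) \<oplus>\<^bsub>X\<^esub> ?H (diff X z) w \<oplus>\<^bsub>X\<^esub> ?H (?sg z) (diff X w))"
      by (intro closure additive_comp[OF _ \<Theta>a] additive_comp[OF X.diff_additive HXl[OF w]]
          additive_comp[OF X.sg_additive HXl[OF X.diff_closed[OF w]]] w)
    show "additive_map X X (\<lambda>z. diff X (?H z w) \<oplus>\<^bsub>X\<^esub> ?\<Theta> z \<otimes>\<^bsub>X\<^esub> w \<oplus>\<^bsub>X\<^esub> ?sg z \<otimes>\<^bsub>X\<^esub> ?\<Theta> w)"
      by (intro closure additive_comp[OF HXl[OF w] X.diff_additive] \<Theta>a X.sg_additive w \<Theta>c)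
    fix a s assume a: "a \<in> carrier P" "s \<in> carrier T"
    let ?z = "ten.pt a s"
    have zc: "?z \<in> carrier X" using a by simp
    show "?\<Theta> (?z \<otimes>\<^bsub>X\<^esub> w) \<oplus>\<^bsub>X\<^esub> ?H (diff X ?z) w \<oplus>\<^bsub>X\<^esub> ?H (?sg ?z) (diff X w) =
      diff X (?H ?z w) \<oplus>\<^bsub>X\<^esub> ?\<Theta> ?z \<otimes>\<^bsub>X\<^esub> w \<oplus>\<^bsub>X\<^esub> ?sg ?z \<otimes>\<^bsub>X\<^esub> ?\<Theta> w"
    proof (rule ten.additive_eqI[OF _ _ _ w])
      show "additive_map X X (\<lambda>w. ?\<Theta> (?z \<otimes>\<^bsub>X\<^esub> w) \<oplus>\<^bsub>X\<^esub> ?H (diff X ?z) w \<oplus>\<^bsub>X\<^esub> ?H (?sg ?z) (diff X w))"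
        by (intro closure additive_comp[OF _ \<Theta>a] HXr[OF X.diff_closed[OF zc]]
            additive_comp[OF X.diff_additive HXr[OF X.sg_closed[OF zc]]] zc)
      show "additive_map X X (\<lambda>w. diff X (?H ?z w) \<oplus>\<^bsub>X\<^esub> ?\<Theta> ?z \<otimes>\<^bsub>X\<^esub> w \<oplus>\<^bsub>X\<^esub> ?sg ?z \<otimes>\<^bsub>X\<^esub> ?\<Theta> w)"
        by (intro closure additive_comp[OF HXr[OF zc] X.diff_additive] \<Theta>a X.sg_closed zc \<Theta>c)
      fix b t assume b: "b \<in> carrier P" "t \<in> carrier T"
      show "?\<Theta> (?z \<otimes>\<^bsub>X\<^esub> ten.pt b t) \<oplus>\<^bsub>X\<^esub> ?H (diff X ?z) (ten.pt b t) \<oplus>\<^bsub>X\<^esub> ?H (?sg ?z) (diff X (ten.pt b t)) =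
        diff X (?H ?z (ten.pt b t)) \<oplus>\<^bsub>X\<^esub> ?\<Theta> ?z \<otimes>\<^bsub>X\<^esub> ten.pt b t \<oplus>\<^bsub>X\<^esub> ?sg ?z \<otimes>\<^bsub>X\<^esub> ?\<Theta> (ten.pt b t)"
        using a b H(2)[of a b]
        by (simp add: diff_X ten.pt_mult \<Theta>_pt HX_pt ten.tensor_map_pt[OF diff_lin] ten.tensor_map_pt[OF sg_lin]
            Hc ten.pt_add_left[symmetric])
    qed
  qed
  have H_zero: "?H \<zero>\<^bsub>X\<^esub> Y = \<zero>\<^bsub>X\<^esub>" "?H Y \<zero>\<^bsub>X\<^esub> = \<zero>\<^bsub>X\<^esub>" if "Y \<in> carrier X" for Y
    using additive_zero[OF ten.X.is_abelian_group ten.X.is_abelian_group HXl[OF that]]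
      additive_zero[OF ten.X.is_abelian_group ten.X.is_abelian_group HXr[OF that]] by simp_all
  show ?thesis
  proof (rule tw.good_step[OF r])
    show "ex.gen f \<one>\<^bsub>T\<^esub> \<in> W" using f by auto
    show "linear_map T X X ?\<Theta>" by (rule ten.tensor_map_linear[OF dd.\<theta>_lin])
    show "diff X (?\<Theta> z) = \<ominus>\<^bsub>X\<^esub> ?\<Theta> (diff X z)" if "z \<in> carrier X" for z
      unfolding diff_X by (rule tm_comp_minus[OF diff_lin dd.\<theta>_lin dd.\<theta>_lin diff_lin dd.diff_\<theta> that])
    show "?\<Theta> (?sg z) = \<ominus>\<^bsub>X\<^esub> ?sg (?\<Theta> z)" if "z \<in> carrier X" for z
      by (rule tm_comp_minus[OF dd.\<theta>_lin sg_lin sg_lin dd.\<theta>_lin dd.\<theta>_sg that])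
    show "?\<Theta> \<one>\<^bsub>X\<^esub> = \<zero>\<^bsub>X\<^esub>"
      by (simp add: ten.pt_one \<Theta>_pt dd.\<theta>_0[OF one_homog] ten.pt_zero_left)
    show "\<exists>b\<in>carrier X. ?\<Theta> (z \<otimes>\<^bsub>X\<^esub> w) = diff X b \<oplus>\<^bsub>X\<^esub> ?\<Theta> z \<otimes>\<^bsub>X\<^esub> w \<oplus>\<^bsub>X\<^esub> ?sg z \<otimes>\<^bsub>X\<^esub> ?\<Theta> w"
      if z: "z \<in> cycles X" and w: "w \<in> cycles X" for z w
    proof (intro bexI)
      have c: "z \<in> carrier X" "w \<in> carrier X" "diff X z = \<zero>\<^bsub>X\<^esub>" "diff X w = \<zero>\<^bsub>X\<^esub>"
        using z w by (simp_all add: X.cycles_iff)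
      show "?\<Theta> (z \<otimes>\<^bsub>X\<^esub> w) = diff X (?H z w) \<oplus>\<^bsub>X\<^esub> ?\<Theta> z \<otimes>\<^bsub>X\<^esub> w \<oplus>\<^bsub>X\<^esub> ?sg z \<otimes>\<^bsub>X\<^esub> ?\<Theta> w"
        using homotopy[OF c(1,2)] c by (simp add: H_zero \<Theta>c)
      show "?H z w \<in> carrier X" by (rule HXc[OF c(1,2)])
    qed
    show "?\<Theta> z = \<zero>\<^bsub>X\<^esub>" if "z \<in> homog X 0" for z
      using that homog_submodule
      by (induction rule: ten.homog_X_induct)
        (simp_all add: homog_closed \<Theta>_pt dd.\<theta>_0 ten.pt_zero_left additive_add[OF \<Theta>a])
    show "?\<Theta> z \<in> homog X n" if "z \<in> homog X (Suc n)" for z n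
      using that homog_submodule
    proof (induction rule: ten.homog_X_induct)
      case (pt a t)
      then show ?case using homog_closed[OF pt(1)] by (simp add: \<Theta>_pt ten.pt_homog dd.\<theta>_Suc)
    next
      case (add Y Z)
      then show ?case using subgroup.m_closed[OF submodule.axioms(1)[OF X.homog_submodule]]
        by (simp add: additive_add[OF \<Theta>a])
    qed
  qed
qed

text \<open>One twist per basis element, by induction on the list. Two values are tracked: on degree
  0 the map stays the augmentation, because every \<theta> kills that degree; on \<open>x\<close> of
  degree 1 with boundary \<open>a \<cdot> 1\<close>, the twist for \<open>b\<close> adds the
  generator of \<open>\<psi> b a\<close> times \<open>b\<close>, so in the end the sum over the list
  appears.\<close>

lemma good_exists:
  assumes \<mu>: "linear_map R P RR \<mu>" "\<And>x. x \<in> carrier P \<Longrightarrow> rc (\<mu> x) = \<epsilon> x"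
    and bs: "distinct bs" "set bs \<subseteq> F"
    and \<psi>: "\<And>b a. \<lbrakk>b \<in> set bs; a \<in> I\<rbrakk> \<Longrightarrow> \<psi> b a \<in> carrier S"
      "\<And>b a a'. \<lbrakk>b \<in> set bs; a \<in> I; a' \<in> I\<rbrakk> \<Longrightarrow> \<psi> b (a \<oplus>\<^bsub>R\<^esub> a') = \<psi> b a \<oplus>\<^bsub>S\<^esub> \<psi> b a'"
      "\<And>b r a. \<lbrakk>b \<in> set bs; r \<in> carrier R; a \<in> I\<rbrakk> \<Longrightarrow> \<psi> b (r \<otimes>\<^bsub>R\<^esub> a) = rc r \<otimes>\<^bsub>S\<^esub> \<psi> b a"
  shows "\<exists>r. tw.good r \<and>
    (\<forall>p\<in>homog P 0. \<forall>t\<in>carrier T. r (ten.pt p t) = (h (\<epsilon> p) \<otimes>\<^bsub>T\<^esub> t) \<odot>\<^bsub>L\<^esub> \<one>\<^bsub>L\<^esub>) \<and>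
    (\<forall>a\<in>I. \<forall>x\<in>homog P 1. \<forall>t\<in>carrier T. diff P x = a \<odot> \<one> \<longrightarrow>
      r (ten.pt x t) = ex.gen (finsum M (\<lambda>b. \<psi> b a \<odot>\<^bsub>M\<^esub> b) (set bs)) t)"
  using bs \<psi>
proof (induction bs)
  case Nil
  obtain r where r: "tw.good r" "\<And>p t. \<lbrakk>p \<in> carrier P; t \<in> carrier T\<rbrakk> \<Longrightarrow>
    r (ten.pt p t) = (h (\<epsilon> p) \<otimes>\<^bsub>T\<^esub> t) \<odot>\<^bsub>L\<^esub> \<one>\<^bsub>L\<^esub>"
    using good_base by blast
  have h_zero: "h \<zero>\<^bsub>S\<^esub> = \<zero>\<^bsub>T\<^esub>"
    using additive_zero[OF S.is_abelian_group T.is_abelian_group, of h] ring_hom_add[OF h_hom] by (simp add: additive_map_def)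
  have "r (ten.pt x t) = ex.gen (finsum M (\<lambda>b. \<psi> b a \<odot>\<^bsub>M\<^esub> b) (set [])) t"
    if x: "x \<in> homog P 1" and t: "t \<in> carrier T" for a x t
  proof -
    have "additive_map M L (\<lambda>f. ex.gen f t)"
      using t ex.gen_add[of _ _ t] by (intro additive_mapI) simp_all
    from additive_zero[OF ex.ext.abelian_group_axioms ex.ten.X.is_abelian_group this]
    have "ex.gen \<zero>\<^bsub>M\<^esub> t = \<zero>\<^bsub>L\<^esub>" .
    moreover have "\<epsilon> x = \<zero>\<^bsub>S\<^esub>" using x augmentation_pos[of x 0] by simp
    moreover have "finsum M (\<lambda>b. \<psi> b a \<odot>\<^bsub>M\<^esub> b) (set []) = \<zero>\<^bsub>M\<^esub>"
      by (simp add: ex.ext.finsum_empty)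
    ultimately show ?thesis using t homog_closed[OF x] by (simp add: r h_zero)
  qed
  then show ?case using r homog_closed by (intro exI[of _ r]) auto
next
  case (Cons b bs)
  obtain r where r: "tw.good r"
    "\<And>p t. \<lbrakk>p \<in> homog P 0; t \<in> carrier T\<rbrakk> \<Longrightarrow> r (ten.pt p t) = (h (\<epsilon> p) \<otimes>\<^bsub>T\<^esub> t) \<odot>\<^bsub>L\<^esub> \<one>\<^bsub>L\<^esub>"
    "\<And>a x t. \<lbrakk>a \<in> I; x \<in> homog P 1; t \<in> carrier T; diff P x = a \<odot> \<one>\<rbrakk> \<Longrightarrow>
      r (ten.pt x t) = ex.gen (finsum M (\<lambda>b. \<psi> b a \<odot>\<^bsub>M\<^esub> b) (set bs)) t"
    using Cons.IH Cons.prems by auto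
  have b: "b \<in> F" "b \<notin> set bs" "set bs \<subseteq> F" using Cons.prems(1,2) by auto
  interpret fr: functional_resolution R P I \<epsilon> C \<kappa> "\<psi> b" \<mu>
    by unfold_locales (use Cons.prems \<mu> in auto)
  obtain \<theta> where \<theta>: "lin \<theta>" "\<And>x. x \<in> homog P 0 \<Longrightarrow> \<theta> x = \<zero>" "\<And>n x. x \<in> homog P (Suc n) \<Longrightarrow> \<theta> x \<in> homog P n"
    "\<And>x. x \<in> homog P 1 \<Longrightarrow> \<epsilon> (\<theta> x) = fr.\<phi> x" "\<And>x. x \<in> carrier P \<Longrightarrow> diff P (\<theta> x) = \<ominus> \<theta> (diff P x)"
    using fr.degree_lowering_exists by blast
  interpret dd: derivation_data R P I \<epsilon> C \<kappa> "\<psi> b" \<mu> \<theta>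
    by unfold_locales (use \<theta> in auto)
  define r' where "r' z = r z \<oplus>\<^bsub>L\<^esub> ex.gen b \<one>\<^bsub>T\<^esub> \<otimes>\<^bsub>L\<^esub> r (ten.tensor_map \<theta> z)" for z
  have good: "tw.good r'"
    unfolding r'_def by (rule good_derivation[OF dd.derivation_data_axioms b(1) r(1)])
  have add: "additive_map X L r" using r(1) unfolding tw.good_def linear_map_def by (elim conjE)
  have r_zero: "r \<zero>\<^bsub>X\<^esub> = \<zero>\<^bsub>L\<^esub>" by (rule additive_zero[OF ten.X.is_abelian_group ex.ten.X.is_abelian_group add])
  have r'_pt: "r' (ten.pt x t) = r (ten.pt x t) \<oplus>\<^bsub>L\<^esub> ex.gen b \<one>\<^bsub>T\<^esub> \<otimes>\<^bsub>L\<^esub> r (ten.pt (\<theta> x) t)"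
    if "x \<in> carrier P" "t \<in> carrier T" for x t
    using that by (simp add: r'_def ten.tensor_map_pt[OF \<theta>(1)])
  have "r' (ten.pt p t) = (h (\<epsilon> p) \<otimes>\<^bsub>T\<^esub> t) \<odot>\<^bsub>L\<^esub> \<one>\<^bsub>L\<^esub>" if p: "p \<in> homog P 0" "t \<in> carrier T" for p t
    using p b homog_closed[OF p(1)] by (simp add: r'_pt \<theta>(2) ten.pt_zero_left r_zero r(2))
  moreover have "r' (ten.pt x t) = ex.gen (finsum M (\<lambda>b. \<psi> b a \<odot>\<^bsub>M\<^esub> b) (set (b # bs))) t"
    if a: "a \<in> I" and x: "x \<in> homog P 1" and t: "t \<in> carrier T" and d: "diff P x = a \<odot> \<one>" for a x t
  proof -
    note xc = homog_closed[OF x]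
    have k: "\<psi> b a \<in> carrier S" using Cons.prems(3)[of b a] a by simp
    have terms: "\<psi> c a \<odot>\<^bsub>M\<^esub> c \<in> carrier M" if "c \<in> set (b # bs)" for c
      using ex.ext.smult_closed[of "\<psi> c a" c] Cons.prems(2,3) a that by auto
    \<comment> \<open>\<theta> takes \<open>x\<close> to degree 0, where \<open>r\<close> is known
      to be the augmentation; so the new term only sees the augmentation of
      \<open>\<theta> x\<close>, which is \<open>\<psi> b a\<close>.\<close>
    have "\<theta> x \<in> homog P 0" using \<theta>(3)[of x 0] x by simp
    then have "r (ten.pt (\<theta> x) t) = (h (fr.\<phi> x) \<otimes>\<^bsub>T\<^esub> t) \<odot>\<^bsub>L\<^esub> \<one>\<^bsub>L\<^esub>" using t x by (simp add: r(2) \<theta>(4))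
    also have "fr.\<phi> x = \<psi> b a" by (rule fr.\<phi>_eq[OF xc a d])
    finally have "ex.gen b \<one>\<^bsub>T\<^esub> \<otimes>\<^bsub>L\<^esub> r (ten.pt (\<theta> x) t) = ex.gen (\<psi> b a \<odot>\<^bsub>M\<^esub> b) t"
      using b t k ex.gen_balance[of "\<psi> b a" b t]
      by (simp add: ex.ten.X.smult_mult_right ex.gen_smult)
    then have "r' (ten.pt x t) = ex.gen (finsum M (\<lambda>b. \<psi> b a \<odot>\<^bsub>M\<^esub> b) (set bs)) t \<oplus>\<^bsub>L\<^esub> ex.gen (\<psi> b a \<odot>\<^bsub>M\<^esub> b) t"
      using xc t x a d by (simp add: r'_pt r(3))
    also have "\<dots> = ex.gen (finsum M (\<lambda>b. \<psi> b a \<odot>\<^bsub>M\<^esub> b) (set bs) \<oplus>\<^bsub>M\<^esub> \<psi> b a \<odot>\<^bsub>M\<^esub> b) t"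
      using terms t by (intro ex.gen_add[symmetric] ex.ext.finsum_closed) auto
    also have "finsum M (\<lambda>b. \<psi> b a \<odot>\<^bsub>M\<^esub> b) (set bs) \<oplus>\<^bsub>M\<^esub> \<psi> b a \<odot>\<^bsub>M\<^esub> b =
        \<psi> b a \<odot>\<^bsub>M\<^esub> b \<oplus>\<^bsub>M\<^esub> finsum M (\<lambda>b. \<psi> b a \<odot>\<^bsub>M\<^esub> b) (set bs)"
      using terms by (intro ex.ext.a_comm ex.ext.finsum_closed) auto
    also have "\<dots> = finsum M (\<lambda>b. \<psi> b a \<odot>\<^bsub>M\<^esub> b) (set (b # bs))"
      using terms b(2) by (simp add: ex.ext.finsum_insert)
    finally show ?thesis .
  qed
  ultimately show ?case using good by blast
qed

end

context tor_main
begin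

subsection \<open>The natural map\<close>

abbreviation "Tor \<equiv> tor_algebra R I P h T"

lemma Tor_eq: "Tor = homology X"
  by (simp add: tor_algebra_def)

lemma degree_one_lift:
  assumes "a \<in> I"
  shows "\<exists>x\<in>homog P 1. diff P x = a \<odot> \<one>"
proof (rule exact_aug)
  have a: "a \<in> carrier R" by (rule I.Icarr[OF assms])
  show "a \<odot> \<one> \<in> homog P 0" using a one_homog by (rule homog_smult)
  have "rc a = \<zero>\<^bsub>S\<^esub>" using I.a_rcos_const[OF assms] by (simp add: FactRing_def)
  then show "\<epsilon> (a \<odot> \<one>) = \<zero>\<^bsub>S\<^esub>" using a by (simp add: augmentation_smult)
qed

lemma h_zero_of_I: "a \<in> I \<Longrightarrow> h (rc a) = \<zero>\<^bsub>T\<^esub>"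
  using additive_zero[OF S.is_abelian_group T.is_abelian_group, of h] ring_hom_add[OF h_hom] I.a_rcos_const[of a]
  by (simp add: additive_map_def FactRing_def)

text \<open>For \<open>c = \<Sum> u\<^sub>i v\<^sub>i\<close> in \<open>I\<^sup>2\<close> the preimage \<open>\<Sum> u\<^sub>i y\<^sub>i\<close> with \<open>\<partial> y\<^sub>i = v\<^sub>i\<close> vanishes after tensoring with \<open>T\<close>.\<close>

lemma square_lift:
  assumes "c \<in> con.I2"
  shows "\<exists>y\<in>homog P 1. diff P y = c \<odot> \<one> \<and> (\<forall>t\<in>carrier T. ten.pt y t = \<zero>\<^bsub>X\<^esub>)"
  using assms
proof (induction rule: ideal_prod.induct)
  case (prod i j)
  obtain z where z: "z \<in> homog P 1" "diff P z = j \<odot> \<one>" using degree_one_lift[OF prod(2)] by auto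
  note c = I.Icarr[OF prod(1)] I.Icarr[OF prod(2)] homog_closed[OF z(1)]
  have "diff P (i \<odot> z) = (i \<otimes>\<^bsub>R\<^esub> j) \<odot> \<one>" using c z by (simp add: diff_smult smult_assoc1)
  moreover have "ten.pt (i \<odot> z) t = \<zero>\<^bsub>X\<^esub>" if "t \<in> carrier T" for t
    using c that by (simp add: ten.pt_balance h_zero_of_I[OF prod(1)] ten.pt_zero_right)
  ultimately show ?case using homog_smult[OF c(1) z(1)] by blast
next
  case (sum s1 s2)
  obtain y1 y2 where y: "y1 \<in> homog P 1" "diff P y1 = s1 \<odot> \<one>" "\<forall>t\<in>carrier T. ten.pt y1 t = \<zero>\<^bsub>X\<^esub>"
    "y2 \<in> homog P 1" "diff P y2 = s2 \<odot> \<one>" "\<forall>t\<in>carrier T. ten.pt y2 t = \<zero>\<^bsub>X\<^esub>"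
    using sum.IH by auto
  have s: "s1 \<in> carrier R" "s2 \<in> carrier R"
    using sum.hyps con.I2.Icarr by auto
  show ?case
    using y s homog_closed[OF y(1)] homog_closed[OF y(4)] homog_add[OF y(1,4)]
    by (intro bexI[of _ "y1 \<oplus> y2"]) (simp_all add: diff_add smult_l_distr ten.pt_add_left)
qed

text \<open>\<open>a\<close> and \<open>a'\<close> differ by an element of the square of
  \<open>I\<close>; let \<open>y\<close> be its lift from \<open>square_lift\<close>. Then
  \<open>x - x' - y\<close> is a cycle of degree 1, hence a boundary, and \<open>y\<close>
  disappears after tensoring.\<close>

lemma class_well_defined:
  assumes a: "a \<in> I" "a' \<in> I" "con.cn a = con.cn a'" and x: "x \<in> homog P 1" "x' \<in> homog P 1"
    and d: "diff P x = a \<odot> \<one>" "diff P x' = a' \<odot> \<one>" and t: "t \<in> carrier T"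
  shows "X.hc (ten.pt x t) = X.hc (ten.pt x' t)"
proof -
  note c = homog_closed[OF x(1)] homog_closed[OF x(2)] I.Icarr[OF a(1)] I.Icarr[OF a(2)]
  have "a \<ominus>\<^bsub>R\<^esub> a' \<in> con.I2" using con.cn_eq_iff[OF a(1,2)] a(3) by simp
  from square_lift[OF this]
  obtain y where y: "y \<in> homog P 1" "diff P y = (a \<ominus>\<^bsub>R\<^esub> a') \<odot> \<one>" "\<forall>t\<in>carrier T. ten.pt y t = \<zero>\<^bsub>X\<^esub>"
    by (elim bexE conjE)
  note yc = homog_closed[OF y(1)]
  have w: "x \<oplus> \<ominus> x' \<oplus> \<ominus> y \<in> homog P 1"
    by (intro homog_add homog_minus x y)
  have "diff P y = a \<odot> \<one> \<oplus> \<ominus> (a' \<odot> \<one>)"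
    using c y(2) by (simp add: a_minus_def smult_l_distr smult_l_minus)
  then have "diff P (x \<oplus> \<ominus> x' \<oplus> \<ominus> y) = \<zero>"
    using c yc d by (simp add: diff_add diff_minus r_neg)
  then obtain p where p: "p \<in> homog P 2" "diff P p = x \<oplus> \<ominus> x' \<oplus> \<ominus> y"
    using exact_pos[of "x \<oplus> \<ominus> x' \<oplus> \<ominus> y" 0] w by (auto simp: numeral_2_eq_2)
  note pc = homog_closed[OF p(1)]
  have "diff X (ten.pt p t) = ten.pt x t \<ominus>\<^bsub>X\<^esub> ten.pt x' t"
    using pc t c yc y(3)[rule_format, OF t] by (simp add: diff_X ten.tensor_map_pt[OF diff_lin] p(2) ten.pt_add_left ten.pt_minus a_minus_def)
  then have "ten.pt x t \<ominus>\<^bsub>X\<^esub> ten.pt x' t \<in> X.B"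
    using X.boundariesI[of "ten.pt p t"] pc t by simp
  then show ?thesis
    using X.hc_eq_iff[OF pt_cycle[OF x(1) d(1) a(1) t] pt_cycle[OF x(2) d(2) a(2) t]] by simp
qed

text \<open>The isomorphism of the conormal module tensored with \<open>T\<close> to the first Tor
  module, evaluated at \<open>f \<otimes> 1\<close>. The choice of \<open>x\<close> and of the
  representative \<open>a\<close> does not matter, by \<open>class_well_defined\<close>.\<close>

definition deg1 :: "'a set \<Rightarrow> ('p \<times> 't \<Rightarrow>\<^sub>0 int) set set" where
  "deg1 f = X.hc (ten.pt (SOME x. x \<in> homog P 1 \<and> (\<exists>a\<in>I. con.cn a = f \<and> diff P x = a \<odot> \<one>)) \<one>\<^bsub>T\<^esub>)"

lemma deg1_eq:
  assumes a: "a \<in> I" and x: "x \<in> homog P 1" and d: "diff P x = a \<odot> \<one>"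
  shows "deg1 (con.cn a) = X.hc (ten.pt x \<one>\<^bsub>T\<^esub>)"
proof -
  let ?Q = "\<lambda>x. x \<in> homog P 1 \<and> (\<exists>a'\<in>I. con.cn a' = con.cn a \<and> diff P x = a' \<odot> \<one>)"
  have "?Q (SOME x. ?Q x)" by (rule someI[of ?Q x]) (use assms in blast)
  then obtain a' where "(SOME x. ?Q x) \<in> homog P 1" "a' \<in> I" "con.cn a' = con.cn a"
    "diff P (SOME x. ?Q x) = a' \<odot> \<one>" by blast
  then show ?thesis
    unfolding deg1_def using class_well_defined[OF _ a _ _ x _ d, of a' "SOME x. ?Q x" "\<one>\<^bsub>T\<^esub>"] by simp
qed

lemma F_cases:
  assumes "f \<in> F"
  obtains a x where "a \<in> I" "f = con.cn a" "x \<in> homog P 1" "diff P x = a \<odot> \<one>"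
proof -
  have "f \<in> carrier con.N" using assms F_sub by auto
  then obtain a where "a \<in> I" "f = con.cn a" by (rule con.N_cases)
  with degree_one_lift[of a] that show thesis by blast
qed

text \<open>The universal property \<open>hom_lift\<close> is applied to \<open>deg1\<close>. Its
  values square to zero because squares of elements of odd degree in \<open>P\<close> are zero,
  which anticommutativity alone would not give. Restriction to the carrier makes the map
  extensional.\<close>

lemma natural_map_exists:
  obtains \<nu> where "is_natural_map R I F P h T \<nu>"
proof -
  note one = T.one_closed
  have deg1_additive: "additive_map M (homology X) deg1"
  proof (rule additive_mapI)
    fix f g assume "f \<in> carrier M" "g \<in> carrier M"
    then have f: "f \<in> F" and g: "g \<in> F" by simp_all
    obtain a x where ax: "a \<in> I" "f = con.cn a" "x \<in> homog P 1" "diff P x = a \<odot> \<one>" using f by (rule F_cases)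
    obtain b y where by': "b \<in> I" "g = con.cn b" "y \<in> homog P 1" "diff P y = b \<odot> \<one>" using g by (rule F_cases)
    note c = homog_closed[OF ax(3)] homog_closed[OF by'(3)] I.Icarr[OF ax(1)] I.Icarr[OF by'(1)]
    note cyc = pt_cycle[OF ax(3,4,1) one] pt_cycle[OF by'(3,4,1) one]
    show "deg1 f \<in> carrier (homology X)"
      unfolding ax(2) deg1_eq[OF ax(1,3,4)] by (rule X.hc_closed[OF cyc(1)])
    have "f \<oplus>\<^bsub>M\<^esub> g = con.cn (a \<oplus>\<^bsub>R\<^esub> b)" using con.cn_add ax by' by simp
    moreover have "a \<oplus>\<^bsub>R\<^esub> b \<in> I" using ax by' by (intro I.a_closed)
    moreover have "diff P (x \<oplus> y) = (a \<oplus>\<^bsub>R\<^esub> b) \<odot> \<one>" using c ax by' by (simp add: diff_add smult_l_distr)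
    ultimately have "deg1 (f \<oplus>\<^bsub>M\<^esub> g) = X.hc (ten.pt (x \<oplus> y) \<one>\<^bsub>T\<^esub>)"
      using deg1_eq homog_add[OF ax(3) by'(3)] by simp
    also have "\<dots> = deg1 f \<oplus>\<^bsub>homology X\<^esub> deg1 g"
      unfolding ax(2) by'(2) deg1_eq[OF ax(1,3,4)] deg1_eq[OF by'(1,3,4)]
      using c cyc by (simp add: ten.pt_add_left X.hc_add)
    finally show "deg1 (f \<oplus>\<^bsub>M\<^esub> g) = deg1 f \<oplus>\<^bsub>homology X\<^esub> deg1 g" .
  qed
  have deg1_smult: "deg1 (s \<odot>\<^bsub>M\<^esub> f) = h s \<odot>\<^bsub>homology X\<^esub> deg1 f" if s: "s \<in> carrier S" and "f \<in> carrier M" for s f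
  proof -
    have "f \<in> F" using that(2) by simp
    then obtain a x where ax: "a \<in> I" "f = con.cn a" "x \<in> homog P 1" "diff P x = a \<odot> \<one>" by (rule F_cases)
    obtain r where r: "r \<in> carrier R" "s = rc r" using s by (rule con.S_cases)
    note c = homog_closed[OF ax(3)] I.Icarr[OF ax(1)]
    note cyc = pt_cycle[OF ax(3,4,1) one]
    have "s \<odot>\<^bsub>M\<^esub> f = con.cn (r \<otimes>\<^bsub>R\<^esub> a)" using con.cn_smult ax r by simp
    moreover have "r \<otimes>\<^bsub>R\<^esub> a \<in> I" using ax r by (intro I.I_l_closed)
    moreover have "diff P (r \<odot> x) = (r \<otimes>\<^bsub>R\<^esub> a) \<odot> \<one>" using c ax r by (simp add: diff_smult smult_assoc1)
    ultimately have "deg1 (s \<odot>\<^bsub>M\<^esub> f) = X.hc (ten.pt (r \<odot> x) \<one>\<^bsub>T\<^esub>)"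
      using deg1_eq homog_smult[OF r(1) ax(3)] by simp
    also have "ten.pt (r \<odot> x) \<one>\<^bsub>T\<^esub> = h s \<odot>\<^bsub>X\<^esub> ten.pt x \<one>\<^bsub>T\<^esub>"
      using c r by (simp add: ten.pt_balance ten.pt_smult)
    also have "X.hc \<dots> = h s \<odot>\<^bsub>homology X\<^esub> deg1 f"
      unfolding ax(2) deg1_eq[OF ax(1,3,4)] using X.hc_smult[OF h_closed[OF s] cyc] by simp
    finally show ?thesis .
  qed
  have deg1_square: "deg1 f \<otimes>\<^bsub>homology X\<^esub> deg1 f = \<zero>\<^bsub>homology X\<^esub>" if "f \<in> carrier M" for f
  proof -
    have "f \<in> F" using that by simp
    then obtain a x where ax: "a \<in> I" "f = con.cn a" "x \<in> homog P 1" "diff P x = a \<odot> \<one>" by (rule F_cases)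
    note cyc = pt_cycle[OF ax(3,4,1) one]
    have "ten.pt x \<one>\<^bsub>T\<^esub> \<otimes>\<^bsub>X\<^esub> ten.pt x \<one>\<^bsub>T\<^esub> = \<zero>\<^bsub>X\<^esub>"
      using homog_closed[OF ax(3)] odd_square[OF ax(3)] by (simp add: ten.pt_mult ten.pt_zero_left)
    then show ?thesis
      unfolding ax(2) deg1_eq[OF ax(1,3,4)] using cyc by (simp add: X.hc_mult X.hc_zero)
  qed
  have deg1_homog: "deg1 f \<otimes>\<^bsub>homology X\<^esub> Y \<in> homog (homology X) (Suc n)"
    if f: "f \<in> carrier M" and Y: "Y \<in> homog (homology X) n" for f Y n
  proof -
    have "f \<in> F" using f by simp
    then obtain a x where ax: "a \<in> I" "f = con.cn a" "x \<in> homog P 1" "diff P x = a \<odot> \<one>" by (rule F_cases)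
    note cyc = pt_cycle[OF ax(3,4,1) one]
    obtain z where z: "z \<in> cycles X" "z \<in> homog X n" "Y = X.hc z" using Y by (auto simp: X.H_fields)
    have "ten.pt x \<one>\<^bsub>T\<^esub> \<otimes>\<^bsub>X\<^esub> z \<in> homog X (Suc n)"
      using z(2) homog_submodule
    proof (induction rule: ten.homog_X_induct)
      case (pt b t)
      then show ?case
        using mult_homog[OF ax(3) pt(1)] homog_closed[OF ax(3)] homog_closed[OF pt(1)] by (simp add: ten.pt_mult ten.pt_homog)
    next
      case (add Y Z)
      then show ?case
        using subgroup.m_closed[OF submodule.axioms(1)[OF X.homog_submodule]] homog_closed[OF ax(3)]
        by (simp add: ten.X.r_distr)
    qed
    then show ?thesis
      unfolding ax(2) deg1_eq[OF ax(1,3,4)] z(3) using cyc z(1) X.cycles_mult[OF cyc z(1)]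
      by (simp add: X.hc_mult X.H_fields(6))
  qed
  have one_homog': "\<one>\<^bsub>homology X\<^esub> \<in> homog (homology X) 0"
    unfolding X.hc_one X.H_fields(6) using X.cycles_one ten.pt_homog[OF one_homog one] by (simp add: ten.pt_one)
  obtain \<nu> where \<nu>: "\<nu> \<in> ring_hom L (homology X)"
    "\<And>s Y. \<lbrakk>s \<in> carrier T; Y \<in> carrier L\<rbrakk> \<Longrightarrow> \<nu> (s \<odot>\<^bsub>L\<^esub> Y) = s \<odot>\<^bsub>homology X\<^esub> \<nu> Y"
    "\<And>f t. \<lbrakk>f \<in> carrier M; t \<in> carrier T\<rbrakk> \<Longrightarrow> \<nu> (ex.gen f t) = t \<odot>\<^bsub>homology X\<^esub> deg1 f"
    "\<And>n. \<nu> ` homog L n \<subseteq> homog (homology X) n"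
    using ex.hom_lift[OF X.H_scalar_alg deg1_additive deg1_smult deg1_square X.H_homog_submodule one_homog' deg1_homog]
    by blast
  define \<nu>' where "\<nu>' = restrict \<nu> (carrier L)"
  have \<nu>': "\<nu>' Y = \<nu> Y" if "Y \<in> carrier L" for Y using that by (simp add: \<nu>'_def)
  have "is_natural_map R I F P h T \<nu>'"
    unfolding is_natural_map_def
  proof (intro conjI ballI impI)
    show "\<nu>' \<in> extensional (carrier L)" by (simp add: \<nu>'_def)
    show "\<nu>' \<in> graded_alg_hom T L Tor"
      unfolding graded_alg_hom_def Tor_eq
    proof (intro CollectI conjI ballI allI image_subsetI ring_hom_memI)
      fix n Y assume Y: "Y \<in> homog L n"
      then have "\<nu>' Y = \<nu> Y" using \<nu>' ex.homog_subset[of n] by blast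
      then show "\<nu>' Y \<in> homog (homology X) n" using \<nu>(4)[of n] Y by auto
    qed (simp_all add: \<nu>' \<nu>(2) ring_hom_closed[OF \<nu>(1)] ring_hom_mult[OF \<nu>(1)] ring_hom_add[OF \<nu>(1)] ring_hom_one[OF \<nu>(1)])
    fix a x t assume a: "a \<in> I" and x: "x \<in> homog P 1" and t: "t \<in> carrier T"
      and "con.cn a \<in> F \<and> diff P x = a \<odot> \<one>"
    then have F: "con.cn a \<in> F" and d: "diff P x = a \<odot> \<one>" by auto
    have "\<nu>' (ex.gen (con.cn a) t) = t \<odot>\<^bsub>homology X\<^esub> X.hc (ten.pt x \<one>\<^bsub>T\<^esub>)"
      using F t by (simp add: \<nu>' \<nu>(3) deg1_eq[OF a x d])
    also have "\<dots> = X.hc (ten.pt x t)"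
      using X.hc_smult[OF t pt_cycle[OF x d a one]] t homog_closed[OF x] by (simp add: ten.pt_smult)
    finally show "\<nu>' (ext_tensor_gen R I F h T (con.cn a) t) = X.hc (ten.pt x t)" by (simp add: gen_eq)
  qed
  then show thesis by (rule that)
qed

lemma natural_map_gen:
  assumes \<nu>: "is_natural_map R I F P h T \<nu>" and "a \<in> I" "x \<in> homog P 1" "t \<in> carrier T" "con.cn a \<in> F" "diff P x = a \<odot> \<one>"
  shows "\<nu> (ex.gen (con.cn a) t) = X.hc (ten.pt x t)"
  using assms unfolding is_natural_map_def gen_eq[symmetric] by blast

lemma natural_map_hom:
  assumes "is_natural_map R I F P h T \<nu>"
  shows "\<nu> \<in> ring_hom L (homology X)" "\<And>s Y. \<lbrakk>s \<in> carrier T; Y \<in> carrier L\<rbrakk> \<Longrightarrow> \<nu> (s \<odot>\<^bsub>L\<^esub> Y) = s \<odot>\<^bsub>homology X\<^esub> \<nu> Y"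
  using assms unfolding is_natural_map_def graded_alg_hom_def Tor_eq by auto

lemma natural_map_unique:
  assumes \<nu>: "is_natural_map R I F P h T \<nu>" and \<nu>': "is_natural_map R I F P h T \<nu>'"
  shows "\<nu> = \<nu>'"
proof (rule extensionalityI)
  show "\<nu> \<in> extensional (carrier L)" "\<nu>' \<in> extensional (carrier L)"
    using \<nu> \<nu>' by (simp_all add: is_natural_map_def)
  fix Y assume Y: "Y \<in> carrier L"
  show "\<nu> Y = \<nu>' Y"
  proof (rule ex.hom_eqI[OF X.H_scalar_alg natural_map_hom[OF \<nu>] natural_map_hom[OF \<nu>'] _ Y])
    fix f t assume "f \<in> carrier M" and t: "t \<in> carrier T"
    then have f: "f \<in> F" by simp
    then obtain a x where ax: "a \<in> I" "f = con.cn a" "x \<in> homog P 1" "diff P x = a \<odot> \<one>" by (rule F_cases)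
    then show "\<nu> (ex.gen f t) = \<nu>' (ex.gen f t)"
      using natural_map_gen[OF \<nu> ax(1,3) t _ ax(4)] natural_map_gen[OF \<nu>' ax(1,3) t _ ax(4)] f by simp
  qed
qed

text \<open>The composite is a homomorphism of \<open>T\<close>-algebras that fixes all
  \<open>gen f t\<close>, so it is the identity by \<open>hom_eqI\<close>.\<close>

lemma natural_map_splits:
  assumes \<nu>: "is_natural_map R I F P h T \<nu>" and r: "tw.good r"
    and r_gen: "\<And>a x t. \<lbrakk>a \<in> I; x \<in> homog P 1; t \<in> carrier T; diff P x = a \<odot> \<one>; con.cn a \<in> F\<rbrakk> \<Longrightarrow>
      r (ten.pt x t) = ex.gen (con.cn a) t"
  shows "\<exists>\<rho>\<in>graded_alg_hom T Tor L. \<forall>Y\<in>carrier L. \<rho> (\<nu> Y) = Y"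
proof -
  obtain \<rho> where \<rho>: "\<rho> \<in> graded_alg_hom T (homology X) L" "\<And>z. z \<in> cycles X \<Longrightarrow> \<rho> (X.hc z) = r z"
    using tw.good_descends[OF r] by blast
  have \<rho>_hom: "\<rho> \<in> ring_hom (homology X) L"
    and \<rho>_smult: "\<And>s Y. \<lbrakk>s \<in> carrier T; Y \<in> carrier (homology X)\<rbrakk> \<Longrightarrow> \<rho> (s \<odot>\<^bsub>homology X\<^esub> Y) = s \<odot>\<^bsub>L\<^esub> \<rho> Y"
    using \<rho>(1) unfolding graded_alg_hom_def by auto
  note \<nu>h = natural_map_hom[OF \<nu>]
  have "\<rho> (\<nu> Y) = Y" if Y: "Y \<in> carrier L" for Y
  proof (rule ex.hom_eqI[OF ex.ten.X.scalar_alg_axioms _ _ _ _ _ Y])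
    show "(\<lambda>Y. \<rho> (\<nu> Y)) \<in> ring_hom L L"
      using ring_hom_trans[OF \<nu>h(1) \<rho>_hom] by (simp add: comp_def)
    show "(\<lambda>Y. Y) \<in> ring_hom L L" by (rule ring_hom_memI) simp_all
    show "\<rho> (\<nu> (s \<odot>\<^bsub>L\<^esub> Y)) = s \<odot>\<^bsub>L\<^esub> \<rho> (\<nu> Y)" if "s \<in> carrier T" "Y \<in> carrier L" for s Y
      using that by (simp add: \<nu>h(2) \<rho>_smult ring_hom_closed[OF \<nu>h(1)])
    fix f t assume "f \<in> carrier M" and t: "t \<in> carrier T"
    then have f: "f \<in> F" by simp
    then obtain a x where ax: "a \<in> I" "f = con.cn a" "x \<in> homog P 1" "diff P x = a \<odot> \<one>" by (rule F_cases)
    have "\<nu> (ex.gen f t) = X.hc (ten.pt x t)" using natural_map_gen[OF \<nu> ax(1,3) t _ ax(4)] f ax(2) by simp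
    then have "\<rho> (\<nu> (ex.gen f t)) = r (ten.pt x t)" using \<rho>(2) pt_cycle[OF ax(3,4,1) t] by simp
    also have "\<dots> = ex.gen f t" using r_gen[OF ax(1,3) t ax(4)] f ax(2) by simp
    finally show "\<rho> (\<nu> (ex.gen f t)) = ex.gen f t" .
  qed simp
  then show ?thesis using \<rho>(1) unfolding Tor_eq by blast
qed

end

theorem theorem4p1:
  fixes R :: "('a, 'm) ring_scheme" and I :: "'a set" and F :: "'a set set"
    and T :: "('t, 'l) ring_scheme" and h :: "'a set \<Rightarrow> 't"
    and P :: "('a, 'p, 'n) dg_algebra_scheme" and \<epsilon> :: "'p \<Rightarrow> 'a set"
  assumes "noetherian_local_ring R"
    and "ideal I R"
    and "direct_summand (R Quot I) (conormal R I) F"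
    and "free_module (R Quot I) ((conormal R I)\<lparr>carrier := F\<rparr>)"
    and "cring T"
    and "h \<in> ring_hom (R Quot I) T"
    and "dg_algebra_resolution R P I \<epsilon>"
  shows "(\<exists>!\<nu>. is_natural_map R I F P h T \<nu>) \<and>
    (\<forall>\<nu>. is_natural_map R I F P h T \<nu> \<longrightarrow>
      (\<exists>\<rho> \<in> graded_alg_hom T (tor_algebra R I P h T) (ext_tensor R I F h T).
        \<forall>x \<in> carrier (ext_tensor R I F h T). \<rho> (\<nu> x) = x))"
proof -
  interpret res: dg_algebra_resolution R P I \<epsilon> by fact
  interpret I: ideal I R by fact
  have R: "cring R" "noetherian_ring R" using assms(1) by (auto simp: noetherian_local_ring_def)
  interpret con: conormal_ideal I R by (intro conormal_ideal.intro assms(2) R(1))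
  obtain C \<kappa> where C: "based_module R P C snd \<kappa>" "\<And>c. c \<in> C \<Longrightarrow> snd c \<in> homog P (fst c)"
    "\<And>c x n. \<lbrakk>c \<in> C; x \<in> homog P n; fst c \<noteq> n\<rbrakk> \<Longrightarrow> \<kappa> c x = \<zero>\<^bsub>R\<^esub>"
    using res.homogeneous_coords[OF res.free_homog] by blast
  have F_sub: "F \<subseteq> carrier (conormal R I)"
    using assms(3) subgroup.subset[of F "add_monoid (conormal R I)"] unfolding direct_summand_def submodule_def by simp
  have cr: "coord_resolution R P I \<epsilon> C \<kappa>"
    by (intro coord_resolution.intro coord_resolution_axioms.intro assms(7,2) C)
  interpret tor_main R P I \<epsilon> C \<kappa> T h F
    using assms(4) F_sub
    by (intro tor_main.intro tor_main_axioms.intro tor_setup.intro tor_setup_axioms.intro cr assms(5,6))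
      (auto simp: free_module_def)
  obtain B \<tau> \<psi> where fin: "finite B" and bm: "based_module S M B (\<lambda>b. b) \<tau>"
    and \<psi>: "\<And>b a. \<lbrakk>b \<in> B; a \<in> I\<rbrakk> \<Longrightarrow> \<psi> b a \<in> carrier S"
    "\<And>b a a'. \<lbrakk>b \<in> B; a \<in> I; a' \<in> I\<rbrakk> \<Longrightarrow> \<psi> b (a \<oplus>\<^bsub>R\<^esub> a') = \<psi> b a \<oplus>\<^bsub>S\<^esub> \<psi> b a'"
    "\<And>b r a. \<lbrakk>b \<in> B; r \<in> carrier R; a \<in> I\<rbrakk> \<Longrightarrow> \<psi> b (r \<otimes>\<^bsub>R\<^esub> a) = rc r \<otimes>\<^bsub>S\<^esub> \<psi> b a"
    "\<And>b a. \<lbrakk>b \<in> B; a \<in> I; con.cn a \<in> F\<rbrakk> \<Longrightarrow> \<psi> b a = \<tau> b (con.cn a)"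
    using con.conormal_coordinates[OF R(2) assms(3,4)] by blast
  interpret bm: based_module S M B "\<lambda>b. b" \<tau> by (rule bm)
  obtain \<mu> where \<mu>: "linear_map R P RR \<mu>" "\<And>x. x \<in> carrier P \<Longrightarrow> rc (\<mu> x) = \<epsilon> x"
    using obtain_eps_lift by blast
  \<comment> \<open>An enumeration of the basis fixes the order in which the twists are composed;
    any order will do.\<close>
  obtain bs where bs: "set bs = B" "distinct bs" using finite_distinct_list[OF fin] by auto
  have "set bs \<subseteq> F" using bm.e_closed bs(1) by auto
  from good_exists[OF \<mu> bs(2) this, of \<psi>] \<psi> bs(1)
  obtain r where r: "tw.good r" "\<And>a x t. \<lbrakk>a \<in> I; x \<in> homog P 1; t \<in> carrier T; diff P x = a \<odot>\<^bsub>P\<^esub> \<one>\<^bsub>P\<^esub>\<rbrakk> \<Longrightarrow>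
      r (ten.pt x t) = ex.gen (finsum M (\<lambda>b. \<psi> b a \<odot>\<^bsub>M\<^esub> b) B) t"
    by auto
  \<comment> \<open>For a class in \<open>F\<close> the functionals are its coordinates, so the sum
    accumulated by the twists is the class itself. The sum over all of the finite \<open>B\<close>
    replaces the one over the support.\<close>
  have expand: "finsum M (\<lambda>b. \<psi> b a \<odot>\<^bsub>M\<^esub> b) B = con.cn a" if a: "a \<in> I" "con.cn a \<in> F" for a
  proof -
    have f: "con.cn a \<in> carrier M" using a by simp
    have "finsum M (\<lambda>b. \<psi> b a \<odot>\<^bsub>M\<^esub> b) B = finsum M (\<lambda>b. \<tau> b (con.cn a) \<odot>\<^bsub>M\<^esub> b) B"
    proof (rule ex.ext.finsum_cong'[OF refl])
      show "(\<lambda>b. \<tau> b (con.cn a) \<odot>\<^bsub>M\<^esub> b) \<in> B \<rightarrow> carrier M"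
        using f bm.\<kappa>_closed bm.e_closed ex.ext.smult_closed by blast
    qed (simp add: \<psi>(4) a)
    also have "\<dots> = bm.lin_ext M (\<lambda>b. b) (con.cn a)"
      by (rule bm.lin_ext_superset[symmetric, OF F_module _ f fin bm.supp_subset]) (use bm.e_closed in auto)
    also have "\<dots> = con.cn a"
      using bm.linear_expansion[OF F_module linear_map_id f] by simp
    finally show ?thesis .
  qed
  obtain \<nu> where "is_natural_map R I F P h T \<nu>" by (rule natural_map_exists)
  then have "\<exists>!\<nu>. is_natural_map R I F P h T \<nu>" using natural_map_unique by blast
  moreover have "\<exists>\<rho>\<in>graded_alg_hom T Tor L. \<forall>Y\<in>carrier L. \<rho> (\<nu> Y) = Y" if "is_natural_map R I F P h T \<nu>" for \<nu>
    by (rule natural_map_splits[OF that r(1)]) (use r(2) expand in simp)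
  ultimately show ?thesis by blast
qed

end
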